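(* Let $f=f(v,t)$ be a weak solution (in the sense of Desvillettes, recalled in the context) to the spatially homogeneous Landau equation with Coulomb potential on $\mathbb{R}^3\times[0,\infty)$. Then, for every $T>0$, $A[f]\in L^\infty(0,T;L^3_{loc}(\mathbb{R}^3))$, $\nabla a[f]\in L^\infty(0,T;L^{3/2}_{loc}(\mathbb{R}^3))$, and $f$ satisfies the weak formulation $$\int_0^T\langle\partial_tf,\phi\rangle\,dt+\int_0^T\int_{\mathbb{R}^3}(A[f]\nabla f-f\nabla a[f])\cdot\nabla\phi\,dv\,dt=0\qquad\forall\phi\in L^\infty(0,T;W^{1,\infty}_c(\mathbb{R}^3)).$$
   Context: The spatially homogeneous Landau equation with Coulomb potential is $\partial_tf=\mathrm{div}(A[f]\nabla f-f\nabla a[f])$, where $$A[f](v,t)=\frac1{8\pi}\int_{\mathbb{R}^3}\frac1{|y|}\Big(\mathrm{Id}-\frac{y\otimes y}{|y|^2}\Big)f(v-y,t)\,dy,\qquad a[f](v,t)=\frac1{4\pi}\int_{\mathbb{R}^3}\frac{f(y,t)}{|v-y|}\,dy=\mathrm{Tr}\,A[f](v,t),$$ so that $-\Delta a[f]=f$. Weak solution (as in Desvillettes' paper on entropy dissipation estimates for the Landau equation in the Coulomb case): let $f_{in}\ge0$ with $\int_{\mathbb{R}^3}f_{in}(1+|v|^2+|\log f_{in}|)\,dv<\infty$. $f\ge0$ is a global H-solution with initial datum $f_{in}$: $f\in C([0,\infty);\mathcal D'(\mathbb{R}^3))$, $f(\cdot,0)=f_{in}$, for all $t\ge0$ mass,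 momentum and energy are conserved, i.e. $\int f(v,t)\psi(v)\,dv=\int f_{in}\psi\,dv$ for $\psi=1,v_1,v_2,v_3,|v|^2$, and the entropy inequality $\int f(t)\log f(t)\,dv+\int_0^tD(f(s))\,ds\le\int f_{in}\log f_{in}\,dv$ holds, where, with $N(z)=\frac1{8\pi|z|}(\mathrm{Id}-\frac{z\otimes z}{|z|^2})$, $D(f)=\frac12\iint f(v)f(w)\,N(v-w)\xi\cdot\xi\,dv\,dw\ge0$, $\xi=\nabla\log f(v)-\nabla\log f(w)$, is the entropy dissipation. Moreover $f\in L^1_{loc}([0,\infty);L^3(\mathbb{R}^3,(1+|v|)^{-3}dv))$, and $f$ satisfies the equation in the following (ultra-weak) sense: for all $\varphi\in C^2_c(\mathbb{R}^3\times[0,\infty))$, $$-\int f_{in}\varphi(\cdot,0)\,dv-\int_0^\infty\!\!\int f\,\partial_t\varphi\,dv\,dt=\frac12\int_0^\infty\!\!\iint f(v)f(w)\,N(v-w):\big(D^2\varphi(v)+D^2\varphi(w)\big)\,dv\,dw\,dt-\frac1{4\pi}\int_0^\infty\!\!\iint f(v)f(w)\frac{v-w}{|v-w|^3}\cdot\big(\nabla\varphi(v)-\nabla\varphi(w)\big)\,dv\,dw\,dt.$$ No evenness of the initial datum is assumed. $W^{1,\infty}_c(\mathbb{R}^3)$ is the space of compactly supported $W^{1,\infty}(\mathbb{R}^3)$ functions, where $\phi_n\to\phi$ if and only if $\phi_n\to\phi$ in $W^{1,\infty}(\mathbb{R}^3)$ and $\bigcup_n\mathrm{supp}(\phi_n)$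 is bounded. $\int_0^T\langle\partial_tf,\phi\rangle\,dt$ is the duality pairing between $(L^\infty(0,T;W^{1,\infty}_c(\mathbb{R}^3)))'$ and $L^\infty(0,T;W^{1,\infty}_c(\mathbb{R}^3))$, $\partial_tf$ being the distributional time derivative. *)

theory Defs
  imports "HOL-Analysis.Analysis" "HOL-Probability.Essential_Supremum"
begin

section \<open>Test functions and classical derivatives\<close>

fun Ck :: "nat \<Rightarrow> ('a::euclidean_space \<Rightarrow> real) \<Rightarrow> bool" where
  "Ck 0 u = continuous_on UNIV u"
| "Ck (Suc k) u = (u differentiable_on UNIV \<and>
     (\<forall>b\<in>Basis. Ck k (\<lambda>x. frechet_derivative u (at x) b)))"

definition Ck_test :: "nat \<Rightarrow> 'a::euclidean_space set \<Rightarrow> ('a \<Rightarrow> real) \<Rightarrow> bool" where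
  "Ck_test k U u \<longleftrightarrow> Ck k u \<and> compact (closure {x. u x \<noteq> 0}) \<and> closure {x. u x \<noteq> 0} \<subseteq> U"

definition smooth_test :: "'a::euclidean_space set \<Rightarrow> ('a \<Rightarrow> real) \<Rightarrow> bool" where
  "smooth_test U u \<longleftrightarrow> (\<forall>k. Ck_test k U u)"

definition partial :: "3 \<Rightarrow> (real^3 \<Rightarrow> real) \<Rightarrow> real^3 \<Rightarrow> real" where
  "partial i u x = frechet_derivative u (at x) (axis i 1)"

definition grad :: "(real^3 \<Rightarrow> real) \<Rightarrow> real^3 \<Rightarrow> real^3" where
  "grad u x = (\<chi> i. partial i u x)"

definition hess :: "(real^3 \<Rightarrow> real) \<Rightarrow> real^3 \<Rightarrow> real^3^3" where
  "hess u x = (\<chi> i j. partial i (partial j u) x)"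

definition frobenius :: "real^3^3 \<Rightarrow> real^3^3 \<Rightarrow> real" where
  "frobenius A B = (\<Sum>i\<in>UNIV. \<Sum>j\<in>UNIV. A $ i $ j * B $ i $ j)"


section \<open>Weak gradients\<close>

definition loc_integrable :: "(real^3 \<Rightarrow> 'b::{banach, second_countable_topology}) \<Rightarrow> bool" where
  "loc_integrable u \<longleftrightarrow> u \<in> borel_measurable lebesgue \<and> (\<forall>K. compact K \<longrightarrow> set_integrable lebesgue K u)"

definition is_weak_grad :: "(real^3 \<Rightarrow> real) \<Rightarrow> (real^3 \<Rightarrow> real^3) \<Rightarrow> bool" where
  "is_weak_grad u G \<longleftrightarrow> loc_integrable u \<and> loc_integrable G \<and>
     (\<forall>\<psi>. smooth_test UNIV \<psi> \<longrightarrow>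
       (\<forall>i. (LINT v|lebesgue. u v * partial i \<psi> v) = - (LINT v|lebesgue. G v $ i * \<psi> v)))"

definition weakly_differentiable :: "(real^3 \<Rightarrow> real) \<Rightarrow> bool" where
  "weakly_differentiable u \<longleftrightarrow> (\<exists>G. is_weak_grad u G)"

text \<open>The weak gradient is determined only up to a null set, and \<open>wgrad u\<close> is some
  representative. For a time-dependent function the representatives are chosen separately for each
  time, so below every joint measurability requirement is imposed modulo null sets in \<open>v\<close>.\<close>

definition wgrad :: "(real^3 \<Rightarrow> real) \<Rightarrow> real^3 \<Rightarrow> real^3" where
  "wgrad u = (SOME G. is_weak_grad u G)"


section \<open>Function spaces\<close>

definition in_Lp :: "real \<Rightarrow> 'a measure \<Rightarrow> ('a \<Rightarrow> 'b::{banach, second_countable_topology}) \<Rightarrow> bool" where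
  "in_Lp p M u \<longleftrightarrow> u \<in> borel_measurable M \<and> integrable M (\<lambda>x. norm (u x) powr p)"

definition Lp_norm :: "real \<Rightarrow> 'a measure \<Rightarrow> ('a \<Rightarrow> 'b::{banach, second_countable_topology}) \<Rightarrow> real" where
  "Lp_norm p M u = (LINT x|M. norm (u x) powr p) powr (1 / p)"

abbreviation slab :: "real \<Rightarrow> (real \<times> (real^3)) set" where
  "slab T \<equiv> {0<..<T} \<times> UNIV"

definition slab_rep :: "real \<Rightarrow> (real \<Rightarrow> real^3 \<Rightarrow> 'b) \<Rightarrow> (real \<times> (real^3) \<Rightarrow> 'b) \<Rightarrow> bool" where
  "slab_rep T u g \<longleftrightarrow> (AE t in lebesgue_on {0<..<T}. AE v in lebesgue. u t v = g (t, v))"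

definition slab_measurable :: "real \<Rightarrow> (real \<Rightarrow> real^3 \<Rightarrow> 'b::{banach, second_countable_topology}) \<Rightarrow> bool" where
  "slab_measurable T u \<longleftrightarrow> (\<exists>g\<in>borel_measurable (lebesgue_on (slab T)). slab_rep T u g)"

definition slab_integrable :: "real \<Rightarrow> (real \<Rightarrow> real^3 \<Rightarrow> 'b::{banach, second_countable_topology}) \<Rightarrow> bool" where
  "slab_integrable T u \<longleftrightarrow> (\<exists>g. integrable (lebesgue_on (slab T)) g \<and> slab_rep T u g)"

text \<open>\<open>Linf_Lploc T p u\<close>: the function \<open>u\<close> belongs to $L^\infty(0,T;L^p_{loc})$.\<close>

definition Linf_Lploc :: "real \<Rightarrow> real \<Rightarrow> (real \<Rightarrow> real^3 \<Rightarrow> 'b::{banach, second_countable_topology}) \<Rightarrow> bool" where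
  "Linf_Lploc T p u \<longleftrightarrow> slab_measurable T u \<and>
     (\<forall>K. compact K \<longrightarrow> (\<exists>C. AE t in lebesgue_on {0<..<T}.
        in_Lp p (lebesgue_on K) (u t) \<and> Lp_norm p (lebesgue_on K) (u t) \<le> C))"

definition W1inf_norm :: "(real^3 \<Rightarrow> real) \<Rightarrow> ereal" where
  "W1inf_norm u = esssup lebesgue (\<lambda>v. ereal \<bar>u v\<bar>) + esssup lebesgue (\<lambda>v. ereal (norm (wgrad u v)))"

text \<open>Support in the closed ball of radius \<open>R\<close>, for functions taken modulo null sets.\<close>

definition supp_in_ball :: "real \<Rightarrow> (real^3 \<Rightarrow> real) \<Rightarrow> bool" where
  "supp_in_ball R u \<longleftrightarrow> (AE v in lebesgue. R < norm v \<longrightarrow> u v = 0)"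

definition W1inf_c :: "(real^3 \<Rightarrow> real) set" where
  "W1inf_c = {u. weakly_differentiable u \<and> W1inf_norm u < \<infinity> \<and> (\<exists>R. supp_in_ball R u)}"

definition conv_W1inf_c :: "(nat \<Rightarrow> real^3 \<Rightarrow> real) \<Rightarrow> (real^3 \<Rightarrow> real) \<Rightarrow> bool" where
  "conv_W1inf_c us u \<longleftrightarrow> (\<exists>R. \<forall>n. supp_in_ball R (us n)) \<and>
     ((\<lambda>n. W1inf_norm (\<lambda>v. us n v - u v)) \<longlonglongrightarrow> 0)"

text \<open>\<open>Linf_W1inf_c T\<close> is $L^\infty(0,T;W^{1,\infty}_c)$. Being essentially bounded with values in
  $W^{1,\infty}_c$ means a bound on the norm together with a common bound on the supports.
  Measurability is joint measurability in time and velocity, which is weaker than strong measurability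
  into the nonseparable space $W^{1,\infty}$, so that the space is the larger one.\<close>

definition Linf_W1inf_c :: "real \<Rightarrow> (real \<times> (real^3) \<Rightarrow> real) set" where
  "Linf_W1inf_c T = {\<phi>. slab_measurable T (\<lambda>t v. \<phi> (t, v)) \<and>
     (\<exists>C R. AE t in lebesgue_on {0<..<T}.
        (\<lambda>v. \<phi> (t, v)) \<in> W1inf_c \<and> W1inf_norm (\<lambda>v. \<phi> (t, v)) \<le> ereal C \<and>
        supp_in_ball R (\<lambda>v. \<phi> (t, v)))}"

definition conv_Linf_W1inf_c :: "real \<Rightarrow> (nat \<Rightarrow> real \<times> (real^3) \<Rightarrow> real) \<Rightarrow> (real \<times> (real^3) \<Rightarrow> real) \<Rightarrow> bool" where
  "conv_Linf_W1inf_c T \<phi>s \<phi> \<longleftrightarrow>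
     (\<exists>R. \<forall>n. AE t in lebesgue_on {0<..<T}. supp_in_ball R (\<lambda>v. \<phi>s n (t, v))) \<and>
     (\<forall>\<epsilon>>0. \<forall>\<^sub>F n in sequentially. AE t in lebesgue_on {0<..<T}.
        W1inf_norm (\<lambda>v. \<phi>s n (t, v) - \<phi> (t, v)) \<le> ereal \<epsilon>)"

text \<open>Linear functionals on \<open>X\<close> that are continuous for the notion of convergence \<open>conv\<close>. With the
  two notions above, continuity forces them to take equal values on functions equal almost
  everywhere.\<close>

definition seq_dual :: "('x \<Rightarrow> real) set \<Rightarrow> ((nat \<Rightarrow> 'x \<Rightarrow> real) \<Rightarrow> ('x \<Rightarrow> real) \<Rightarrow> bool)
    \<Rightarrow> (('x \<Rightarrow> real) \<Rightarrow> real) set" where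
  "seq_dual X conv = {L.
     (\<forall>u\<in>X. \<forall>w\<in>X. \<forall>a b. L (\<lambda>x. a * u x + b * w x) = a * L u + b * L w) \<and>
     (\<forall>us u. (\<forall>n. us n \<in> X) \<and> u \<in> X \<and> conv us u \<longrightarrow> (\<lambda>n. L (us n)) \<longlonglongrightarrow> L u)}"

abbreviation W1inf_c_dual :: "((real^3 \<Rightarrow> real) \<Rightarrow> real) set" where
  "W1inf_c_dual \<equiv> seq_dual W1inf_c conv_W1inf_c"

abbreviation Linf_W1inf_c_dual :: "real \<Rightarrow> ((real \<times> (real^3) \<Rightarrow> real) \<Rightarrow> real) set" where
  "Linf_W1inf_c_dual T \<equiv> seq_dual (Linf_W1inf_c T) (conv_Linf_W1inf_c T)"

text \<open>\<open>g\<close> is the distributional derivative on $(0,T)$ of $t\mapsto f(t)$, the latter regarded as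
  taking values in the dual of $W^{1,\infty}_c$ through $\psi\mapsto\int f(t)\psi\,dv$. Products
  $\theta(t)\psi(v)$ already span a dense subspace of the smooth test functions on $(0,T)\times\mathbb{R}^3$.\<close>

definition is_time_deriv :: "real \<Rightarrow> (real \<Rightarrow> real^3 \<Rightarrow> real) \<Rightarrow> (real \<Rightarrow> (real^3 \<Rightarrow> real) \<Rightarrow> real) \<Rightarrow> bool" where
  "is_time_deriv T f g \<longleftrightarrow>
     (AE t in lebesgue_on {0<..<T}. g t \<in> W1inf_c_dual) \<and>
     (\<forall>\<psi>\<in>W1inf_c. \<forall>\<theta>. smooth_test {0<..<T} \<theta> \<longrightarrow>
        set_integrable lebesgue {0<..<T} (\<lambda>t. \<theta> t * g t \<psi>) \<and>
        (LINT t:{0<..<T}|lebesgue. \<theta> t * g t \<psi>) =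
          - (LINT t:{0<..<T}|lebesgue. deriv \<theta> t * (LINT v|lebesgue. f t v * \<psi> v)))"

definition time_pairing :: "real \<Rightarrow> (real \<Rightarrow> (real^3 \<Rightarrow> real) \<Rightarrow> real) \<Rightarrow> (real \<times> (real^3) \<Rightarrow> real) \<Rightarrow> real" where
  "time_pairing T g \<phi> = (LINT t:{0<..<T}|lebesgue. g t (\<lambda>v. \<phi> (t, v)))"


section \<open>The Landau equation with Coulomb potential\<close>

definition landau_N :: "real^3 \<Rightarrow> real^3^3" where
  "landau_N z = (1 / (8 * pi * norm z)) *\<^sub>R (mat 1 - (\<chi> i j. z $ i * z $ j / (norm z)\<^sup>2))"

definition landau_A :: "(real^3 \<Rightarrow> real) \<Rightarrow> real^3 \<Rightarrow> real^3^3" where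
  "landau_A u v = (LINT y|lebesgue. u (v - y) *\<^sub>R landau_N y)"

definition landau_a :: "(real^3 \<Rightarrow> real) \<Rightarrow> real^3 \<Rightarrow> real" where
  "landau_a u v = 1 / (4 * pi) * (LINT y|lebesgue. u y / norm (v - y))"

definition landau_flux :: "(real^3 \<Rightarrow> real) \<Rightarrow> real^3 \<Rightarrow> real^3" where
  "landau_flux u v = landau_A u v *v wgrad u v - u v *\<^sub>R wgrad (landau_a u) v"

text \<open>Since \<open>u\<close> may vanish, $\nabla\log u$ is understood as $\nabla u/u$ with the weak gradient of \<open>u\<close>;
  its value on the set where \<open>u\<close> is zero is immaterial in the dissipation, because the integrand carries
  the factor \<open>u v * u w\<close>. The dissipation is infinite if \<open>u\<close> has no weak gradient.\<close>

definition grad_log :: "(real^3 \<Rightarrow> real) \<Rightarrow> real^3 \<Rightarrow> real^3" where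
  "grad_log u v = wgrad u v /\<^sub>R u v"

definition entropy_dissipation :: "(real^3 \<Rightarrow> real) \<Rightarrow> ennreal" where
  "entropy_dissipation u =
     (if weakly_differentiable u then
        ennreal (1/2) * (\<integral>\<^sup>+ (v, w). ennreal (u v * u w *
          ((landau_N (v - w) *v (grad_log u v - grad_log u w)) \<bullet> (grad_log u v - grad_log u w))) \<partial>lebesgue)
      else \<infinity>)"

definition admissible_datum :: "(real^3 \<Rightarrow> real) \<Rightarrow> bool" where
  "admissible_datum f_in \<longleftrightarrow> f_in \<in> borel_measurable lebesgue \<and> (AE v in lebesgue. 0 \<le> f_in v) \<and>
     integrable lebesgue (\<lambda>v. f_in v * (1 + (norm v)\<^sup>2 + \<bar>ln (f_in v)\<bar>))"

text \<open>Test functions in $C^2_c(\mathbb{R}^3\times[0,\infty))$ are the restrictions to nonnegative times of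
  functions in $C^2_c(\mathbb{R}^3\times\mathbb{R})$.\<close>

definition ultraweak :: "(real^3 \<Rightarrow> real) \<Rightarrow> (real \<Rightarrow> real^3 \<Rightarrow> real) \<Rightarrow> bool" where
  "ultraweak f_in f \<longleftrightarrow> (\<forall>\<phi> :: real \<times> (real^3) \<Rightarrow> real. Ck_test 2 UNIV \<phi> \<longrightarrow>
     - (LINT v|lebesgue. f_in v * \<phi> (0, v))
     - (LINT t:{0..}|lebesgue. LINT v|lebesgue. f t v * deriv (\<lambda>s. \<phi> (s, v)) t)
     = 1/2 * (LINT t:{0..}|lebesgue. LINT (v, w)|lebesgue. f t v * f t w *
           frobenius (landau_N (v - w)) (hess (\<lambda>x. \<phi> (t, x)) v + hess (\<lambda>x. \<phi> (t, x)) w))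
     - 1 / (4 * pi) * (LINT t:{0..}|lebesgue. LINT (v, w)|lebesgue. f t v * f t w *
           (((1 / norm (v - w) ^ 3) *\<^sub>R (v - w)) \<bullet> (grad (\<lambda>x. \<phi> (t, x)) v - grad (\<lambda>x. \<phi> (t, x)) w))))"

definition global_H_solution :: "(real^3 \<Rightarrow> real) \<Rightarrow> (real \<Rightarrow> real^3 \<Rightarrow> real) \<Rightarrow> bool" where
  "global_H_solution f_in f \<longleftrightarrow>
     (\<lambda>(t, v). f t v) \<in> borel_measurable (lebesgue_on ({0..} \<times> UNIV)) \<and>
     (\<forall>t\<ge>0. AE v in lebesgue. 0 \<le> f t v) \<and>
     (AE v in lebesgue. f 0 v = f_in v) \<and>
     \<comment> \<open>mass, momentum and energy\<close>
     (\<forall>t\<ge>0. integrable lebesgue (\<lambda>v. f t v * (1 + (norm v)\<^sup>2)) \<and>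
        f t \<in> borel_measurable lebesgue \<and>
        (LINT v|lebesgue. f t v) = (LINT v|lebesgue. f_in v) \<and>
        (\<forall>i. (LINT v|lebesgue. f t v * v $ i) = (LINT v|lebesgue. f_in v * v $ i)) \<and>
        (LINT v|lebesgue. f t v * (norm v)\<^sup>2) = (LINT v|lebesgue. f_in v * (norm v)\<^sup>2)) \<and>
     \<comment> \<open>continuity in time with values in the distributions\<close>
     (\<forall>\<psi>. smooth_test UNIV \<psi> \<longrightarrow> continuous_on {0..} (\<lambda>t. LINT v|lebesgue. f t v * \<psi> v)) \<and>
     \<comment> \<open>entropy inequality\<close>
     (\<forall>t\<ge>0. integrable lebesgue (\<lambda>v. f t v * ln (f t v)) \<and>
        ereal (LINT v|lebesgue. f t v * ln (f t v))
          + enn2ereal (\<integral>\<^sup>+ s. entropy_dissipation (f s) \<partial>lebesgue_on {0..t})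
        \<le> ereal (LINT v|lebesgue. f_in v * ln (f_in v))) \<and>
     \<comment> \<open>local integrability in time with values in the weighted space\<close>
     (let M = density lebesgue (\<lambda>v. ennreal ((1 + norm v) powr - 3)) in
        \<forall>T>0. (AE t in lebesgue_on {0..T}. in_Lp 3 M (f t)) \<and>
          set_integrable lebesgue {0..T} (\<lambda>t. Lp_norm 3 M (f t))) \<and>
     ultraweak f_in f"

end

theory Submission
  imports Defs "HOL-Computational_Algebra.Polynomial"
begin

text \<open>In the flux $A[f]\nabla f-f\nabla a[f]$ the product $A[f]\nabla f$ is the difficulty: $A[f]$ is bounded
only in $L^3_{loc}$, and no matching integrability of $\nabla f$ is given. The flux is nevertheless integrable,
because it is an average of what the entropy dissipation controls. With $N$ the Landau kernel
and $\xi=\nabla\log f(v)-\nabla\log f(w)$, it equals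
$\int f(v)f(w)N(v-w)\xi\,dw$. As $8\pi|z|N(z)$ is a projection, $|N\xi|\le|z|^{-1}+N\xi\cdot\xi$. Hence
the $L^1$ norm of the flux over a ball is at most the pair energy $\int\int f(v)f(w)|v-w|^{-1}$ plus the
dissipation (\<open>flux_L1_bound\<close>). The pair energy is linear in the local $L^3$ norm
(\<open>pair_energy_le\<close>), so both terms are integrable in time. The flux therefore acts on
functions with bounded gradient, and minus this action is a candidate for the time derivative.

That it is the time derivative is seen by testing with $\theta(t)\psi(v)$, \<open>\<psi>\<close> smooth. At a
fixed time the flux form and the ultraweak form agree (\<open>flux_weak_form\<close>): integrate by parts in $v$
against the singular kernel $N(v-w)$, whose divergence is the Coulomb field, and symmetrize. Test
functions in $W^{1,\infty}_c$ follow by mollification (\<open>is_time_derivI\<close>), and continuity of the functionals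
from the $L^1$ bound. Finite dissipation forces the solution to be weakly differentiable at almost every
time, and the gradients can be chosen jointly measurable in time and velocity
(\<open>measurable_weak_gradient\<close>).

The bounds for $A[f]$ and $\nabla a[f]$ are bounds for potentials with the kernels $|z|^{-1}$ and $|z|^{-2}$.
These are of weak type $L^3$ and $L^{3/2}$ only, so that the mass alone does not suffice; the entropy makes up
for the missing logarithm (\<open>Riesz_potential_borderline\<close>). Mass, energy and entropy bound
$\int f\log^+f$ uniformly in time (\<open>density_bounds\<close>).\<close>

section \<open>Notation\<close>

text \<open>Short forms for what occurs throughout: the nonnegative counterpart of \<open>LBINT\<close>, also restricted
 to a set or to a centred ball, almost everywhere statements for Lebesgue measure, and limits of
 sequences.\<close>

abbreviation Borel :: "('a::topological_space \<Rightarrow> 'b::topological_space) set" where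
 "Borel \<equiv> borel_measurable borel"

abbreviation nn_lborel :: "('a::euclidean_space \<Rightarrow> ennreal) \<Rightarrow> ennreal" (binder "NBINT " 10) where
 "nn_lborel g \<equiv> integral\<^sup>N lborel g"

abbreviation NBSET :: "'a::euclidean_space set \<Rightarrow> ('a \<Rightarrow> ennreal) \<Rightarrow> ennreal" where
 "NBSET A g \<equiv> (\<integral>\<^sup>+x\<in>A. g x \<partial>lborel)"

abbreviation NBALL :: "real \<Rightarrow> ('a::euclidean_space \<Rightarrow> ennreal) \<Rightarrow> ennreal" where
 "NBALL R g \<equiv> NBSET (cball 0 R) g"

abbreviation ball_ind :: "real \<Rightarrow> 'a::real_normed_vector \<Rightarrow> 'b::zero_neq_one" where
 "ball_ind R \<equiv> indicator (cball 0 R)"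

abbreviation AE_lborel :: "('a::euclidean_space \<Rightarrow> bool) \<Rightarrow> bool" (binder "AEL " 10) where
 "AE_lborel P \<equiv> almost_everywhere lborel P"

abbreviation seq_lim :: "(nat \<Rightarrow> 'a::topological_space) \<Rightarrow> 'a \<Rightarrow> bool" (infix "\<leadsto>" 60) where
 "X \<leadsto> l \<equiv> X \<longlonglongrightarrow> l"

section \<open>Smooth functions\<close>

lemma Ck_imp_continuous: "Ck k u ==> continuous_on UNIV u"
 by (cases k) (auto intro: differentiable_imp_continuous_on)

lemma Ck_SucD: "Ck (Suc k) u ==> Ck k u"
proof (induction k arbitrary: u)
 case 0
 then show ?case using Ck_imp_continuous[of "Suc 0" u] by simp
next
 case (Suc k)
 then show ?case by (metis Ck.simps(2))
qed

lemma Ck_differentiable: "Ck (Suc k) u ==> u differentiable (at x)"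
 by (simp add: differentiable_on_def)

lemma frechet_derivative_eqI: "(u has_derivative D) (at x) ==> frechet_derivative u (at x) h = D h"
 using frechet_derivative_at[of u D x] by simp

lemma Ck_SucI:
 assumes "!!x. (u has_derivative D x) (at x)" "!!b. b : Basis ==> Ck k (%x. D x b)"
 shows "Ck (Suc k) u"
proof -
 have "u differentiable_on UNIV"
  using assms(1) by (auto simp: differentiable_on_def differentiable_def)
 moreover have "(%x. frechet_derivative u (at x) b) = (%x. D x b)" for b
  using frechet_derivative_eqI[OF assms(1)] by blast
 ultimately show ?thesis using assms(2) by simp
qed

lemma Ck_const: "Ck k (%x. c)"
proof (induction k arbitrary: c)
 case (Suc k)
 show ?case by (rule Ck_SucI[where D="%x h. 0"]) (auto intro: Suc)
qed simp

lemma has_frechet_derivative: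
 "Ck (Suc k) u ==> (u has_derivative frechet_derivative u (at x)) (at x)"
 using Ck_differentiable frechet_derivative_works by blast

lemma Ck_add:
 assumes "Ck k u" "Ck k w" shows "Ck k (%x. u x + w x)"
 using assms
proof (induction k arbitrary: u w)
 case 0
 then show ?case by (simp add: continuous_on_add)
next
 case (Suc k)
 show ?case
  by (rule Ck_SucI[OF has_derivative_add[OF has_frechet_derivative[OF Suc.prems(1)] has_frechet_derivative[OF Suc.prems(2)]]])
   (use Suc in auto)
qed

lemma Ck_mult:
 assumes "Ck k u" "Ck k w" shows "Ck k (%x. u x * w x)"
 using assms
proof (induction k arbitrary: u w)
 case 0
 then show ?case by (simp add: continuous_on_mult)
next
 case (Suc k)
 show ?case
  by (rule Ck_SucI[OF has_derivative_mult[OF has_frechet_derivative[OF Suc.prems(1)] has_frechet_derivative[OF Suc.prems(2)]]])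
   (use Suc Ck_SucD[OF Suc.prems(1)] Ck_SucD[OF Suc.prems(2)] in \<open>auto intro!: Ck_add Suc.IH\<close>)
qed

lemma Ck_sum: "(!!i. i : I ==> Ck k (u i)) ==> Ck k (%x. \<Sum>i\<in>I. u i x)"
 by (induction I rule: infinite_finite_induct) (auto intro: Ck_const Ck_add)

lemma Ck_inner: "Ck k (%x. x \<bullet> b)"
proof (cases k)
 case (Suc m)
 show ?thesis unfolding Suc
  by (rule Ck_SucI[where D="%x h. h \<bullet> b"]) (auto intro: Ck_const derivative_eq_intros)
qed (auto intro: continuous_intros)

lemma Ck_compose_real:
 assumes "!!n s. s : S ==> (\<phi> n has_real_derivative \<phi> (Suc n) s) (at s)"
  and "Ck k g" "!!x. g x : S"
 shows "Ck k (%x. \<phi> n (g x))"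
 using assms(2)
proof (induction k arbitrary: n)
 case 0
 have "isCont (\<phi> n) (g x)" for x using assms(1,3) DERIV_isCont by blast
 moreover have "isCont g x" for x using 0 by (simp add: continuous_on_eq_continuous_at)
 ultimately have "isCont (%x. \<phi> n (g x)) x" for x using isCont_o2 by blast
 then show ?case by (simp add: continuous_at_imp_continuous_on)
next
 case (Suc k)
 have D: "((%x. \<phi> n (g x)) has_derivative (%h. frechet_derivative g (at x) h * \<phi> (Suc n) (g x))) (at x)" for x
  using has_derivative_compose[OF has_frechet_derivative[OF Suc.prems], of "\<phi> n" "(*) (\<phi> (Suc n) (g x))"] assms(1,3)
  by (auto simp: has_field_derivative_def mult.commute)
 show ?case
  by (rule Ck_SucI[OF D]) (use Suc Ck_SucD[OF Suc.prems] in \<open>auto intro!: Ck_mult\<close>)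
qed

lemma Ck_frechet_derivative:
 assumes "Ck (Suc k) u" shows "Ck k (%x. frechet_derivative u (at x) h)"
proof -
 have "frechet_derivative u (at x) h = (\<Sum>b\<in>Basis. (h \<bullet> b) * frechet_derivative u (at x) b)" for x
 proof -
  have l: "linear (frechet_derivative u (at x))"
   using has_frechet_derivative[OF assms] has_derivative_linear by blast
  have "frechet_derivative u (at x) (\<Sum>b\<in>Basis. (h \<bullet> b) *\<^sub>R b) = (\<Sum>b\<in>Basis. (h \<bullet> b) * frechet_derivative u (at x) b)"
   by (simp add: linear_sum[OF l] linear_scale[OF l])
  then show ?thesis by (simp add: euclidean_representation)
 qed
 then show ?thesis using assms by (auto intro!: Ck_sum Ck_mult Ck_const)
qed

lemma Ck_affine:
 fixes L :: "'a::euclidean_space => 'b::euclidean_space"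
 assumes "bounded_linear L" "Ck k u" shows "Ck k (%x. u (c + L x))"
 using assms(2)
proof (induction k arbitrary: u)
 case 0
 then show ?case
  using continuous_on_compose2[of UNIV u UNIV "%x. c + L x"]
   continuous_on_add[OF continuous_on_const linear_continuous_on[OF assms(1)]] by auto
next
 case (Suc k)
 have L: "((%x. c + L x) has_derivative L) (at x)" for x
  using has_derivative_add[OF has_derivative_const bounded_linear_imp_has_derivative[OF assms(1)]] by simp
 show ?case
  by (rule Ck_SucI[OF has_derivative_compose[OF L has_frechet_derivative[OF Suc.prems]]])
   (use Suc.IH Ck_frechet_derivative[OF Suc.prems] in auto)
qed

definition smooth :: "('a::euclidean_space => real) => bool" where
 "smooth u \<longleftrightarrow> (\<forall>k. Ck k u)"

lemma smooth_const: "smooth (%x. c)"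
 and smooth_inner: "smooth (%x. x \<bullet> b)"
 and smooth_add: "smooth u ==> smooth w ==> smooth (%x. u x + w x)"
 and smooth_mult: "smooth u ==> smooth w ==> smooth (%x. u x * w x)"
 and smooth_sum: "(!!i. i : I ==> smooth (U i)) ==> smooth (%x. \<Sum>i\<in>I. U i x)"
 and smooth_frechet_derivative: "smooth u ==> smooth (%x. frechet_derivative u (at x) h)"
 by (simp_all add: smooth_def Ck_const Ck_inner Ck_add Ck_mult Ck_sum Ck_frechet_derivative)

lemma smooth_minus: "smooth u ==> smooth (%x. - u x)"
 using smooth_mult[OF smooth_const[of "-1"]] by simp

lemma smooth_diff: "smooth u ==> smooth w ==> smooth (%x. u x - w x)"
 using smooth_add[OF _ smooth_minus] by simp

lemma smooth_nth: "smooth (%x::real^3. x $ i)"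
 using smooth_inner[of "axis i (1::real)"] by (simp add: inner_axis)

lemma smooth_affine: "bounded_linear L ==> smooth u ==> smooth (%x. u (c + L x))"
 by (simp add: smooth_def Ck_affine)

lemma smooth_compose_real:
 assumes "!!n s. s : S ==> (\<phi> n has_real_derivative \<phi> (Suc n) s) (at s)"
  and "smooth g" "!!x. g x : S"
 shows "smooth (%x. \<phi> n (g x))"
 unfolding smooth_def
proof
 fix k
 have "Ck k g" using assms(2) unfolding smooth_def by blast
 then show "Ck k (%x. \<phi> n (g x))"
  using assms(1,3) by (intro Ck_compose_real[of S \<phi> k g n])
qed

lemma smooth_has_derivative: "smooth u ==> (u has_derivative frechet_derivative u (at x)) (at x)"
 unfolding smooth_def using has_frechet_derivative[of 0 u x] by blast

lemma smooth_continuous: "smooth u ==> continuous_on A u"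
 unfolding smooth_def using Ck_imp_continuous continuous_on_subset by blast

lemma smooth_borel[measurable_dest]: "smooth u ==> u : Borel"
 by (simp add: smooth_continuous borel_measurable_continuous_onI)

lemma smooth_partial: "smooth u ==> smooth (partial i u)"
 using smooth_frechet_derivative[of u "axis i 1"] by (simp add: partial_def[abs_def])

lemma partial_eqI: "(u has_derivative D) (at x) ==> partial i u x = D (axis i 1)"
 by (simp add: partial_def frechet_derivative_eqI)

lemma partial_add:
 "smooth u ==> smooth w ==> partial i (%x. u x + w x) x = partial i u x + partial i w x"
 unfolding partial_def
 by (rule frechet_derivative_eqI, intro has_derivative_add smooth_has_derivative)

lemma partial_mult:
 "smooth u ==> smooth w ==> partial i (%x. u x * w x) x = u x * partial i w x + partial i u x * w x"
 unfolding partial_def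
 by (rule frechet_derivative_eqI, intro has_derivative_mult smooth_has_derivative)

lemma partial_const: "partial i (%x. c) x = 0"
 using partial_eqI[OF has_derivative_const] by simp

lemma partial_translate:
 assumes "smooth u" shows "partial i (%x. u (x - w)) x = partial i u (x - w)"
proof -
 have "((%x. x - w) has_derivative (%h. h)) (at x)" by (auto intro!: derivative_eq_intros)
 from partial_eqI[OF has_derivative_compose[OF this smooth_has_derivative[OF assms]]]
 show ?thesis by (simp add: partial_def)
qed

lemma partial_reflect:
 assumes "smooth u" shows "partial i (%y. u (x - y)) y = - partial i u (x - y)"
proof -
 have *: "((%y. x - y) has_derivative (%h. - h)) (at y)" by (auto intro!: derivative_eq_intros)
 have "linear (frechet_derivative u (at (x - y)))"
  using smooth_has_derivative[OF assms] has_derivative_linear by blast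
 with partial_eqI[OF has_derivative_compose[OF * smooth_has_derivative[OF assms]], of i]
 show ?thesis by (simp add: partial_def linear_neg)
qed

lemma smooth_translate: "smooth u ==> smooth (%x. u (x - w))"
 using smooth_affine[of "%x. x" u "-w"] bounded_linear_ident by (simp add: algebra_simps)

lemma smooth_reflect: "smooth u ==> smooth (%y. u (x - y))"
 using smooth_affine[OF bounded_linear_minus[OF bounded_linear_ident], of u x] by simp

lemma smooth_scale: "smooth u ==> smooth (%x. u (c *\<^sub>R x))"
 using smooth_affine[OF bounded_linear_scaleR_right[of c], of u 0] by simp

lemma smooth_test_iff: "smooth_test UNIV u \<longleftrightarrow> smooth u \<and> bounded {x. u x \<noteq> 0}"
 by (auto simp: smooth_test_def smooth_def Ck_test_def compact_closure)

lemma smooth_testI: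
 "smooth u ==> (!!x. R < norm x ==> u x = 0) ==> smooth_test UNIV u"
 unfolding smooth_test_iff bounded_iff by (auto intro!: exI[of _ R] simp: not_less[symmetric])

lemma smooth_testE:
 assumes "smooth_test UNIV u"
 obtains R where "R > 0" "smooth u" "!!x. R <= norm x ==> u x = 0"
proof -
 from assms obtain r where "!!x. u x \<noteq> 0 ==> norm x <= r" "smooth u"
  unfolding smooth_test_iff bounded_iff by auto
 then show ?thesis by (intro that[of "\<bar>r\<bar> + 1"]) force+
qed

lemma frechet_derivative_zero_outside:
 assumes "smooth u" "!!x. R < norm x ==> u x = 0" "R < norm x"
 shows "frechet_derivative u (at x) h = 0"
proof -
 have "open {x::'a. R < norm x}" by (auto intro!: open_Collect_less continuous_intros)
 then have "(u has_derivative (%h. 0)) (at x)"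
  using has_derivative_transform_within_open[of "%x. 0" "%h. 0" x "UNIV" "{x. R < norm x}" u] assms
  by auto
 then show ?thesis by (rule frechet_derivative_eqI)
qed

lemma partial_zero_outside:
 "smooth u ==> (!!x. R < norm x ==> u x = 0) ==> R < norm x ==> partial i u x = 0"
 unfolding partial_def by (rule frechet_derivative_zero_outside)

lemma smooth_test_partial: "smooth_test UNIV u ==> smooth_test UNIV (partial i u)"
proof (erule smooth_testE)
 fix R assume "smooth u" and z: "!!x. R <= norm x ==> u x = 0"
 then show "smooth_test UNIV (partial i u)"
  by (intro smooth_testI[where R=R] smooth_partial partial_zero_outside[where R=R]) auto
qed

lemma smooth_test_mult: "smooth_test UNIV u ==> smooth w ==> smooth_test UNIV (%x. u x * w x)"
proof (erule smooth_testE)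
 fix R assume "smooth w" "smooth u" and z: "!!x. R <= norm x ==> u x = 0"
 then show "smooth_test UNIV (%x. u x * w x)"
  by (intro smooth_testI[where R=R] smooth_mult) auto
qed

lemma smooth_test_bounded:
 assumes "smooth_test UNIV u" obtains C where "C > 0" "!!x. \<bar>u x\<bar> <= C"
proof -
 from assms obtain R where R: "R > 0" "smooth u" "!!x. R <= norm x ==> u x = 0" by (rule smooth_testE) blast
 have "bounded (u ` cball 0 R)"
  by (intro compact_imp_bounded compact_continuous_image smooth_continuous R compact_cball)
 then obtain C where "\<forall>x\<in>cball 0 R. \<bar>u x\<bar> <= C" unfolding bounded_iff by auto
 then have C: "norm x <= R ==> \<bar>u x\<bar> <= C" for x by simp
 have "\<bar>u x\<bar> <= \<bar>C\<bar> + 1" for x using C[of x] R(3)[of x] by (cases "norm x <= R") auto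
 then show ?thesis by (intro that[of "\<bar>C\<bar> + 1"]) auto
qed

lemma smooth_test_frechet_derivative:
 "smooth_test UNIV u ==> smooth_test UNIV (%x. frechet_derivative u (at x) h)"
proof (erule smooth_testE)
 fix R assume "smooth u" and z: "!!x. R <= norm x ==> u x = 0"
 then show "smooth_test UNIV (%x. frechet_derivative u (at x) h)"
  by (intro smooth_testI[where R=R] smooth_frechet_derivative frechet_derivative_zero_outside[where R=R]) auto
qed

lemma smooth_test_lipschitz:
 fixes u :: "'a::euclidean_space => real"
 assumes "smooth_test UNIV u"
 obtains L where "L > 0" "!!x h. \<bar>frechet_derivative u (at x) h\<bar> <= L * norm h"
  "!!x y. \<bar>u x - u y\<bar> <= L * norm (x - y)"
proof -
 have "\<forall>b. \<exists>C. C > 0 \<and> (\<forall>x. \<bar>frechet_derivative u (at x) b\<bar> <= C)"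
  using smooth_test_bounded[OF smooth_test_frechet_derivative[OF assms]] by metis
 then obtain C where C: "!!b. C b > 0" "!!b x. \<bar>frechet_derivative u (at x) b\<bar> <= C b" by metis
 define L where "L = (\<Sum>b\<in>(Basis::'a set). C b) + 1"
 have der: "(u has_derivative frechet_derivative u (at x)) (at x)" for x
  using assms smooth_has_derivative by (auto simp: smooth_test_iff)
 have 1: "\<bar>frechet_derivative u (at x) h\<bar> <= L * norm h" for x h
 proof -
  have l: "linear (frechet_derivative u (at x))" using der has_derivative_linear by blast
  have "frechet_derivative u (at x) (\<Sum>b\<in>Basis. (h \<bullet> b) *\<^sub>R b) = (\<Sum>b\<in>Basis. (h \<bullet> b) * frechet_derivative u (at x) b)"
   by (simp add: linear_sum[OF l] linear_scale[OF l])
  then have "frechet_derivative u (at x) h = (\<Sum>b\<in>Basis. (h \<bullet> b) * frechet_derivative u (at x) b)"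
   by (simp add: euclidean_representation)
  also have "\<bar>...\<bar> <= (\<Sum>b\<in>Basis. norm h * C b)"
   by (rule order_trans[OF sum_abs sum_mono]) (auto simp: abs_mult C Basis_le_norm intro!: mult_mono)
  also have "... <= L * norm h" by (simp add: L_def sum_distrib_left algebra_simps)
  finally show ?thesis .
 qed
 have "onorm (frechet_derivative u (at x)) <= L" for x using 1 by (intro onorm_le) simp
 then have 2: "\<bar>u x - u y\<bar> <= L * norm (x - y)" for x y
  using differentiable_bound[of UNIV u "%x. frechet_derivative u (at x)" L x y] der
  by simp
 have "L > 0" unfolding L_def using C(1) by (smt (verit) sum_nonneg)
 then show ?thesis using 1 2 that by blast
qed

subsection \<open>A smooth bump\<close>

text \<open>The functions $P(1/s)e^{-1/s}$ for $s>0$, extended by zero, form a class closed under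
 differentiation; all derivatives of $e^{-1/s}$ belong to it.\<close>

definition flat_exp :: "real poly => real => real" where
 "flat_exp P s = (if s > 0 then poly P (1 / s) * exp (- (1 / s)) else 0)"

lemma poly_times_exp_minus_tendsto_0: "((%x. poly P x * exp (- x)) \<longlongrightarrow> (0::real)) at_top"
proof -
 have "((%x. \<Sum>i\<le>degree P. coeff P i * (x ^ i / exp x)) \<longlongrightarrow> (\<Sum>i\<le>degree P. coeff P i * 0)) at_top"
  by (intro tendsto_sum tendsto_mult tendsto_const tendsto_power_div_exp_0)
 then show ?thesis by (simp add: poly_altdef sum_distrib_right exp_minus divide_inverse mult.assoc)
qed

lemma flat_exp_has_derivative:
 "(flat_exp P has_real_derivative flat_exp ([:0,0,1:] * (P - pderiv P)) s) (at s)"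
proof (cases "s = 0")
 case False
 show ?thesis
 proof (cases "s > 0")
  case True
  have d: "((%s. 1 / s) has_real_derivative - (1 / s^2)) (at s)"
   using True by (auto intro!: derivative_eq_intros simp: power2_eq_square)
  have "((%s. poly P (1 / s) * exp (- (1 / s))) has_real_derivative
    poly (pderiv P) (1 / s) * - (1 / s^2) * exp (- (1 / s))
     + exp (- (1 / s)) * - (- (1 / s^2)) * poly P (1 / s)) (at s)"
   by (intro DERIV_mult DERIV_chain2[OF poly_DERIV d] DERIV_chain2[OF DERIV_exp DERIV_minus[OF d]])
  moreover have "poly (pderiv P) (1 / s) * - (1 / s^2) * exp (- (1 / s))
     + exp (- (1 / s)) * - (- (1 / s^2)) * poly P (1 / s) = flat_exp ([:0,0,1:] * (P - pderiv P)) s"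
   using True by (simp add: flat_exp_def algebra_simps power2_eq_square)
  ultimately have "((%s. poly P (1 / s) * exp (- (1 / s))) has_real_derivative
    flat_exp ([:0,0,1:] * (P - pderiv P)) s) (at s)" by metis
  then show ?thesis
   by (rule has_field_derivative_transform_within_open[where S="{0<..}"]) (use True in \<open>auto simp: flat_exp_def\<close>)
 next
  case nf: False
  have "((%s. 0) has_real_derivative 0) (at s)" by simp
  then have "(flat_exp P has_real_derivative 0) (at s)"
   by (rule has_field_derivative_transform_within_open[where S="{..<0}"]) (use nf False in \<open>auto simp: flat_exp_def\<close>)
  then show ?thesis using nf by (simp add: flat_exp_def)
 qed
next
 case True
 have "((%s. flat_exp P s / s) \<longlongrightarrow> 0) (at_right 0)"
 proof -
  have "((%s. poly (pCons 0 P) (inverse s) * exp (- inverse s)) \<longlongrightarrow> 0) (at_right 0)"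
   by (rule filterlim_compose[OF poly_times_exp_minus_tendsto_0 filterlim_inverse_at_top_right])
  then show ?thesis
   by (rule Lim_transform_eventually) (auto simp: eventually_at_filter flat_exp_def divide_inverse)
 qed
 moreover have "((%s. flat_exp P s / s) \<longlongrightarrow> 0) (at_left 0)"
  by (rule Lim_transform_eventually[OF tendsto_const]) (auto simp: eventually_at_filter flat_exp_def)
 ultimately have "((%s. flat_exp P s / s) \<longlongrightarrow> 0) (at 0)" by (simp add: filterlim_split_at_real)
 then show ?thesis using True by (simp add: has_field_derivative_iff flat_exp_def)
qed

definition bump :: "'a::euclidean_space => real" where
 "bump x = flat_exp 1 (1 - x \<bullet> x)"

lemma smooth_bump: "smooth bump"
proof -
 define \<phi> where "\<phi> n = flat_exp (((%P. [:0,0,1:] * (P - pderiv P)) ^^ n) 1)" for n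
 have "(\<phi> n has_real_derivative \<phi> (Suc n) s) (at s)" for n s
  unfolding \<phi>_def using flat_exp_has_derivative by simp
 moreover have "smooth (%x::'a. 1 - (\<Sum>b\<in>Basis. (x \<bullet> b) * (x \<bullet> b)))"
  by (intro smooth_diff smooth_const smooth_sum smooth_mult smooth_inner)
 ultimately have "smooth (%x::'a. \<phi> 0 (1 - (\<Sum>b\<in>Basis. (x \<bullet> b) * (x \<bullet> b))))"
  by (intro smooth_compose_real[of UNIV \<phi> "%x::'a. 1 - (\<Sum>b\<in>Basis. (x \<bullet> b) * (x \<bullet> b))" 0]) auto
 then show ?thesis by (simp add: \<phi>_def bump_def[abs_def] euclidean_inner[symmetric])
qed

lemma bump_nonneg: "0 <= bump x" by (simp add: bump_def flat_exp_def)
lemma bump_le_1: "bump x <= 1" by (simp add: bump_def flat_exp_def)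
lemma bump_zero: "1 <= norm x ==> bump x = 0"
 using one_le_power[of "norm x" 2] by (simp add: bump_def flat_exp_def dot_square_norm not_less)
lemma bump_pos: "norm x < 1 ==> 0 < bump x"
 by (simp add: bump_def flat_exp_def dot_square_norm power_less_one_iff abs_square_less_1)

section \<open>Mollification\<close>

lemma nn_integral_lborel_reflect:
 fixes f :: "'a::euclidean_space => ennreal"
 assumes [measurable]: "f : Borel"
 shows "(NBINT y. f (x - y)) = (NBINT y. f y)"
proof -
 have e: "lborel = distr lborel borel (%y::'a. x + (-1) *\<^sub>R y)"
  using lborel_affine[of "-1" x] by (simp add: density_1)
 have "(NBINT y. f y) = (\<integral>\<^sup>+y. f y \<partial>distr lborel borel (%y::'a. x + (-1) *\<^sub>R y))"
  using e by simp
 also have "... = (NBINT y. f (x + (-1) *\<^sub>R y))" by (rule nn_integral_distr) simp_all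
 finally show ?thesis by simp
qed

lemma integral_lborel_reflect:
 fixes f :: "'a::euclidean_space => 'b::{banach, second_countable_topology}"
 assumes [measurable]: "f : Borel"
 shows "(LBINT y. f (x - y)) = (LBINT y. f y)"
proof -
 have e: "lborel = distr lborel borel (%y::'a. x + (-1) *\<^sub>R y)"
  using lborel_affine[of "-1" x] by (simp add: density_1)
 have "(LBINT y. f y) = (LINT y|distr lborel borel (%y::'a. x + (-1) *\<^sub>R y). f y)"
  using e by simp
 also have "... = (LBINT y. f (x + (-1) *\<^sub>R y))" by (rule integral_distr) simp_all
 finally show ?thesis by simp
qed

lemma nn_integral_lborel_translate:
 fixes f :: "'a::euclidean_space => ennreal"
 assumes [measurable]: "f : Borel"
 shows "(NBINT y. f (y - x)) = (NBINT y. f y)"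
 using nn_integral_lborel_reflect[of "%y. f (- y)" x] nn_integral_lborel_reflect[of f 0] by simp

lemma sets_borel_cball[measurable]: "cball (a::'a::euclidean_space) r : sets borel"
 by simp

text \<open>Local integrability for Borel functions, stated with the nonnegative integral, for which no
 integrability has to be known in advance.\<close>

definition loc_int :: "('a::euclidean_space => real) => bool" where
 "loc_int g \<longleftrightarrow> g : Borel \<and> (\<forall>R. (NBALL R (%y. ennreal \<bar>g y\<bar>)) < \<infinity>)"

lemma loc_int_borel[measurable_dest]: "loc_int g ==> g : Borel"
 and loc_int_finite: "loc_int g ==> (NBALL R (%y. ennreal \<bar>g y\<bar>)) < \<infinity>"
 by (auto simp: loc_int_def)

lemma integrable_imp_loc_int:
 assumes "integrable lborel g" shows "loc_int g"
 unfolding loc_int_def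
proof safe
 show "g : Borel" using assms by auto
 fix R
 have "(NBALL R (%y. ennreal \<bar>g y\<bar>)) <= (NBINT y. ennreal (norm (g y)))"
  by (intro nn_integral_mono) (auto simp: indicator_def)
 also have "... < \<infinity>" using assms by (simp add: integrable_iff_bounded)
 finally show "(NBALL R (%y. ennreal \<bar>g y\<bar>)) < \<infinity>" .
qed

lemma bounded_imp_loc_int:
 assumes "g : Borel" "!!x. \<bar>g x\<bar> <= C" shows "loc_int (g :: 'a::euclidean_space => real)"
 unfolding loc_int_def
proof (intro conjI assms(1) allI)
 fix R
 have "(NBALL R (%y. ennreal \<bar>g y\<bar>)) <= (NBINT y. ennreal C * indicator (cball (0::'a) R) y)"
  by (intro nn_integral_mono) (use assms in \<open>auto simp: indicator_def ennreal_leI\<close>)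
 also have "... = ennreal C * emeasure lborel (cball (0::'a) R)" by (simp add: nn_integral_cmult_indicator)
 also have "... < \<infinity>" using emeasure_lborel_cball_finite by (auto simp: ennreal_mult_less_top)
 finally show "(NBALL R (%y. ennreal \<bar>g y\<bar>)) < \<infinity>" .
qed

lemma loc_int_times_bounded:
 assumes g: "loc_int g" and [measurable]: "\<eta> : Borel"
  and b: "!!z. \<bar>\<eta> z\<bar> <= C" and z: "!!z. R < norm z ==> \<eta> z = 0"
 shows "integrable lborel (%y. g y * \<eta> y)"
proof (rule integrableI_bounded)
 have [measurable]: "g : Borel" using g by auto
 show "(%y. g y * \<eta> y) : borel_measurable lborel" by measurable
 have C: "C \<ge> 0" using b[of undefined] by linarith
 have "(NBINT y. ennreal (norm (g y * \<eta> y)))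
   <= (NBINT y. ennreal C * (ennreal \<bar>g y\<bar> * ball_ind R y))"
 proof (intro nn_integral_mono)
  fix y
  have "\<bar>g y\<bar> * \<bar>\<eta> y\<bar> <= \<bar>g y\<bar> * C" by (rule mult_left_mono[OF b]) simp
  then have "ennreal \<bar>g y * \<eta> y\<bar> <= ennreal C * ennreal \<bar>g y\<bar>"
   using C by (simp add: ennreal_mult[symmetric] abs_mult mult.commute ennreal_leI)
  then show "ennreal (norm (g y * \<eta> y)) <= ennreal C * (ennreal \<bar>g y\<bar> * ball_ind R y)"
   using z[of y] by (cases "norm y <= R") (auto simp: indicator_def not_le)
 qed
 also have "... = ennreal C * (NBALL R (%y. ennreal \<bar>g y\<bar>))"
  by (rule nn_integral_cmult) measurable
 also have "... < \<infinity>" using loc_int_finite[OF g] by (simp add: ennreal_mult_less_top)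
 finally show "(NBINT y. ennreal (norm (g y * \<eta> y))) < \<infinity>" .
qed

lemma loc_int_times_test:
 assumes "loc_int g" "smooth_test UNIV \<eta>" shows "integrable lborel (%y. g y * \<eta> y)"
proof -
 obtain C where "!!x. \<bar>\<eta> x\<bar> <= C" using smooth_test_bounded[OF assms(2)] by blast
 moreover obtain R where "smooth \<eta>" "!!x. R <= norm x ==> \<eta> x = 0" using smooth_testE[OF assms(2)] by blast
 ultimately show ?thesis
  by (intro loc_int_times_bounded[OF assms(1), where C=C and R=R]) (auto intro: smooth_borel)
qed

lemma smooth_test_reflect:
 fixes \<eta> :: "'a::euclidean_space => real"
 assumes "smooth_test UNIV \<eta>" shows "smooth_test UNIV (%y. \<eta> (x - y))"
proof (rule smooth_testE[OF assms])
 fix R :: real assume R: "smooth \<eta>" "!!x::'a. R <= norm x ==> \<eta> x = 0"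
 show ?thesis
 proof (rule smooth_testI[where R="norm x + R"])
  show "smooth (%y. \<eta> (x - y))" using R by (intro smooth_reflect)
  fix y :: 'a assume "norm x + R < norm y"
  then have "R <= norm (x - y)" using norm_triangle_ineq2[of y x] by (simp add: norm_minus_commute)
  then show "\<eta> (x - y) = 0" by (rule R)
 qed
qed

definition conv :: "('a::euclidean_space => real) => ('a => real) => 'a => real" where
 "conv g \<eta> x = (LBINT y. g y * \<eta> (x - y))"

text \<open>Differentiation under the integral sign puts all derivatives on the kernel; dominated
 convergence applies because the kernel is Lipschitz with compact support.\<close>

lemma conv_has_derivative:
 fixes g :: "'a::euclidean_space => real"
 assumes g: "loc_int g" and \<eta>: "smooth_test UNIV \<eta>"
 shows "(conv g \<eta> has_derivative (%h. conv g (%z. frechet_derivative \<eta> (at z) h) x)) (at x)"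
proof -
 let ?D = "%h z. frechet_derivative \<eta> (at z) h"
 have [measurable]: "g : Borel" using g by auto
 obtain L where L: "L > 0" "!!x h. \<bar>?D h x\<bar> <= L * norm h" "!!x y. \<bar>\<eta> x - \<eta> y\<bar> <= L * norm (x - y)"
  using smooth_test_lipschitz[OF \<eta>] by blast
 obtain R where R: "R > 0" "smooth \<eta>" "!!x. R <= norm x ==> \<eta> x = 0" using smooth_testE[OF \<eta>] by blast
 have D0: "?D h z = 0" if "R < norm z" for z h
  using frechet_derivative_zero_outside[of \<eta> R z] R that by auto
 have lin: "linear (%h. ?D h z)" for z
  using smooth_has_derivative[OF R(2)] has_derivative_linear by blast
 have int: "integrable lborel (%y. g y * \<eta> (x - y))" for x
  by (intro loc_int_times_test g smooth_test_reflect \<eta>)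
 have intD: "integrable lborel (%y. g y * ?D h (x - y))" for x h
  using smooth_test_reflect[OF smooth_test_frechet_derivative[OF \<eta>]] by (intro loc_int_times_test g)
 have D_borel[measurable]: "(%y. ?D h (x - y)) : Borel" for h x
  by (intro smooth_borel smooth_reflect[where u="%z. ?D h z"] smooth_frechet_derivative R)
 have \<eta>_borel[measurable]: "(%y. \<eta> (x - y)) : Borel" for x
  by (intro smooth_borel smooth_reflect R)
 have linc: "linear (%h. conv g (?D h) x)"
 proof
  fix a b show "conv g (?D (a + b)) x = conv g (?D a) x + conv g (?D b) x"
   unfolding conv_def using linear_add[OF lin] intD by (simp add: distrib_left)
 next
  fix r b show "conv g (?D (r *\<^sub>R b)) x = r *\<^sub>R conv g (?D b) x"
   unfolding conv_def using linear_scale[OF lin] by (simp add: mult.left_commute)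
 qed
 show ?thesis
  unfolding has_derivative_iff_norm
 proof (intro conjI linear_conv_bounded_linear[THEN iffD1] linc)
  show "((%y. norm (conv g \<eta> y - conv g \<eta> x - conv g (?D (y - x)) x) / norm (y - x)) \<longlongrightarrow> 0) (at x)"
   unfolding tendsto_at_iff_sequentially comp_def
  proof (intro allI impI)
   fix X :: "nat => 'a" assume X: "\<forall>i. X i : UNIV - {x}" "X \<leadsto> x"
   define k where "k n y = g y * ((\<eta> (X n - y) - \<eta> (x - y) - ?D (X n - x) (x - y)) / norm (X n - x))" for n y
   obtain B where B: "!!n. norm (X n) <= B" using X(2) by (meson BseqE convergentI convergent_imp_Bseq)
   then have Bx: "norm x <= B" using X(2) by (intro Lim_norm_ubound[OF _ X(2)]) auto
   have "(%n. LBINT y. k n y) \<leadsto> integral\<^sup>L lborel (%y::'a. 0::real)"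
   proof (rule integral_dominated_convergence[where w="%y. \<bar>g y * (2 * L * ball_ind (B + R) y)\<bar>"])
    show "k n : borel_measurable lborel" for n unfolding k_def by measurable
    show "integrable lborel (%y. \<bar>g y * (2 * L * ball_ind (B + R) y)\<bar>)"
     by (intro integrable_abs loc_int_times_bounded[OF g, where R="B + R" and C="2*L"])
      (use L in \<open>auto simp: indicator_def\<close>)
    show "AEL y. (%n. k n y) \<leadsto> 0"
    proof (rule AE_I2)
     fix y
     have "((%z. norm (\<eta> z - \<eta> (x - y) - ?D (z - (x - y)) (x - y)) / norm (z - (x - y))) \<longlongrightarrow> 0) (at (x - y))"
      using smooth_has_derivative[OF R(2), of "x - y"] unfolding has_derivative_iff_norm by blast
     then have "(%n. norm (\<eta> (X n - y) - \<eta> (x - y) - ?D ((X n - y) - (x - y)) (x - y)) / norm ((X n - y) - (x - y))) \<leadsto> 0"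
      unfolding tendsto_at_iff_sequentially comp_def
      by (elim allE[of _ "%n. X n - y"]) (use X in \<open>auto intro!: tendsto_diff\<close>)
     then have "(%n. norm ((\<eta> (X n - y) - \<eta> (x - y) - ?D (X n - x) (x - y)) / norm (X n - x))) \<leadsto> 0"
      by simp
     from tendsto_mult[OF tendsto_const[of "g y"] tendsto_norm_zero_cancel[OF this]] show "(%n. k n y) \<leadsto> 0"
      unfolding k_def by simp
    qed
    show "AEL y. norm (k n y) <= \<bar>g y * (2 * L * ball_ind (B + R) y)\<bar>" for n
    proof (rule AE_I2)
     fix y
     have ne: "norm (X n - x) > 0" using X(1) by simp
     have "\<bar>\<eta> (X n - y) - \<eta> (x - y) - ?D (X n - x) (x - y)\<bar> <= L * norm (X n - x) + L * norm (X n - x)"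
      using L(3)[of "X n - y" "x - y"] L(2)[of "x - y" "X n - x"] by simp
     then have 1: "\<bar>(\<eta> (X n - y) - \<eta> (x - y) - ?D (X n - x) (x - y)) / norm (X n - x)\<bar> <= 2 * L"
      using ne by (simp add: field_simps)
     have 2: "\<eta> (X n - y) = 0 \<and> \<eta> (x - y) = 0 \<and> ?D (X n - x) (x - y) = 0" if "B + R < norm y"
      using that B[of n] Bx norm_triangle_ineq2[of y "X n"] norm_triangle_ineq2[of y x]
      by (auto intro!: R D0 simp: norm_minus_commute)
     show "norm (k n y) <= \<bar>g y * (2 * L * ball_ind (B + R) y)\<bar>"
      using mult_left_mono[OF 1, of "\<bar>g y\<bar>"] 2 L(1) unfolding k_def
      by (cases "norm y <= B + R") (simp_all add: abs_mult del: abs_divide times_divide_eq_right)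
    qed
   qed simp
   moreover have "(LBINT y. k n y) = (conv g \<eta> (X n) - conv g \<eta> x - conv g (?D (X n - x)) x) / norm (X n - x)" for n
   proof -
    have "(LBINT y. k n y) = (LBINT y. (g y * \<eta> (X n - y) - g y * \<eta> (x - y) - g y * ?D (X n - x) (x - y)) / norm (X n - x))"
     unfolding k_def by (simp add: algebra_simps diff_divide_distrib)
    also have "... = (conv g \<eta> (X n) - conv g \<eta> x - conv g (?D (X n - x)) x) / norm (X n - x)"
     unfolding conv_def using int intD by simp
    finally show ?thesis .
   qed
   ultimately have "(%n. (conv g \<eta> (X n) - conv g \<eta> x - conv g (?D (X n - x)) x) / norm (X n - x)) \<leadsto> 0"
    by simp
   from tendsto_norm_zero[OF this]
   show "(%n. norm (conv g \<eta> (X n) - conv g \<eta> x - conv g (?D (X n - x)) x) / norm (X n - x)) \<leadsto> 0"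
    by simp
  qed
 qed
qed

lemma smooth_conv:
 fixes g :: "'a::euclidean_space => real"
 assumes g: "loc_int g" and \<eta>: "smooth_test UNIV \<eta>" shows "smooth (conv g \<eta>)"
proof -
 have "Ck k (conv g \<eta>)" if "smooth_test UNIV \<eta>" for k \<eta>
  using that
 proof (induction k arbitrary: \<eta>)
  case 0
  have "continuous (at x) (conv g \<eta>)" for x
   using conv_has_derivative[OF g 0] has_derivative_continuous by blast
  then show ?case by (simp add: continuous_at_imp_continuous_on)
 next
  case (Suc k)
  show ?case
   by (rule Ck_SucI[OF conv_has_derivative[OF g Suc.prems]])
    (use Suc.IH[OF smooth_test_frechet_derivative[OF Suc.prems]] in blast)
 qed
 then show ?thesis using \<eta> by (simp add: smooth_def)
qed

lemma partial_conv:
 "loc_int g ==> smooth_test UNIV \<eta> ==> partial i (conv g \<eta>) x = conv g (partial i \<eta>) x"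
 using partial_eqI[OF conv_has_derivative] by (simp add: partial_def[abs_def])

text \<open>The convolution of the constant function one with a test function is constant, so its
 derivative, the integral of the derivative of the test function, vanishes.\<close>

lemma integral_partial_zero:
 assumes "smooth_test UNIV \<eta>" shows "(LBINT x. partial i \<eta> x) = 0"
proof -
 have li: "loc_int (%x::real^3. 1)" by (rule bounded_imp_loc_int[of _ 1]) auto
 have s: "smooth \<eta>" using assms by (simp add: smooth_test_iff)
 have "conv (%x. 1) \<eta> = (%x. LBINT y. \<eta> y)"
  using integral_lborel_reflect[OF smooth_borel[OF s]] by (auto simp: conv_def)
 then have "partial i (conv (%x. 1) \<eta>) 0 = 0" by (simp add: partial_const)
 then have "conv (%x. 1) (partial i \<eta>) 0 = 0" using partial_conv[OF li assms] by simp
 then show ?thesis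
  using integral_lborel_reflect[OF smooth_borel[OF smooth_partial[OF s]], of i 0] by (simp add: conv_def)
qed

subsection \<open>The standard mollifiers\<close>

definition mollifier :: "nat => 'a::euclidean_space => real" where
 "mollifier n x = bump (real (Suc n) *\<^sub>R x) / (LBINT y. bump (real (Suc n) *\<^sub>R (y::'a)))"

lemma smooth_test_scaled_bump: "smooth_test UNIV (%x. bump (real (Suc n) *\<^sub>R x))"
proof (rule smooth_testI[where R=1])
 fix x :: 'a assume "1 < norm x"
 then have "1 <= real (Suc n) * norm x" using mult_mono[of 1 "real (Suc n)" 1 "norm x"] by simp
 then have "1 <= norm (real (Suc n) *\<^sub>R x)" by simp
 then show "bump (real (Suc n) *\<^sub>R x) = 0" by (rule bump_zero)
qed (intro smooth_scale smooth_bump)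

lemma integral_scaled_bump_pos: "0 < (LBINT y. bump (real (Suc n) *\<^sub>R (y::'a::euclidean_space)))"
proof -
 let ?b = "%y::'a. bump (real (Suc n) *\<^sub>R y)"
 have int: "integrable lborel ?b"
  using loc_int_times_test[OF bounded_imp_loc_int[of "%_. 1" 1] smooth_test_scaled_bump] by simp
 have "(LBINT y. ?b y) \<noteq> 0"
 proof
  assume "(LBINT y. ?b y) = 0"
  then have "AEL y. ?b y = 0"
   using integral_nonneg_eq_0_iff_AE[OF int] bump_nonneg by auto
  then have "AEL y. y \<notin> ball (0::'a) (1 / real (Suc n))"
  proof eventually_elim
   case (elim y)
   then have "\<not> norm (real (Suc n) *\<^sub>R y) < 1" using bump_pos by (metis less_irrefl)
   then have "\<not> real (Suc n) * norm y < 1" by simp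
   then show ?case by (simp add: field_simps)
  qed
  then have "emeasure lborel (ball (0::'a) (1 / real (Suc n))) = 0"
   by (subst (asm) AE_iff_null_sets[symmetric]) (auto simp: null_sets_def)
  then show False using unit_ball_vol_pos[of "real DIM('a)"] by (simp add: emeasure_ball)
 qed
 moreover have "0 <= (LBINT y. ?b y)" by (intro integral_nonneg_AE AE_I2 bump_nonneg)
 ultimately show ?thesis by linarith
qed

lemma smooth_test_mollifier: "smooth_test UNIV (mollifier n)"
 using smooth_test_mult[OF smooth_test_scaled_bump[of n, where ?'a='a] smooth_const[of "1 / (LBINT y. bump (real (Suc n) *\<^sub>R (y::'a)))"]]
 by (simp add: mollifier_def[abs_def])

lemma smooth_mollifier: "smooth (mollifier n)"
 using smooth_test_mollifier smooth_test_iff by blast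

lemma mollifier_borel[measurable]: "mollifier n : Borel"
 by (rule smooth_borel[OF smooth_mollifier])

lemma mollifier_nonneg: "0 <= mollifier n x"
 unfolding mollifier_def using integral_scaled_bump_pos less_imp_le by (intro divide_nonneg_nonneg bump_nonneg) blast

lemma mollifier_zero: "1 <= real (Suc n) * norm x ==> mollifier n x = 0"
 using bump_zero[of "real (Suc n) *\<^sub>R x"] by (simp add: mollifier_def)

lemma mollifier_zero': assumes "1 <= norm x" shows "mollifier n x = 0"
 using mult_mono[of 1 "real (Suc n)" 1 "norm x"] assms by (intro mollifier_zero) simp

lemma integral_mollifier: "(LBINT x. mollifier n (x::'a::euclidean_space)) = 1"
 using integral_scaled_bump_pos[of n, where 'a='a] by (simp add: mollifier_def)

lemma integrable_mollifier: "integrable lborel (mollifier n)"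
 using loc_int_times_test[OF bounded_imp_loc_int[of "%_. 1" 1] smooth_test_mollifier] by simp

lemma nn_integral_mollifier: "(NBINT x. ennreal (mollifier n x)) = 1"
 by (subst nn_integral_eq_integral[OF integrable_mollifier]) (simp_all add: mollifier_nonneg integral_mollifier)

definition moll :: "nat => ('a::euclidean_space => real) => 'a => real" where
 "moll n g = conv g (mollifier n)"

lemma smooth_moll: "loc_int g ==> smooth (moll n g)"
 unfolding moll_def by (intro smooth_conv smooth_test_mollifier)

lemma moll_integrand: "loc_int g ==> integrable lborel (%y. g y * mollifier n (x - y))"
 by (intro loc_int_times_test smooth_test_reflect smooth_test_mollifier)

lemma moll_borel: "loc_int g ==> moll n g : Borel"
 by (intro smooth_borel smooth_moll)

lemma moll_diff: "loc_int g ==> loc_int k ==> moll n (%y. g y - k y) x = moll n g x - moll n k x"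
 unfolding moll_def conv_def left_diff_distrib by (intro Bochner_Integration.integral_diff moll_integrand)

lemma integral_mollifier_reflect: "(LBINT y. mollifier n (x - y)) = 1"
 using integral_lborel_reflect[of "mollifier n" x] integral_mollifier[where 'a='a] by simp

lemma integrable_mollifier_reflect: "integrable lborel (%y. mollifier n (x - y))"
 using moll_integrand[OF bounded_imp_loc_int[of "%_. 1" 1], of n x] by simp

lemma moll_bound:
 assumes "loc_int g" "AEL y. \<bar>g y\<bar> <= C" shows "\<bar>moll n g x\<bar> <= C"
proof -
 have "\<bar>moll n g x\<bar> <= (LBINT y. \<bar>g y * mollifier n (x - y)\<bar>)"
  unfolding moll_def conv_def by (rule integral_abs_bound)
 also have "... <= (LBINT y. C * mollifier n (x - y))"
 proof (rule integral_mono_AE)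
  show "AEL y. \<bar>g y * mollifier n (x - y)\<bar> <= C * mollifier n (x - y)"
   using assms(2) by eventually_elim (auto simp: abs_mult mollifier_nonneg intro!: mult_right_mono)
 qed (use moll_integrand[OF assms(1)] integrable_mollifier_reflect in auto)
 also have "... = C" by (simp add: integral_mollifier_reflect)
 finally show ?thesis .
qed

lemma moll_nonneg: "(!!y. 0 <= g y) ==> 0 <= moll n g x"
 unfolding moll_def conv_def by (intro integral_nonneg_AE AE_I2 mult_nonneg_nonneg mollifier_nonneg) auto

lemma moll_zero_outside:
 fixes g :: "'a::euclidean_space => real"
 assumes "AEL y. R < norm y --> g y = 0" "R + 1 <= norm x" "loc_int g" shows "moll n g x = 0"
proof -
 have [measurable]: "g : Borel" using assms by auto
 have "(LBINT y. g y * mollifier n (x - y)) = integral\<^sup>L lborel (%y::'a. 0::real)"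
 proof (rule integral_cong_AE)
  show "AEL y. g y * mollifier n (x - y) = 0"
   using assms(1)
  proof eventually_elim
   case (elim y)
   show ?case
   proof (cases "R < norm y")
    case False
    then have "1 <= norm (x - y)" using norm_triangle_ineq2[of x y] assms(2) by linarith
    then show ?thesis by (simp add: mollifier_zero')
   qed (use elim in simp)
  qed
 qed (measurable)
 then show ?thesis by (simp add: moll_def conv_def)
qed

lemma moll_contraction:
 assumes g: "integrable lborel g"
 shows "(NBINT x. ennreal \<bar>moll n g x\<bar>) <= (NBINT x. ennreal \<bar>g x\<bar>)"
proof -
 have [measurable]: "g : Borel" using g by auto
 have "(NBINT x. ennreal \<bar>moll n g x\<bar>) <= (NBINT x. (NBINT y. ennreal (\<bar>g y\<bar> * mollifier n (x - y))))"
 proof (intro nn_integral_mono)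
  fix x
  have "ennreal \<bar>moll n g x\<bar> = ennreal (norm (LBINT y. g y * mollifier n (x - y)))"
   by (simp add: moll_def conv_def)
  also have "... <= (NBINT y. ennreal (norm (g y * mollifier n (x - y))))"
   by (rule integral_norm_bound_ennreal[OF moll_integrand[OF integrable_imp_loc_int[OF g]]])
  finally show "ennreal \<bar>moll n g x\<bar> <= (NBINT y. ennreal (\<bar>g y\<bar> * mollifier n (x - y)))"
   by (simp add: abs_mult mollifier_nonneg)
 qed
 also have "... = (NBINT y. (NBINT x. ennreal (\<bar>g y\<bar> * mollifier n (x - y))))"
  by (rule lborel_pair.Fubini') measurable
 also have "... = (NBINT y. ennreal \<bar>g y\<bar>)"
  by (intro nn_integral_cong) (simp add: ennreal_mult mollifier_nonneg nn_integral_cmult nn_integral_mollifier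
    nn_integral_lborel_translate[of "%y. ennreal (mollifier n y)"])
 finally show ?thesis .
qed

lemma moll_tendsto:
 fixes \<phi> :: "'a::euclidean_space => real"
 assumes \<phi>: "continuous_on UNIV \<phi>" "loc_int \<phi>"
 shows "(%n. moll n \<phi> x) \<leadsto> \<phi> x"
proof (rule LIMSEQ_I)
 fix e :: real assume e: "0 < e"
 have "isCont \<phi> x" using \<phi>(1) by (simp add: continuous_on_eq_continuous_at)
 then obtain d where d: "d > 0" "!!y. dist y x < d ==> dist (\<phi> y) (\<phi> x) < e / 2"
  unfolding continuous_at_eps_delta using e by (metis half_gt_zero)
 obtain N where N: "inverse (real (Suc N)) < d" using reals_Archimedean d(1) by blast
 have "norm (moll n \<phi> x - \<phi> x) < e" if "n \<ge> N" for n
 proof -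
  have "moll n \<phi> x - \<phi> x = moll n \<phi> x - \<phi> x * (LBINT y. mollifier n (x - y))"
   by (simp add: integral_mollifier_reflect)
  also have "... = (LBINT y. (\<phi> y - \<phi> x) * mollifier n (x - y))"
   unfolding moll_def conv_def using moll_integrand[OF \<phi>(2), of n x] integrable_mollifier_reflect[of n x]
   by (simp add: left_diff_distrib)
  also have "\<bar>...\<bar> <= (LBINT y. \<bar>(\<phi> y - \<phi> x) * mollifier n (x - y)\<bar>)" by (rule integral_abs_bound)
  also have "... <= (LBINT y. (e / 2) * mollifier n (x - y))"
  proof (rule integral_mono)
   show "integrable lborel (%y. \<bar>(\<phi> y - \<phi> x) * mollifier n (x - y)\<bar>)"
    using moll_integrand[OF \<phi>(2), of n x] integrable_mollifier_reflect[of n x] by (simp add: left_diff_distrib)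
   show "integrable lborel (%y. (e / 2) * mollifier n (x - y))"
    by (intro integrable_mult_right integrable_mollifier_reflect)
   fix y
   show "\<bar>(\<phi> y - \<phi> x) * mollifier n (x - y)\<bar> <= (e / 2) * mollifier n (x - y)"
   proof (cases "1 <= real (Suc n) * norm (x - y)")
    case True then show ?thesis by (simp add: mollifier_zero)
   next
    case False
    then have "norm (x - y) < inverse (real (Suc n))" by (simp add: field_simps)
    also have "... <= inverse (real (Suc N))" using that by simp
    finally have "dist y x < d" using N by (simp add: dist_norm norm_minus_commute)
    then have "\<bar>\<phi> y - \<phi> x\<bar> <= e / 2" using d(2) by (simp add: dist_real_def less_imp_le)
    from mult_right_mono[OF this mollifier_nonneg[of n "x - y"]] show ?thesis
     by (simp add: abs_mult mollifier_nonneg)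
   qed
  qed
  also have "... = e / 2" by (simp add: integral_mollifier_reflect)
  finally show ?thesis using e by simp
 qed
 then show "\<exists>N. \<forall>n\<ge>N. norm (moll n \<phi> x - \<phi> x) < e" by blast
qed

lemma tendsto_zero_less:
 fixes X :: "nat => real"
 assumes "X \<leadsto> 0" "e > 0" obtains n where "X n < e"
 using order_tendstoD(2)[OF assms] by (auto simp: eventually_sequentially)

text \<open>Compactly supported continuous functions are dense in $L^1$: truncate the height and the
 support of the function, then truncate in the same way a sequence of continuous functions that
 converges to it almost everywhere.\<close>

lemma L1_approx_continuous:
 fixes g :: "'a::euclidean_space => real"
 assumes g: "integrable lborel g" and e: "e > 0"
 obtains \<phi> R C where "continuous_on UNIV \<phi>" "!!x. R < norm x ==> \<phi> x = 0" "!!x. \<bar>\<phi> x\<bar> <= C"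
  "(NBINT x. ennreal \<bar>g x - \<phi> x\<bar>) < ennreal e"
proof -
 have [measurable]: "g : Borel" using g by auto
 define cut where "cut m x = max 0 (min 1 (real m + 1 - norm x))" for m :: nat and x :: 'a
 define tr where "tr m s = max (- real m) (min (real m) s)" for m s
 have cut: "0 <= cut m x" "cut m x <= 1" "real m + 1 < norm x ==> cut m x = 0" for m x
  by (auto simp: cut_def)
 have [measurable]: "cut m : Borel" for m unfolding cut_def by measurable
 have tr_borel[measurable]: "tr m : Borel" for m unfolding tr_def by measurable
 have tr: "\<bar>tr m s\<bar> <= real m" "\<bar>tr m s\<bar> <= \<bar>s\<bar>" for m s by (auto simp: tr_def)
 have absint: "integrable lborel (%x. \<bar>g x\<bar>)" using g by simp
 have "(%m. LBINT x. \<bar>g x - tr m (g x) * cut m x\<bar>) \<leadsto> integral\<^sup>L lborel (%x::'a. 0::real)"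
 proof (rule integral_dominated_convergence[where w="%x. 2 * \<bar>g x\<bar>"])
  show "AEL x. (%m. \<bar>g x - tr m (g x) * cut m x\<bar>) \<leadsto> 0"
  proof (rule AE_I2, rule tendsto_eventually)
   fix x
   obtain M where M: "norm x <= real M" "\<bar>g x\<bar> <= real M"
    using real_arch_simple[of "max (norm x) \<bar>g x\<bar>"] by auto
   show "\<forall>\<^sub>F m in sequentially. \<bar>g x - tr m (g x) * cut m x\<bar> = 0"
    by (rule eventually_sequentiallyI[of M]) (use M in \<open>auto simp: tr_def cut_def\<close>)
  qed
  show "AEL x. norm \<bar>g x - tr m (g x) * cut m x\<bar> <= 2 * \<bar>g x\<bar>" for m
  proof (rule AE_I2)
   fix x
   have "\<bar>tr m (g x) * cut m x\<bar> <= \<bar>g x\<bar> * 1" unfolding abs_mult by (intro mult_mono tr) (use cut[of m x] in auto)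
   then show "norm \<bar>g x - tr m (g x) * cut m x\<bar> <= 2 * \<bar>g x\<bar>" by simp
  qed
 qed (use absint in simp_all)
 then have "(%m. LBINT x. \<bar>g x - tr m (g x) * cut m x\<bar>) \<leadsto> 0" by simp
 then obtain m where m: "(LBINT x. \<bar>g x - tr m (g x) * cut m x\<bar>) < e / 2"
  by (rule tendsto_zero_less[of _ "e/2"]) (use e in simp_all)
 have "g : borel_measurable lebesgue" by (simp add: measurable_completion)
 then have "g measurable_on UNIV" by (intro lebesgue_measurable_imp_measurable_on) auto
 then obtain N G where N: "negligible N" and G: "!!n. continuous_on UNIV (G n)" "!!x. x \<notin> N ==> (%n. G n x) \<leadsto> g x"
  unfolding measurable_on_def by auto
 have [measurable]: "G n : Borel" for n using G(1) by (rule borel_measurable_continuous_onI)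
 have aeN: "AEL x. x \<notin> N"
  using N AE_not_in[of N lebesgue] by (simp add: negligible_iff_null_sets AE_completion_iff)
 have intcut: "integrable lborel (%x. real m * cut m x)"
  using loc_int_times_bounded[OF bounded_imp_loc_int[of "%_. real m" "real m"], of "cut m" 1 "real m + 1"] cut by auto
 have "(%n. LBINT x. \<bar>tr m (g x) * cut m x - tr m (G n x) * cut m x\<bar>) \<leadsto> integral\<^sup>L lborel (%x::'a. 0::real)"
 proof (rule integral_dominated_convergence[where w="%x. 2 * (real m * cut m x)"])
  show "AEL x. (%n. \<bar>tr m (g x) * cut m x - tr m (G n x) * cut m x\<bar>) \<leadsto> 0"
   using aeN
  proof eventually_elim
   case (elim x)
   have "(%n. \<bar>tr m (g x) * cut m x - tr m (G n x) * cut m x\<bar>) \<leadsto> \<bar>tr m (g x) * cut m x - tr m (g x) * cut m x\<bar>"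
    unfolding tr_def by (intro tendsto_intros G(2)[OF elim])
   then show ?case by simp
  qed
  show "AEL x. norm \<bar>tr m (g x) * cut m x - tr m (G n x) * cut m x\<bar> <= 2 * (real m * cut m x)" for n
  proof (rule AE_I2)
   fix x
   have "\<bar>tr m s * cut m x\<bar> <= real m * cut m x" for s
    unfolding abs_mult using cut[of m x] by (intro mult_mono tr) auto
   from this[of "g x"] this[of "G n x"]
   show "norm \<bar>tr m (g x) * cut m x - tr m (G n x) * cut m x\<bar> <= 2 * (real m * cut m x)" by simp
  qed
 qed (use intcut in simp_all)
 then have "(%n. LBINT x. \<bar>tr m (g x) * cut m x - tr m (G n x) * cut m x\<bar>) \<leadsto> 0" by simp
 then obtain n where n: "(LBINT x. \<bar>tr m (g x) * cut m x - tr m (G n x) * cut m x\<bar>) < e / 2"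
  by (rule tendsto_zero_less[of _ "e/2"]) (use e in simp_all)
 let ?\<phi> = "%x. tr m (G n x) * cut m x"
 have b: "\<bar>tr m s * cut m x\<bar> <= real m * cut m x" for s x
  unfolding abs_mult using cut[of m x] by (intro mult_mono tr) auto
 have i1: "integrable lborel (%x. tr m (g x) * cut m x)" and i2: "integrable lborel ?\<phi>"
  by (rule Bochner_Integration.integrable_bound[OF intcut]; use b cut in \<open>force simp: abs_mult\<close>)+
 show ?thesis
 proof (rule that[of ?\<phi> "real m + 1" "real m"])
  show "continuous_on UNIV ?\<phi>" unfolding tr_def cut_def by (intro continuous_intros G)
  show "real m + 1 < norm x ==> ?\<phi> x = 0" for x using cut by simp
  show "\<bar>?\<phi> x\<bar> <= real m" for x
   using b[of "G n x" x] mult_left_mono[OF cut(2)[of m x], of "real m"] by simp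
  have eq: "(NBINT x. ennreal \<bar>g x - ?\<phi> x\<bar>) = ennreal (LBINT x. \<bar>g x - ?\<phi> x\<bar>)"
   using g i2 by (intro nn_integral_eq_integral) auto
  have "(LBINT x. \<bar>g x - ?\<phi> x\<bar>) <= (LBINT x. \<bar>g x - tr m (g x) * cut m x\<bar> + \<bar>tr m (g x) * cut m x - ?\<phi> x\<bar>)"
   using g i1 i2 by (intro integral_mono) auto
  also have "... < e" using m n g i1 i2 by simp
  finally have "(LBINT x. \<bar>g x - ?\<phi> x\<bar>) < e" .
  then have "ennreal (LBINT x. \<bar>g x - ?\<phi> x\<bar>) < ennreal e"
   using e by (intro ennreal_lessI)
  with eq show "(NBINT x. ennreal \<bar>g x - ?\<phi> x\<bar>) < ennreal e" by simp
 qed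
qed

lemma moll_L1:
 fixes g :: "'a::euclidean_space => real"
 assumes g: "integrable lborel g"
 shows "(%n. \<integral>\<^sup>+x. ennreal \<bar>moll n g x - g x\<bar> \<partial>lborel) \<leadsto> 0"
proof (rule order_tendstoI)
 fix e :: ennreal assume "0 < e"
 obtain e' where e': "0 < e'" "ennreal e' < e"
 proof -
  obtain d where d: "0 < d" "d < e" using \<open>0 < e\<close> dense by blast
  then have "d \<noteq> top" by (metis not_less_iff_gr_or_eq top.not_eq_extremum order.strict_trans)
  then have "ennreal (enn2real d) = d" by (simp add: ennreal_enn2real less_top)
  moreover have "0 < enn2real d" using d \<open>d \<noteq> top\<close> by (simp add: enn2real_positive_iff less_top)
  ultimately show ?thesis using d that[of "enn2real d"] by simp
 qed
 obtain \<phi> R C where \<phi>: "continuous_on UNIV \<phi>" "!!x. R < norm x ==> \<phi> x = 0" "!!x. \<bar>\<phi> x\<bar> <= C"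
  "(NBINT x. ennreal \<bar>g x - \<phi> x\<bar>) < ennreal (e'/3)"
  using L1_approx_continuous[OF g, of "e'/3"] e' by auto
 have [measurable]: "g : Borel" "\<phi> : Borel"
  using g \<phi>(1) by (auto intro: borel_measurable_continuous_onI)
 have i\<phi>: "integrable lborel \<phi>"
  using loc_int_times_bounded[OF bounded_imp_loc_int[of "%_. 1" 1], of \<phi> C R] \<phi> by auto
 have l: "loc_int \<phi>" "loc_int g" using i\<phi> g integrable_imp_loc_int by auto
 note [measurable] = moll_borel[OF l(1)] moll_borel[OF l(2)]
 have C0: "0 <= C" using \<phi>(3)[of undefined] by linarith
 have ib: "integrable lborel (ball_ind (R+1) :: 'a => real)"
  using emeasure_lborel_cball_finite by (intro integrable_real_indicator) auto
 have "(%n. LBINT x. \<bar>moll n \<phi> x - \<phi> x\<bar>) \<leadsto> integral\<^sup>L lborel (%x::'a. 0::real)"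
 proof (rule integral_dominated_convergence[where w="%x. 2 * C * ball_ind (R+1) x"])
  show "AEL x. (%n. \<bar>moll n \<phi> x - \<phi> x\<bar>) \<leadsto> 0"
   by (intro AE_I2 tendsto_rabs_zero) (simp add: LIM_zero_iff moll_tendsto[OF \<phi>(1) l(1)])
  show "AEL x. norm \<bar>moll n \<phi> x - \<phi> x\<bar> <= 2 * C * ball_ind (R+1) x" for n
  proof (rule AE_I2)
   fix x
   have "\<bar>moll n \<phi> x\<bar> <= C" by (rule moll_bound[OF l(1)]) (use \<phi> in auto)
   moreover have "moll n \<phi> x = 0 \<and> \<phi> x = 0" if "R + 1 < norm x"
    using moll_zero_outside[of R \<phi> x n] \<phi> l that by auto
   ultimately show "norm \<bar>moll n \<phi> x - \<phi> x\<bar> <= 2 * C * ball_ind (R+1) x"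
    using \<phi>(3)[of x] by (auto simp: indicator_def)
  qed
 qed (use ib in simp_all)
 then have "\<forall>\<^sub>F n in sequentially. (LBINT x. \<bar>moll n \<phi> x - \<phi> x\<bar>) < e'/3"
  using order_tendstoD(2)[of _ "integral\<^sup>L lborel (%x. 0::real)" sequentially "e'/3"] e' by simp
 then show "\<forall>\<^sub>F n in sequentially. (NBINT x. ennreal \<bar>moll n g x - g x\<bar>) < e"
 proof eventually_elim
  case (elim n)
  have im: "integrable lborel (%x. \<bar>moll n \<phi> x - \<phi> x\<bar>)"
  proof (rule Bochner_Integration.integrable_bound[of _ "%x. 2 * C * ball_ind (R+1) x"])
   show "AEL x. norm \<bar>moll n \<phi> x - \<phi> x\<bar> <= norm (2 * C * ball_ind (R+1) x)"
   proof (rule AE_I2)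
    fix x
    have "\<bar>moll n \<phi> x\<bar> <= C" by (rule moll_bound[OF l(1)]) (use \<phi> in auto)
    moreover have "moll n \<phi> x = 0 \<and> \<phi> x = 0" if "R + 1 < norm x"
     using moll_zero_outside[of R \<phi> x n] \<phi> l that by auto
    ultimately show "norm \<bar>moll n \<phi> x - \<phi> x\<bar> <= norm (2 * C * ball_ind (R+1) x)"
     using \<phi>(3)[of x] C0 by (auto simp: indicator_def)
   qed
  qed (use ib in simp_all)
  have 2: "(NBINT x. ennreal \<bar>moll n \<phi> x - \<phi> x\<bar>) < ennreal (e'/3)"
   using elim e'(1) nn_integral_eq_integral[OF im] by (simp add: ennreal_less_iff)
  have igp: "integrable lborel (%x. g x - \<phi> x)" using g i\<phi> by simp
  have 1: "(NBINT x. ennreal \<bar>moll n (%x. g x - \<phi> x) x\<bar>) < ennreal (e'/3)"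
   using moll_contraction[OF igp, of n] \<phi>(4) by (rule le_less_trans)
  have [measurable]: "moll n (%x. g x - \<phi> x) : Borel"
   by (rule moll_borel[OF integrable_imp_loc_int[OF igp]])
  have "(NBINT x. ennreal \<bar>moll n g x - g x\<bar>) \<le>
   (NBINT x. (ennreal \<bar>moll n (%x. g x - \<phi> x) x\<bar> + ennreal \<bar>moll n \<phi> x - \<phi> x\<bar>) + ennreal \<bar>g x - \<phi> x\<bar>)"
  proof (rule nn_integral_mono)
   fix x
   have "\<bar>moll n g x - g x\<bar> <= \<bar>moll n (%x. g x - \<phi> x) x\<bar> + \<bar>moll n \<phi> x - \<phi> x\<bar> + \<bar>g x - \<phi> x\<bar>"
    using moll_diff[OF l(2,1), of n x] by simp
   then show "ennreal \<bar>moll n g x - g x\<bar> <= (ennreal \<bar>moll n (%x. g x - \<phi> x) x\<bar> + ennreal \<bar>moll n \<phi> x - \<phi> x\<bar>) + ennreal \<bar>g x - \<phi> x\<bar>"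
    by (simp add: ennreal_plus[symmetric] ennreal_leI del: ennreal_plus)
  qed
  also have "... = (NBINT x. ennreal \<bar>moll n (%x. g x - \<phi> x) x\<bar>) + (NBINT x. ennreal \<bar>moll n \<phi> x - \<phi> x\<bar>) + (NBINT x. ennreal \<bar>g x - \<phi> x\<bar>)"
   by (simp add: nn_integral_add)
  also have "... <= ennreal (e'/3) + ennreal (e'/3) + ennreal (e'/3)"
   by (intro add_mono less_imp_le 1 2 \<phi>(4))
  also have "... = ennreal e'" using e' by (simp add: ennreal_plus[symmetric] del: ennreal_plus)
  finally show ?case using e'(2) by (rule le_less_trans)
 qed
qed simp

lemma moll_L1_loc:
 fixes g :: "'a::euclidean_space => real"
 assumes g: "loc_int g"
 shows "(%n. \<integral>\<^sup>+x\<in>cball 0 R. ennreal \<bar>moll n g x - g x\<bar> \<partial>lborel) \<leadsto> 0"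
proof -
 define g' where "g' x = g x * ball_ind (R+1) x" for x
 have [measurable]: "g : Borel" using g by auto
 have i: "integrable lborel g'"
  unfolding g'_def by (rule loc_int_times_bounded[OF g, where C=1 and R="R+1"]) (auto simp: indicator_def)
 have eq: "moll n g x = moll n g' x" if "x : cball 0 R" for x n
 proof -
  have "g y * mollifier n (x - y) = g' y * mollifier n (x - y)" for y
  proof (cases "norm y <= R + 1")
   case False
   then have "1 <= norm (x - y)" using that norm_triangle_ineq2[of y x] by (simp add: norm_minus_commute)
   then show ?thesis by (simp add: mollifier_zero')
  qed (simp add: g'_def)
  then have "(%y. g y * mollifier n (x - y)) = (%y. g' y * mollifier n (x - y))" by blast
  then show ?thesis unfolding moll_def conv_def by simp
 qed
 show ?thesis
 proof (rule tendsto_sandwich[OF _ _ tendsto_const moll_L1[OF i]])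
  show "\<forall>\<^sub>F n in sequentially. (NBALL R (%x. ennreal \<bar>moll n g x - g x\<bar>)) <= (NBINT x. ennreal \<bar>moll n g' x - g' x\<bar>)"
  proof (rule always_eventually, rule allI, rule nn_integral_mono)
   fix n x
   show "ennreal \<bar>moll n g x - g x\<bar> * ball_ind R x <= ennreal \<bar>moll n g' x - g' x\<bar>"
    using eq[of x n] by (cases "x : cball 0 R") (auto simp: g'_def)
  qed
 qed simp
qed

section \<open>Weak gradients\<close>

subsection \<open>Borel representatives\<close>

lemma lebesgue_cong_AE:
 fixes f g :: "'a::euclidean_space => 'b::euclidean_space"
 assumes ae: "AEL x. f x = g x"
 shows lebesgue_measurable_cong_AE: "f : borel_measurable lebesgue \<longleftrightarrow> g : borel_measurable lebesgue"
  and lebesgue_integrable_cong_AE: "integrable lebesgue f \<longleftrightarrow> integrable lebesgue g"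
  and lebesgue_integral_cong_AE: "(LINT x|lebesgue. f x) = (LINT x|lebesgue. g x)"
proof -
 have ae': "AE x in lebesgue. f x = g x" using ae by (rule AE_completion)
 then have ae'': "AE x in lebesgue. g x = f x" by eventually_elim simp
 show m: "f : borel_measurable lebesgue \<longleftrightarrow> g : borel_measurable lebesgue"
  using borel_measurable_AE ae' ae'' by blast
 show i: "integrable lebesgue f \<longleftrightarrow> integrable lebesgue g"
  using integrable_cong_AE_imp[of lebesgue f g] integrable_cong_AE_imp[of lebesgue g f] m ae' ae''
  by (meson borel_measurable_integrable)
 show "(LINT x|lebesgue. f x) = (LINT x|lebesgue. g x)"
 proof (cases "integrable lebesgue f")
  case True
  then show ?thesis using i ae' by (intro integral_cong_AE) auto
 next
  case False
  then show ?thesis using i by (simp add: not_integrable_integral_eq)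
 qed
qed

lemma lebesgue_ex_borel_vector:
 fixes f :: "'a::euclidean_space => real^'n"
 assumes "f : borel_measurable lebesgue"
 obtains g where "g : Borel" "AEL x. f x = g x"
proof -
 have m: "(%x. f x $ i) : borel_measurable (completion lborel)" for i
 proof -
  have "(%x. f x \<bullet> axis i 1) : borel_measurable lebesgue" using assms by (intro borel_measurable_inner) auto
  then show ?thesis by (simp add: inner_axis)
 qed
 have "\<exists>g. g : borel_measurable lborel \<and> (AEL x. f x $ i = g x)" for i
  using completion_ex_borel_measurable_real[OF m[of i]] by blast
 then obtain g where g: "!!i. g i : borel_measurable lborel" "!!i. AEL x. f x $ i = g i x"
  by metis
 show ?thesis
 proof (rule that)
  show "(%x. \<chi> i. g i x) : Borel"
   unfolding borel_measurable_euclidean_space[of "%x. \<chi> i. g i x"] using g(1)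
   by (auto simp: Basis_vec_def inner_axis)
  have "AEL x. \<forall>i. f x $ i = g i x" using g(2) by (simp add: AE_all_countable)
  then show "AEL x. f x = (\<chi> i. g i x)" by eventually_elim (simp add: vec_eq_iff)
 qed
qed

lemma set_integrable_lebesgue_iff:
 fixes u :: "'a::euclidean_space => 'b::euclidean_space"
 assumes [measurable]: "u : Borel" "K : sets borel"
 shows "set_integrable lebesgue K u \<longleftrightarrow> (NBSET K (%x. ennreal (norm (u x)))) < \<infinity>"
proof -
 have "set_integrable lebesgue K u \<longleftrightarrow> integrable lborel (%x. indicator K x *\<^sub>R u x)"
  unfolding set_integrable_def by (rule integrable_completion) measurable
 also have "... \<longleftrightarrow> (NBINT x. ennreal (norm (indicator K x *\<^sub>R u x))) < \<infinity>"
  by (simp add: integrable_iff_bounded)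
 also have "(NBINT x. ennreal (norm (indicator K x *\<^sub>R u x))) = (NBSET K (%x. ennreal (norm (u x))))"
  by (intro nn_integral_cong) (auto simp: indicator_def)
 finally show ?thesis .
qed

lemma loc_integrable_iff_balls:
 fixes u :: "real^3 => 'b::euclidean_space"
 assumes [measurable]: "u : Borel"
 shows "loc_integrable u \<longleftrightarrow> (\<forall>R. (NBALL R (%x. ennreal (norm (u x)))) < \<infinity>)"
proof
 assume l: "loc_integrable u"
 show "\<forall>R. (NBALL R (%x. ennreal (norm (u x)))) < \<infinity>"
 proof
  fix R
  have "set_integrable lebesgue (cball 0 R) u" using l compact_cball unfolding loc_integrable_def by blast
  then show "(NBALL R (%x. ennreal (norm (u x)))) < \<infinity>"
   using set_integrable_lebesgue_iff[OF assms sets_borel_cball] by simp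
 qed
next
 assume R: "\<forall>R. (NBALL R (%x. ennreal (norm (u x)))) < \<infinity>"
 show "loc_integrable u" unfolding loc_integrable_def
 proof (intro conjI allI impI)
  fix K :: "(real^3) set" assume K: "compact K"
  then obtain r where r: "!!x. x : K ==> norm x <= r" using compact_imp_bounded bounded_iff by metis
  have "(NBSET K (%x. ennreal (norm (u x)))) <= (NBALL r (%x. ennreal (norm (u x))))"
   by (intro nn_integral_mono) (auto simp: indicator_def r)
  also have "... < \<infinity>" using R by blast
  finally show "set_integrable lebesgue K u"
   using set_integrable_lebesgue_iff[OF assms] K by (simp add: borel_compact)
 qed (simp add: measurable_completion)
qed

lemma loc_integrable_iff_loc_int:
 assumes "u : Borel" shows "loc_integrable u \<longleftrightarrow> loc_int u"
 using loc_integrable_iff_balls[OF assms] assms by (simp add: loc_int_def)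

lemma borel_measurable_nth[measurable (raw)]:
 "G : borel_measurable M ==> (%v. (G v :: real^3) $ i) : borel_measurable M"
 using borel_measurable_inner[of G M "%_. axis i 1"] by (simp add: inner_axis)

lemma loc_integrable_vector_iff:
 fixes G :: "real^3 => real^3"
 assumes [measurable]: "G : Borel"
 shows "loc_integrable G \<longleftrightarrow> (\<forall>i. loc_int (%v. G v $ i))"
proof
 assume "loc_integrable G"
 then have fin: "(NBALL R (%x. ennreal (norm (G x)))) < \<infinity>" for R
  using loc_integrable_iff_balls[OF assms] by simp
 show "\<forall>i. loc_int (%v. G v $ i)"
  unfolding loc_int_def
 proof (intro allI conjI)
  fix i R
  have "(NBALL R (%x. ennreal \<bar>G x $ i\<bar>)) <= (NBALL R (%x. ennreal (norm (G x))))"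
   by (intro nn_integral_mono mult_right_mono ennreal_leI component_le_norm_cart) auto
  then show "(NBALL R (%x. ennreal \<bar>G x $ i\<bar>)) < \<infinity>" using fin le_less_trans by blast
 qed measurable
next
 assume l: "\<forall>i. loc_int (%v. G v $ i)"
 show "loc_integrable G" unfolding loc_integrable_iff_balls[OF assms]
 proof
  fix R
  have "(NBALL R (%x. ennreal (norm (G x))))
   <= (NBINT x. (\<Sum>i\<in>UNIV. ennreal \<bar>G x $ i\<bar> * ball_ind R x))"
   unfolding sum_distrib_right[symmetric]
   by (intro nn_integral_mono mult_right_mono) (auto intro: ennreal_leI norm_le_l1_cart simp: sum_ennreal)
  also have "... = (\<Sum>i\<in>UNIV. (NBALL R (%x. ennreal \<bar>G x $ i\<bar>)))"
   by (rule nn_integral_sum) measurable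
  also have "... < \<infinity>" using l loc_int_finite by (auto simp: less_top[symmetric])
  finally show "(NBALL R (%x. ennreal (norm (G x)))) < \<infinity>" .
 qed
qed

definition borel_weak_grad :: "(real^3 => real) => (real^3 => real^3) => bool" where
 "borel_weak_grad u G \<longleftrightarrow> loc_int u \<and> G : Borel \<and> (\<forall>i. loc_int (%v. G v $ i)) \<and>
  (\<forall>\<psi> i. smooth_test UNIV \<psi> --> (LBINT v. u v * partial i \<psi> v) = - (LBINT v. G v $ i * \<psi> v))"

lemma is_weak_grad_borel_iff:
 assumes [measurable]: "u : Borel" "G : Borel"
 shows "is_weak_grad u G \<longleftrightarrow> borel_weak_grad u G"
proof -
 have "(LINT v|lebesgue. u v * partial i \<psi> v) = (LBINT v. u v * partial i \<psi> v)"
  "(LINT v|lebesgue. G v $ i * \<psi> v) = (LBINT v. G v $ i * \<psi> v)" if "smooth_test UNIV \<psi>" for i \<psi>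
 proof -
  have s: "smooth \<psi>" using that by (simp add: smooth_test_iff)
  note [measurable] = smooth_borel[OF s] smooth_borel[OF smooth_partial[OF s]]
  show "(LINT v|lebesgue. u v * partial i \<psi> v) = (LBINT v. u v * partial i \<psi> v)"
   by (rule integral_completion) measurable
  show "(LINT v|lebesgue. G v $ i * \<psi> v) = (LBINT v. G v $ i * \<psi> v)"
   by (rule integral_completion) measurable
 qed
 then show ?thesis
  unfolding is_weak_grad_def borel_weak_grad_def loc_integrable_iff_loc_int[OF assms(1)] loc_integrable_vector_iff[OF assms(2)]
  using assms by simp
qed

lemma loc_integrable_cong_AE:
 fixes u w :: "real^3 => 'b::euclidean_space"
 assumes ae: "AEL x. u x = w x" shows "loc_integrable u \<longleftrightarrow> loc_integrable w"
proof -
 have "AEL x. indicator K x *\<^sub>R u x = indicator K x *\<^sub>R w x" for K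
  using ae by eventually_elim simp
 then have "integrable lebesgue (%x. indicator K x *\<^sub>R u x) = integrable lebesgue (%x. indicator K x *\<^sub>R w x)" for K
  by (rule lebesgue_integrable_cong_AE)
 then show ?thesis
  unfolding loc_integrable_def set_integrable_def lebesgue_measurable_cong_AE[OF ae] by simp
qed

lemma is_weak_grad_cong_AE:
 assumes u: "AEL x. u x = u' x" and G: "AEL x. G x = G' x"
 shows "is_weak_grad u G \<longleftrightarrow> is_weak_grad u' G'"
proof -
 have "(LINT v|lebesgue. u v * partial i \<psi> v) = (LINT v|lebesgue. u' v * partial i \<psi> v)" for i \<psi>
  by (rule lebesgue_integral_cong_AE) (use u in eventually_elim, simp)
 moreover have "(LINT v|lebesgue. G v $ i * \<psi> v) = (LINT v|lebesgue. G' v $ i * \<psi> v)" for i \<psi>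
  by (rule lebesgue_integral_cong_AE) (use G in eventually_elim, simp)
 ultimately show ?thesis
  unfolding is_weak_grad_def loc_integrable_cong_AE[OF u] loc_integrable_cong_AE[OF G] by simp
qed

lemma wgrad_cong_AE:
 assumes "AEL x. u x = u' x" shows "wgrad u = wgrad u'" "weakly_differentiable u \<longleftrightarrow> weakly_differentiable u'"
proof -
 have "is_weak_grad u = is_weak_grad u'"
  by (intro ext is_weak_grad_cong_AE[OF assms]) simp
 then show "wgrad u = wgrad u'" "weakly_differentiable u \<longleftrightarrow> weakly_differentiable u'"
  unfolding wgrad_def weakly_differentiable_def by simp_all
qed

lemma weakly_differentiable_borel:
 assumes "weakly_differentiable u" "u : Borel"
 obtains G where "borel_weak_grad u G" "AEL v. wgrad u v = G v"
proof -
 have w: "is_weak_grad u (wgrad u)"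
  using assms(1) unfolding weakly_differentiable_def wgrad_def by (rule someI_ex)
 then have "wgrad u : borel_measurable lebesgue" by (simp add: is_weak_grad_def loc_integrable_def)
 then obtain G where G: "G : Borel" "AEL v. wgrad u v = G v"
  by (rule lebesgue_ex_borel_vector)
 have "is_weak_grad u G" using w is_weak_grad_cong_AE[of u u "wgrad u" G] G(2) by simp
 then show ?thesis using that G is_weak_grad_borel_iff[OF assms(2) G(1)] by blast
qed

subsection \<open>Mollifying weak gradients\<close>

lemma partial_moll:
 assumes w: "borel_weak_grad u G" shows "partial i (moll n u) x = moll n (%v. G v $ i) x"
proof -
 have l: "loc_int u" "loc_int (%v. G v $ i)" using w by (auto simp: borel_weak_grad_def)
 have t: "smooth_test UNIV (%y::real^3. mollifier n (x - y))"
  by (intro smooth_test_reflect smooth_test_mollifier)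
 have "partial i (moll n u) x = conv u (partial i (mollifier n)) x"
  unfolding moll_def by (intro partial_conv l smooth_test_mollifier)
 also have "... = - (LBINT y. u y * partial i (%y. mollifier n (x - y)) y)"
  by (simp add: conv_def partial_reflect[OF smooth_mollifier])
 also have "... = moll n (%v. G v $ i) x"
  using w t unfolding borel_weak_grad_def moll_def conv_def by simp
 finally show ?thesis .
qed

lemma loc_int_AE_zeroI:
 fixes g :: "'a::euclidean_space => real"
 assumes g: "loc_int g" and z: "!!n x. moll n g x = 0" shows "AEL x. g x = 0"
proof -
 have [measurable]: "g : Borel" using g by auto
 have "(NBALL (real k) (%x. ennreal \<bar>g x\<bar>)) = 0" for k
  using moll_L1_loc[OF g, of "real k"] by (simp add: z LIMSEQ_const_iff)
 then have "AEL x. \<forall>k. ennreal \<bar>g x\<bar> * ball_ind (real k) x = 0"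
  by (auto simp: AE_all_countable nn_integral_0_iff_AE simp del: mult_eq_0_iff)
 then show ?thesis
 proof eventually_elim
  case (elim x)
  obtain k where "norm x <= real k" using real_arch_simple by blast
  with elim[rule_format, of k] show ?case by simp
 qed
qed

lemma loc_int_test_zeroI:
 fixes g :: "'a::euclidean_space => real"
 assumes g: "loc_int g" and z: "!!\<psi>. smooth_test UNIV \<psi> ==> (LBINT v. g v * \<psi> v) = 0"
 shows "AEL x. g x = 0"
 by (rule loc_int_AE_zeroI[OF g])
  (auto simp: moll_def conv_def intro!: z smooth_test_reflect smooth_test_mollifier)

lemma loc_int_lincomb: assumes "loc_int g" "loc_int h" shows "loc_int (%x. a * g x + b * h x)"
proof -
 have [measurable]: "g : Borel" "h : Borel" using assms by auto
 show ?thesis unfolding loc_int_def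
 proof (intro conjI allI)
  fix R
  have "(NBALL R (%x. ennreal \<bar>a * g x + b * h x\<bar>))
   <= (NBINT x. ennreal \<bar>a\<bar> * (ennreal \<bar>g x\<bar> * ball_ind R x) + ennreal \<bar>b\<bar> * (ennreal \<bar>h x\<bar> * ball_ind R x))"
  proof (intro nn_integral_mono)
   fix x
   have "\<bar>a * g x + b * h x\<bar> <= \<bar>a\<bar> * \<bar>g x\<bar> + \<bar>b\<bar> * \<bar>h x\<bar>" by (metis abs_mult abs_triangle_ineq)
   then have "ennreal \<bar>a * g x + b * h x\<bar> <= ennreal \<bar>a\<bar> * ennreal \<bar>g x\<bar> + ennreal \<bar>b\<bar> * ennreal \<bar>h x\<bar>"
    by (simp add: ennreal_mult[symmetric] ennreal_plus[symmetric] ennreal_leI del: ennreal_plus)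
   then show "ennreal \<bar>a * g x + b * h x\<bar> * ball_ind R x <= ennreal \<bar>a\<bar> * (ennreal \<bar>g x\<bar> * ball_ind R x) + ennreal \<bar>b\<bar> * (ennreal \<bar>h x\<bar> * ball_ind R x)"
    by (auto simp: indicator_def)
  qed
  also have "... = ennreal \<bar>a\<bar> * (NBALL R (%x. ennreal \<bar>g x\<bar>)) + ennreal \<bar>b\<bar> * (NBALL R (%x. ennreal \<bar>h x\<bar>))"
   by (simp add: nn_integral_add nn_integral_cmult)
  also have "... < \<infinity>" using loc_int_finite[OF assms(1)] loc_int_finite[OF assms(2)] by (simp add: ennreal_mult_less_top)
  finally show "(NBALL R (%x. ennreal \<bar>a * g x + b * h x\<bar>)) < \<infinity>" .
 qed measurable
qed

lemma borel_weak_grad_unique: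
 assumes "borel_weak_grad u G" "borel_weak_grad u H" shows "AEL v. G v = H v"
proof -
 have "AEL v. G v $ i - H v $ i = 0" for i
 proof (rule loc_int_AE_zeroI)
  have l: "loc_int (%v. G v $ i)" "loc_int (%v. H v $ i)" using assms by (auto simp: borel_weak_grad_def)
  then show "loc_int (%v. G v $ i - H v $ i)" using loc_int_lincomb[OF l, of 1 "-1"] by simp
  show "moll n (%v. G v $ i - H v $ i) x = 0" for n x
   using moll_diff[OF l, of n x] partial_moll[OF assms(1), of i n x] partial_moll[OF assms(2), of i n x] by simp
 qed
 then have "AEL v. \<forall>i. G v $ i - H v $ i = 0" by (simp add: AE_all_countable)
 then show ?thesis by eventually_elim (simp add: vec_eq_iff)
qed

lemma wgrad_eqI:
 assumes "borel_weak_grad u G" shows "weakly_differentiable u" "AEL v. wgrad u v = G v"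
proof -
 have b: "u : Borel" "G : Borel" using assms by (auto simp: borel_weak_grad_def)
 show w: "weakly_differentiable u"
  using assms is_weak_grad_borel_iff[OF b] unfolding weakly_differentiable_def by blast
 obtain H where H: "borel_weak_grad u H" "AEL v. wgrad u v = H v"
  using weakly_differentiable_borel[OF w b(1)] by blast
 show "AEL v. wgrad u v = G v"
  using H(2) borel_weak_grad_unique[OF H(1) assms] by eventually_elim simp
qed

lemma borel_weak_grad_lincomb:
 assumes "borel_weak_grad u G" "borel_weak_grad w H"
 shows "borel_weak_grad (%v. a * u v + b * w v) (%v. a *\<^sub>R G v + b *\<^sub>R H v)"
proof -
 have l: "loc_int u" "loc_int w" "!!i. loc_int (%v. G v $ i)" "!!i. loc_int (%v. H v $ i)"
  and [measurable]: "G : Borel" "H : Borel"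
  using assms by (auto simp: borel_weak_grad_def)
 show ?thesis unfolding borel_weak_grad_def
 proof (intro conjI allI impI)
  show "loc_int (%v. a * u v + b * w v)" by (intro loc_int_lincomb l)
  show "(%v. a *\<^sub>R G v + b *\<^sub>R H v) : Borel" by measurable
  show "loc_int (%v. (a *\<^sub>R G v + b *\<^sub>R H v) $ i)" for i using loc_int_lincomb[OF l(3,4)] by simp
  fix \<psi> i assume t: "smooth_test UNIV (\<psi> :: real^3 => real)"
  note i = loc_int_times_test[OF _ t] loc_int_times_test[OF _ smooth_test_partial[OF t, of i]]
  have "(LBINT v. (a * u v + b * w v) * partial i \<psi> v)
    = (LBINT v. a * (u v * partial i \<psi> v) + b * (w v * partial i \<psi> v))"
   by (simp add: algebra_simps)
  also have "... = a * (LBINT v. u v * partial i \<psi> v) + b * (LBINT v. w v * partial i \<psi> v)"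
   using i(2)[OF l(1)] i(2)[OF l(2)] by simp
  also have "... = - (a * (LBINT v. G v $ i * \<psi> v) + b * (LBINT v. H v $ i * \<psi> v))"
   using assms t by (simp add: borel_weak_grad_def)
  also have "... = - (LBINT v. a * (G v $ i * \<psi> v) + b * (H v $ i * \<psi> v))"
   using i(1)[OF l(3)] i(1)[OF l(4)] by simp
  also have "... = - (LBINT v. (a *\<^sub>R G v + b *\<^sub>R H v) $ i * \<psi> v)"
   by (simp add: algebra_simps)
  finally show "(LBINT v. (a * u v + b * w v) * partial i \<psi> v) = - (LBINT v. (a *\<^sub>R G v + b *\<^sub>R H v) $ i * \<psi> v)" .
 qed
qed

lemma weakly_differentiable_rep:
 assumes "weakly_differentiable u"
 obtains u' G where "AEL v. u v = u' v" "borel_weak_grad u' G" "AEL v. wgrad u v = G v"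
proof -
 have "u : borel_measurable lebesgue"
  using assms by (auto simp: weakly_differentiable_def is_weak_grad_def loc_integrable_def)
 then obtain u' where u': "u' : Borel" "AEL v. u v = u' v"
  using completion_ex_borel_measurable_real by fastforce
 then obtain G where "borel_weak_grad u' G" "AEL v. wgrad u' v = G v"
  using weakly_differentiable_borel assms wgrad_cong_AE(2)[OF u'(2)] by blast
 then show ?thesis using that u' wgrad_cong_AE(1)[OF u'(2)] by simp
qed

lemma wgrad_lincomb:
 assumes "weakly_differentiable u" "weakly_differentiable w"
 shows "weakly_differentiable (%v. a * u v + b * w v)"
  "AEL v. wgrad (%v. a * u v + b * w v) v = a *\<^sub>R wgrad u v + b *\<^sub>R wgrad w v"
proof -
 obtain u' G where u: "AEL v. u v = u' v" "borel_weak_grad u' G" "AEL v. wgrad u v = G v"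
  using weakly_differentiable_rep[OF assms(1)] by blast
 obtain w' H where w: "AEL v. w v = w' v" "borel_weak_grad w' H" "AEL v. wgrad w v = H v"
  using weakly_differentiable_rep[OF assms(2)] by blast
 have ae: "AEL v. a * u v + b * w v = a * u' v + b * w' v"
  using u(1) w(1) by eventually_elim simp
 note g = wgrad_eqI[OF borel_weak_grad_lincomb[OF u(2) w(2), of a b]]
 show "weakly_differentiable (%v. a * u v + b * w v)" using g(1) wgrad_cong_AE(2)[OF ae] by simp
 show "AEL v. wgrad (%v. a * u v + b * w v) v = a *\<^sub>R wgrad u v + b *\<^sub>R wgrad w v"
  unfolding wgrad_cong_AE(1)[OF ae] using g(2) u(3) w(3) by eventually_elim simp
qed

lemma loc_int_of_cont:
 fixes g :: "'a::euclidean_space => real"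
 assumes "continuous_on UNIV g" shows "loc_int g"
 unfolding loc_int_def
proof (intro conjI allI)
 show m[measurable]: "g : Borel" using assms by (rule borel_measurable_continuous_onI)
 fix R
 have "bounded (g ` cball 0 R)"
  by (intro compact_imp_bounded compact_continuous_image continuous_on_subset[OF assms]) auto
 then obtain C where C: "\<forall>x\<in>cball 0 R. \<bar>g x\<bar> <= C" unfolding bounded_iff by auto
 have "(NBALL R (%y. ennreal \<bar>g y\<bar>)) <= (NBINT y. ennreal C * indicator (cball (0::'a) R) y)"
  by (intro nn_integral_mono) (use C in \<open>auto simp: indicator_def ennreal_leI\<close>)
 also have "... = ennreal C * emeasure lborel (cball (0::'a) R)" by (simp add: nn_integral_cmult_indicator)
 also have "... < \<infinity>" using emeasure_lborel_cball_finite by (auto simp: ennreal_mult_less_top)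
 finally show "(NBALL R (%y. ennreal \<bar>g y\<bar>)) < \<infinity>" .
qed

subsection \<open>Almost everywhere convergence\<close>

text \<open>The integrals sum up to a finite value, so that the sum of the functions is finite almost
 everywhere; every point lies in all but finitely many of the balls.\<close>

lemma AE_summable_of_fast_L1_loc:
 fixes h :: "nat => 'a::euclidean_space => real"
 assumes [measurable]: "!!k. h k : Borel"
  and fast: "!!k. (NBALL (real k) (%x. ennreal \<bar>h k x\<bar>)) <= ennreal ((1/2) ^ k)"
 shows "AEL x. summable (%k. \<bar>h k x\<bar>)"
proof -
 have "(NBINT x. (\<Sum>k. ennreal \<bar>h k x\<bar> * ball_ind (real k) x))
   = (\<Sum>k. \<integral>\<^sup>+x\<in>cball 0 (real k). ennreal \<bar>h k x\<bar> \<partial>lborel)"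
  by (rule nn_integral_suminf) measurable
 also have "... <= (\<Sum>k. ennreal ((1/2) ^ k))" by (intro suminf_le fast) auto
 also have "... = ennreal (\<Sum>k. (1/2) ^ k)" by (rule suminf_ennreal2) (auto simp: summable_geometric)
 also have "... < \<infinity>" by simp
 finally have "(NBINT x. (\<Sum>k. ennreal \<bar>h k x\<bar> * ball_ind (real k) x)) \<noteq> \<infinity>"
  by simp
 from nn_integral_noteq_infinite[OF _ this]
 have "AEL x. (\<Sum>k. ennreal \<bar>h k x\<bar> * ball_ind (real k) x) \<noteq> \<infinity>" by measurable
 then show ?thesis
 proof eventually_elim
  case (elim x)
  have e: "(\<Sum>k. ennreal (\<bar>h k x\<bar> * ball_ind (real k) x)) \<noteq> top"
  proof -
   have "ennreal (\<bar>h k x\<bar> * ball_ind (real k) x) = ennreal \<bar>h k x\<bar> * ball_ind (real k) x" for k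
    by (auto simp: indicator_def)
   then show ?thesis using elim by simp
  qed
  have s: "summable (%k. \<bar>h k x\<bar> * ball_ind (real k) x)"
   by (rule summable_suminf_not_top[OF _ e]) simp
  obtain K where "norm x <= real K" using real_arch_simple by blast
  then have "\<forall>\<^sub>F k in sequentially. \<bar>h k x\<bar> * ball_ind (real k) x = \<bar>h k x\<bar>"
   by (intro eventually_sequentiallyI[of K]) (auto simp: indicator_def)
  from summable_cong[OF this] s show ?case by simp
 qed
qed

lemma AE_tendsto_zero_of_fast_L1_loc:
 fixes h :: "nat => 'a::euclidean_space => real"
 assumes [measurable]: "!!k. h k : Borel"
  and fast: "!!k. (NBALL (real k) (%x. ennreal \<bar>h k x\<bar>)) <= ennreal ((1/2) ^ k)"
 shows "AEL x. (%k. h k x) \<leadsto> 0"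
 using AE_summable_of_fast_L1_loc[of h, OF assms]
 by eventually_elim (rule tendsto_rabs_zero_cancel[OF summable_LIMSEQ_zero])

lemma borel_weak_grad_moll_AE:
 assumes w: "borel_weak_grad u G"
 obtains r where "filterlim r at_top sequentially" "AEL x. (%k. moll (r k) u x) \<leadsto> u x"
  "AEL x. \<forall>i. (%k. partial i (moll (r k) u) x) \<leadsto> G x $ i"
proof -
 have l: "loc_int u" "!!i. loc_int (%v. G v $ i)" using w by (auto simp: borel_weak_grad_def)
 have [measurable]: "u : Borel" "G : Borel" using w by (auto simp: borel_weak_grad_def)
 note [measurable] = moll_borel[OF l(1)] moll_borel[OF l(2)]
 define h where "h n x = \<bar>moll n u x - u x\<bar> + (\<Sum>i\<in>UNIV. \<bar>moll n (%v. G v $ i) x - G x $ i\<bar>)" for n x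
 have [measurable]: "h n : Borel" for n unfolding h_def by measurable
 have h0: "0 <= h n x" for n x by (simp add: h_def sum_nonneg)
 have lim: "(%n. \<integral>\<^sup>+x\<in>cball 0 R. ennreal \<bar>h n x\<bar> \<partial>lborel) \<leadsto> 0" for R
 proof -
  have "(NBALL R (%x. ennreal \<bar>h n x\<bar>)) = (NBALL R (%x. ennreal \<bar>moll n u x - u x\<bar>))
    + (\<Sum>i\<in>UNIV. \<integral>\<^sup>+x\<in>cball 0 R. ennreal \<bar>moll n (%v. G v $ i) x - G x $ i\<bar> \<partial>lborel)" for n
  proof -
   have eq: "ennreal \<bar>h n x\<bar> * ball_ind R x = ennreal \<bar>moll n u x - u x\<bar> * ball_ind R x
    + (\<Sum>i\<in>UNIV. ennreal \<bar>moll n (%v. G v $ i) x - G x $ i\<bar> * ball_ind R x)" for x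
   proof (cases "x : cball 0 R")
    case True
    then show ?thesis using h0[of n x] by (simp add: h_def sum_nonneg sum_ennreal)
   next
    case False
    then have "ball_ind R x = (0::ennreal)" by simp
    then show ?thesis by (simp only: mult_zero_right sum.neutral_const add_0)
   qed
   have "(NBALL R (%x. ennreal \<bar>h n x\<bar>)) = (NBINT x. ennreal \<bar>moll n u x - u x\<bar> * ball_ind R x
    + (\<Sum>i\<in>UNIV. ennreal \<bar>moll n (%v. G v $ i) x - G x $ i\<bar> * ball_ind R x))"
    by (intro nn_integral_cong eq)
   also have "... = (NBALL R (%x. ennreal \<bar>moll n u x - u x\<bar>))
    + (NBINT x. (\<Sum>i\<in>UNIV. ennreal \<bar>moll n (%v. G v $ i) x - G x $ i\<bar> * ball_ind R x))"
    by (rule nn_integral_add) measurable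
   also have "(NBINT x. (\<Sum>i\<in>UNIV. ennreal \<bar>moll n (%v. G v $ i) x - G x $ i\<bar> * ball_ind R x))
    = (\<Sum>i\<in>UNIV. \<integral>\<^sup>+x\<in>cball 0 R. ennreal \<bar>moll n (%v. G v $ i) x - G x $ i\<bar> \<partial>lborel)"
    by (rule nn_integral_sum) measurable
   finally show ?thesis .
  qed
  moreover have "(%n. (NBALL R (%x. ennreal \<bar>moll n u x - u x\<bar>))
    + (\<Sum>i\<in>UNIV. \<integral>\<^sup>+x\<in>cball 0 R. ennreal \<bar>moll n (%v. G v $ i) x - G x $ i\<bar> \<partial>lborel)) \<leadsto> 0 + (\<Sum>i\<in>(UNIV::3 set). 0)"
   by (intro tendsto_add tendsto_sum moll_L1_loc l)
  ultimately show ?thesis by simp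
 qed
 have "\<exists>n\<ge>k. (NBALL (real k) (%x. ennreal \<bar>h n x\<bar>)) < ennreal ((1/2) ^ k)" for k
 proof -
  have "\<forall>\<^sub>F n in sequentially. (NBALL (real k) (%x. ennreal \<bar>h n x\<bar>)) < ennreal ((1/2) ^ k)"
   by (rule order_tendstoD(2)[OF lim]) simp
  then have "\<forall>\<^sub>F n in sequentially. n \<ge> k \<and> (NBALL (real k) (%x. ennreal \<bar>h n x\<bar>)) < ennreal ((1/2) ^ k)"
   using eventually_ge_at_top[of k] by eventually_elim simp
  then show ?thesis by (auto simp: eventually_sequentially)
 qed
 then obtain r where r: "!!k. r k \<ge> k" "!!k. (NBALL (real k) (%x. ennreal \<bar>h (r k) x\<bar>)) < ennreal ((1/2) ^ k)"
  by metis
 have ae: "AEL x. (%k. h (r k) x) \<leadsto> 0"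
  by (rule AE_tendsto_zero_of_fast_L1_loc[OF _ less_imp_le[OF r(2)]]) simp
 show ?thesis
 proof (rule that)
  show "filterlim r at_top sequentially"
   using r(1) by (intro filterlim_at_top_mono[OF filterlim_ident]) (auto intro: always_eventually)
  show "AEL x. (%k. moll (r k) u x) \<leadsto> u x" using ae
  proof eventually_elim
   case (elim x)
   have "(%k. \<bar>moll (r k) u x - u x\<bar>) \<leadsto> 0"
    by (rule tendsto_sandwich[OF _ _ tendsto_const elim]) (auto simp: h_def sum_nonneg intro!: always_eventually)
   then show ?case by (rule LIM_zero_cancel[OF tendsto_rabs_zero_cancel])
  qed
  show "AEL x. \<forall>i. (%k. partial i (moll (r k) u) x) \<leadsto> G x $ i" using ae
  proof eventually_elim
   case (elim x)
   show ?case
   proof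
    fix i
    have le: "\<bar>moll (r k) (%v. G v $ i) x - G x $ i\<bar> <= h (r k) x" for k
     unfolding h_def using member_le_sum[of i UNIV "%i. \<bar>moll (r k) (%v. G v $ i) x - G x $ i\<bar>"]
     by (simp add: add_increasing)
    have "(%k. \<bar>moll (r k) (%v. G v $ i) x - G x $ i\<bar>) \<leadsto> 0"
     by (rule tendsto_sandwich[OF _ _ tendsto_const elim]) (auto simp: le intro!: always_eventually)
    then show "(%k. partial i (moll (r k) u) x) \<leadsto> G x $ i"
     unfolding partial_moll[OF w] by (rule LIM_zero_cancel[OF tendsto_rabs_zero_cancel])
   qed
  qed
 qed
qed

text \<open>The \<open>n\<close>-th derivative of $s\mapsto(s+\varepsilon)^a$.\<close>

definition shifted_powr :: "real => real => nat => real => real" where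
 "shifted_powr \<epsilon> a n s = (\<Prod>i<n. a - real i) * (s + \<epsilon>) powr (a - real n)"

lemma shifted_powr_has_derivative:
 assumes "0 < s + \<epsilon>"
 shows "(shifted_powr \<epsilon> a n has_real_derivative shifted_powr \<epsilon> a (Suc n) s) (at s)"
proof -
 have "((%s. s + \<epsilon>) has_real_derivative 1) (at s)" by (auto intro!: derivative_eq_intros)
 from DERIV_chain2[OF has_real_derivative_powr[OF assms, of "a - real n"] this]
 have "((%s. (\<Prod>i<n. a - real i) * (s + \<epsilon>) powr (a - real n)) has_real_derivative
   (\<Prod>i<n. a - real i) * ((a - real n) * (s + \<epsilon>) powr (a - real n - 1) * 1)) (at s)"
  by (rule DERIV_cmult)
 then show ?thesis unfolding shifted_powr_def[abs_def] by (simp add: algebra_simps)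
qed

lemma smooth_shifted_powr:
 assumes "smooth g" "!!x. 0 < g x + \<epsilon>" shows "smooth (%x. (g x + \<epsilon>) powr a)"
proof -
 have "smooth (%x. shifted_powr \<epsilon> a 0 (g x))"
  by (rule smooth_compose_real[of "{s. 0 < s + \<epsilon>}" "shifted_powr \<epsilon> a" g 0])
   (use shifted_powr_has_derivative assms in auto)
 then show ?thesis by (simp add: shifted_powr_def)
qed

subsection \<open>The gradient vanishes on the zero set\<close>

text \<open>With $\beta(s)=\varepsilon s/(s+\varepsilon)$, the functions $\beta(u)$ tend to zero uniformly as
 $\varepsilon\to0$, whereas their gradients $\beta'(u)\nabla u$ tend to the restriction of
 $\nabla u$ to the set where $u$ vanishes.\<close>

lemma borel_weak_grad_zero_set:
 assumes w: "borel_weak_grad u G" and u0: "!!v. 0 <= u v"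
 shows "AEL v. u v = 0 --> G v = 0"
proof -
 have l: "loc_int u" "!!i. loc_int (%v. G v $ i)" using w by (auto simp: borel_weak_grad_def)
 have [measurable]: "u : Borel" "G : Borel" using w by (auto simp: borel_weak_grad_def)
 obtain r where r: "filterlim r at_top sequentially" "AEL x. (%k. moll (r k) u x) \<leadsto> u x"
  "AEL x. \<forall>i. (%k. partial i (moll (r k) u) x) \<leadsto> G x $ i"
  by (rule borel_weak_grad_moll_AE[OF w])
 have mu0: "0 <= moll n u x" for n x using moll_nonneg u0 by blast
 have chain: "(LBINT v. \<epsilon> * u v / (u v + \<epsilon>) * partial i \<psi> v) = - (LBINT v. (\<epsilon> / (u v + \<epsilon>))\<^sup>2 * (G v $ i * \<psi> v))"
  if e: "\<epsilon> > 0" and t: "smooth_test UNIV \<psi>" for \<epsilon> \<psi> i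
 proof -
  define \<phi> where "\<phi> n s = (if n = 0 then \<epsilon> else 0) + (- \<epsilon>\<^sup>2) * shifted_powr \<epsilon> (-1) n s" for n :: nat and s
  have \<phi>0: "\<phi> 0 s = \<epsilon> * s / (s + \<epsilon>)" and \<phi>1: "\<phi> 1 s = (\<epsilon> / (s + \<epsilon>))\<^sup>2" if "0 <= s" for s
  proof -
   have p: "0 < s + \<epsilon>" using that e by simp
   show "\<phi> 0 s = \<epsilon> * s / (s + \<epsilon>)"
    using p by (simp add: \<phi>_def shifted_powr_def powr_minus field_simps power2_eq_square)
   have "(s + \<epsilon>) powr (- 2) = inverse ((s + \<epsilon>)\<^sup>2)" using p by (simp add: powr_minus)
   then show "\<phi> 1 s = (\<epsilon> / (s + \<epsilon>))\<^sup>2"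
    by (simp add: \<phi>_def shifted_powr_def divide_inverse power_mult_distrib power_inverse)
  qed
  have d\<phi>: "(\<phi> n has_real_derivative \<phi> (Suc n) s) (at s)" if "s : {0..}" for n s
  proof -
   have "0 < s + \<epsilon>" using that e by auto
   from DERIV_add[OF DERIV_const[of "if n = 0 then \<epsilon> else 0"] DERIV_cmult[OF shifted_powr_has_derivative[OF this, of "-1" n], of "- \<epsilon>\<^sup>2"]]
   have "((%s. (if n = 0 then \<epsilon> else 0) + (- \<epsilon>\<^sup>2) * shifted_powr \<epsilon> (-1) n s) has_real_derivative (- \<epsilon>\<^sup>2) * shifted_powr \<epsilon> (-1) (Suc n) s) (at s)"
    by (simp only: add_0)
   then show ?thesis unfolding \<phi>_def[abs_def] by simp
  qed
  have s\<psi>: "smooth \<psi>" using t by (simp add: smooth_test_iff)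
  let ?m = "%k. moll (r k) u" and ?g = "%k x. moll (r k) (%v. G v $ i) x - G x $ i"
  have sm: "smooth (?m k)" for k by (rule smooth_moll[OF l(1)])
  have sb: "smooth (%x. \<phi> 0 (?m k x))" for k
   by (rule smooth_compose_real[of "{0..}" \<phi> "?m k" 0]) (use d\<phi> sm mu0 in auto)
  note [measurable] = smooth_borel[OF sb] smooth_borel[OF sm] smooth_borel[OF s\<psi>] smooth_borel[OF smooth_partial[OF s\<psi>]]
   smooth_borel[OF smooth_partial[OF sm]]
  have [measurable]: "\<phi> n : Borel" for n unfolding \<phi>_def[abs_def] shifted_powr_def by measurable
  note [measurable] = moll_borel[OF l(1)] moll_borel[OF l(2)]
  have pb: "partial i (%x. \<phi> 0 (?m k x)) x = \<phi> 1 (?m k x) * moll (r k) (%v. G v $ i) x" for k x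
  proof -
   have d0: "(\<phi> 0 has_derivative (*) (\<phi> (Suc 0) (?m k x))) (at (?m k x))"
    using d\<phi>[of "?m k x" 0] mu0 by (simp add: has_field_derivative_def)
   have "partial i (%x. \<phi> 0 (?m k x)) x = \<phi> (Suc 0) (?m k x) * frechet_derivative (?m k) (at x) (axis i 1)"
    unfolding partial_def by (rule frechet_derivative_eqI[OF has_derivative_compose[OF smooth_has_derivative[OF sm] d0]])
   then show ?thesis using partial_moll[OF w, of i "r k" x] by (simp add: partial_def)
  qed
  obtain C where C: "C > 0" "!!x. \<bar>\<psi> x\<bar> <= C" using smooth_test_bounded[OF t] by blast
  obtain R where R: "0 < R" "smooth \<psi>" "!!x. R <= norm x ==> \<psi> x = 0" using smooth_testE[OF t] by blast
  have \<phi>0b: "\<bar>\<phi> 0 s\<bar> <= \<epsilon>" if "0 <= s" for s using that e by (simp add: \<phi>0 field_simps)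
  have \<phi>1b: "\<bar>\<phi> 1 s\<bar> <= 1" if "0 <= s" for s
   using that e unfolding \<phi>1[OF that] by (simp add: power_le_one)
  have \<phi>c: "isCont (\<phi> n) s" if "0 <= s" for n s using d\<phi>[of s n] that DERIV_isCont by auto
  have i1: "integrable lborel (%x. \<epsilon> * \<bar>partial i \<psi> x\<bar>)"
   using loc_int_times_test[OF bounded_imp_loc_int[of "%_. 1" 1] smooth_test_partial[OF t]] by simp
  have i2: "integrable lborel (%x. \<bar>G x $ i * \<psi> x\<bar>)" using loc_int_times_test[OF l(2) t] by simp
  have i3: "integrable lborel (%x. moll (r k) (%v. G v $ i) x * \<psi> x)" for k
   by (intro loc_int_times_test t loc_int_of_cont smooth_continuous smooth_moll l)
  have L1: "(%k. LBINT x. \<phi> 0 (?m k x) * partial i \<psi> x) \<leadsto> (LBINT x. \<phi> 0 (u x) * partial i \<psi> x)"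
  proof (rule integral_dominated_convergence[OF _ _ i1])
   show "AEL x. (%k. \<phi> 0 (?m k x) * partial i \<psi> x) \<leadsto> \<phi> 0 (u x) * partial i \<psi> x"
    using r(2) by eventually_elim (intro tendsto_mult isCont_tendsto_compose[OF \<phi>c] tendsto_const u0)
   show "AEL x. norm (\<phi> 0 (?m k x) * partial i \<psi> x) <= \<epsilon> * \<bar>partial i \<psi> x\<bar>" for k
    using \<phi>0b[OF mu0] by (intro AE_I2) (auto simp: abs_mult intro!: mult_right_mono)
  qed measurable
  have L2: "(%k. LBINT x. \<phi> 1 (?m k x) * (G x $ i * \<psi> x)) \<leadsto> (LBINT x. \<phi> 1 (u x) * (G x $ i * \<psi> x))"
  proof (rule integral_dominated_convergence[OF _ _ i2])
   show "AEL x. (%k. \<phi> 1 (?m k x) * (G x $ i * \<psi> x)) \<leadsto> \<phi> 1 (u x) * (G x $ i * \<psi> x)"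
    using r(2) by eventually_elim (intro tendsto_mult isCont_tendsto_compose[OF \<phi>c] tendsto_const u0)
   show "AEL x. norm (\<phi> 1 (?m k x) * (G x $ i * \<psi> x)) <= \<bar>G x $ i * \<psi> x\<bar>" for k
   proof (rule AE_I2)
    fix x
    show "norm (\<phi> 1 (?m k x) * (G x $ i * \<psi> x)) <= \<bar>G x $ i * \<psi> x\<bar>"
     using mult_right_mono[OF \<phi>1b[OF mu0[of "r k" x]], of "\<bar>G x $ i * \<psi> x\<bar>"] by (simp add: abs_mult)
   qed
  qed measurable
  have L3: "(%k. LBINT x. \<phi> 1 (?m k x) * (?g k x * \<psi> x)) \<leadsto> 0"
  proof (rule tendsto_norm_zero_cancel, rule tendsto_sandwich[OF _ _ tendsto_const])
   have "(%k. \<integral>\<^sup>+x\<in>cball 0 R. ennreal \<bar>?g k x\<bar> \<partial>lborel) \<leadsto> 0"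
    using filterlim_compose[OF moll_L1_loc[OF l(2)] r(1)] by simp
   then have "(%k. enn2real (NBALL R (%x. ennreal \<bar>?g k x\<bar>))) \<leadsto> 0"
    by (intro tendsto_enn2real) simp_all
   from tendsto_mult_right_zero[OF this, of C]
   show "(%k. C * enn2real (NBALL R (%x. ennreal \<bar>?g k x\<bar>))) \<leadsto> 0" .
   show "\<forall>\<^sub>F k in sequentially. 0 <= norm (LBINT x. \<phi> 1 (?m k x) * (?g k x * \<psi> x))" by simp
   show "\<forall>\<^sub>F k in sequentially. norm (LBINT x. \<phi> 1 (?m k x) * (?g k x * \<psi> x))
    <= C * enn2real (NBALL R (%x. ennreal \<bar>?g k x\<bar>))"
   proof (intro always_eventually allI)
    fix k
    have ld: "loc_int (%x. ?g k x)"
     using loc_int_lincomb[OF loc_int_of_cont[OF smooth_continuous[OF smooth_moll[OF l(2)[of i], of "r k"]]] l(2)[of i], where a=1 and b="-1"] by simp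
    have id: "integrable lborel (%x. ?g k x * ball_ind R x)"
     by (rule loc_int_times_bounded[OF ld, where C=1 and R=R]) (auto simp: indicator_def)
    have "norm (LBINT x. \<phi> 1 (?m k x) * (?g k x * \<psi> x))
     <= (LBINT x. norm (\<phi> 1 (?m k x) * (?g k x * \<psi> x)))"
     by (rule integral_norm_bound)
    also have "... <= (LBINT x. C * \<bar>?g k x * ball_ind R x\<bar>)"
    proof (rule integral_mono')
     fix x
     show "norm (\<phi> 1 (?m k x) * (?g k x * \<psi> x)) <= C * \<bar>?g k x * ball_ind R x\<bar>"
     proof (cases "norm x <= R")
      case True
      have "\<bar>\<phi> 1 (?m k x)\<bar> * (\<bar>?g k x\<bar> * \<bar>\<psi> x\<bar>) <= 1 * (\<bar>?g k x\<bar> * C)"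
       by (intro mult_mono \<phi>1b mu0 C) auto
      then show ?thesis using True by (simp add: abs_mult mult.commute)
     next
      case False then show ?thesis using R(3)[of x] by simp
     qed
    qed (use id C(1) in auto)
    also have "... = C * enn2real (NBINT x. ennreal \<bar>?g k x * ball_ind R x\<bar>)"
     by (subst integral_mult_right_zero, subst integral_eq_nn_integral) (use borel_measurable_integrable[OF id] in simp_all)
    also have "(NBINT x. ennreal \<bar>?g k x * ball_ind R x\<bar>)
     = (NBALL R (%x. ennreal \<bar>?g k x\<bar>))"
     by (intro nn_integral_cong) (auto simp: indicator_def)
    finally show "norm (LBINT x. \<phi> 1 (?m k x) * (?g k x * \<psi> x))
     <= C * enn2real (NBALL R (%x. ennreal \<bar>?g k x\<bar>))" .
   qed
  qed
  have eq: "(LBINT x. \<phi> 0 (?m k x) * partial i \<psi> x)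
   = - (LBINT x. \<phi> 1 (?m k x) * (?g k x * \<psi> x)) - (LBINT x. \<phi> 1 (?m k x) * (G x $ i * \<psi> x))" for k
  proof -
   have j1: "integrable lborel (%x. \<phi> 0 (?m k x) * partial i \<psi> x)"
    by (intro loc_int_times_test loc_int_of_cont smooth_continuous sb smooth_test_partial t)
   have j2: "integrable lborel (%x. \<phi> 1 (?m k x) * (G x $ i * \<psi> x))"
    by (rule Bochner_Integration.integrable_bound[OF i2])
     (use \<phi>1b[OF mu0] in \<open>auto simp: abs_mult intro!: AE_I2 mult_left_le_one_le\<close>)
   have j3: "integrable lborel (%x. \<phi> 1 (?m k x) * ((moll (r k) (%v. G v $ i) x) * \<psi> x))"
    by (rule Bochner_Integration.integrable_bound[OF i3[of k]])
     (use \<phi>1b[OF mu0] in \<open>auto simp: abs_mult intro!: AE_I2 mult_left_le_one_le\<close>)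
   have "0 = (LBINT x. partial i (%x. \<psi> x * \<phi> 0 (?m k x)) x)"
    using integral_partial_zero[OF smooth_test_mult[OF t sb]] by simp
   also have "... = (LBINT x. \<phi> 1 (?m k x) * ((moll (r k) (%v. G v $ i) x) * \<psi> x) + \<phi> 0 (?m k x) * partial i \<psi> x)"
    by (intro Bochner_Integration.integral_cong refl) (simp add: partial_mult[OF s\<psi> sb] pb algebra_simps)
   also have "... = (LBINT x. \<phi> 1 (?m k x) * ((moll (r k) (%v. G v $ i) x) * \<psi> x)) + (LBINT x. \<phi> 0 (?m k x) * partial i \<psi> x)"
    using j1 j3 by simp
   also have "(LBINT x. \<phi> 1 (?m k x) * ((moll (r k) (%v. G v $ i) x) * \<psi> x))
     = (LBINT x. \<phi> 1 (?m k x) * (?g k x * \<psi> x)) + (LBINT x. \<phi> 1 (?m k x) * (G x $ i * \<psi> x))"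
    using Bochner_Integration.integral_diff[OF j3 j2] by (simp add: algebra_simps)
   finally show ?thesis by simp
  qed
  have "(%k. LBINT x. \<phi> 0 (?m k x) * partial i \<psi> x) \<leadsto> - 0 - (LBINT x. \<phi> 1 (u x) * (G x $ i * \<psi> x))"
   unfolding eq by (intro tendsto_intros L2 L3)
  from LIMSEQ_unique[OF L1 this] show ?thesis by (simp only: \<phi>0[OF u0] \<phi>1[OF u0])
 qed
 have "AEL v. G v $ i * indicator {v. u v = 0} v = 0" for i
 proof (rule loc_int_test_zeroI)
  show "loc_int (%v. G v $ i * indicator {v. u v = 0} v)" unfolding loc_int_def
  proof (intro conjI allI)
   fix R
   have "(NBALL R (%y. ennreal \<bar>G y $ i * indicator {v. u v = 0} y\<bar>)) <= (NBALL R (%y. ennreal \<bar>G y $ i\<bar>))"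
    by (intro nn_integral_mono) (auto simp: indicator_def)
   also have "... < \<infinity>" by (rule loc_int_finite[OF l(2)])
   finally show "(NBALL R (%y. ennreal \<bar>G y $ i * indicator {v. u v = 0} y\<bar>)) < \<infinity>" .
  qed measurable
  fix \<psi> :: "real^3 => real" assume t: "smooth_test UNIV \<psi>"
  have s\<psi>: "smooth \<psi>" using t by (simp add: smooth_test_iff)
  note [measurable] = smooth_borel[OF s\<psi>] smooth_borel[OF smooth_partial[OF s\<psi>]]
  define e where "e n = inverse (real (Suc n))" for n
  have e: "0 < e n" "e n <= 1" for n by (auto simp: e_def inverse_le_1_iff)
  have e0: "e \<leadsto> 0" unfolding e_def by (rule LIMSEQ_inverse_real_of_nat)
  have b1: "\<bar>e n * u v / (u v + e n)\<bar> <= e n" for n v using u0[of v] e(1)[of n] by (simp add: field_simps)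
  have b2: "(e n / (u v + e n))\<^sup>2 <= 1" for n v using u0[of v] e(1)[of n] by (intro power_le_one) auto
  have L1: "(%n. LBINT v. e n * u v / (u v + e n) * partial i \<psi> v) \<leadsto> (LBINT v. 0 * partial i \<psi> v)"
  proof (rule integral_dominated_convergence)
   show "integrable lborel (%x. \<bar>partial i \<psi> x\<bar>)"
    using loc_int_times_test[OF bounded_imp_loc_int[of "%_. 1" 1] smooth_test_partial[OF t]] by simp
   show "AEL v. (%n. e n * u v / (u v + e n) * partial i \<psi> v) \<leadsto> 0 * partial i \<psi> v"
    by (intro AE_I2 tendsto_mult tendsto_const Lim_null_comparison[OF _ e0]) (use b1 in simp)
   show "AEL v. norm (e n * u v / (u v + e n) * partial i \<psi> v) <= \<bar>partial i \<psi> v\<bar>" for n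
   proof (rule AE_I2)
    fix v
    show "norm (e n * u v / (u v + e n) * partial i \<psi> v) <= \<bar>partial i \<psi> v\<bar>"
     using mult_right_mono[OF order_trans[OF b1[of n v] e(2)], of "\<bar>partial i \<psi> v\<bar>"] by (simp add: abs_mult)
   qed
  qed measurable
  have L2: "(%n. LBINT v. (e n / (u v + e n))\<^sup>2 * (G v $ i * \<psi> v)) \<leadsto> (LBINT v. indicator {v. u v = 0} v * (G v $ i * \<psi> v))"
  proof (rule integral_dominated_convergence)
   show "integrable lborel (%x. \<bar>G x $ i * \<psi> x\<bar>)" using loc_int_times_test[OF l(2) t] by simp
   show "AEL v. (%n. (e n / (u v + e n))\<^sup>2 * (G v $ i * \<psi> v)) \<leadsto> indicator {v. u v = 0} v * (G v $ i * \<psi> v)"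
   proof (rule AE_I2, intro tendsto_mult tendsto_const)
    fix v
    show "(%n. (e n / (u v + e n))\<^sup>2) \<leadsto> indicator {v. u v = 0} v"
    proof (cases "u v = 0")
     case True
     then show ?thesis using e(1) by (simp add: less_imp_neq[symmetric])
    next
     case False
     have "(%n. (e n / (u v + e n))\<^sup>2) \<leadsto> (0 / (u v + 0))\<^sup>2" using False by (intro tendsto_intros e0) simp
     then show ?thesis using False by simp
    qed
   qed
   show "AEL v. norm ((e n / (u v + e n))\<^sup>2 * (G v $ i * \<psi> v)) <= \<bar>G v $ i * \<psi> v\<bar>" for n
   proof (rule AE_I2)
    fix v
    show "norm ((e n / (u v + e n))\<^sup>2 * (G v $ i * \<psi> v)) <= \<bar>G v $ i * \<psi> v\<bar>"
     using mult_right_mono[OF b2[of n v], of "\<bar>G v $ i * \<psi> v\<bar>"] by (simp add: abs_mult)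
   qed
  qed measurable
  have "(%n. LBINT v. e n * u v / (u v + e n) * partial i \<psi> v) \<leadsto> - (LBINT v. indicator {v. u v = 0} v * (G v $ i * \<psi> v))"
   unfolding chain[OF e(1) t] by (intro tendsto_minus L2)
  from LIMSEQ_unique[OF L1 this] show "(LBINT v. G v $ i * indicator {v. u v = 0} v * \<psi> v) = 0"
   by (simp add: algebra_simps)
 qed
 then have "AEL v. \<forall>i. G v $ i * indicator {v. u v = 0} v = 0"
  unfolding AE_all_countable by blast
 then show ?thesis by eventually_elim (auto simp: vec_eq_iff)
qed

section \<open>Riesz potentials of functions of finite entropy\<close>

lemma norm_powr_minus_1: "norm z powr (-1) = 1 / norm z"
 by (simp add: powr_minus_divide)

lemma norm_powr_minus_2: "norm z powr (-2) = 1 / (norm z)\<^sup>2"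
 by (cases "z = 0") (simp_all add: powr_minus_divide)

lemma emeasure_cball_3: "0 <= r ==> emeasure lborel (cball (c::real^3) r) = ennreal (unit_ball_vol 3 * r ^ 3)"
 using emeasure_cball[of r c] by simp

lemma unit_ball_vol_3_nonneg: "0 <= unit_ball_vol 3"
 using unit_ball_vol_pos[of 3] by linarith

lemma power_swap: "((a::real) ^ k) ^ n = (a ^ n) ^ k"
 by (simp only: power_mult[symmetric] mult.commute)

lemma term_le_suminf: "f k <= (\<Sum>k. f k :: ennreal)"
 using sum_le_suminf[of f "{k}"] by simp

lemma dyadic_shell:
 fixes x :: real assumes "0 < x" "x <= 1" obtains k where "x <= (1/2) ^ k" "(1/2) ^ Suc k < x"
proof -
 obtain n where n: "(1/2::real) ^ n < x" using real_arch_pow_inv[OF assms(1), of "1/2"] by auto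
 define m where "m = (LEAST n. (1/2::real) ^ n < x)"
 have m: "(1/2::real) ^ m < x" unfolding m_def by (rule LeastI[of _ n]) (rule n)
 then have "m \<noteq> 0" using assms(2) by (metis not_less power_0)
 then obtain k where k: "m = Suc k" using not0_implies_Suc by blast
 then have "\<not> (1/2::real) ^ k < x" using not_less_Least[of k "%n. (1/2::real) ^ n < x"] unfolding m_def by simp
 then show ?thesis using that[of k] m k by simp
qed

lemma dyadic_powr_le:
 fixes x :: real assumes "(1/2) ^ Suc k < x" "0 <= s" shows "x powr (-s) <= 2 powr (s * real (Suc k))"
proof -
 have "x powr (-s) <= ((1/2) ^ Suc k) powr (-s)"
  using assms by (intro powr_mono2') auto
 also have "((1/2::real) ^ Suc k) = 2 powr (- real (Suc k))"
  by (simp only: powr_minus powr_realpow power_one_over inverse_eq_divide zero_less_numeral)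
 also have "(2 powr (- real (Suc k))) powr (-s) = 2 powr (s * real (Suc k))"
  by (simp only: powr_powr minus_mult_minus mult.commute)
 finally show ?thesis .
qed

lemma nn_integral_cball_translate:
 fixes f :: "real => ennreal"
 assumes [measurable]: "f : Borel"
 shows "(NBINT v. f (norm (v - y :: real^3))) = (NBINT z. f (norm (z :: real^3)))"
 by (rule nn_integral_lborel_translate[of "%z. f (norm z)"]) measurable

lemma singular_kernel_integrable:
 assumes s: "0 <= s" "s < 3"
 obtains C where "0 <= C" "!!y::real^3. (NBINT v. ennreal (norm (v - y) powr (-s)) * indicator {..1} (norm (v - y))) <= ennreal C"
proof -
 let ?V = "unit_ball_vol 3"
 define a where "a k = 2 powr (s * real (Suc k)) * (?V * ((1/2) ^ k) ^ 3)" for k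
 have q: "0 <= 2 powr (s - 3)" "2 powr (s - 3) < (1::real)" using s powr_less_mono[of "s - 3" 0 2] by auto
 have a_eq: "a k = 2 powr s * ?V * (2 powr (s - 3)) ^ k" for k
 proof -
  have "((1/2::real) ^ k) ^ 3 = 2 powr (-3 * real k)"
  proof -
   have "2 powr (-3 * real k) = (2 powr (-3)) powr real k" by (simp only: powr_powr)
   also have "2 powr (-3) = (1/8::real)" by (simp add: powr_minus_divide)
   also have "(1/8::real) powr real k = (1/8) ^ k" by (rule powr_realpow) simp
   also have "... = ((1/2) ^ k) ^ 3" unfolding power_swap[of "1/2" k 3] by (simp add: power_divide)
   finally show ?thesis by simp
  qed
  then have "a k = ?V * (2 powr (s * real (Suc k)) * 2 powr (-3 * real k))" by (simp add: a_def)
  also have "2 powr (s * real (Suc k)) * 2 powr (-3 * real k) = 2 powr (s + (s - 3) * real k)"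
   by (simp add: powr_add[symmetric] algebra_simps)
  also have "... = 2 powr s * (2 powr (s - 3)) ^ k"
  proof -
   have "2 powr (s + (s - 3) * real k) = 2 powr s * (2 powr (s - 3)) powr real k" by (simp only: powr_add powr_powr)
   then show ?thesis by (simp add: powr_realpow)
  qed
  finally show ?thesis by simp
 qed
 have sa: "summable a" unfolding a_eq using q by (intro summable_mult summable_geometric) simp
 have a0: "0 <= a k" for k using unit_ball_vol_3_nonneg by (simp add: a_def)
 have le: "ennreal (norm z powr (-s)) * indicator {..1} (norm z)
   <= (\<Sum>k. ennreal (2 powr (s * real (Suc k))) * ball_ind ((1/2) ^ k) z)" for z :: "real^3"
 proof (cases "z = 0 \<or> norm z > 1")
  case False
  then have "0 < norm z" "norm z <= 1" by auto
  then obtain k where k: "norm z <= (1/2) ^ k" "(1/2) ^ Suc k < norm z"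
   by (rule dyadic_shell)
  have "ennreal (norm z powr (-s)) * indicator {..1} (norm z) <= ennreal (2 powr (s * real (Suc k))) * ball_ind ((1/2) ^ k) z"
   using dyadic_powr_le[OF k(2) s(1)] k(1) False by (simp add: ennreal_leI)
  also have "... <= (\<Sum>k. ennreal (2 powr (s * real (Suc k))) * ball_ind ((1/2) ^ k) z)"
   by (rule term_le_suminf)
  finally show ?thesis .
 qed auto
 have "(NBINT v. ennreal (norm (v - y) powr (-s)) * indicator {..1} (norm (v - y))) <= ennreal (\<Sum>k. a k)" for y :: "real^3"
 proof -
  have "(NBINT v. ennreal (norm (v - y) powr (-s)) * indicator {..1} (norm (v - y)))
    = (NBINT z. ennreal (norm (z::real^3) powr (-s)) * indicator {..1} (norm z))"
   by (rule nn_integral_cball_translate[of "%t. ennreal (t powr (-s)) * indicator {..1} t"]) measurable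
  also have "... <= (NBINT z. (\<Sum>k. ennreal (2 powr (s * real (Suc k))) * indicator (cball (0::real^3) ((1/2) ^ k)) z))"
   by (intro nn_integral_mono le)
  also have "... = (\<Sum>k. \<integral>\<^sup>+z. ennreal (2 powr (s * real (Suc k))) * indicator (cball (0::real^3) ((1/2) ^ k)) z \<partial>lborel)"
   by (rule nn_integral_suminf) measurable
  also have "... = (\<Sum>k. ennreal (a k))"
   using unit_ball_vol_3_nonneg
   by (intro suminf_cong) (simp add: nn_integral_cmult_indicator emeasure_cball_3 a_def ennreal_mult[symmetric])
  also have "... = ennreal (\<Sum>k. a k)" by (rule suminf_ennreal2[OF a0 sa])
  finally show ?thesis by simp
 qed
 then show ?thesis using that[of "\<Sum>k. a k"] suminf_nonneg[OF sa a0] by blast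
qed

text \<open>At the critical exponent each dyadic shell contributes the same amount, and the number of
 shells outside radius $r$ is logarithmic in $r$.\<close>

lemma critical_kernel_log_bound:
 obtains C where "0 <= C" "!!(y::real^3) r. 0 < r ==> r <= 1 ==>
  (NBINT v. ennreal (norm (v - y) powr (-3)) * indicator {r..1} (norm (v - y))) <= ennreal (C * (1 + ln (1 / r)))"
proof -
 let ?V = "unit_ball_vol 3"
 have "(NBINT v. ennreal (norm (v - y) powr (-3)) * indicator {r..1} (norm (v - y)))
   <= ennreal (16 * ?V * (1 + ln (1 / r)))" if r: "0 < r" "r <= 1" for y :: "real^3" and r
 proof -
  define K where "K = nat \<lfloor>log 2 (1 / r)\<rfloor>"
  have l0: "0 <= log 2 (1 / r)" using r by (simp add: zero_le_log_cancel_iff)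
  have le: "ennreal (norm z powr (-3)) * indicator {r..1} (norm z)
   <= (\<Sum>k\<le>K. ennreal (2 powr (3 * real (Suc k))) * ball_ind ((1/2) ^ k) z)" for z :: "real^3"
  proof (cases "r <= norm z \<and> norm z <= 1")
   case True
   then have "0 < norm z" "norm z <= 1" using r by linarith+
   then obtain k where k: "norm z <= (1/2) ^ k" "(1/2) ^ Suc k < norm z"
    by (rule dyadic_shell)
   have "r <= (1/2) ^ k" using True k by linarith
   then have "2 ^ k <= 1 / r" using r by (simp add: power_one_over field_simps)
   then have "log 2 (2 ^ k) <= log 2 (1 / r)" using r by (subst log_le_cancel_iff) auto
   then have kK: "k <= K" unfolding K_def by (simp add: log_nat_power le_nat_iff le_floor_iff)
   have "ennreal (norm z powr (-3)) * indicator {r..1} (norm z) <= ennreal (2 powr (3 * real (Suc k))) * ball_ind ((1/2) ^ k) z"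
    using dyadic_powr_le[OF k(2), of 3] k(1) True by (simp add: ennreal_leI)
   also have "... <= (\<Sum>k\<le>K. ennreal (2 powr (3 * real (Suc k))) * ball_ind ((1/2) ^ k) z)"
    by (rule member_le_sum) (use kK in auto)
   finally show ?thesis .
  qed auto
  have "(NBINT v. ennreal (norm (v - y) powr (-3)) * indicator {r..1} (norm (v - y)))
    = (NBINT z. ennreal (norm (z::real^3) powr (-3)) * indicator {r..1} (norm z))"
   by (rule nn_integral_cball_translate[of "%t. ennreal (t powr (-3)) * indicator {r..1} t"]) measurable
  also have "... <= (NBINT z. (\<Sum>k\<le>K. ennreal (2 powr (3 * real (Suc k))) * indicator (cball (0::real^3) ((1/2) ^ k)) z))"
   by (intro nn_integral_mono le)
  also have "... = (\<Sum>k\<le>K. \<integral>\<^sup>+z. ennreal (2 powr (3 * real (Suc k))) * indicator (cball (0::real^3) ((1/2) ^ k)) z \<partial>lborel)"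
   by (rule nn_integral_sum) measurable
  also have "... = (\<Sum>k\<le>K. ennreal (8 * ?V))"
  proof (rule sum.cong[OF refl])
   fix k
   have p: "2 powr (3 * real (Suc k)) * (?V * ((1/2) ^ k) ^ 3) = 8 * ?V"
   proof -
    have "2 powr (3 * real (Suc k)) = 2 powr real (3 * Suc k)" by simp
    also have "... = 2 ^ (3 * Suc k)" by (rule powr_realpow) simp
    also have "... = 8 * 8 ^ k" by (simp only: power_mult power_Suc) simp
    finally have "2 powr (3 * real (Suc k)) = 8 * 8 ^ k" .
    moreover have "((1/2::real) ^ k) ^ 3 = (1/8) ^ k"
     by (simp only: power_swap[of "1/2" k 3]) (simp add: power_divide)
    moreover have "8 ^ k * (1/8::real) ^ k = 1" by (simp flip: power_mult_distrib)
    ultimately show ?thesis by simp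
   qed
   have "(NBINT z. ennreal (2 powr (3 * real (Suc k))) * indicator (cball (0::real^3) ((1/2) ^ k)) z)
    = ennreal (2 powr (3 * real (Suc k))) * ennreal (?V * ((1/2) ^ k) ^ 3)"
    by (simp add: nn_integral_cmult_indicator emeasure_cball_3)
   also have "... = ennreal (2 powr (3 * real (Suc k)) * (?V * ((1/2) ^ k) ^ 3))"
    using unit_ball_vol_3_nonneg by (intro ennreal_mult[symmetric]) auto
   also have "... = ennreal (8 * ?V)" by (simp only: p)
   finally show "(NBINT z. ennreal (2 powr (3 * real (Suc k))) * indicator (cball (0::real^3) ((1/2) ^ k)) z) = ennreal (8 * ?V)" .
  qed
  also have "... = ennreal (8 * ?V * (real K + 1))"
   using unit_ball_vol_3_nonneg by (subst sum_ennreal) (auto simp: algebra_simps)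
  also have "... <= ennreal (16 * ?V * (1 + ln (1 / r)))"
  proof (rule ennreal_leI)
   have "real K <= log 2 (1 / r)" unfolding K_def using l0 by simp
   also have "... <= 2 * ln (1 / r)"
   proof -
    have "exp (1/2) <= (2::real)" using exp_bound[of "1/2"] by (simp add: power2_eq_square)
    then have "1/2 <= ln (2::real)" by (subst ln_ge_iff) auto
    moreover have "0 <= ln (1 / r)" using r by simp
    ultimately show ?thesis unfolding log_def using mult_mono[of "1/2" "ln 2" "ln (1/r)" "ln (1/r)"]
     by (simp add: field_simps)
   qed
   finally have "8 * ?V * (real K + 1) <= 8 * ?V * (2 * (1 + ln (1 / r)))"
    using unit_ball_vol_3_nonneg by (intro mult_left_mono) auto
   then show "8 * ?V * (real K + 1) <= 16 * ?V * (1 + ln (1 / r))" by (simp add: algebra_simps)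
  qed
  finally show ?thesis .
 qed
 then show ?thesis using that[of "16 * ?V"] unit_ball_vol_3_nonneg by auto
qed

lemma quartic_decay_integrable:
 "(NBINT v. ennreal ((1 + (norm (v::real^3))\<^sup>2) powr (-2))) < \<infinity>"
proof -
 let ?V = "unit_ball_vol 3"
 have le: "ennreal ((1 + (norm v)\<^sup>2) powr (-2)) <= (\<Sum>k. ennreal (16 * (1/16) ^ k) * ball_ind (2 ^ k) v)" for v :: "real^3"
 proof -
  obtain n where n: "norm v < 2 ^ n" using real_arch_pow[of 2 "norm v"] by auto
  define k where "k = (LEAST n. norm v < 2 ^ n)"
  have k: "norm v < 2 ^ k" unfolding k_def by (rule LeastI[of _ n]) (rule n)
  have "(1 + (norm v)\<^sup>2) powr (-2) <= 16 * (1/16) ^ k"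
  proof (cases k)
   case 0
   have "(1 + (norm v)\<^sup>2) powr (-2) <= 1 powr (-2)" by (intro powr_mono2') auto
   then show ?thesis using 0 by simp
  next
   case (Suc m)
   then have "\<not> norm v < 2 ^ m" using not_less_Least[of m "%n. norm v < 2 ^ n"] unfolding k_def by simp
   then have "(2 ^ m)\<^sup>2 <= (norm v)\<^sup>2" by (intro power_mono) auto
   then have "(4::real) ^ m <= 1 + (norm v)\<^sup>2" unfolding power_swap[of 2 m 2] by simp
   then have "(1 + (norm v)\<^sup>2) powr (-2) <= (4 ^ m) powr (-2)" by (intro powr_mono2') auto
   also have "... = (1/16) ^ m"
   proof -
    have "(4 ^ m) powr (-2) = 1 / ((4::real) ^ m)\<^sup>2" using norm_powr_minus_2[of "4 ^ m :: real"] by simp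
    also have "... = (1/16) ^ m" unfolding power_swap[of 4 m 2] by (simp add: power_one_over)
    finally show ?thesis .
   qed
   finally show ?thesis using Suc by simp
  qed
  then have "ennreal ((1 + (norm v)\<^sup>2) powr (-2)) <= ennreal (16 * (1/16) ^ k) * ball_ind (2 ^ k) v"
   using k by (simp add: ennreal_leI)
  also have "... <= (\<Sum>k. ennreal (16 * (1/16) ^ k) * ball_ind (2 ^ k) v)"
   by (rule term_le_suminf)
  finally show ?thesis .
 qed
 have "(NBINT v. ennreal ((1 + (norm (v::real^3))\<^sup>2) powr (-2)))
   <= (NBINT v. (\<Sum>k. ennreal (16 * (1/16) ^ k) * indicator (cball (0::real^3) (2 ^ k)) v))"
  by (intro nn_integral_mono le)
 also have "... = (\<Sum>k. \<integral>\<^sup>+v. ennreal (16 * (1/16) ^ k) * indicator (cball (0::real^3) (2 ^ k)) v \<partial>lborel)"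
  by (rule nn_integral_suminf) measurable
 also have "... = (\<Sum>k. ennreal (16 * ?V * (1/2) ^ k))"
 proof (rule suminf_cong)
  fix k
  have "(NBINT v. ennreal (16 * (1/16) ^ k) * indicator (cball (0::real^3) (2 ^ k)) v)
   = ennreal (16 * (1/16) ^ k) * ennreal (?V * (2 ^ k) ^ 3)"
   by (simp add: nn_integral_cmult_indicator emeasure_cball_3)
  also have "... = ennreal (16 * (1/16) ^ k * (?V * (2 ^ k) ^ 3))"
   using unit_ball_vol_3_nonneg by (intro ennreal_mult[symmetric]) auto
  also have "(2 ^ k) ^ 3 = (8::real) ^ k" unfolding power_swap[of 2 k 3] by simp
  also have "16 * (1/16::real) ^ k * (?V * 8 ^ k) = 16 * ?V * (1/2) ^ k"
  proof -
   have "(1/16::real) ^ k * 8 ^ k = (1/2) ^ k" by (simp flip: power_mult_distrib)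
   then show ?thesis by simp
  qed
  finally show "(NBINT v. ennreal (16 * (1/16) ^ k) * indicator (cball (0::real^3) (2 ^ k)) v) = ennreal (16 * ?V * (1/2) ^ k)" .
 qed
 also have "... = ennreal (\<Sum>k. 16 * ?V * (1/2) ^ k)"
  using unit_ball_vol_3_nonneg by (intro suminf_ennreal2 summable_mult summable_geometric) auto
 finally show ?thesis using le_less_trans[OF _ ennreal_less_top] by simp
qed

subsection \<open>Entropy and energy bound the positive part of the entropy\<close>

text \<open>Only $x<1$ matters. If $x\ge(1+a)^{-4}$ then $\ln(1/x)\le4\ln(1+a)\le4a$; otherwise
 $x\ln(1/x)\le2\sqrt x\le2(1+a)^{-2}$.\<close>

lemma xlnx_bound:
 fixes x a :: real assumes "0 <= x" "0 <= a"
 shows "x * max 0 (ln x) <= x * ln x + 4 * (x * a) + 2 * (1 + a) powr (-2)"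
proof (cases "x = 0 \<or> 1 <= x")
 case True
 then show ?thesis using assms by (auto simp: max_def)
next
 case False
 then have x: "0 < x" "x < 1" using assms by auto
 have "- (x * ln x) <= 4 * (x * a) + 2 * (1 + a) powr (-2)"
 proof (cases "(1 + a) powr (-4) <= x")
  case True
  then have "ln ((1 + a) powr (-4)) <= ln x" using x assms by (subst ln_le_cancel_iff) auto
  then have "- ln x <= 4 * ln (1 + a)" using assms by (simp add: ln_powr)
  also have "... <= 4 * a" using ln_add_one_self_le_self[OF assms(2)] by simp
  finally have "x * (- ln x) <= x * (4 * a)" using x by (intro mult_left_mono) auto
  then show ?thesis by (simp add: algebra_simps add_increasing2)
 next
  case False
  have "sqrt x <= sqrt ((1 + a) powr (-4))" using False by simp
  also have "... = (1 + a) powr (-2)" using assms by (simp add: powr_half_sqrt[symmetric] powr_powr)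
  finally have 1: "sqrt x <= (1 + a) powr (-2)" .
  have "ln (1 / sqrt x) <= 1 / sqrt x - 1" using x by (intro ln_le_minus_one) simp
  then have "sqrt x * ln (1 / sqrt x) <= sqrt x * (1 / sqrt x - 1)" using x by (intro mult_left_mono) auto
  also have "... <= 1" using x by (simp add: algebra_simps)
  finally have "2 * sqrt x * (sqrt x * ln (1 / sqrt x)) <= 2 * sqrt x * 1" using x by (intro mult_left_mono) auto
  moreover have "2 * sqrt x * (sqrt x * ln (1 / sqrt x)) = - (x * ln x)"
  proof -
   have "ln (1 / sqrt x) = - ln x / 2" using x by (simp add: ln_div ln_sqrt)
   moreover have "2 * sqrt x * (sqrt x * ln (1 / sqrt x)) = 2 * (sqrt x * sqrt x) * ln (1 / sqrt x)"
    by (simp only: mult.assoc)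
   ultimately show ?thesis using x by simp
  qed
  ultimately have "- (x * ln x) <= 2 * (1 + a) powr (-2)" using 1 by linarith
  moreover have "0 <= 4 * (x * a)" using x assms by simp
  ultimately show ?thesis by linarith
 qed
 then show ?thesis using x by (simp add: max_def ln_less_zero)
qed

subsection \<open>The borderline estimate\<close>

lemma jensen_powr:
 fixes f k :: "'a::euclidean_space => real"
 assumes [measurable]: "f : Borel" "k : Borel"
  and f0: "!!x. 0 <= f x" and k0: "!!x. 0 <= k x" and p: "1 < p" and M: "0 < M"
  and fM: "(NBINT x. ennreal (f x)) <= ennreal M"
  and fin: "(NBINT x. ennreal (f x * k x powr p)) < \<infinity>"
 shows "(NBINT x. ennreal (f x * k x)) < \<infinity>"
  "ennreal (enn2real (NBINT x. ennreal (f x * k x)) powr p)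
   <= ennreal (M powr (p - 1)) * (NBINT x. ennreal (f x * k x powr p))"
proof -
 obtain B where B: "0 <= B" "(NBINT x. ennreal (f x * k x powr p)) = ennreal B"
  using fin by (cases "\<integral>\<^sup>+x. ennreal (f x * k x powr p) \<partial>lborel") auto
 have young: "p * (m powr (p - 1) * y) <= y powr p + (p - 1) * m powr p" if "0 <= m" "0 <= y" for m y
 proof (cases "m = 0 \<or> y = 0")
  case True
  then show ?thesis using p by auto
 next
  case False
  have "(y powr p) powr (1/p) * (m powr p) powr (1 - 1/p) <= (1/p) * y powr p + (1 - 1/p) * m powr p"
   using p False by (intro Youngs_inequality_0) (auto simp: field_simps)
  moreover have "(y powr p) powr (1/p) = y" using p that by (simp add: powr_powr)
  moreover have "(m powr p) powr (1 - 1/p) = m powr (p - 1)" using p by (simp add: powr_powr right_diff_distrib)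
  ultimately have "p * (y * m powr (p - 1)) <= p * ((1/p) * y powr p + (1 - 1/p) * m powr p)"
   using p by (intro mult_left_mono) auto
  moreover have "p * ((1/p) * y powr p + (1 - 1/p) * m powr p) = y powr p + (p - 1) * m powr p"
   using p by (simp add: field_simps)
  ultimately show ?thesis by (simp add: mult.commute)
 qed
 have main: "ennreal (p * m powr (p - 1)) * (NBINT x. ennreal (f x * k x)) <= ennreal (B + (p - 1) * m powr p * M)" if m: "0 <= m" for m
 proof -
  have "ennreal (p * m powr (p - 1)) * (NBINT x. ennreal (f x * k x)) = (NBINT x. ennreal (p * m powr (p - 1)) * ennreal (f x * k x))"
   by (rule nn_integral_cmult[symmetric]) measurable
  also have "... <= (NBINT x. ennreal (f x * k x powr p) + ennreal ((p - 1) * m powr p) * ennreal (f x))"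
  proof (intro nn_integral_mono)
   fix x
   have "f x * (p * (m powr (p - 1) * k x)) <= f x * (k x powr p + (p - 1) * m powr p)"
    by (intro mult_left_mono young m k0 f0)
   then have "ennreal (p * m powr (p - 1) * (f x * k x)) <= ennreal (f x * k x powr p + (p - 1) * m powr p * f x)"
    by (intro ennreal_leI) (simp add: algebra_simps)
   then show "ennreal (p * m powr (p - 1)) * ennreal (f x * k x) <= ennreal (f x * k x powr p) + ennreal ((p - 1) * m powr p) * ennreal (f x)"
    using p f0[of x] k0[of x] by (simp add: ennreal_mult ennreal_plus)
  qed
  also have "... = ennreal B + ennreal ((p - 1) * m powr p) * (NBINT x. ennreal (f x))"
   using B(2) by (simp add: nn_integral_add nn_integral_cmult)
  also have "... <= ennreal B + ennreal ((p - 1) * m powr p) * ennreal M"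
   by (intro add_left_mono mult_left_mono fM) auto
  also have "... = ennreal (B + (p - 1) * m powr p * M)"
   using p M B(1) by (simp add: ennreal_mult ennreal_plus)
  finally show ?thesis .
 qed
 have "ennreal p * (NBINT x. ennreal (f x * k x)) \<noteq> top"
  using main[of 1] by (auto simp: top_unique)
 then show fk: "(NBINT x. ennreal (f x * k x)) < \<infinity>"
  using p by (auto simp: ennreal_mult_eq_top_iff less_top)
 define X where "X = enn2real (NBINT x. ennreal (f x * k x))"
 have X: "0 <= X" "(NBINT x. ennreal (f x * k x)) = ennreal X"
  using fk by (auto simp: X_def less_top)
 have "X powr p <= M powr (p - 1) * B"
 proof (cases "X = 0")
  case True then show ?thesis using B(1) by simp
 next
  case False
  then have Xp: "0 < X" using X(1) by simp
  have "ennreal (p * (X / M) powr (p - 1)) * ennreal X <= ennreal (B + (p - 1) * (X / M) powr p * M)"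
   using main[of "X / M"] X M by simp
  then have "ennreal (p * (X / M) powr (p - 1) * X) <= ennreal (B + (p - 1) * (X / M) powr p * M)"
   using p X(1) by (subst ennreal_mult) auto
  then have "p * (X / M) powr (p - 1) * X <= B + (p - 1) * (X / M) powr p * M"
   using p M B(1) Xp by (subst (asm) ennreal_le_iff) auto
  moreover have "(X / M) powr p * M = (X / M) powr (p - 1) * X"
   using Xp M powr_mult_base[of "X/M" "p - 1"] by (simp add: field_simps)
  ultimately have "p * ((X / M) powr (p - 1) * X) <= B + (p - 1) * ((X / M) powr (p - 1) * X)"
   by (simp only: mult.assoc)
  then have "(X / M) powr (p - 1) * X <= B" by (simp only: left_diff_distrib)
  then have "M powr (p - 1) * ((X / M) powr (p - 1) * X) <= M powr (p - 1) * B" by (intro mult_left_mono) auto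
  moreover have "M powr (p - 1) * ((X / M) powr (p - 1) * X) = X powr p"
   using Xp M powr_mult_base[of X "p - 1"] by (simp add: powr_divide mult.commute)
  ultimately show ?thesis by simp
 qed
 then show "ennreal (enn2real (NBINT x. ennreal (f x * k x)) powr p)
   <= ennreal (M powr (p - 1)) * (NBINT x. ennreal (f x * k x powr p))"
  unfolding B(2) X_def[symmetric] using B(1) by (simp add: ennreal_mult[symmetric] ennreal_leI)
qed

text \<open>The kernel $|z|^{-3/p}$ belongs only to weak $L^p$, so integrability of $u$ does not put the
 potential in $L^p$; finite entropy does. Split the potential at the distance
 $\rho(w)=\min(1,1/u(w))$. Far from $w$, Jensen's inequality reduces the $p$-th power to the
 integral of $|z|^{-3}$ over $|z|\ge\rho(w)$, which costs a factor $1+\log^+u(w)$. Near $w$ one has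
 $u<|z|^{-1}$, and trading $u^{1-1/p}$ for $|z|^{-(1-1/p)}$ leaves the convolution of
 $u^{1/p}\in L^p$ with an integrable kernel.\<close>

lemma Riesz_potential_borderline:
 assumes p: "1 < p" and M: "0 < M" and H: "0 <= H"
 obtains C where "0 <= C" "!!u :: real^3 => real. u : Borel ==> (!!x. 0 <= u x) ==>
  (NBINT w. ennreal (u w)) <= ennreal M ==>
  (NBINT w. ennreal (u w * max 0 (ln (u w)))) <= ennreal H ==>
  (AEL v. (NBINT w. ennreal (u w * norm (v - w) powr (-(3/p)))) < \<infinity>) \<and>
  (NBALL R (%v. ennreal (enn2real (NBINT w. ennreal (u w * norm (v - w) powr (-(3/p)))) powr p))) <= ennreal C"
proof -
 define s where "s = 1 + 2 / p"
 have s: "0 <= s" "s < 3" using p by (auto simp: s_def field_simps)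
 obtain C1 where C1: "0 <= C1" "!!y::real^3. (NBINT v. ennreal (norm (v - y) powr (-s)) * indicator {..1} (norm (v - y))) <= ennreal C1"
  using singular_kernel_integrable[OF s] by blast
 obtain C3 where C3: "0 <= C3" "!!(y::real^3) r. 0 < r ==> r <= 1 ==>
  (NBINT v. ennreal (norm (v - y) powr (-3)) * indicator {r..1} (norm (v - y))) <= ennreal (C3 * (1 + ln (1 / r)))"
  using critical_kernel_log_bound by blast
 define \<kappa> where "\<kappa> z = norm (z::real^3) powr (-s) * indicator {..1} (norm z)" for z
 have [measurable]: "\<kappa> : Borel" unfolding \<kappa>_def by measurable
 have \<kappa>0: "0 <= \<kappa> z" for z by (simp add: \<kappa>_def)
 have C1\<kappa>: "(NBINT v. ennreal (\<kappa> (v - y))) <= ennreal C1" for y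
  using C1(2)[of y] by (simp add: \<kappa>_def ennreal_mult ennreal_indicator)
 have C1\<kappa>': "(NBINT y. ennreal (\<kappa> (v - y))) <= ennreal (C1 + 1)" for v
 proof -
  have "(NBINT y. ennreal (\<kappa> (v - y))) = (NBINT y. ennreal (\<kappa> (y - v)))"
   by (simp add: \<kappa>_def norm_minus_commute)
  also have "... <= ennreal C1" by (rule C1\<kappa>)
  also have "... <= ennreal (C1 + 1)" by (simp add: ennreal_leI)
  finally show ?thesis .
 qed
 define VR where "VR = measure lborel (cball (0::real^3) R)"
 have VR: "0 <= VR" "emeasure lborel (cball (0::real^3) R) = ennreal VR"
  using emeasure_lborel_cball_finite[of "0::real^3" R] by (auto simp: VR_def emeasure_eq_ennreal_measure less_top[symmetric])
 define Cn where "Cn = (C1 + 1) powr (p - 1) * (M * C1)"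
 define Cf where "Cf = M powr (p - 1) * ((C3 + VR) * M + C3 * H)"
 define C where "C = 2 powr p * (Cn + Cf)"
 have C: "0 <= C" using C1(1) C3(1) VR(1) M H by (simp add: C_def Cn_def Cf_def)
 show ?thesis
 proof (rule that[OF C])
  fix u :: "real^3 => real"
  assume [measurable]: "u : Borel" and u0: "!!x. 0 <= u x"
   and uM: "(NBINT w. ennreal (u w)) <= ennreal M"
   and uH: "(NBINT w. ennreal (u w * max 0 (ln (u w)))) <= ennreal H"
  (* The splitting distance min 1 (1 / u w), without division by zero. *)
  define \<rho> where "\<rho> w = (if u w <= 1 then 1 else 1 / u w)" for w
  have \<rho>: "0 < \<rho> w" "\<rho> w <= 1" "ln (1 / \<rho> w) = max 0 (ln (u w))" for w
  proof -
   show "0 < \<rho> w" "\<rho> w <= 1" by (auto simp: \<rho>_def)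
   have "u w <= 1 ==> ln (u w) <= 0" using u0[of w] by (cases "u w = 0") auto
   then show "ln (1 / \<rho> w) = max 0 (ln (u w))" by (auto simp: \<rho>_def)
  qed
  have [measurable]: "\<rho> : Borel" unfolding \<rho>_def by measurable
  let ?k = "%z::real^3. norm z powr (-(3/p))"
  define far where "far v w = (if \<rho> w <= norm (v - w) then ?k (v - w) else 0)" for v w
  have far_meas[measurable]: "(%x. far (fst x) (snd x)) : borel_measurable (lborel \<Otimes>\<^sub>M lborel)"
   unfolding far_def by measurable
  have [measurable]: "far v : Borel" for v unfolding far_def by measurable
  have far0: "0 <= far v w" for v w by (simp add: far_def)
  have farp: "far v w powr p = (if \<rho> w <= norm (v - w) then norm (v - w) powr (-3) else 0)" for v w
   using p by (auto simp: far_def indicator_def powr_powr)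
  define Nr where "Nr v = (NBINT w. ennreal (\<kappa> (v - w) * u w powr (1/p)))" for v
  define Fr where "Fr v = (NBINT w. ennreal (u w * far v w))" for v
  define Np where "Np v = (NBINT w. ennreal (\<kappa> (v - w) * (u w powr (1/p)) powr p))" for v
  define Fp where "Fp v = (NBINT w. ennreal (u w * far v w powr p))" for v
  have [measurable]: "Np : Borel" "Fp : Borel"
   unfolding Np_def Fp_def farp by measurable
  have split: "ennreal (u w * ?k (v - w)) <= ennreal (\<kappa> (v - w) * u w powr (1/p)) + ennreal (u w * far v w)" for v w
  proof (cases "\<rho> w <= norm (v - w) \<or> v = w \<or> u w = 0")
   case True
   then show ?thesis using p by (auto simp: far_def)
  next
   case False
   define r where "r = norm (v - w)"
   have r: "0 < r" "r < 1" "0 < u w" "r < \<rho> w"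
    using False \<rho>[of w] u0[of w] by (auto simp: r_def)
   have "u w < 1 / r"
   proof (cases "u w <= 1")
    case True
    have "1 < 1 / r" using r by simp
    with True show ?thesis by linarith
   next
    case False
    then show ?thesis using r by (simp add: \<rho>_def field_simps)
   qed
   have "u w = u w powr (1/p) * u w powr (1 - 1/p)" using r by (simp add: powr_add[symmetric])
   also have "... <= u w powr (1/p) * (1 / r) powr (1 - 1/p)"
    using r p \<open>u w < 1 / r\<close> by (intro mult_left_mono powr_mono2) auto
   also have "(1 / r) powr (1 - 1/p) = r powr (-(1 - 1/p))"
    using r by (simp only: powr_minus_divide powr_divide powr_one_eq_one)
   finally have "u w * r powr (-(3/p)) <= u w powr (1/p) * r powr (-(1 - 1/p)) * r powr (-(3/p))"
    by (rule mult_right_mono) simp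
   also have "... = u w powr (1/p) * r powr (-s)"
    by (simp add: mult.assoc powr_add[symmetric] s_def field_simps)
   finally have "u w * ?k (v - w) <= \<kappa> (v - w) * u w powr (1/p)"
    using r(2) by (simp add: \<kappa>_def r_def mult.commute)
   then show ?thesis by (simp add: ennreal_leI add_increasing2)
  qed
  have pot_le: "(NBINT w. ennreal (u w * ?k (v - w))) <= Nr v + Fr v" for v
  proof -
   have "(NBINT w. ennreal (u w * ?k (v - w))) <= (NBINT w. ennreal (\<kappa> (v - w) * u w powr (1/p)) + ennreal (u w * far v w))"
    by (intro nn_integral_mono split)
   also have "... = Nr v + Fr v" unfolding Nr_def Fr_def by (rule nn_integral_add) measurable
   finally show ?thesis .
  qed
  have intN: "(NBINT v. Np v) <= ennreal (M * C1)"
  proof -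
   have "(NBINT v. Np v) = (NBINT w. (NBINT v. ennreal (\<kappa> (v - w) * (u w powr (1/p)) powr p)))"
    unfolding Np_def by (rule lborel_pair.Fubini') measurable
   also have "... <= (NBINT w. ennreal (u w) * ennreal C1)"
   proof (intro nn_integral_mono)
    fix w
    have "(NBINT v. ennreal (\<kappa> (v - w) * (u w powr (1/p)) powr p)) = (NBINT v. ennreal (u w) * ennreal (\<kappa> (v - w)))"
     using p u0[of w] by (intro nn_integral_cong) (simp add: powr_powr ennreal_mult \<kappa>0 mult.commute)
    also have "... = ennreal (u w) * (NBINT v. ennreal (\<kappa> (v - w)))" by (rule nn_integral_cmult) measurable
    also have "... <= ennreal (u w) * ennreal C1" by (intro mult_left_mono C1\<kappa>) simp
    finally show "(NBINT v. ennreal (\<kappa> (v - w) * (u w powr (1/p)) powr p)) <= ennreal (u w) * ennreal C1" .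
   qed
   also have "... = (NBINT w. ennreal (u w)) * ennreal C1" by (rule nn_integral_multc) measurable
   also have "... <= ennreal M * ennreal C1" by (intro mult_right_mono uM) simp
   also have "... = ennreal (M * C1)" using M C1(1) by (simp add: ennreal_mult)
   finally show ?thesis .
  qed
  have intF: "(NBALL r (%v. Fp v)) <= ennreal ((C3 + measure lborel (cball (0::real^3) r)) * M + C3 * H)" for r
  proof -
   define V where "V = measure lborel (cball (0::real^3) r)"
   have V: "0 <= V" "emeasure lborel (cball (0::real^3) r) = ennreal V"
    using emeasure_lborel_cball_finite[of "0::real^3" r] by (auto simp: V_def emeasure_eq_ennreal_measure less_top[symmetric])
   have "(NBALL r (%v. Fp v)) = (NBINT v. (NBINT w. ennreal (u w * far v w powr p) * ball_ind r v))"
    unfolding Fp_def farp by (intro nn_integral_cong nn_integral_multc[symmetric]) measurable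
   also have "... = (NBINT w. (NBINT v. ennreal (u w * far v w powr p) * ball_ind r v))"
    unfolding farp by (rule lborel_pair.Fubini') measurable
   also have "... <= (NBINT w. ennreal (C3 + V) * ennreal (u w) + ennreal C3 * ennreal (u w * max 0 (ln (u w))))"
   proof (intro nn_integral_mono)
    fix w
    have "(NBINT v. ennreal (u w * far v w powr p) * ball_ind r v)
     <= (NBINT v. ennreal (u w) * (ennreal (norm (v - w) powr (-3)) * indicator {\<rho> w..1} (norm (v - w)) + ball_ind r v))"
    proof (intro nn_integral_mono)
     fix v
     have "ennreal (far v w powr p) * ball_ind r v <= ennreal (norm (v - w) powr (-3)) * indicator {\<rho> w..1} (norm (v - w)) + ball_ind r v"
     proof (cases "norm (v - w) <= 1")
      case True
      then show ?thesis by (auto simp: farp indicator_def add_increasing2)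
     next
      case False
      have "norm (v - w) powr (-3) <= 1 powr (-3)" using False by (intro powr_mono2') auto
      then have "ennreal (far v w powr p) <= 1" by (auto simp: farp indicator_def)
      then show ?thesis by (auto simp: indicator_def intro: add_increasing)
     qed
     then have "ennreal (u w) * (ennreal (far v w powr p) * ball_ind r v) <= ennreal (u w) * (ennreal (norm (v - w) powr (-3)) * indicator {\<rho> w..1} (norm (v - w)) + ball_ind r v)"
      by (rule mult_left_mono) simp
     then show "ennreal (u w * far v w powr p) * ball_ind r v <= ennreal (u w) * (ennreal (norm (v - w) powr (-3)) * indicator {\<rho> w..1} (norm (v - w)) + ball_ind r v)"
      using u0[of w] by (simp add: ennreal_mult mult.assoc)
    qed
    also have "... = ennreal (u w) * ((NBINT v. ennreal (norm (v - w) powr (-3)) * indicator {\<rho> w..1} (norm (v - w))) + ennreal V)"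
     by (simp add: nn_integral_cmult nn_integral_add V(2))
    also have "... <= ennreal (u w) * (ennreal (C3 * (1 + max 0 (ln (u w)))) + ennreal V)"
     using C3(2)[OF \<rho>(1,2), of w w] unfolding \<rho>(3) by (intro mult_left_mono add_right_mono) auto
    also have "... = ennreal (u w * (C3 * (1 + max 0 (ln (u w))) + V))"
     using u0[of w] C3(1) V(1) by (simp add: ennreal_mult ennreal_plus)
    also have "u w * (C3 * (1 + max 0 (ln (u w))) + V) = (C3 + V) * u w + C3 * (u w * max 0 (ln (u w)))"
     by (simp add: algebra_simps)
    also have "ennreal ... = ennreal (C3 + V) * ennreal (u w) + ennreal C3 * ennreal (u w * max 0 (ln (u w)))"
     using u0[of w] C3(1) V(1) by (subst ennreal_plus) (auto intro!: mult_nonneg_nonneg simp: ennreal_mult)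
    finally show "(NBINT v. ennreal (u w * far v w powr p) * ball_ind r v)
     <= ennreal (C3 + V) * ennreal (u w) + ennreal C3 * ennreal (u w * max 0 (ln (u w)))" .
   qed
   also have "... = ennreal (C3 + V) * (NBINT w. ennreal (u w)) + ennreal C3 * (NBINT w. ennreal (u w * max 0 (ln (u w))))"
    by (simp add: nn_integral_add nn_integral_cmult)
   also have "... <= ennreal (C3 + V) * ennreal M + ennreal C3 * ennreal H"
    by (intro add_mono mult_left_mono uM uH) auto
   also have "... = ennreal ((C3 + V) * M + C3 * H)"
    using C3(1) V(1) M H by (simp add: ennreal_mult ennreal_plus)
   finally show ?thesis by (simp add: V_def)
  qed
  have aeN: "AEL v. Np v < \<infinity>"
   using nn_integral_noteq_infinite[of Np lborel] le_less_trans[OF intN ennreal_less_top] by (simp add: less_top)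
  have aeF: "AEL v. Fp v < \<infinity>"
  proof -
   have "AEL v. Fp v * ball_ind (real k) v \<noteq> \<infinity>" for k
    using nn_integral_noteq_infinite[of "%v. Fp v * ball_ind (real k) v" lborel] le_less_trans[OF intF[of "real k"] ennreal_less_top]
    by simp
   then have "AEL v. \<forall>k. Fp v * ball_ind (real k) v \<noteq> \<infinity>" unfolding AE_all_countable by blast
   then show ?thesis
   proof eventually_elim
    case (elim v)
    obtain k where "norm v <= real k" using real_arch_simple by blast
    with elim[rule_format, of k] show ?case by (simp add: less_top)
   qed
  qed
  have fin: "Nr v < \<infinity>" "ennreal (enn2real (Nr v) powr p) <= ennreal ((C1 + 1) powr (p - 1)) * Np v" if "Np v < \<infinity>" for v
   using jensen_powr[of "%w. \<kappa> (v - w)" "%w. u w powr (1/p)" p "C1 + 1"] that C1(1) p C1\<kappa>' \<kappa>0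
   unfolding Nr_def Np_def by auto
  have finF: "Fr v < \<infinity>" "ennreal (enn2real (Fr v) powr p) <= ennreal (M powr (p - 1)) * Fp v" if "Fp v < \<infinity>" for v
   using jensen_powr[of u "far v" p M] that M p uM u0 far0 unfolding Fr_def Fp_def by auto
  have pw: "ennreal (enn2real (NBINT w. ennreal (u w * ?k (v - w))) powr p)
    <= ennreal (2 powr p) * (ennreal ((C1 + 1) powr (p - 1)) * Np v + ennreal (M powr (p - 1)) * Fp v)"
   if "Np v < \<infinity>" "Fp v < \<infinity>" for v
  proof -
   define a where "a = enn2real (Nr v)"
   define b where "b = enn2real (Fr v)"
   have ab: "Nr v = ennreal a" "Fr v = ennreal b" "0 <= a" "0 <= b"
    using fin(1)[OF that(1)] finF(1)[OF that(2)] by (auto simp: a_def b_def less_top)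
   have "enn2real (NBINT w. ennreal (u w * ?k (v - w))) <= a + b"
    using pot_le[of v] ab by (intro enn2real_leI) (auto simp: ennreal_plus)
   then have "enn2real (NBINT w. ennreal (u w * ?k (v - w))) powr p <= (2 * max a b) powr p"
    using p ab by (intro powr_mono2) auto
   also have "... = 2 powr p * (max a b) powr p" using ab by (simp add: powr_mult)
   also have "... <= 2 powr p * (a powr p + b powr p)" by (intro mult_left_mono) (auto simp: max_def)
   finally have "ennreal (enn2real (NBINT w. ennreal (u w * ?k (v - w))) powr p) <= ennreal (2 powr p) * (ennreal (a powr p) + ennreal (b powr p))"
    by (simp add: ennreal_mult[symmetric] ennreal_plus[symmetric] ennreal_leI del: ennreal_plus)
   also have "... <= ennreal (2 powr p) * (ennreal ((C1 + 1) powr (p - 1)) * Np v + ennreal (M powr (p - 1)) * Fp v)"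
    unfolding a_def b_def by (intro mult_left_mono add_mono fin(2) finF(2) that) simp
   finally show ?thesis .
  qed
  show "(AEL v. (NBINT w. ennreal (u w * norm (v - w) powr (-(3/p)))) < \<infinity>) \<and>
   (NBALL R (%v. ennreal (enn2real (NBINT w. ennreal (u w * norm (v - w) powr (-(3/p)))) powr p))) <= ennreal C"
  proof
   show "AEL v. (NBINT w. ennreal (u w * norm (v - w) powr (-(3/p)))) < \<infinity>"
    using aeN aeF
   proof eventually_elim
    case (elim v)
    then have "Nr v + Fr v < \<infinity>" using fin(1) finF(1) by simp
    then show ?case using pot_le[of v] by (rule le_less_trans[rotated])
   qed
   have "(NBALL R (%v. ennreal (enn2real (NBINT w. ennreal (u w * norm (v - w) powr (-(3/p)))) powr p)))
    <= (NBINT v. ennreal (2 powr p) * (ennreal ((C1 + 1) powr (p - 1)) * Np v + ennreal (M powr (p - 1)) * (Fp v * ball_ind R v)))"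
    by (rule nn_integral_mono_AE, use aeN aeF in eventually_elim) (use pw in \<open>auto simp: indicator_def\<close>)
   also have "... = ennreal (2 powr p) * (ennreal ((C1 + 1) powr (p - 1)) * (NBINT v. Np v) + ennreal (M powr (p - 1)) * (NBALL R (%v. Fp v)))"
    by (simp add: nn_integral_cmult nn_integral_add)
   also have "... <= ennreal (2 powr p) * (ennreal ((C1 + 1) powr (p - 1)) * ennreal (M * C1) + ennreal (M powr (p - 1)) * ennreal ((C3 + VR) * M + C3 * H))"
    unfolding VR_def by (intro mult_left_mono add_mono intN intF) auto
   also have "... = ennreal C"
    using C1(1) C3(1) VR(1) M H by (simp add: C_def Cn_def Cf_def ennreal_mult[symmetric] ennreal_plus[symmetric] del: ennreal_plus)
   finally show "(NBALL R (%v. ennreal (enn2real (NBINT w. ennreal (u w * norm (v - w) powr (-(3/p)))) powr p))) <= ennreal C" .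
  qed
 qed
qed

subsection \<open>Local bounds for potentials\<close>

lemma nn_integral_lborel_swap:
 fixes f :: "'a::euclidean_space => 'b::euclidean_space => ennreal"
 assumes "(%x. f (fst x) (snd x)) : borel_measurable (lborel \<Otimes>\<^sub>M lborel)"
 shows "(NBINT x. (NBINT y. f x y)) = (NBINT y. (NBINT x. f x y))"
 using lborel_pair.Fubini[OF assms] lborel.nn_integral_fst[OF assms] by (simp add: lborel.nn_integral_fst[OF assms])

lemma kernel_ball_bound:
 fixes s :: real assumes "0 <= s" "s < 3"
 obtains C where "0 <= C" "!!y::real^3. (NBALL R (%v. ennreal (norm (v - y) powr (-s)))) <= ennreal C"
proof -
 obtain C where C: "0 <= C" "!!y::real^3. (NBINT v. ennreal (norm (v - y) powr (-s)) * indicator {..1} (norm (v - y))) <= ennreal C"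
  using singular_kernel_integrable[OF assms] by blast
 define V where "V = measure lborel (cball (0::real^3) R)"
 have V: "0 <= V" "emeasure lborel (cball (0::real^3) R) = ennreal V"
  using emeasure_lborel_cball_finite[of "0::real^3" R] by (auto simp: V_def emeasure_eq_ennreal_measure less_top[symmetric])
 have "(NBALL R (%v. ennreal (norm (v - y) powr (-s)))) <= ennreal (C + V)" for y :: "real^3"
 proof -
  have "(NBALL R (%v. ennreal (norm (v - y) powr (-s))))
   <= (NBINT v. ennreal (norm (v - y) powr (-s)) * indicator {..1} (norm (v - y)) + ball_ind R v)"
  proof (intro nn_integral_mono)
   fix v
   show "ennreal (norm (v - y) powr (-s)) * ball_ind R v <= ennreal (norm (v - y) powr (-s)) * indicator {..1} (norm (v - y)) + ball_ind R v"
   proof (cases "norm (v - y) <= 1")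
    case True then show ?thesis by (auto simp: indicator_def)
   next
    case False
    then have "norm (v - y) powr (-s) <= 1 powr (-s)" using assms by (intro powr_mono2') auto
    then have "ennreal (norm (v - y) powr (-s)) <= 1" by simp
    then show ?thesis by (auto simp: indicator_def)
   qed
  qed
  also have "... = (NBINT v. ennreal (norm (v - y) powr (-s)) * indicator {..1} (norm (v - y))) + ennreal V"
   using V by (simp add: nn_integral_add)
  also have "... <= ennreal C + ennreal V" by (intro add_right_mono C)
  finally show ?thesis using C(1) V(1) by simp
 qed
 then show ?thesis using that[of "C + V"] C(1) V(1) by auto
qed

lemma potential_L1_loc:
 fixes u :: "real^3 => real"
 assumes [measurable]: "u : Borel" and u0: "!!x. 0 <= u x"
  and fin: "(NBINT w. ennreal (u w)) < \<infinity>" and s: "0 <= s" "s < 3"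
 shows "(NBALL R (%v. (NBINT w. ennreal (u w * norm (v - w) powr (-s))))) < \<infinity>"
proof -
 obtain C where C: "0 <= C" "!!y::real^3. (NBALL R (%v. ennreal (norm (v - y) powr (-s)))) <= ennreal C"
  using kernel_ball_bound[OF s] by blast
 have "(NBALL R (%v. (NBINT w. ennreal (u w * norm (v - w) powr (-s)))))
  = (NBINT v. (NBINT w. ennreal (u w * norm (v - w) powr (-s)) * ball_ind R v))"
  by (intro nn_integral_cong nn_integral_multc[symmetric]) measurable
 also have "... = (NBINT w. (NBINT v. ennreal (u w * norm (v - w) powr (-s)) * ball_ind R v))"
  by (rule nn_integral_lborel_swap) measurable
 also have "... = (NBINT w. ennreal (u w) * (NBALL R (%v. ennreal (norm (v - w) powr (-s)))))"
  by (intro nn_integral_cong) (simp add: ennreal_mult u0 mult.assoc nn_integral_cmult)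
 also have "... <= (NBINT w. ennreal (u w) * ennreal C)"
  by (intro nn_integral_mono mult_left_mono C) simp
 also have "... = (NBINT w. ennreal (u w)) * ennreal C" by (rule nn_integral_multc) measurable
 also have "... < \<infinity>" using fin by (simp add: ennreal_mult_less_top)
 finally show ?thesis .
qed

lemma AE_of_L1_loc:
 fixes P :: "'a::euclidean_space => ennreal"
 assumes [measurable]: "P : Borel" and fin: "!!R. (NBALL R (%v. P v)) < \<infinity>"
 shows "AEL v. P v < \<infinity>"
proof -
 have "AEL v. P v * ball_ind (real k) v \<noteq> \<infinity>" for k
  using fin[of "real k"] by (intro nn_integral_noteq_infinite) auto
 then have "AEL v. \<forall>k. P v * ball_ind (real k) v \<noteq> \<infinity>" unfolding AE_all_countable by blast
 then show ?thesis
 proof eventually_elim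
  case (elim v)
  obtain k where "norm v <= real k" using real_arch_simple by blast
  with elim[rule_format, of k] show ?case by (simp add: less_top)
 qed
qed

lemma product_le_cubes:
 fixes a b :: real assumes "0 <= a" "0 <= b" shows "a * b <= a ^ 3 + b powr (3/2)"
proof (cases "a <= b powr (1/2)")
 case True
 then have "a * b <= b powr (1/2) * b" using assms by (intro mult_right_mono)
 also have "... = b powr (3/2)" using assms powr_mult_base[of b "1/2"] by (simp add: mult.commute)
 finally show ?thesis using assms by (simp add: add_increasing)
next
 case False
 then have "(b powr (1/2)) * (b powr (1/2)) <= a * a" using assms by (intro mult_mono) auto
 moreover have "(b powr (1/2)) * (b powr (1/2)) = b" using assms by (simp add: powr_add[symmetric])
 ultimately have "a * b <= a * (a * a)" using assms by (intro mult_left_mono) auto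
 then show ?thesis by (simp add: power3_eq_cube add_increasing2 mult.assoc)
qed

text \<open>Young's inequality with parameter $\mu$: the resulting bound is linear in the $L^3$ norm
 of $u$ once $\mu$ is taken comparable to that norm.\<close>

lemma Newton_potential_L3_bound:
 obtains C where "0 <= C" "!!(u :: real^3 => real) \<mu> v. u : Borel ==> (!!x. 0 <= u x) ==> 0 < \<mu> ==>
  (NBINT w. ennreal (u w * norm (v - w) powr (-1)))
   <= (NBINT w. ennreal (u w)) + ennreal \<mu> * (ennreal C + (NBSET (cball v 1) (%w. ennreal ((u w / \<mu>) ^ 3))))"
proof -
 obtain C where C: "0 <= C" "!!y::real^3. (NBINT v. ennreal (norm (v - y) powr (-(3/2))) * indicator {..1} (norm (v - y))) <= ennreal C"
  using singular_kernel_integrable[of "3/2"] by auto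
 show ?thesis
 proof (rule that[OF C(1)])
  fix u :: "real^3 => real" and \<mu> v assume [measurable]: "u : Borel" and u0: "!!x. 0 <= u x" and l: "0 < (\<mu>::real)"
  have "(NBINT w. ennreal (u w * norm (v - w) powr (-1))) \<le>
   (NBINT w. ennreal (u w) + ennreal \<mu> * (ennreal (norm (w - v) powr (-(3/2))) * indicator {..1} (norm (w - v)) + ennreal ((u w / \<mu>) ^ 3) * indicator (cball v 1) w))"
  proof (intro nn_integral_mono)
   fix w
   show "ennreal (u w * norm (v - w) powr (-1)) <= ennreal (u w) + ennreal \<mu> * (ennreal (norm (w - v) powr (-(3/2))) * indicator {..1} (norm (w - v)) + ennreal ((u w / \<mu>) ^ 3) * indicator (cball v 1) w)"
   proof (cases "norm (w - v) <= 1")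
    case False
    then have "norm (v - w) powr (-1) <= 1 powr (-1)" by (intro powr_mono2') (auto simp: norm_minus_commute)
    from mult_left_mono[OF this u0[of w]] have "u w * norm (v - w) powr (-1) <= u w" by simp
    then show ?thesis by (simp add: ennreal_leI add_increasing2)
   next
    case True
    have "(u w / \<mu>) * norm (w - v) powr (-1) <= (u w / \<mu>) ^ 3 + (norm (w - v) powr (-1)) powr (3/2)"
     using u0[of w] l by (intro product_le_cubes) auto
    then have "\<mu> * ((u w / \<mu>) * norm (w - v) powr (-1)) <= \<mu> * ((u w / \<mu>) ^ 3 + (norm (w - v) powr (-1)) powr (3/2))"
     using l by (intro mult_left_mono) auto
    then have "u w * norm (v - w) powr (-1) <= \<mu> * (norm (w - v) powr (-(3/2)) + (u w / \<mu>) ^ 3)"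
    proof -
     have "(norm (w - v) powr (-1)) powr (3/2) = norm (w - v) powr (-(3/2))" by (simp only: powr_powr) simp
     moreover assume "\<mu> * ((u w / \<mu>) * norm (w - v) powr (-1)) <= \<mu> * ((u w / \<mu>) ^ 3 + (norm (w - v) powr (-1)) powr (3/2))"
     ultimately show ?thesis using l by (simp add: norm_minus_commute[of v w] add.commute del: powr_minus)
    qed
    then have "ennreal (u w * norm (v - w) powr (-1)) <= ennreal (\<mu> * (norm (w - v) powr (-(3/2)) + (u w / \<mu>) ^ 3))" by (rule ennreal_leI)
    also have "... = ennreal \<mu> * (ennreal (norm (w - v) powr (-(3/2))) + ennreal ((u w / \<mu>) ^ 3))"
     using l u0[of w] by (subst ennreal_mult) (auto simp: ennreal_plus)
    finally show ?thesis using True by (simp add: add_increasing dist_norm norm_minus_commute)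
   qed
  qed
  also have "... = (NBINT w. ennreal (u w)) + ennreal \<mu> * ((NBINT w. ennreal (norm (w - v) powr (-(3/2))) * indicator {..1} (norm (w - v))) + (NBSET (cball v 1) (%w. ennreal ((u w / \<mu>) ^ 3))))"
   by (simp add: nn_integral_add nn_integral_cmult)
  also have "... <= (NBINT w. ennreal (u w)) + ennreal \<mu> * (ennreal C + (NBSET (cball v 1) (%w. ennreal ((u w / \<mu>) ^ 3))))"
   by (intro add_left_mono mult_left_mono add_right_mono C) auto
  finally show "(NBINT w. ennreal (u w * norm (v - w) powr (-1)))
   <= (NBINT w. ennreal (u w)) + ennreal \<mu> * (ennreal C + (NBSET (cball v 1) (%w. ennreal ((u w / \<mu>) ^ 3))))" .
 qed
qed

lemma square_le_cube: "0 <= (x::real) ==> x\<^sup>2 <= 1 + x ^ 3"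
proof (cases "x <= 1")
 case True assume "0 <= x" then have "x\<^sup>2 <= 1" using True by (intro power_le_one)
 then show ?thesis using \<open>0 \<le> x\<close> by (simp add: add_increasing2)
next
 case False then have "x ^ 2 <= x ^ 3" by (intro power_increasing) auto
 then show ?thesis by simp
qed

text \<open>The kernel $|z|^{-2}$ is integrable near the origin, so the double integral is finite as soon
 as $u$ is locally square integrable: near the diagonal $u(v)u(w)\le u(v)^2+u(w)^2$.\<close>

lemma double_potential_finite:
 fixes u :: "real^3 => real"
 assumes [measurable]: "u : Borel" and u0: "!!x. 0 <= u x"
  and fin: "(NBINT w. ennreal (u w)) < \<infinity>"
  and fin3: "!!r. (NBALL r (%w. ennreal (u w ^ 3))) < \<infinity>"
 shows "(NBALL R (%v. (NBINT w. ennreal (u v * (u w * norm (v - w) powr (-2)))))) < \<infinity>"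
proof -
 define S where "S = (NBALL (R+1) (%w. ennreal ((u w)\<^sup>2)))"
 have S: "S < \<infinity>"
 proof -
  have "S <= (NBINT w. ball_ind (R+1) w + ennreal (u w ^ 3) * ball_ind (R+1) w)"
   unfolding S_def
  proof (intro nn_integral_mono)
   fix w
   have "ennreal ((u w)\<^sup>2) <= 1 + ennreal (u w ^ 3)"
    using ennreal_leI[OF square_le_cube[OF u0[of w]]] u0[of w] by simp
   then show "ennreal ((u w)\<^sup>2) * ball_ind (R+1) w <= ball_ind (R+1) w + ennreal (u w ^ 3) * ball_ind (R+1) w"
    by (auto simp: indicator_def)
  qed
  also have "... = emeasure lborel (cball (0::real^3) (R+1)) + (NBALL (R+1) (%w. ennreal (u w ^ 3)))"
   by (simp add: nn_integral_add)
  also have "... < \<infinity>" using fin3[of "R+1"] emeasure_lborel_cball_finite[of "0::real^3" "R+1"] by simp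
  finally show ?thesis .
 qed
 obtain C where C: "0 <= C" "!!y::real^3. (NBINT v. ennreal (norm (v - y) powr (-2)) * indicator {..1} (norm (v - y))) <= ennreal C"
  using singular_kernel_integrable[of 2] by auto
 let ?k = "%z::real^3. ennreal (norm z powr (-2)) * indicator {..1} (norm z)"
 let ?q = "%w. ennreal ((u w)\<^sup>2) * ball_ind (R+1) w"
 have le: "ennreal (u v * (u w * norm (v - w) powr (-2))) * ball_ind R v
   <= ennreal (u v) * ennreal (u w) + (?q v * ?k (w - v) + ?q w * ?k (v - w))" for v w
 proof (cases "norm (v - w) <= 1")
  case False
  then have "norm (v - w) powr (-2) <= 1 powr (-2)" by (intro powr_mono2') auto
  then have "u v * (u w * norm (v - w) powr (-2)) <= u v * u w" using u0[of v] u0[of w] by (simp add: mult_left_le mult_left_mono)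
  then have "ennreal (u v * (u w * norm (v - w) powr (-2))) <= ennreal (u v) * ennreal (u w)"
   using u0[of v] u0[of w] by (simp add: ennreal_mult[symmetric] ennreal_leI)
  then show ?thesis by (auto simp: indicator_def add_increasing2)
 next
  case True
  show ?thesis
  proof (cases "norm v <= R")
   case vR: True
   then have wR: "norm w <= R + 1" using True norm_triangle_ineq2[of w v] by (simp add: norm_minus_commute)
   have "2 * (u v * u w) <= (u v)\<^sup>2 + (u w)\<^sup>2" using sum_squares_bound[of "u v" "u w"] by simp
   then have "u v * u w <= (u v)\<^sup>2 + (u w)\<^sup>2" using mult_nonneg_nonneg[OF u0[of v] u0[of w]] by linarith
   from mult_right_mono[OF this, of "norm (v - w) powr (-2)"]
   have "u v * (u w * norm (v - w) powr (-2)) <= (u v)\<^sup>2 * norm (w - v) powr (-2) + (u w)\<^sup>2 * norm (v - w) powr (-2)"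
    by (simp add: algebra_simps norm_minus_commute)
   then have "ennreal (u v * (u w * norm (v - w) powr (-2))) <= ennreal ((u v)\<^sup>2 * norm (w - v) powr (-2) + (u w)\<^sup>2 * norm (v - w) powr (-2))"
    by (rule ennreal_leI)
   then have "ennreal (u v * (u w * norm (v - w) powr (-2))) <= ennreal ((u v)\<^sup>2) * ennreal (norm (w - v) powr (-2)) + ennreal ((u w)\<^sup>2) * ennreal (norm (v - w) powr (-2))"
    by (simp add: ennreal_mult)
   then show ?thesis using True vR wR by (simp add: norm_minus_commute add_increasing)
  qed simp
 qed
 have C': "(NBINT v. ?q w * ?k (v - w)) <= ?q w * ennreal C" for w
 proof -
  have "(NBINT v. ?q w * ?k (v - w)) = ?q w * (NBINT v. ?k (v - w))" by (rule nn_integral_cmult) measurable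
  also have "... <= ?q w * ennreal C" by (intro mult_left_mono C) simp
  finally show ?thesis .
 qed
 have "(NBALL R (%v. (NBINT w. ennreal (u v * (u w * norm (v - w) powr (-2))))))
  = (NBINT v. (NBINT w. ennreal (u v * (u w * norm (v - w) powr (-2))) * ball_ind R v))"
  by (intro nn_integral_cong nn_integral_multc[symmetric]) measurable
 also have "... <= (NBINT v. (NBINT w. ennreal (u v) * ennreal (u w) + (?q v * ?k (w - v) + ?q w * ?k (v - w))))"
  by (intro nn_integral_mono le)
 also have "... = (NBINT v. ennreal (u v) * (NBINT w. ennreal (u w)) + ((NBINT w. ?q v * ?k (w - v)) + (NBINT w. ?q w * ?k (v - w))))"
  by (intro nn_integral_cong) (simp add: nn_integral_add nn_integral_cmult)
 also have "... = (NBINT v. ennreal (u v) * (NBINT w. ennreal (u w))) + ((NBINT v. (NBINT w. ?q v * ?k (w - v))) + (NBINT v. (NBINT w. ?q w * ?k (v - w))))"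
  by (subst nn_integral_add, measurable, subst nn_integral_add, measurable)
 also have "(NBINT v. (NBINT w. ?q w * ?k (v - w))) = (NBINT w. (NBINT v. ?q w * ?k (v - w)))"
  by (rule nn_integral_lborel_swap) measurable
 also have "(NBINT v. ennreal (u v) * (NBINT w. ennreal (u w))) + ((NBINT v. (NBINT w. ?q v * ?k (w - v))) + (NBINT w. (NBINT v. ?q w * ?k (v - w))))
  <= (NBINT v. ennreal (u v) * (NBINT w. ennreal (u w))) + ((NBINT v. ?q v * ennreal C) + (NBINT v. ?q v * ennreal C))"
  by (intro add_left_mono add_mono nn_integral_mono C')
 also have "... = (NBINT v. ennreal (u v)) * (NBINT w. ennreal (u w)) + (S * ennreal C + S * ennreal C)"
  unfolding S_def by (simp add: nn_integral_multc)
 also have "... < \<infinity>" using fin S by (simp add: ennreal_mult_less_top)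
 finally show ?thesis .
qed

section \<open>Integration by parts against singular kernels\<close>

text \<open>Kernels with a singularity of order one at the origin that are limits of smooth kernels with
 uniform bounds of the right homogeneity; \<open>k'\<close> is the pointwise gradient off the origin.\<close>

definition regularizable :: "(real^3 => real) => (3 => real^3 => real) => bool" where
 "regularizable k k' \<longleftrightarrow> (\<exists>kn C. (\<forall>n::nat. smooth (kn n)) \<and>
  (\<forall>n z. z \<noteq> 0 --> \<bar>kn n z\<bar> <= C * norm z powr (-1)) \<and>
  (\<forall>n z i. z \<noteq> 0 --> \<bar>partial i (kn n) z\<bar> <= C * norm z powr (-2)) \<and>
  (\<forall>z. z \<noteq> 0 --> (%n. kn n z) \<leadsto> k z) \<and>
  (\<forall>z i. z \<noteq> 0 --> (%n. partial i (kn n) z) \<leadsto> k' i z))"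

lemma regularizable_integral_by_parts:
 assumes k: "regularizable k k'" and [measurable]: "k : Borel" "k' j : Borel"
  and u: "borel_weak_grad u G" and \<zeta>: "smooth_test UNIV \<zeta>" "!!v. R < norm v ==> \<zeta> v = 0"
  and fu: "(NBALL R (%v. ennreal (\<bar>u v\<bar> * norm (v - w) powr (-2)))) < \<infinity>"
  and fG: "(NBALL R (%v. ennreal (\<bar>G v $ j\<bar> * norm (v - w) powr (-1)))) < \<infinity>"
 shows "integrable lborel (%v. k (v - w) * G v $ j * \<zeta> v)"
  and "integrable lborel (%v. u v * (k' j (v - w) * \<zeta> v))"
  and "integrable lborel (%v. u v * (k (v - w) * partial j \<zeta> v))"
  and "(LBINT v. k (v - w) * G v $ j * \<zeta> v) =
   - ((LBINT v. u v * (k' j (v - w) * \<zeta> v)) + (LBINT v. u v * (k (v - w) * partial j \<zeta> v)))"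
proof -
 obtain kn C where kn: "!!n::nat. smooth (kn n)" and b0: "!!n z. z \<noteq> 0 ==> \<bar>kn n z\<bar> <= C * norm z powr (-1)"
  and b1: "!!n z i. z \<noteq> 0 ==> \<bar>partial i (kn n) z\<bar> <= C * norm z powr (-2)"
  and l0: "!!z. z \<noteq> 0 ==> (%n. kn n z) \<leadsto> k z"
  and l1: "!!z i. z \<noteq> 0 ==> (%n. partial i (kn n) z) \<leadsto> k' i z"
  using k unfolding regularizable_def by blast
 have lu: "loc_int u" "loc_int (%v. G v $ j)" and [measurable]: "u : Borel" "G : Borel"
  using u by (auto simp: borel_weak_grad_def)
 have s\<zeta>: "smooth \<zeta>" using \<zeta>(1) by (simp add: smooth_test_iff)
 have p\<zeta>: "partial j \<zeta> v = 0" if "R < norm v" for v by (rule partial_zero_outside[OF s\<zeta> \<zeta>(2) that])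
 note [measurable] = smooth_borel[OF s\<zeta>] smooth_borel[OF smooth_partial[OF s\<zeta>]] smooth_borel[OF kn] smooth_borel[OF smooth_partial[OF kn]]
 obtain B0 where B0: "B0 > 0" "!!x. \<bar>\<zeta> x\<bar> <= B0" using smooth_test_bounded[OF \<zeta>(1)] by blast
 obtain B1 where B1: "B1 > 0" "!!x. \<bar>partial j \<zeta> x\<bar> <= B1" using smooth_test_bounded[OF smooth_test_partial[OF \<zeta>(1)]] by blast
 have C0: "0 <= C"
 proof -
  have "0 <= C * norm (axis 1 1 :: real^3) powr (-1)" using b0[of "axis 1 1" 0] by (metis abs_ge_zero axis_eq_0_iff order_trans zero_neq_one)
  then show ?thesis by simp
 qed
 have ne: "AEL v. v - w \<noteq> 0" using AE_lborel_singleton[of w] by eventually_elim simp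
 define W1 where "W1 v = B0 * C * (\<bar>G v $ j\<bar> * norm (v - w) powr (-1)) * ball_ind R v" for v
 define W2 where "W2 v = (\<bar>u v\<bar> * norm (v - w) powr (-2)) * ball_ind R v" for v
 define W3 where "W3 v = (\<bar>u v\<bar> * norm (v - w) powr (-1)) * ball_ind R v" for v
 have iW2: "integrable lborel W2"
 proof (rule integrableI_bounded)
  have "(NBINT v. ennreal (norm (W2 v))) = (NBALL R (%v. ennreal (\<bar>u v\<bar> * norm (v - w) powr (-2))))"
   by (intro nn_integral_cong) (auto simp: W2_def indicator_def)
  then show "(NBINT v. ennreal (norm (W2 v))) < \<infinity>" using fu by simp
 qed (simp add: W2_def[abs_def])
 have iW1: "integrable lborel W1"
 proof -
  have "integrable lborel (%v. (\<bar>G v $ j\<bar> * norm (v - w) powr (-1)) * ball_ind R v)"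
  proof (rule integrableI_bounded)
   have "(NBINT v. ennreal (norm ((\<bar>G v $ j\<bar> * norm (v - w) powr (-1)) * ball_ind R v))) = (NBALL R (%v. ennreal (\<bar>G v $ j\<bar> * norm (v - w) powr (-1))))"
    by (intro nn_integral_cong) (auto simp: indicator_def)
   then show "(NBINT v. ennreal (norm ((\<bar>G v $ j\<bar> * norm (v - w) powr (-1)) * ball_ind R v))) < \<infinity>" using fG by simp
  qed simp
  from integrable_mult_right[OF this, of "B0 * C"] show ?thesis unfolding W1_def[abs_def] by (simp add: mult.assoc)
 qed
 have iu: "integrable lborel (%v. u v * ball_ind R v)"
  by (rule loc_int_times_bounded[OF lu(1), where C=1 and R=R]) (auto simp: indicator_def)
 have iW3: "integrable lborel W3"
 proof (rule Bochner_Integration.integrable_bound[OF Bochner_Integration.integrable_add[OF iW2 integrable_abs[OF iu]]])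
  show "W3 : borel_measurable lborel" unfolding W3_def by measurable
  show "AEL v. norm (W3 v) <= norm (W2 v + \<bar>u v * ball_ind R v\<bar>)"
  proof (rule AE_I2)
   fix v
   have "norm (v - w) powr (-1) <= norm (v - w) powr (-2) + 1"
   proof (cases "norm (v - w) <= 1")
    case True
    have "norm (v - w) powr (-1) <= norm (v - w) powr (-2)"
    proof (cases "v = w")
     case False
     then show ?thesis using True by (simp add: norm_powr_minus_1 norm_powr_minus_2 power2_eq_square divide_simps)
    qed simp
    then show ?thesis by simp
   next
    case False
    then have "norm (v - w) powr (-1) <= 1 powr (-1)" by (intro powr_mono2') auto
    then show ?thesis by (simp add: add_increasing)
   qed
   from mult_left_mono[OF this, of "\<bar>u v\<bar>"]
   show "norm (W3 v) <= norm (W2 v + \<bar>u v * ball_ind R v\<bar>)"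
    by (auto simp: W3_def W2_def indicator_def algebra_simps)
  qed
 qed
 have m1: "(%v. k (v - w) * G v $ j * \<zeta> v) : borel_measurable lborel"
  and m2: "(%v. u v * (k' j (v - w) * \<zeta> v)) : borel_measurable lborel"
  and m3: "(%v. u v * (k (v - w) * partial j \<zeta> v)) : borel_measurable lborel" by measurable
 have c1: "AEL v. (%n. kn n (v - w) * G v $ j * \<zeta> v) \<leadsto> k (v - w) * G v $ j * \<zeta> v"
  using ne by eventually_elim (intro tendsto_intros l0)
 have c2: "AEL v. (%n. u v * (partial j (kn n) (v - w) * \<zeta> v)) \<leadsto> u v * (k' j (v - w) * \<zeta> v)"
  using ne by eventually_elim (intro tendsto_intros l1)
 have c3: "AEL v. (%n. u v * (kn n (v - w) * partial j \<zeta> v)) \<leadsto> u v * (k (v - w) * partial j \<zeta> v)"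
  using ne by eventually_elim (intro tendsto_intros l0)
 have d1: "AEL v. norm (kn n (v - w) * G v $ j * \<zeta> v) <= W1 v" for n
  using ne
 proof eventually_elim
  case (elim v)
  show ?case
  proof (cases "norm v <= R")
   case True
   have "\<bar>kn n (v - w)\<bar> * \<bar>G v $ j\<bar> * \<bar>\<zeta> v\<bar> <= (C * norm (v - w) powr (-1)) * \<bar>G v $ j\<bar> * B0"
    by (intro mult_mono b0 elim B0) (auto simp: C0)
   then show ?thesis using True by (simp add: W1_def abs_mult algebra_simps)
  next
   case False then show ?thesis using \<zeta>(2)[of v] by (simp add: W1_def)
  qed
 qed
 have d2: "AEL v. norm (u v * (partial j (kn n) (v - w) * \<zeta> v)) <= (C * B0) * W2 v" for n
  using ne
 proof eventually_elim
  case (elim v)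
  show ?case
  proof (cases "norm v <= R")
   case True
   have "\<bar>u v\<bar> * (\<bar>partial j (kn n) (v - w)\<bar> * \<bar>\<zeta> v\<bar>) <= \<bar>u v\<bar> * ((C * norm (v - w) powr (-2)) * B0)"
    by (intro mult_mono b1 elim B0) (auto simp: C0)
   then show ?thesis using True by (simp add: W2_def abs_mult algebra_simps)
  next
   case False then show ?thesis using \<zeta>(2)[of v] by (simp add: W2_def)
  qed
 qed
 have d3: "AEL v. norm (u v * (kn n (v - w) * partial j \<zeta> v)) <= (C * B1) * W3 v" for n
  using ne
 proof eventually_elim
  case (elim v)
  show ?case
  proof (cases "norm v <= R")
   case True
   have "\<bar>u v\<bar> * (\<bar>kn n (v - w)\<bar> * \<bar>partial j \<zeta> v\<bar>) <= \<bar>u v\<bar> * ((C * norm (v - w) powr (-1)) * B1)"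
    by (intro mult_mono b0 elim B1) (auto simp: C0)
   then show ?thesis using True by (simp add: W3_def abs_mult algebra_simps)
  next
   case False then show ?thesis using p\<zeta>[of v] by (simp add: W3_def)
  qed
 qed
 note i2 = integrable_mult_right[OF iW2, of "C * B0"] and i3 = integrable_mult_right[OF iW3, of "C * B1"]
 have n1: "(%v. kn n (v - w) * G v $ j * \<zeta> v) : borel_measurable lborel"
  and n2: "(%v. u v * (partial j (kn n) (v - w) * \<zeta> v)) : borel_measurable lborel"
  and n3: "(%v. u v * (kn n (v - w) * partial j \<zeta> v)) : borel_measurable lborel" for n by measurable
 show "integrable lborel (%v. k (v - w) * G v $ j * \<zeta> v)"
  by (rule integrable_dominated_convergence[OF m1 n1 iW1 c1 d1])
 show "integrable lborel (%v. u v * (k' j (v - w) * \<zeta> v))"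
  by (rule integrable_dominated_convergence[OF m2 n2 i2 c2 d2])
 show "integrable lborel (%v. u v * (k (v - w) * partial j \<zeta> v))"
  by (rule integrable_dominated_convergence[OF m3 n3 i3 c3 d3])
 note L1 = integral_dominated_convergence[OF m1 n1 iW1 c1 d1]
  and L2 = integral_dominated_convergence[OF m2 n2 i2 c2 d2]
  and L3 = integral_dominated_convergence[OF m3 n3 i3 c3 d3]
 have eq: "(LBINT v. kn n (v - w) * G v $ j * \<zeta> v)
  = - ((LBINT v. u v * (partial j (kn n) (v - w) * \<zeta> v)) + (LBINT v. u v * (kn n (v - w) * partial j \<zeta> v)))" for n
 proof -
  have sk: "smooth (%v. kn n (v - w))" by (rule smooth_translate[OF kn])
  have t: "smooth_test UNIV (%v. \<zeta> v * kn n (v - w))" by (rule smooth_test_mult[OF \<zeta>(1) sk])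
  have "(LBINT v. u v * partial j (%v. \<zeta> v * kn n (v - w)) v) = - (LBINT v. G v $ j * (\<zeta> v * kn n (v - w)))"
   using u t by (simp add: borel_weak_grad_def)
  moreover have "u v * partial j (%v. \<zeta> v * kn n (v - w)) v = u v * (partial j (kn n) (v - w) * \<zeta> v) + u v * (kn n (v - w) * partial j \<zeta> v)" for v
   using partial_mult[OF s\<zeta> sk, of j v] partial_translate[OF kn, of j n w v] by (simp add: algebra_simps)
  moreover have "integrable lborel (%v. u v * (partial j (kn n) (v - w) * \<zeta> v))"
   by (rule Bochner_Integration.integrable_bound[OF i2 n2]) (use d2[of n] in eventually_elim, simp)
  moreover have "integrable lborel (%v. u v * (kn n (v - w) * partial j \<zeta> v))"
   by (rule Bochner_Integration.integrable_bound[OF i3 n3]) (use d3[of n] in eventually_elim, simp)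
  ultimately show ?thesis by (simp add: algebra_simps)
 qed
 show "(LBINT v. k (v - w) * G v $ j * \<zeta> v) =
   - ((LBINT v. u v * (k' j (v - w) * \<zeta> v)) + (LBINT v. u v * (k (v - w) * partial j \<zeta> v)))"
  using LIMSEQ_unique[OF L1[unfolded eq] tendsto_minus[OF tendsto_add[OF L2 L3]]] .
qed

subsection \<open>Regularization of the Coulomb and Landau kernels\<close>

definition reg_inv :: "nat => real^3 => real" where
 "reg_inv n z = (z \<bullet> z + inverse (real (Suc n))) powr (-1/2)"

lemma smooth_reg_inv: "smooth (reg_inv n)"
proof -
 have "smooth (%z::real^3. \<Sum>b\<in>Basis. (z \<bullet> b) * (z \<bullet> b))"
  by (intro smooth_sum smooth_mult smooth_inner)
 then have "smooth (%z::real^3. z \<bullet> z)" by (simp add: euclidean_inner[symmetric])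
 then have "smooth (%z::real^3. (z \<bullet> z + inverse (real (Suc n))) powr (-1/2))"
  by (rule smooth_shifted_powr) (simp add: add_nonneg_pos)
 then show ?thesis by (simp add: reg_inv_def[abs_def])
qed

lemma reg_inv_pos: "0 < reg_inv n z"
 using add_nonneg_pos[of "z \<bullet> z" "inverse (real (Suc n))"] by (simp add: reg_inv_def)

lemma partial_reg_inv: "partial i (reg_inv n) z = - (z $ i) * reg_inv n z ^ 3"
proof -
 let ?e = "inverse (real (Suc n))"
 have pos: "0 < z \<bullet> z + ?e" by (rule add_nonneg_pos) auto
 have d1: "((%z. z \<bullet> z + ?e) has_derivative (%h. 2 * (z \<bullet> h))) (at z)"
  by (auto intro!: derivative_eq_intros simp: inner_commute)
 have d2: "((%s. s powr (-1/2)) has_derivative (*) (-1/2 * (z \<bullet> z + ?e) powr (-1/2 - 1))) (at (z \<bullet> z + ?e))"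
  using has_real_derivative_powr[OF pos, of "-1/2"] by (simp add: has_field_derivative_def)
 have "partial i (reg_inv n) z = -1/2 * (z \<bullet> z + ?e) powr (-1/2 - 1) * (2 * (z \<bullet> axis i 1))"
  unfolding reg_inv_def[abs_def] by (rule partial_eqI[OF has_derivative_compose[OF d1 d2]])
 moreover have "reg_inv n z ^ 3 = (z \<bullet> z + ?e) powr (-1/2 - 1)"
  using pos unfolding reg_inv_def by (subst powr_power) auto
 ultimately show ?thesis by (simp add: inner_axis)
qed

lemma norm_reg_inv_le_1: "norm z * reg_inv n z <= 1"
proof -
 let ?e = "inverse (real (Suc n))"
 have pos: "0 < z \<bullet> z + ?e" by (rule add_nonneg_pos) auto
 have "reg_inv n z = 1 / sqrt (z \<bullet> z + ?e)"
  using pos by (simp add: reg_inv_def powr_minus_divide powr_half_sqrt)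
 moreover have "norm z <= sqrt (z \<bullet> z + ?e)" by (rule real_le_rsqrt) (simp add: dot_square_norm)
 ultimately show ?thesis using pos by simp
qed

lemma reg_inv_tendsto: assumes "z \<noteq> 0" shows "(%n. reg_inv n z) \<leadsto> 1 / norm z"
proof -
 have "(%n. (z \<bullet> z + inverse (real (Suc n))) powr (-1/2)) \<leadsto> (z \<bullet> z + 0) powr (-1/2)"
  using assms by (intro tendsto_intros LIMSEQ_inverse_real_of_nat) auto
 moreover have "(z \<bullet> z + 0) powr (-1/2) = 1 / norm z"
  by (simp add: powr_minus_divide powr_half_sqrt norm_eq_sqrt_inner)
 ultimately show ?thesis by (simp add: reg_inv_def)
qed

lemma nth_reg_inv_le_1: "\<bar>z $ i\<bar> * reg_inv n z <= 1"
 by (rule order_trans[OF mult_right_mono[OF component_le_norm_cart less_imp_le[OF reg_inv_pos]] norm_reg_inv_le_1])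

lemma reg_inv_le: "z \<noteq> 0 ==> reg_inv n z <= norm z powr (-1)"
 using norm_reg_inv_le_1[of z n] by (simp add: norm_powr_minus_1 field_simps)

lemma reg_inv_square_le: assumes "z \<noteq> 0" shows "(reg_inv n z)\<^sup>2 <= norm z powr (-2)"
proof -
 have "(reg_inv n z)\<^sup>2 <= (norm z powr (-1))\<^sup>2"
  using reg_inv_le[OF assms] reg_inv_pos[of n z] by (intro power_mono) (auto simp: less_imp_le)
 then show ?thesis by (simp add: norm_powr_minus_1 norm_powr_minus_2 power_divide)
qed

lemma partial_nth: "partial k (%z. z $ i) z = (if i = k then 1 else 0)"
 using partial_eqI[OF bounded_linear_imp_has_derivative[OF bounded_linear_vec_nth[of i]]] by (simp add: axis_def)

lemma regularizable_Newton: "regularizable (%z. 1 / norm z) (%i z. - (z $ i) / norm z ^ 3)"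
 unfolding regularizable_def
proof (intro exI[of _ reg_inv] exI[of _ 1] conjI allI impI)
 fix n i and z :: "real^3" assume z: "z \<noteq> 0"
 show "\<bar>reg_inv n z\<bar> <= 1 * norm z powr (-1)" using reg_inv_le[OF z] reg_inv_pos[of n z] by simp
 have "\<bar>partial i (reg_inv n) z\<bar> = (\<bar>z $ i\<bar> * reg_inv n z) * (reg_inv n z)\<^sup>2"
  using reg_inv_pos[of n z] by (simp add: partial_reg_inv abs_mult power2_eq_square power3_eq_cube)
 also have "... <= 1 * (reg_inv n z)\<^sup>2" by (intro mult_right_mono nth_reg_inv_le_1) simp
 also have "... <= 1 * norm z powr (-2)" using reg_inv_square_le[OF z] by simp
 finally show "\<bar>partial i (reg_inv n) z\<bar> <= 1 * norm z powr (-2)" .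
 show "(%n. reg_inv n z) \<leadsto> 1 / norm z" by (rule reg_inv_tendsto[OF z])
 have "(%n. - (z $ i) * reg_inv n z ^ 3) \<leadsto> - (z $ i) * (1 / norm z) ^ 3"
  by (intro tendsto_intros reg_inv_tendsto z)
 then show "(%n. partial i (reg_inv n) z) \<leadsto> - (z $ i) / norm z ^ 3"
  by (simp add: partial_reg_inv power_divide)
qed (rule smooth_reg_inv)

definition delta :: "3 => 3 => real" where "delta i j = (if i = j then 1 else 0)"

lemma landau_N_nth: "landau_N z $ i $ j = 1 / (8 * pi) * (delta i j * (1 / norm z) - z $ i * (z $ j * ((1 / norm z) * ((1 / norm z) * (1 / norm z)))))"
 by (simp add: landau_N_def delta_def mat_def power2_eq_square field_simps)

definition grad_landau_N :: "3 => 3 => 3 => real^3 => real" where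
 "grad_landau_N i j k z = 1 / (8 * pi) * (3 * (z $ i * z $ j * z $ k) / norm z ^ 5
  - (delta i j * z $ k + delta j k * z $ i + delta i k * z $ j) / norm z ^ 3)"

lemma regularizable_landau_N: "regularizable (%z. landau_N z $ i $ j) (grad_landau_N i j)"
proof -
 define N where "N n z = 1 / (8 * pi) * (delta i j * reg_inv n z - z $ i * (z $ j * (reg_inv n z * (reg_inv n z * reg_inv n z))))" for n z
 let ?q = reg_inv
 have s3: "smooth (%z. ?q n z * (?q n z * ?q n z))" for n by (intro smooth_mult smooth_reg_inv)
 have sN: "smooth (N n)" for n
  unfolding N_def[abs_def] by (intro smooth_mult smooth_diff smooth_const smooth_nth smooth_reg_inv)
 have p3: "partial k (%z. ?q n z * (?q n z * ?q n z)) z = - 3 * z $ k * ?q n z ^ 5" for k n z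
  by (simp add: partial_mult smooth_mult smooth_reg_inv partial_reg_inv algebra_simps power3_eq_cube eval_nat_numeral)
 have pN: "partial k (N n) z = 1 / (8 * pi) * (3 * (z $ i * z $ j * z $ k) * ?q n z ^ 5
  - (delta i j * z $ k + delta j k * z $ i + delta i k * z $ j) * ?q n z ^ 3)" for k n z
 proof -
  have sj: "smooth (%z. z $ j * (?q n z * (?q n z * ?q n z)))" by (intro smooth_mult smooth_nth smooth_reg_inv)
  have pj: "partial k (%z. z $ j * (?q n z * (?q n z * ?q n z))) z = z $ j * (- 3 * z $ k * ?q n z ^ 5) + delta j k * ?q n z ^ 3"
   by (subst partial_mult[OF smooth_nth s3]) (simp add: p3 partial_nth delta_def power3_eq_cube mult.assoc)
  have pij: "partial k (%z. z $ i * (z $ j * (?q n z * (?q n z * ?q n z)))) z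
    = z $ i * (z $ j * (- 3 * z $ k * ?q n z ^ 5) + delta j k * ?q n z ^ 3) + delta i k * (z $ j * ?q n z ^ 3)"
   by (subst partial_mult[OF smooth_nth sj]) (simp add: pj partial_nth delta_def power3_eq_cube mult.assoc)
  have sij: "smooth (%z. z $ i * (z $ j * (?q n z * (?q n z * ?q n z))))" by (intro smooth_mult smooth_nth smooth_reg_inv)
  have pq: "partial k (%z. delta i j * ?q n z) z = delta i j * (- z $ k * ?q n z ^ 3)"
   by (subst partial_mult[OF smooth_const smooth_reg_inv]) (simp add: partial_const partial_reg_inv)
  have pm: "partial k (%z. - (z $ i * (z $ j * (?q n z * (?q n z * ?q n z))))) z = - partial k (%z. z $ i * (z $ j * (?q n z * (?q n z * ?q n z)))) z"
   using partial_mult[OF smooth_const[of "-1"] sij, of k z] by (simp add: partial_const)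
  have sd: "smooth (%z. delta i j * ?q n z + - (z $ i * (z $ j * (?q n z * (?q n z * ?q n z)))))"
   by (intro smooth_add smooth_minus sij smooth_mult smooth_const smooth_reg_inv)
  have "partial k (N n) z = 1 / (8 * pi) * partial k (%z. delta i j * ?q n z + - (z $ i * (z $ j * (?q n z * (?q n z * ?q n z))))) z"
   using partial_mult[OF smooth_const[of "1 / (8 * pi)"] sd, of k z] by (simp add: N_def[abs_def] partial_const)
  also have "partial k (%z. delta i j * ?q n z + - (z $ i * (z $ j * (?q n z * (?q n z * ?q n z))))) z
   = delta i j * (- z $ k * ?q n z ^ 3) - (z $ i * (z $ j * (- 3 * z $ k * ?q n z ^ 5) + delta j k * ?q n z ^ 3) + delta i k * (z $ j * ?q n z ^ 3))"
   using partial_add[OF smooth_mult[OF smooth_const[of "delta i j"] smooth_reg_inv[of n]] smooth_minus[OF sij], of k z] pm pij pq by simp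
  finally show ?thesis by (simp add: algebra_simps)
 qed
 have pi1: "1 / (8 * pi) * 8 <= 1" using pi_gt3 by (simp add: field_simps)
 have d1: "\<bar>delta a b\<bar> <= 1" for a b by (simp add: delta_def)
 show ?thesis unfolding regularizable_def
 proof (intro exI[of _ N] exI[of _ 1] conjI allI impI)
  fix n and z :: "real^3" and k assume z: "z \<noteq> 0"
  define q where "q = ?q n z"
  have q0: "0 <= q" using reg_inv_pos[of n z] by (simp add: q_def less_imp_le)
  define t where "t a = \<bar>z $ a\<bar> * q" for a
  have t: "0 <= t a" "t a <= 1" for a using nth_reg_inv_le_1[of z a n] q0 by (auto simp: t_def q_def)
  have tt: "t a * t b <= 1" for a b using t by (meson mult_le_one)
  have ttt: "t a * t b * t c <= 1" for a b c using t tt by (meson mult_le_one mult_nonneg_nonneg)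
  have b: "\<bar>delta i j * q - z $ i * (z $ j * (q * (q * q)))\<bar> <= 2 * q"
  proof -
   have "\<bar>z $ i * (z $ j * (q * (q * q)))\<bar> = (t i * t j) * q" using q0 by (simp add: t_def abs_mult)
   also have "... <= 1 * q" by (intro mult_right_mono tt q0)
   finally have 1: "\<bar>z $ i * (z $ j * (q * (q * q)))\<bar> <= q" by simp
   have "\<bar>delta i j * q\<bar> <= 1 * q" unfolding abs_mult using q0 d1 by (intro mult_mono) auto
   with 1 show ?thesis by linarith
  qed
  have "\<bar>N n z\<bar> = 1 / (8 * pi) * \<bar>delta i j * q - z $ i * (z $ j * (q * (q * q)))\<bar>"
   by (simp add: N_def q_def abs_mult)
  also have "... <= 1 / (8 * pi) * (8 * q)" using b q0 by (intro mult_left_mono) auto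
  also have "... <= 1 * q" using mult_right_mono[OF pi1 q0] by simp
  also have "... <= 1 * norm z powr (-1)" using reg_inv_le[OF z, of n] by (simp add: q_def)
  finally show "\<bar>N n z\<bar> <= 1 * norm z powr (-1)" .
  have b3: "\<bar>delta a b * z $ c * q ^ 3\<bar> <= q\<^sup>2" for a b c
  proof -
   have "\<bar>delta a b * z $ c * q ^ 3\<bar> = \<bar>delta a b\<bar> * t c * q\<^sup>2"
    using q0 by (simp add: t_def abs_mult power2_eq_square power3_eq_cube)
   also have "... <= 1 * 1 * q\<^sup>2" using t d1 by (intro mult_mono) auto
   finally show ?thesis by simp
  qed
  have b5: "\<bar>3 * (z $ i * z $ j * z $ k) * q ^ 5\<bar> <= 3 * q\<^sup>2"
  proof -
   have "\<bar>3 * (z $ i * z $ j * z $ k) * q ^ 5\<bar> = 3 * (t i * t j * t k) * q\<^sup>2"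
    using q0 by (simp add: t_def abs_mult power2_eq_square eval_nat_numeral)
   also have "... <= 3 * 1 * q\<^sup>2" by (intro mult_right_mono mult_left_mono ttt) auto
   finally show ?thesis by simp
  qed
  have "partial k (N n) z = 1 / (8 * pi) * (3 * (z $ i * z $ j * z $ k) * q ^ 5
   - (delta i j * z $ k * q ^ 3 + delta j k * z $ i * q ^ 3 + delta i k * z $ j * q ^ 3))"
   unfolding pN q_def by (simp only: distrib_right)
  then have "\<bar>partial k (N n) z\<bar> = 1 / (8 * pi) * \<bar>3 * (z $ i * z $ j * z $ k) * q ^ 5
   - (delta i j * z $ k * q ^ 3 + delta j k * z $ i * q ^ 3 + delta i k * z $ j * q ^ 3)\<bar>"
   by (simp only: abs_mult) simp
  also have "... <= 1 / (8 * pi) * (8 * q\<^sup>2)"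
   using b5 b3[of i j k] b3[of j k i] b3[of i k j] zero_le_power2[of q] by (intro mult_left_mono) (auto simp: abs_le_iff)
  also have "... <= 1 * q\<^sup>2" using mult_right_mono[OF pi1 zero_le_power2[of q]] by simp
  also have "... <= 1 * norm z powr (-2)" using reg_inv_square_le[OF z, of n] by (simp add: q_def)
  finally show "\<bar>partial k (N n) z\<bar> <= 1 * norm z powr (-2)" .
  show "(%n. N n z) \<leadsto> landau_N z $ i $ j"
   unfolding N_def landau_N_nth by (intro tendsto_intros reg_inv_tendsto z)
  have "(%n. partial k (N n) z) \<leadsto> 1 / (8 * pi) * (3 * (z $ i * z $ j * z $ k) * (1 / norm z) ^ 5
   - (delta i j * z $ k + delta j k * z $ i + delta i k * z $ j) * (1 / norm z) ^ 3)"
   unfolding pN by (intro tendsto_intros reg_inv_tendsto z)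
  then show "(%n. partial k (N n) z) \<leadsto> grad_landau_N i j k z"
   by (simp add: grad_landau_N_def power_divide)
 qed (rule sN)
qed

definition coulomb_field :: "real^3 => real^3" where
 "coulomb_field z = - (1 / (4 * pi)) *\<^sub>R ((1 / norm z ^ 3) *\<^sub>R z)"

lemma coulomb_field_nth: "coulomb_field z $ i = 1 / (4 * pi) * (- (z $ i) / norm z ^ 3)"
 by (simp add: coulomb_field_def)

lemma sum_squares_norm: "(\<Sum>j\<in>UNIV. z $ j * z $ j) = (norm (z::real^3))\<^sup>2"
 by (simp add: dot_square_norm[symmetric] inner_vec_def)

lemma divergence_landau_N: "(\<Sum>j\<in>UNIV. grad_landau_N i j j z) = coulomb_field z $ i"
proof (cases "z = 0")
 case False
 have d: "(\<Sum>j\<in>UNIV. delta i j * z $ j) = z $ i" "(\<Sum>j\<in>(UNIV::3 set). delta j j * z $ i) = 3 * z $ i"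
  by (simp_all add: delta_def if_distrib if_distribR sum.delta cong: if_cong)
 define a where "a = 1 / (8 * pi) * (3 * z $ i / norm z ^ 5)"
 define b where "b = 1 / (8 * pi) / norm z ^ 3"
 have "grad_landau_N i j j z = a * (z $ j * z $ j) - (2 * b * (delta i j * z $ j) + b * (delta j j * z $ i))" for j
  by (simp add: grad_landau_N_def a_def b_def add_divide_distrib algebra_simps)
 then have "(\<Sum>j\<in>UNIV. grad_landau_N i j j z) = a * (\<Sum>j\<in>UNIV. z $ j * z $ j)
   - (2 * b * (\<Sum>j\<in>UNIV. delta i j * z $ j) + b * (\<Sum>j\<in>(UNIV::3 set). delta j j * z $ i))"
  by (simp only: sum_subtractf sum.distrib sum_distrib_left)
 also have "... = 1 / (8 * pi) * (3 * z $ i / norm z ^ 3 - 5 * z $ i / norm z ^ 3)"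
  unfolding d sum_squares_norm a_def b_def using False by (simp add: field_simps eval_nat_numeral)
 also have "... = coulomb_field z $ i" by (simp add: coulomb_field_nth field_simps)
 finally show ?thesis .
qed (simp add: grad_landau_N_def coulomb_field_nth)

subsection \<open>Elementary properties of the kernels\<close>

lemma borel_measurable_cartesian:
 fixes f :: "'a => ('b::euclidean_space)^'n"
 assumes "!!i. (%x. f x $ i) : borel_measurable M" shows "f : borel_measurable M"
 unfolding borel_measurable_euclidean_space[of f]
 using assms by (auto simp: Basis_vec_def inner_axis intro!: borel_measurable_inner)

lemma borel_measurable_nth'[measurable (raw)]:
 fixes f :: "'a => real^3^3"
 assumes "f : borel_measurable M" shows "(%x. f x $ i) : borel_measurable M"
proof -
 have "continuous_on UNIV (%A::real^3^3. A $ i)" by (intro continuous_intros)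
 then have "(%A::real^3^3. A $ i) : Borel" by (rule borel_measurable_continuous_onI)
 from measurable_compose[OF assms this] show ?thesis .
qed

lemma landau_N_borel[measurable]: "landau_N : Borel"
 by (rule borel_measurable_cartesian, rule borel_measurable_cartesian) (unfold landau_N_nth, measurable)

lemma coulomb_field_borel[measurable]: "coulomb_field : Borel"
 unfolding coulomb_field_def[abs_def] by measurable

lemma grad_landau_N_borel[measurable]: "grad_landau_N i j k : Borel"
 unfolding grad_landau_N_def[abs_def] by measurable

lemma borel_measurable_matrix_vector_mult[measurable (raw)]:
 fixes A :: "'a => real^3^3"
 assumes [measurable]: "A : borel_measurable M" "b : borel_measurable M"
 shows "(%x. A x *v b x) : borel_measurable M"
 by (rule borel_measurable_cartesian) (simp add: matrix_vector_mult_def)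

lemma landau_N_minus: "landau_N (- z) = landau_N z"
 by (simp add: vec_eq_iff landau_N_nth)

lemma coulomb_field_minus: "coulomb_field (- z) = - coulomb_field z"
 by (simp add: coulomb_field_def)

lemma landau_N_commute: "landau_N z $ i $ j = landau_N z $ j $ i"
 by (simp add: landau_N_nth delta_def)

lemma landau_N_vec: "landau_N z *v x = (1 / (8 * pi * norm z)) *\<^sub>R (x - ((z \<bullet> x) / (norm z)\<^sup>2) *\<^sub>R z)"
proof -
 have "(landau_N z *v x) $ i = ((1 / (8 * pi * norm z)) *\<^sub>R (x - ((z \<bullet> x) / (norm z)\<^sup>2) *\<^sub>R z)) $ i" for i
 proof -
  have 1: "(\<Sum>j\<in>UNIV. delta i j * x $ j) = x $ i"
   by (simp add: delta_def if_distrib if_distribR sum.delta cong: if_cong)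
  have 2: "(\<Sum>j\<in>UNIV. z $ j * x $ j) = z \<bullet> x" by (simp add: inner_vec_def)
  have "(landau_N z *v x) $ i = (\<Sum>j\<in>UNIV. (1 / (8 * pi * norm z)) * (delta i j * x $ j) - (1 / (8 * pi * norm z)) * (z $ i / (norm z)\<^sup>2) * (z $ j * x $ j))"
   unfolding matrix_vector_mult_def by (auto intro!: sum.cong simp: landau_N_def mat_def delta_def algebra_simps diff_divide_distrib)
  also have "... = (1 / (8 * pi * norm z)) * (\<Sum>j\<in>UNIV. delta i j * x $ j) - (1 / (8 * pi * norm z)) * (z $ i / (norm z)\<^sup>2) * (\<Sum>j\<in>UNIV. z $ j * x $ j)"
   by (simp only: sum_subtractf sum_distrib_left)
  finally show ?thesis unfolding 1 2 by (simp add: algebra_simps diff_divide_distrib)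
 qed
 then show ?thesis by (simp add: vec_eq_iff)
qed

definition orth_proj :: "real^3 => real^3 => real^3" where
 "orth_proj z x = x - ((z \<bullet> x) / (norm z)\<^sup>2) *\<^sub>R z"

lemma orth_proj_inner: "orth_proj z x \<bullet> x = (norm (orth_proj z x))\<^sup>2"
proof (cases "z = 0")
 case False
 then have "z \<bullet> z \<noteq> 0" by simp
 then have "orth_proj z x \<bullet> z = 0"
  by (simp add: orth_proj_def inner_diff_left inner_commute[of x z] dot_square_norm[symmetric])
 then have "orth_proj z x \<bullet> orth_proj z x = orth_proj z x \<bullet> x"
  by (metis (no_types, lifting) diff_zero inner_diff_right inner_scaleR_right mult_zero_right orth_proj_def)
 then show ?thesis by (simp add: dot_square_norm)
qed (simp add: orth_proj_def dot_square_norm)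

lemma norm_orth_proj_le: "norm (orth_proj z x) <= norm x"
proof -
 have "(norm (orth_proj z x))\<^sup>2 <= norm (orth_proj z x) * norm x"
  using norm_cauchy_schwarz[of "orth_proj z x" x] by (simp add: orth_proj_inner)
 then show ?thesis by (cases "orth_proj z x = 0") (auto simp: power2_eq_square)
qed

text \<open>The kernel is a multiple of a projection, so that $|N\xi|$ is controlled by its quadratic form
 and the scalar factor alone.\<close>

lemma norm_landau_N_vec_le_form:
 "norm (landau_N z *v x) <= 1 / norm z + (landau_N z *v x) \<bullet> x"
proof -
 define c where "c = 1 / (8 * pi * norm z)"
 define y where "y = norm (orth_proj z x)"
 have c: "0 <= c" by (simp add: c_def)
 have cn: "c <= 1 / norm z"
 proof -
  have "c = (1 / (8 * pi)) * (1 / norm z)" by (simp add: c_def)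
  also have "... <= 1 * (1 / norm z)" using pi_gt3 by (intro mult_right_mono) (auto simp: field_simps)
  finally show ?thesis by simp
 qed
 have "norm (landau_N z *v x) = c * y" "(landau_N z *v x) \<bullet> x = c * y\<^sup>2"
  using c by (simp_all add: landau_N_vec orth_proj_def[symmetric] c_def[symmetric] y_def orth_proj_inner)
 moreover have "c * y <= c * (1 + y\<^sup>2)"
 proof (intro mult_left_mono c)
  have "0 <= (y - 1)\<^sup>2" by simp
  then have "2 * y <= 1 + y\<^sup>2" by (simp add: power2_diff)
  moreover have "0 <= y" by (simp add: y_def)
  ultimately show "y <= 1 + y\<^sup>2" by linarith
 qed
 ultimately show ?thesis using cn by (simp add: algebra_simps)
qed

lemma landau_N_form_nonneg: "0 <= (landau_N z *v x) \<bullet> x"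
 by (simp add: landau_N_vec orth_proj_def[symmetric] orth_proj_inner)

lemma norm_landau_N_vec_le: "norm (landau_N z *v x) <= norm z powr (-1) * norm x"
proof -
 have "norm (landau_N z *v x) = (1 / (8 * pi)) * (norm z powr (-1) * norm (orth_proj z x))"
  by (simp add: landau_N_vec orth_proj_def[symmetric] norm_powr_minus_1)
 also have "... <= 1 * (norm z powr (-1) * norm x)"
  using pi_gt3 norm_orth_proj_le[of z x] by (intro mult_mono) (auto simp: field_simps intro!: mult_left_mono divide_right_mono)
 finally show ?thesis by simp
qed

lemma norm_coulomb_field_le: "norm (coulomb_field z) <= norm z powr (-2)"
proof (cases "z = 0")
 case False
 then have "norm (coulomb_field z) = (1 / (4 * pi)) * norm z powr (-2)"
  by (simp add: coulomb_field_def norm_powr_minus_2 power2_eq_square power3_eq_cube)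
 also have "... <= 1 * norm z powr (-2)" using pi_gt3 by (intro mult_right_mono) (auto simp: field_simps)
 finally show ?thesis by simp
qed (simp add: coulomb_field_def)

lemma abs_landau_N_nth_le: "\<bar>landau_N z $ i $ j\<bar> <= norm z powr (-1)"
proof -
 have "landau_N z *v axis j 1 = (\<chi> i. landau_N z $ i $ j)"
  by (simp add: matrix_vector_mult_basis column_def)
 then have "landau_N z $ i $ j = (landau_N z *v axis j 1) $ i" by simp
 also have "\<bar>...\<bar> <= norm (landau_N z *v axis j 1)" by (rule component_le_norm_cart)
 also have "... <= norm z powr (-1) * norm (axis j (1::real))" by (rule norm_landau_N_vec_le)
 finally show ?thesis by simp
qed

lemma norm_matrix_le: "norm (A::real^3^3) <= (\<Sum>i\<in>UNIV. \<Sum>j\<in>UNIV. \<bar>A $ i $ j\<bar>)"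
proof -
 have "norm A <= (\<Sum>i\<in>UNIV. norm (A $ i))" unfolding norm_vec_def by (rule L2_set_le_sum) simp
 also have "... <= (\<Sum>i\<in>UNIV. \<Sum>j\<in>UNIV. \<bar>A $ i $ j\<bar>)" by (intro sum_mono norm_le_l1_cart)
 finally show ?thesis .
qed

lemma norm_landau_N_le: "norm (landau_N z) <= 9 * norm z powr (-1)"
proof -
 have "norm (landau_N z) <= (\<Sum>i\<in>(UNIV::3 set). \<Sum>j\<in>(UNIV::3 set). norm z powr (-1))"
  by (rule order_trans[OF norm_matrix_le]) (intro sum_mono abs_landau_N_nth_le)
 then show ?thesis by simp
qed

text \<open>Integration by parts moves the gradient from the density to the Landau kernel, whose
 divergence is the Coulomb field.\<close>

lemma landau_kernel_integral_by_parts: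
 assumes u: "borel_weak_grad u G" and \<zeta>: "smooth_test UNIV \<zeta>" "!!v. R < norm v ==> \<zeta> v = 0"
  and fu: "(NBALL R (%v. ennreal (\<bar>u v\<bar> * norm (v - w) powr (-2)))) < \<infinity>"
  and fG: "!!j. (NBALL R (%v. ennreal (\<bar>G v $ j\<bar> * norm (v - w) powr (-1)))) < \<infinity>"
 shows "integrable lborel (%v. (landau_N (v - w) *v G v) $ i * \<zeta> v)"
  and "integrable lborel (%v. u v * (coulomb_field (v - w) $ i * \<zeta> v))"
  and "integrable lborel (%v. u v * (\<Sum>j\<in>UNIV. landau_N (v - w) $ i $ j * partial j \<zeta> v))"
  and "(LBINT v. (landau_N (v - w) *v G v) $ i * \<zeta> v) =
   - ((LBINT v. u v * (coulomb_field (v - w) $ i * \<zeta> v)) + (LBINT v. u v * (\<Sum>j\<in>UNIV. landau_N (v - w) $ i $ j * partial j \<zeta> v)))"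
proof -
 note p = regularizable_integral_by_parts[OF regularizable_landau_N _ _ u \<zeta> fu fG]
 have i1: "integrable lborel (%v. landau_N (v - w) $ i $ j * G v $ j * \<zeta> v)" for j by (rule p(1)) measurable
 have i2: "integrable lborel (%v. u v * (grad_landau_N i j j (v - w) * \<zeta> v))" for j by (rule p(2)) measurable
 have i3: "integrable lborel (%v. u v * (landau_N (v - w) $ i $ j * partial j \<zeta> v))" for j by (rule p(3)) measurable
 have i4: "(LBINT v. landau_N (v - w) $ i $ j * G v $ j * \<zeta> v) =
   - ((LBINT v. u v * (grad_landau_N i j j (v - w) * \<zeta> v)) + (LBINT v. u v * (landau_N (v - w) $ i $ j * partial j \<zeta> v)))" for j
  by (rule p(4)) measurable
 have e1: "(landau_N (v - w) *v G v) $ i * \<zeta> v = (\<Sum>j\<in>UNIV. landau_N (v - w) $ i $ j * G v $ j * \<zeta> v)" for v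
  by (simp add: matrix_vector_mult_def sum_distrib_right)
 have e2: "u v * (coulomb_field (v - w) $ i * \<zeta> v) = (\<Sum>j\<in>UNIV. u v * (grad_landau_N i j j (v - w) * \<zeta> v))" for v
  by (simp add: divergence_landau_N[symmetric] sum_distrib_right sum_distrib_left)
 have e3: "u v * (\<Sum>j\<in>UNIV. landau_N (v - w) $ i $ j * partial j \<zeta> v) = (\<Sum>j\<in>UNIV. u v * (landau_N (v - w) $ i $ j * partial j \<zeta> v))" for v
  by (simp add: sum_distrib_left)
 show "integrable lborel (%v. (landau_N (v - w) *v G v) $ i * \<zeta> v)" unfolding e1 by (intro Bochner_Integration.integrable_sum i1)
 show "integrable lborel (%v. u v * (coulomb_field (v - w) $ i * \<zeta> v))" unfolding e2 by (intro Bochner_Integration.integrable_sum i2)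
 show "integrable lborel (%v. u v * (\<Sum>j\<in>UNIV. landau_N (v - w) $ i $ j * partial j \<zeta> v))" unfolding e3 by (intro Bochner_Integration.integrable_sum i3)
 show "(LBINT v. (landau_N (v - w) *v G v) $ i * \<zeta> v) =
   - ((LBINT v. u v * (coulomb_field (v - w) $ i * \<zeta> v)) + (LBINT v. u v * (\<Sum>j\<in>UNIV. landau_N (v - w) $ i $ j * partial j \<zeta> v)))"
  unfolding e1 e2 e3 by (simp add: Bochner_Integration.integral_sum i1 i2 i3 i4 sum_negf sum.distrib sum_subtractf)
qed

section \<open>The collision operator at a fixed time\<close>

lemma integrable_pairI:
 fixes f :: "'a::euclidean_space => 'b::euclidean_space => 'c::{banach, second_countable_topology}"
 assumes [measurable]: "(%p. f (fst p) (snd p)) : borel_measurable (lborel \<Otimes>\<^sub>M lborel)"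
  and fin: "(NBINT x. (NBINT y. ennreal (norm (f x y)))) < \<infinity>"
 shows "integrable (lborel \<Otimes>\<^sub>M lborel) (case_prod f)"
proof (rule integrableI_bounded)
 have e: "case_prod f = (%p. f (fst p) (snd p))" by (auto simp: case_prod_unfold)
 show "case_prod f : borel_measurable (lborel \<Otimes>\<^sub>M lborel)" unfolding e by measurable
 have "(\<integral>\<^sup>+p. ennreal (norm (f (fst p) (snd p))) \<partial>(lborel \<Otimes>\<^sub>M lborel)) = (NBINT x. (NBINT y. ennreal (norm (f x y))))"
  using lborel.nn_integral_fst[of "%p. ennreal (norm (f (fst p) (snd p)))" lborel] by simp
 then show "(\<integral>\<^sup>+p. ennreal (norm (case_prod f p)) \<partial>(lborel \<Otimes>\<^sub>M lborel)) < \<infinity>" unfolding e using fin by simp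
qed

lemma integral_pair_swap:
 fixes f :: "'a::euclidean_space => 'a => 'c::{banach, second_countable_topology}"
 assumes [measurable]: "(%p. f (fst p) (snd p)) : borel_measurable (lborel \<Otimes>\<^sub>M lborel)"
 shows "integral\<^sup>L (lborel \<Otimes>\<^sub>M lborel) (%(x, y). f y x) = integral\<^sup>L (lborel \<Otimes>\<^sub>M lborel) (%(x, y). f x y)"
proof -
 have e: "case_prod f = (%p. f (fst p) (snd p))" by (auto simp: case_prod_unfold)
 have "case_prod f : borel_measurable (lborel \<Otimes>\<^sub>M lborel)" unfolding e by measurable
 from lborel_pair.integral_product_swap[OF this] show ?thesis by simp
qed

lemma borel_weak_grad_one: "borel_weak_grad (%_. 1) (%_. 0)"
 unfolding borel_weak_grad_def
 by (auto simp: integral_partial_zero intro!: bounded_imp_loc_int[of _ 1])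

lemma Newton_kernel_integral_by_parts:
 assumes \<psi>: "smooth_test UNIV \<psi>"
 shows "integrable lborel (%v. (- ((v - w) $ i) / norm (v - w) ^ 3) * \<psi> v)"
  "(LBINT v. 1 / norm (v - w) * partial i \<psi> v) = - (LBINT v. (- ((v - w) $ i) / norm (v - w) ^ 3) * \<psi> v)"
proof -
 obtain R where R: "0 < R" "smooth \<psi>" "!!v. R <= norm v ==> \<psi> v = 0" using smooth_testE[OF \<psi>] by blast
 obtain C where C: "0 <= C" "!!y::real^3. (NBALL R (%v. ennreal (norm (v - y) powr (-2)))) <= ennreal C"
  using kernel_ball_bound[of 2 R] by auto
 have f: "(NBALL R (%v. ennreal (\<bar>1\<bar> * norm (v - w) powr (-2)))) < \<infinity>"
  using le_less_trans[OF C(2) ennreal_less_top] by simp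
 have g: "(NBALL R (%v. ennreal (\<bar>(0::real^3) $ i\<bar> * norm (v - w) powr (-1)))) < \<infinity>" by simp
 have z: "R < norm v ==> \<psi> v = 0" for v using R(3) by simp
 note p = regularizable_integral_by_parts[OF regularizable_Newton _ _ borel_weak_grad_one \<psi> z f g]
 show "integrable lborel (%v. (- ((v - w) $ i) / norm (v - w) ^ 3) * \<psi> v)"
  using p(2) by simp
 show "(LBINT v. 1 / norm (v - w) * partial i \<psi> v) = - (LBINT v. (- ((v - w) $ i) / norm (v - w) ^ 3) * \<psi> v)"
  using p(4) by simp
qed

definition borel_A :: "(real^3 => real) => real^3 => real^3^3" where
 "borel_A u v = (LBINT w. u w *\<^sub>R landau_N (v - w))"

definition borel_B :: "(real^3 => real) => real^3 => real^3" where
 "borel_B u v = (LBINT w. u w *\<^sub>R coulomb_field (v - w))"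

lemma borel_A_borel[measurable]:
 assumes [measurable]: "u : Borel" shows "borel_A u : Borel"
 unfolding borel_A_def[abs_def] by measurable

lemma borel_B_borel[measurable]:
 assumes [measurable]: "u : Borel" shows "borel_B u : Borel"
 unfolding borel_B_def[abs_def] by measurable

lemma landau_A_eq_borel_A:
 assumes [measurable]: "u : Borel" shows "landau_A u v = borel_A u v"
proof -
 have "landau_A u v = (LBINT y. u (v - y) *\<^sub>R landau_N y)"
  unfolding landau_A_def by (rule integral_completion) measurable
 also have "... = borel_A u v"
  using integral_lborel_reflect[of "%w. u w *\<^sub>R landau_N (v - w)" v] by (simp add: borel_A_def)
 finally show ?thesis .
qed

lemma landau_a_eq:
 assumes [measurable]: "u : Borel"
 shows "landau_a u v = 1 / (4 * pi) * (LBINT w. u w / norm (v - w))"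
 unfolding landau_a_def by (subst integral_completion) measurable

lemma integrable_kernel:
 fixes k :: "real^3 => 'b::{banach, second_countable_topology}"
 assumes [measurable]: "f : Borel" "k : Borel"
  and kb: "!!z. norm (k z) <= c * norm z powr (-s)"
  and fin: "(NBINT w. ennreal (\<bar>f w\<bar> * norm (v - w) powr (-s))) < \<infinity>"
 shows "integrable lborel (%w. f w *\<^sub>R k (v - w))"
proof (rule integrableI_bounded)
 have "(NBINT w. ennreal (norm (f w *\<^sub>R k (v - w)))) <= (NBINT w. ennreal \<bar>c\<bar> * ennreal (\<bar>f w\<bar> * norm (v - w) powr (-s)))"
 proof (intro nn_integral_mono)
  fix w
  have "norm (k (v - w)) <= \<bar>c\<bar> * norm (v - w) powr (-s)"
   by (rule order_trans[OF kb]) (intro mult_right_mono, auto)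
  from mult_left_mono[OF this, of "\<bar>f w\<bar>"]
  show "ennreal (norm (f w *\<^sub>R k (v - w))) <= ennreal \<bar>c\<bar> * ennreal (\<bar>f w\<bar> * norm (v - w) powr (-s))"
   by (simp add: ennreal_mult[symmetric] ennreal_leI mult.left_commute)
 qed
 also have "... = ennreal \<bar>c\<bar> * (NBINT w. ennreal (\<bar>f w\<bar> * norm (v - w) powr (-s)))" by (rule nn_integral_cmult) measurable
 also have "... < \<infinity>" using fin by (simp add: ennreal_mult_less_top)
 finally show "(NBINT w. ennreal (norm (f w *\<^sub>R k (v - w)))) < \<infinity>" .
qed measurable

lemma AE_potential_finite:
 fixes f :: "real^3 => real"
 assumes [measurable]: "f : Borel" and f0: "!!x. 0 <= f x"
  and fin: "(NBINT w. ennreal (f w)) < \<infinity>" and s: "0 <= s" "s < 3"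
 shows "AEL v. (NBINT w. ennreal (f w * norm (v - w) powr (-s))) < \<infinity>"
 by (rule AE_of_L1_loc[OF _ potential_L1_loc[OF assms(1) f0 fin s]]) measurable

lemma AE_local_potential_finite:
 fixes f :: "real^3 => real"
 assumes f: "loc_int f" and s: "0 <= s" "s < 3"
 shows "AEL v. (NBALL R (%w. ennreal (\<bar>f w\<bar> * norm (w - v) powr (-s)))) < \<infinity>"
proof -
 have [measurable]: "f : Borel" using f by auto
 define g where "g w = \<bar>f w\<bar> * ball_ind R w" for w
 have [measurable]: "g : Borel" unfolding g_def by measurable
 have "(NBINT w. ennreal (g w)) = (NBALL R (%w. ennreal \<bar>f w\<bar>))"
  by (intro nn_integral_cong) (auto simp: g_def indicator_def)
 also have "... < \<infinity>" by (rule loc_int_finite[OF f])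
 finally have "AEL v. (NBINT w. ennreal (g w * norm (v - w) powr (-s))) < \<infinity>"
  by (intro AE_potential_finite s) (auto simp: g_def)
 moreover have "(NBINT w. ennreal (g w * norm (v - w) powr (-s))) = (NBALL R (%w. ennreal (\<bar>f w\<bar> * norm (w - v) powr (-s))))" for v
  by (intro nn_integral_cong) (auto simp: g_def indicator_def norm_minus_commute)
 ultimately show ?thesis by simp
qed

lemma potential_loc_int:
 fixes f k :: "real^3 => real"
 assumes [measurable]: "f : Borel" "k : Borel" and f0: "!!x. 0 <= f x"
  and fin: "(NBINT w. ennreal (f w)) < \<infinity>" and s: "0 <= s" "s < 3"
  and kb: "!!z. \<bar>k z\<bar> <= norm z powr (-s)"
 shows "loc_int (%v. LBINT w. f w * k (v - w))"
 unfolding loc_int_def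
proof (intro conjI allI)
 show "(%v. LBINT w. f w * k (v - w)) : Borel" by measurable
 fix R
 have ae: "AEL v. (NBINT w. ennreal (f w * norm (v - w) powr (-s))) < \<infinity>"
  by (rule AE_potential_finite[OF assms(1) f0 fin s])
 have "(NBALL R (%v. ennreal \<bar>LBINT w. f w * k (v - w)\<bar>))
   <= (NBALL R (%v. (NBINT w. ennreal (f w * norm (v - w) powr (-s)))))"
 proof (rule nn_integral_mono_AE, use ae in eventually_elim)
  case (elim v)
  have i: "integrable lborel (%w. f w * k (v - w))"
   using integrable_kernel[of f k 1 s v] elim kb f0 by simp
  have "ennreal \<bar>LBINT w. f w * k (v - w)\<bar> <= (NBINT w. ennreal \<bar>f w * k (v - w)\<bar>)"
   using integral_norm_bound_ennreal[OF i] by simp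
  also have "... <= (NBINT w. ennreal (f w * norm (v - w) powr (-s)))"
   by (intro nn_integral_mono ennreal_leI) (simp add: abs_mult f0 mult_left_mono kb)
  finally show ?case by (rule mult_right_mono) simp
 qed
 also have "... < \<infinity>" by (rule potential_L1_loc[OF assms(1) f0 fin s])
 finally show "(NBALL R (%v. ennreal \<bar>LBINT w. f w * k (v - w)\<bar>)) < \<infinity>" .
qed

lemma pair_integrable_kernel:
 fixes f \<eta> k :: "real^3 => real"
 assumes [measurable]: "f : Borel" "k : Borel" and f0: "!!x. 0 <= f x"
  and fin: "(NBINT w. ennreal (f w)) < \<infinity>" and s: "0 <= s" "s < 3"
  and kb: "!!z. \<bar>k z\<bar> <= norm z powr (-s)" and \<eta>: "smooth_test UNIV \<eta>"
 shows "integrable (lborel \<Otimes>\<^sub>M lborel) (%(v, w). f w * k (v - w) * \<eta> v)"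
proof (rule integrable_pairI)
 obtain R where R: "0 < R" "smooth \<eta>" "!!v. R <= norm v ==> \<eta> v = 0" using smooth_testE[OF \<eta>] by blast
 obtain B where B: "0 < B" "!!x. \<bar>\<eta> x\<bar> <= B" using smooth_test_bounded[OF \<eta>] by blast
 note [measurable] = smooth_borel[OF R(2)]
 show "(%p. f (snd p) * k (fst p - snd p) * \<eta> (fst p)) : borel_measurable (lborel \<Otimes>\<^sub>M lborel)" by measurable
 have "(NBINT v. (NBINT w. ennreal (norm (f w * k (v - w) * \<eta> v))))
  <= (NBINT v. ennreal B * ((NBINT w. ennreal (f w * norm (v - w) powr (-s))) * ball_ind R v))"
 proof (rule nn_integral_mono)
  fix v
  have "(NBINT w. ennreal (norm (f w * k (v - w) * \<eta> v))) <= (NBINT w. (ennreal B * ball_ind R v) * ennreal (f w * norm (v - w) powr (-s)))"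
  proof (rule nn_integral_mono)
   fix w
   show "ennreal (norm (f w * k (v - w) * \<eta> v)) <= (ennreal B * ball_ind R v) * ennreal (f w * norm (v - w) powr (-s))"
   proof (cases "norm v <= R")
    case True
    have "(f w * \<bar>k (v - w)\<bar>) * \<bar>\<eta> v\<bar> <= (f w * norm (v - w) powr (-s)) * B"
     using f0[of w] B by (intro mult_mono kb B(2)) auto
    then show ?thesis using True f0[of w] B(1)
     by (simp add: abs_mult ennreal_mult[symmetric] ennreal_leI mult.commute mult.left_commute)
   next
    case False then show ?thesis using R(3)[of v] by simp
   qed
  qed
  also have "... = (ennreal B * ball_ind R v) * (NBINT w. ennreal (f w * norm (v - w) powr (-s)))"
   by (rule nn_integral_cmult) measurable
  finally show "(NBINT w. ennreal (norm (f w * k (v - w) * \<eta> v))) <= ennreal B * ((NBINT w. ennreal (f w * norm (v - w) powr (-s))) * ball_ind R v)"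
   by (simp only: ac_simps)
 qed
 also have "... = ennreal B * (NBALL R (%v. (NBINT w. ennreal (f w * norm (v - w) powr (-s)))))"
  by (rule nn_integral_cmult) measurable
 also have "... < \<infinity>" using potential_L1_loc[OF assms(1) f0 fin s, of R] by (simp add: ennreal_mult_less_top)
 finally show "(NBINT v. (NBINT w. ennreal (norm (f w * k (v - w) * \<eta> v)))) < \<infinity>" .
qed

lemma borel_B_nth:
 assumes [measurable]: "u : Borel" and u0: "!!x. 0 <= u x"
  and fin: "(NBINT w. ennreal (u w * norm (v - w) powr (-2))) < \<infinity>"
 shows "integrable lborel (%w. u w *\<^sub>R coulomb_field (v - w))"
  and "borel_B u v $ i = (LBINT w. u w * coulomb_field (v - w) $ i)"
proof -
 show i: "integrable lborel (%w. u w *\<^sub>R coulomb_field (v - w))"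
  using integrable_kernel[of u coulomb_field 1 2 v] norm_coulomb_field_le fin u0 by simp
 from integral_bounded_linear[OF bounded_linear_vec_nth i, of i]
 show "borel_B u v $ i = (LBINT w. u w * coulomb_field (v - w) $ i)"
  by (simp add: borel_B_def)
qed

lemma borel_weak_grad_landau_a:
 assumes [measurable]: "u : Borel" and u0: "!!x. 0 <= u x"
  and fin: "(NBINT w. ennreal (u w)) < \<infinity>"
 shows "borel_weak_grad (landau_a u) (borel_B u)"
 unfolding borel_weak_grad_def
proof (intro conjI allI impI)
 let ?k = "%z::real^3. 1 / norm z"
 let ?k' = "%i z. - (z $ i) / norm (z::real^3) ^ 3"
 have kb: "\<bar>?k z\<bar> <= norm z powr (-1)" for z by (simp add: norm_powr_minus_1)
 have kb': "\<bar>?k' i z\<bar> <= norm z powr (-2)" for i z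
  using component_le_norm_cart[of z i]
  by (cases "z = 0") (auto simp: norm_powr_minus_2 power2_eq_square power3_eq_cube divide_simps abs_mult intro!: mult_mono)
 have cb: "\<bar>coulomb_field z $ i\<bar> <= norm z powr (-2)" for i z
  using order_trans[OF component_le_norm_cart norm_coulomb_field_le] by blast
 have aeq: "landau_a u = (%v. LBINT w. (u w / (4 * pi)) * ?k (v - w))"
 proof
  fix v
  have "landau_a u v = (LBINT w. 1 / (4 * pi) * (u w / norm (v - w)))"
   unfolding landau_a_eq[OF assms(1)] by (rule integral_mult_right_zero[symmetric])
  also have "... = (LBINT w. (u w / (4 * pi)) * ?k (v - w))"
   by (intro Bochner_Integration.integral_cong refl) simp
  finally show "landau_a u v = (LBINT w. (u w / (4 * pi)) * ?k (v - w))" .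
 qed
 have u4fin: "(NBINT w. ennreal (u w / (4 * pi))) < \<infinity>"
 proof -
  have "(NBINT w. ennreal (u w / (4 * pi))) <= (NBINT w. ennreal (u w))"
  proof (intro nn_integral_mono ennreal_leI)
   fix w
   have "u w / (4 * pi) <= u w / 1" using pi_gt3 u0[of w] by (intro divide_left_mono) auto
   then show "u w / (4 * pi) <= u w" by simp
  qed
  then show ?thesis using fin by (rule le_less_trans)
 qed
 show "loc_int (landau_a u)" unfolding aeq
  by (rule potential_loc_int[where s=1, OF _ _ _ u4fin]) (use u0 kb in auto)
 show "borel_B u : Borel" by measurable
 have ae: "AEL v. (NBINT w. ennreal (u w * norm (v - w) powr (-2))) < \<infinity>"
  by (rule AE_potential_finite[OF assms(1) u0 fin]) auto
 have Bi: "AEL v. borel_B u v $ i = (LBINT w. u w * coulomb_field (v - w) $ i)" for i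
  using ae by eventually_elim (rule borel_B_nth(2)[OF assms(1) u0])
 have l: "loc_int (%v. LBINT w. u w * coulomb_field (v - w) $ i)" for i
  by (rule potential_loc_int[where s=2, OF _ _ u0 fin]) (use cb in auto)
 show "loc_int (%v. borel_B u v $ i)" for i
  unfolding loc_int_def
 proof (intro conjI allI)
  fix R
  have "(NBALL R (%v. ennreal \<bar>borel_B u v $ i\<bar>)) = (NBALL R (%v. ennreal \<bar>LBINT w. u w * coulomb_field (v - w) $ i\<bar>))"
   by (rule nn_integral_cong_AE) (use Bi[of i] in eventually_elim, simp)
  then show "(NBALL R (%v. ennreal \<bar>borel_B u v $ i\<bar>)) < \<infinity>" using loc_int_finite[OF l[of i], of R] by simp
 qed measurable
 fix \<psi> :: "real^3 => real" and i assume \<psi>: "smooth_test UNIV \<psi>"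
 have s\<psi>: "smooth \<psi>" using \<psi> by (simp add: smooth_test_iff)
 note [measurable] = smooth_borel[OF s\<psi>] smooth_borel[OF smooth_partial[OF s\<psi>]]
 have p1: "integrable (lborel \<Otimes>\<^sub>M lborel) (%(v, w). (u w / (4 * pi)) * ?k (v - w) * partial i \<psi> v)"
  by (rule pair_integrable_kernel[where s=1, OF _ _ _ u4fin _ _ kb smooth_test_partial[OF \<psi>]]) (use u0 in auto)
 have p2: "integrable (lborel \<Otimes>\<^sub>M lborel) (%(v, w). u w * coulomb_field (v - w) $ i * \<psi> v)"
  by (rule pair_integrable_kernel[where s=2 and k="%z. coulomb_field z $ i", OF _ _ u0 fin _ _ cb \<psi>]) auto
 have "(LBINT v. landau_a u v * partial i \<psi> v) = (LBINT v. LBINT w. (u w / (4 * pi)) * ?k (v - w) * partial i \<psi> v)"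
  by (simp only: aeq integral_mult_left_zero)
 also have "... = (LBINT w. LBINT v. (u w / (4 * pi)) * ?k (v - w) * partial i \<psi> v)"
  by (rule lborel_pair.Fubini_integral[symmetric, OF p1])
 also have "... = (LBINT w. - (LBINT v. u w * coulomb_field (v - w) $ i * \<psi> v))"
 proof (intro Bochner_Integration.integral_cong refl)
  fix w
  have "(LBINT v. (u w / (4 * pi)) * ?k (v - w) * partial i \<psi> v) = (u w / (4 * pi)) * (LBINT v. ?k (v - w) * partial i \<psi> v)"
   by (simp only: mult.assoc integral_mult_right_zero)
  also have "... = - ((u w / (4 * pi)) * (LBINT v. ?k' i (v - w) * \<psi> v))"
   using Newton_kernel_integral_by_parts(2)[OF \<psi>, of w i] by simp
  also have "... = - (LBINT v. (u w / (4 * pi)) * (?k' i (v - w) * \<psi> v))"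
   by (simp only: integral_mult_right_zero)
  also have "... = - (LBINT v. u w * coulomb_field (v - w) $ i * \<psi> v)"
   by (simp add: coulomb_field_nth mult.assoc)
  finally show "(LBINT v. (u w / (4 * pi)) * ?k (v - w) * partial i \<psi> v) = - (LBINT v. u w * coulomb_field (v - w) $ i * \<psi> v)" .
 qed
 also have "... = - (LBINT w. LBINT v. u w * coulomb_field (v - w) $ i * \<psi> v)" by simp
 also have "(LBINT w. LBINT v. u w * coulomb_field (v - w) $ i * \<psi> v) = (LBINT v. LBINT w. u w * coulomb_field (v - w) $ i * \<psi> v)"
  by (rule lborel_pair.Fubini_integral[OF p2])
 also have "... = (LBINT v. borel_B u v $ i * \<psi> v)"
 proof (rule integral_cong_AE)
  show "AEL v. (LBINT w. u w * coulomb_field (v - w) $ i * \<psi> v) = borel_B u v $ i * \<psi> v"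
   using Bi[of i] by eventually_elim simp
 qed measurable
 finally show "(LBINT v. landau_a u v * partial i \<psi> v) = - (LBINT v. borel_B u v $ i * \<psi> v)" .
qed

subsection \<open>The weak form of the flux\<close>

lemma grad_borel[measurable_dest]: "smooth \<psi> ==> grad \<psi> : Borel"
 by (rule borel_measurable_cartesian) (simp add: grad_def smooth_borel smooth_partial)

lemma hess_borel[measurable_dest]: "smooth \<psi> ==> hess \<psi> : Borel"
 by (rule borel_measurable_cartesian, rule borel_measurable_cartesian) (simp add: hess_def smooth_borel smooth_partial)

lemma smooth_test_grad_hess_bounds:
 assumes \<psi>: "smooth_test UNIV \<psi>"
 obtains L R where "0 < L" "0 < R" "!!v. norm (grad \<psi> v) <= L * ball_ind R v"
  "!!v w. norm (grad \<psi> v - grad \<psi> w) <= L * norm (v - w)"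
  "!!i j v. \<bar>hess \<psi> v $ i $ j\<bar> <= L * ball_ind R v"
  "!!v. R < norm v ==> \<psi> v = 0"
proof -
 obtain R where R: "0 < R" "smooth \<psi>" "!!v. R <= norm v ==> \<psi> v = 0" using smooth_testE[OF \<psi>] by blast
 have z: "R < norm v ==> \<psi> v = 0" for v using R(3) by simp
 have z1: "partial i \<psi> v = 0" if "R < norm v" for i v by (rule partial_zero_outside[OF R(2) z that])
 have z2: "partial j (partial i \<psi>) v = 0" if "R < norm v" for i j v
  by (rule partial_zero_outside[OF smooth_partial[OF R(2)] z1 that])
 have "\<forall>i. \<exists>B. 0 < B \<and> (\<forall>v. \<bar>partial i \<psi> v\<bar> <= B)"
  using smooth_test_bounded[OF smooth_test_partial[OF \<psi>]] by metis
 then obtain B where B: "!!i. 0 < B i" "!!i v. \<bar>partial i \<psi> v\<bar> <= B i" by metis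
 have "\<forall>i j. \<exists>D. 0 < D \<and> (\<forall>v. \<bar>partial i (partial j \<psi>) v\<bar> <= D)"
  using smooth_test_bounded[OF smooth_test_partial[OF smooth_test_partial[OF \<psi>]]] by metis
 then obtain D where D: "!!i j. 0 < D i j" "!!i j v. \<bar>partial i (partial j \<psi>) v\<bar> <= D i j" by metis
 have "\<forall>i. \<exists>M. 0 < M \<and> (\<forall>v w. \<bar>partial i \<psi> v - partial i \<psi> w\<bar> <= M * norm (v - w))"
  using smooth_test_lipschitz[OF smooth_test_partial[OF \<psi>]] by metis
 then obtain M where M: "!!i. 0 < M i" "!!i v w. \<bar>partial i \<psi> v - partial i \<psi> w\<bar> <= M i * norm (v - w)" by metis
 define L where "L = (\<Sum>i\<in>UNIV. B i) + (\<Sum>i\<in>UNIV. M i) + (\<Sum>i\<in>UNIV. \<Sum>j\<in>UNIV. D i j) + 1"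
 have s: "0 <= (\<Sum>i\<in>UNIV. B i)" "0 <= (\<Sum>i\<in>UNIV. M i)" "0 <= (\<Sum>i\<in>UNIV. \<Sum>j\<in>UNIV. D i j)"
  by (intro sum_nonneg less_imp_le B M D)+
 have Lg: "(\<Sum>i\<in>UNIV. B i) <= L" "(\<Sum>i\<in>UNIV. M i) <= L" "0 < L" using s by (auto simp: L_def)
 have DL: "D i j <= L" for i j
 proof -
  have "D i j <= (\<Sum>j\<in>UNIV. D i j)" by (rule member_le_sum) (auto intro: less_imp_le D)
  also have "... <= (\<Sum>i\<in>UNIV. \<Sum>j\<in>UNIV. D i j)"
   by (rule member_le_sum[of i UNIV "%i. \<Sum>j\<in>UNIV. D i j"]) (auto intro: less_imp_le D sum_nonneg)
  also have "... <= L" using s by (simp add: L_def)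
  finally show ?thesis .
 qed
 show ?thesis
 proof (rule that[OF Lg(3) R(1)])
  show "norm (grad \<psi> v) <= L * ball_ind R v" for v
  proof (cases "norm v <= R")
   case True
   have "norm (grad \<psi> v) <= (\<Sum>i\<in>UNIV. \<bar>grad \<psi> v $ i\<bar>)" by (rule norm_le_l1_cart)
   also have "... <= (\<Sum>i\<in>UNIV. B i)" by (intro sum_mono) (simp add: grad_def B)
   finally show ?thesis using Lg True by simp
  next
   case False then have "grad \<psi> v = 0" by (simp add: vec_eq_iff grad_def z1)
   then show ?thesis using Lg by (simp add: indicator_def)
  qed
  show "norm (grad \<psi> v - grad \<psi> w) <= L * norm (v - w)" for v w
  proof -
   have "norm (grad \<psi> v - grad \<psi> w) <= (\<Sum>i\<in>UNIV. \<bar>(grad \<psi> v - grad \<psi> w) $ i\<bar>)" by (rule norm_le_l1_cart)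
   also have "... <= (\<Sum>i\<in>UNIV. M i * norm (v - w))" by (intro sum_mono) (simp add: grad_def M)
   also have "... = (\<Sum>i\<in>UNIV. M i) * norm (v - w)" by (simp add: sum_distrib_right)
   also have "... <= L * norm (v - w)" by (intro mult_right_mono Lg) simp
   finally show ?thesis .
  qed
  show "\<bar>hess \<psi> v $ i $ j\<bar> <= L * ball_ind R v" for i j v
  proof -
   have "\<bar>partial i (partial j \<psi>) v\<bar> <= L" by (rule order_trans[OF D(2) DL])
   then show ?thesis using z2[of v] Lg by (cases "norm v <= R") (auto simp: hess_def)
  qed
  show "R < norm v ==> \<psi> v = 0" for v by (rule z)
 qed
qed

lemma frobenius_landau_N_bound:
 assumes "!!i j. \<bar>H $ i $ j\<bar> <= L" shows "\<bar>frobenius (landau_N z) H\<bar> <= 9 * L * norm z powr (-1)"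
proof -
 have "\<bar>frobenius (landau_N z) H\<bar> <= (\<Sum>i\<in>UNIV. \<Sum>j\<in>UNIV. \<bar>landau_N z $ i $ j * H $ i $ j\<bar>)"
  unfolding frobenius_def by (rule order_trans[OF sum_abs sum_mono[OF sum_abs]])
 also have "... <= (\<Sum>i\<in>(UNIV::3 set). \<Sum>j\<in>(UNIV::3 set). norm z powr (-1) * L)"
  unfolding abs_mult by (intro sum_mono mult_mono abs_landau_N_nth_le assms) auto
 finally show ?thesis by simp
qed

lemma frobenius_borel[measurable (raw)]:
 assumes [measurable]: "A : borel_measurable M" "B : borel_measurable M"
 shows "(%x. frobenius (A x) (B x)) : borel_measurable M"
 unfolding frobenius_def by measurable

definition pair_energy :: "(real^3 => real) => real => ennreal" where
 "pair_energy u R = (NBALL R (%v. (NBINT w. ennreal (u v * (u w * norm (v - w) powr (-1))))))"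

lemma symmetric_kernel_bound:
 assumes [measurable]: "u : Borel" "(%p. f (fst p) (snd p)) : borel_measurable (lborel \<Otimes>\<^sub>M lborel)"
  and u0: "!!x. 0 <= u x" and K: "0 <= K"
  and b: "!!v w :: real^3. \<bar>f v w :: real\<bar> <= K * (u v * (u w * norm (v - w) powr (-1))) * (ball_ind R v + ball_ind R w)"
 shows "ennreal \<bar>LINT (v, w)|lborel. f v w\<bar> <= ennreal (2 * K) * pair_energy u R"
proof -
 let ?g = "%v w. ennreal (u v * (u w * norm (v - w) powr (-1))) * ball_ind R v"
 have g1: "(NBINT v. (NBINT w. ?g v w)) = pair_energy u R"
  unfolding pair_energy_def by (intro nn_integral_cong nn_integral_multc) measurable
 have g2: "(NBINT v. (NBINT w. ?g w v)) = pair_energy u R"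
  unfolding g1[symmetric] by (rule nn_integral_lborel_swap) measurable
 have "ennreal \<bar>LINT (v, w)|lborel. f v w\<bar> <= (\<integral>\<^sup>+(v, w). ennreal \<bar>f v w\<bar> \<partial>lborel)"
 proof (cases "integrable lborel (%(v, w). f v w)")
  case True
  from integral_norm_bound_ennreal[OF True] show ?thesis by (simp add: case_prod_unfold)
 next
  case False then show ?thesis by (simp add: not_integrable_integral_eq)
 qed
 also have "... = (\<integral>\<^sup>+p. ennreal \<bar>f (fst p) (snd p)\<bar> \<partial>(lborel \<Otimes>\<^sub>M lborel))"
  by (simp add: lborel_prod case_prod_unfold)
 also have "... = (NBINT v. (NBINT w. ennreal \<bar>f v w\<bar>))"
  using lborel.nn_integral_fst[of "%p. ennreal \<bar>f (fst p) (snd p)\<bar>" lborel] by simp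
 also have "... <= (NBINT v. (NBINT w. ennreal K * (?g v w + ?g w v)))"
 proof (intro nn_integral_mono)
  fix v w
  have "ennreal \<bar>f v w\<bar> <= ennreal (K * (u v * (u w * norm (v - w) powr (-1)) * ball_ind R v + u w * (u v * norm (w - v) powr (-1)) * ball_ind R w))"
   by (rule ennreal_leI, rule order_trans[OF b]) (simp add: algebra_simps add_divide_distrib norm_minus_commute)
  also have "... = ennreal K * (?g v w + ?g w v)"
   using K u0[of v] u0[of w]
   by (cases "norm v <= R"; cases "norm w <= R") (simp_all add: ennreal_mult[symmetric] ennreal_plus[symmetric] del: ennreal_plus)
  finally show "ennreal \<bar>f v w\<bar> <= ennreal K * (?g v w + ?g w v)" .
 qed
 also have "... = ennreal K * ((NBINT v. (NBINT w. ?g v w)) + (NBINT v. (NBINT w. ?g w v)))"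
 proof -
  have "(NBINT w. ennreal K * (?g v w + ?g w v)) = ennreal K * ((NBINT w. ?g v w) + (NBINT w. ?g w v))" for v
   by (subst nn_integral_cmult, measurable, subst nn_integral_add, measurable)
  then show ?thesis by (simp only:) (subst nn_integral_cmult, measurable, subst nn_integral_add, measurable)
 qed
 also have "... = ennreal (2 * K) * pair_energy u R"
  unfolding g1 g2 using K by (simp add: ennreal_mult mult_2[symmetric] mult.commute mult.left_commute)
 finally show ?thesis .
qed

lemma ultraweak_terms_bound:
 assumes \<psi>: "smooth_test UNIV \<psi>"
 obtains C R where "0 <= C" "0 < R" "!!u. u : Borel ==> (!!x. 0 <= u x) ==>
   ennreal \<bar>LINT (v, w)|lborel. u v * u w * frobenius (landau_N (v - w)) (hess \<psi> v + hess \<psi> w)\<bar> <= ennreal C * pair_energy u R \<and>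
   ennreal \<bar>LINT (v, w)|lborel. u v * u w * (((1 / norm (v - w) ^ 3) *\<^sub>R (v - w)) \<bullet> (grad \<psi> v - grad \<psi> w))\<bar> <= ennreal C * pair_energy u R"
proof -
 obtain L R where L: "0 < L" "0 < R" "!!v. norm (grad \<psi> v) <= L * ball_ind R v"
  "!!v w. norm (grad \<psi> v - grad \<psi> w) <= L * norm (v - w)"
  "!!i j v. \<bar>hess \<psi> v $ i $ j\<bar> <= L * ball_ind R v" "!!v. R < norm v ==> \<psi> v = 0"
  using smooth_test_grad_hess_bounds[OF \<psi>] by blast
 have s: "smooth \<psi>" using \<psi> by (simp add: smooth_test_iff)
 note [measurable] = grad_borel[OF s] hess_borel[OF s]
 show ?thesis
 proof (rule that[of "2 * (9 * L)" R])
  fix u :: "real^3 => real" assume [measurable]: "u : Borel" and u0: "!!x. 0 <= u x"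
  show "ennreal \<bar>LINT (v, w)|lborel. u v * u w * frobenius (landau_N (v - w)) (hess \<psi> v + hess \<psi> w)\<bar> <= ennreal (2 * (9 * L)) * pair_energy u R \<and>
   ennreal \<bar>LINT (v, w)|lborel. u v * u w * (((1 / norm (v - w) ^ 3) *\<^sub>R (v - w)) \<bullet> (grad \<psi> v - grad \<psi> w))\<bar> <= ennreal (2 * (9 * L)) * pair_energy u R"
  proof (intro conjI symmetric_kernel_bound u0)
   fix v w :: "real^3"
   let ?I = "ball_ind R v + ball_ind R w :: real"
   have "\<bar>(hess \<psi> v + hess \<psi> w) $ i $ j\<bar> <= L * ?I" for i j
    using order_trans[OF abs_triangle_ineq add_mono[OF L(5)[of v i j] L(5)[of w i j]]] by (simp add: algebra_simps)
   then have "\<bar>frobenius (landau_N (v - w)) (hess \<psi> v + hess \<psi> w)\<bar> <= 9 * (L * ?I) * norm (v - w) powr (-1)"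
    by (rule frobenius_landau_N_bound)
   from mult_left_mono[OF this, of "u v * u w"]
   show "\<bar>u v * u w * frobenius (landau_N (v - w)) (hess \<psi> v + hess \<psi> w)\<bar> <= 9 * L * (u v * (u w * norm (v - w) powr (-1))) * ?I"
    using u0[of v] u0[of w] by (simp add: abs_mult ac_simps)
   have gb: "norm (grad \<psi> v - grad \<psi> w) <= 9 * L * norm (v - w) * ?I"
   proof (cases "norm v <= R \<or> norm w <= R")
    case True
    then have "1 <= ?I" by (auto simp: indicator_def)
    then have "1 * (L * norm (v - w)) <= ?I * (9 * L * norm (v - w))" using L(1) by (intro mult_mono) auto
    then show ?thesis using L(4)[of v w] by (simp add: mult.commute)
   next
    case False
    then have "grad \<psi> v = 0" "grad \<psi> w = 0" using L(3)[of v] L(3)[of w] by auto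
    then show ?thesis using False by simp
   qed
   have "\<bar>((1 / norm (v - w) ^ 3) *\<^sub>R (v - w)) \<bullet> (grad \<psi> v - grad \<psi> w)\<bar> <= norm ((1 / norm (v - w) ^ 3) *\<^sub>R (v - w)) * norm (grad \<psi> v - grad \<psi> w)"
    by (rule Cauchy_Schwarz_ineq2)
   also have "... <= norm (v - w) powr (-2) * (9 * L * norm (v - w) * ?I)"
    by (intro mult_mono gb) (auto simp: norm_powr_minus_2 power2_eq_square power3_eq_cube)
   also have "... = 9 * L * norm (v - w) powr (-1) * ?I"
    by (cases "v = w") (simp_all add: norm_powr_minus_2 norm_powr_minus_1 power2_eq_square)
   finally have "\<bar>((1 / norm (v - w) ^ 3) *\<^sub>R (v - w)) \<bullet> (grad \<psi> v - grad \<psi> w)\<bar> <= 9 * L * norm (v - w) powr (-1) * ?I" .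
   from mult_left_mono[OF this mult_nonneg_nonneg[OF u0[of v] u0[of w]]]
   show "\<bar>u v * u w * (((1 / norm (v - w) ^ 3) *\<^sub>R (v - w)) \<bullet> (grad \<psi> v - grad \<psi> w))\<bar> <= 9 * L * (u v * (u w * norm (v - w) powr (-1))) * ?I"
    using u0[of v] u0[of w] by (simp only: abs_mult abs_of_nonneg ac_simps)
  qed (use L in \<open>auto\<close>)
 qed (use L in auto)
qed

text \<open>What is known of a time slice of an H-solution at almost every time.\<close>

locale sobolev_density =
 fixes u :: "real^3 => real" and G :: "real^3 => real^3"
 assumes u0: "!!x. 0 <= u x" and u_fin: "(NBINT w. ennreal (u w)) < \<infinity>"
  and u3_fin: "!!r. (NBALL r (%w. ennreal (u w ^ 3))) < \<infinity>"
  and wg: "borel_weak_grad u G"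
begin

lemma u_borel[measurable]: "u : Borel"
 and G_borel[measurable]: "G : Borel"
 and lu: "loc_int u" and lG: "loc_int (%v. G v $ i)"
 using wg by (auto simp: borel_weak_grad_def)

definition flux :: "real^3 => real^3" where
 "flux v = borel_A u v *v G v - u v *\<^sub>R borel_B u v"

lemma flux_borel[measurable]: "flux : Borel"
 unfolding flux_def[abs_def] by measurable

lemma G_loc: "(NBALL R (%v. ennreal (norm (G v)))) < \<infinity>"
 using loc_integrable_iff_balls[OF G_borel] loc_integrable_vector_iff[OF G_borel] lG by blast

lemma Newton_bounded:
 obtains B where "0 <= B" "!!v. norm v <= R ==> (NBINT w. ennreal (u w * norm (v - w) powr (-1))) <= ennreal B"
proof -
 obtain C where C: "0 <= C" "!!(u :: real^3 => real) \<mu> v. u : Borel ==> (!!x. 0 <= u x) ==> 0 < \<mu> ==>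
  (NBINT w. ennreal (u w * norm (v - w) powr (-1)))
   <= (NBINT w. ennreal (u w)) + ennreal \<mu> * (ennreal C + (NBSET (cball v 1) (%w. ennreal ((u w / \<mu>) ^ 3))))"
  using Newton_potential_L3_bound by blast
 define X where "X = (NBINT w. ennreal (u w)) + (ennreal C + (NBALL (R+1) (%w. ennreal (u w ^ 3))))"
 have X: "X < \<infinity>" using u_fin u3_fin[of "R+1"] by (simp add: X_def)
 have "(NBINT w. ennreal (u w * norm (v - w) powr (-1))) <= X" if "norm v <= R" for v
 proof -
  have "(NBINT w. ennreal (u w * norm (v - w) powr (-1)))
   <= (NBINT w. ennreal (u w)) + (ennreal C + (NBSET (cball v 1) (%w. ennreal (u w ^ 3))))"
   using C(2)[of u 1 v] u0 by simp
  also have "... <= X" unfolding X_def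
  proof (intro add_left_mono nn_integral_mono)
   fix w
   have "norm w <= R + 1" if "dist v w <= 1"
    using that \<open>norm v \<le> R\<close> norm_triangle_ineq2[of w v] by (simp add: dist_norm norm_minus_commute)
   then show "ennreal (u w ^ 3) * indicator (cball v 1) w <= ennreal (u w ^ 3) * ball_ind (R + 1) w"
    by (auto simp: indicator_def)
  qed
  finally show ?thesis .
 qed
 then show ?thesis using that[of "enn2real X"] X by (simp add: less_top)
qed

lemma Newton_finite: "(NBINT w. ennreal (u w * norm (v - w) powr (-1))) < \<infinity>"
proof -
 obtain B where "!!x. norm x <= norm v ==> (NBINT w. ennreal (u w * norm (x - w) powr (-1))) <= ennreal B"
  using Newton_bounded[of "norm v"] by blast
 from le_less_trans[OF this[OF order_refl] ennreal_less_top] show ?thesis by simp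
qed

lemma integrable_A: "integrable lborel (%w. u w *\<^sub>R landau_N (v - w))"
 using integrable_kernel[of u landau_N 9 1 v] norm_landau_N_le Newton_finite u0 by simp

lemma bounded_linear_matrix_vector: "bounded_linear (%M::real^3^3. M *v x)"
proof -
 have "linear (%M::real^3^3. M *v x)"
  by (rule linearI) (simp_all add: matrix_vector_mult_add_rdistrib scaleR_matrix_vector_assoc)
 then show ?thesis by (rule linear_conv_bounded_linear[THEN iffD1])
qed

lemma integrable_Ax: "integrable lborel (%w. u w *\<^sub>R (landau_N (v - w) *v x))"
 and borel_A_vec: "borel_A u v *v x = (LBINT w. u w *\<^sub>R (landau_N (v - w) *v x))"
 using integrable_bounded_linear[OF bounded_linear_matrix_vector[of x] integrable_A[of v]]
  integral_bounded_linear[OF bounded_linear_matrix_vector[of x] integrable_A[of v]]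
 by (simp_all add: borel_A_def scaleR_matrix_vector_assoc)

lemma AE_quadratic: "AEL v. (NBINT w. ennreal (u w * norm (v - w) powr (-2))) < \<infinity>"
 by (rule AE_potential_finite[OF u_borel u0 u_fin]) auto

lemma pair_integrable_Newton:
 fixes f :: "real^3 => real^3 => real"
 assumes [measurable]: "(%p. f (fst p) (snd p)) : borel_measurable (lborel \<Otimes>\<^sub>M lborel)" "a : Borel"
  and a0: "!!v. 0 <= a v" and af: "(NBALL R (%v. ennreal (a v))) < \<infinity>"
  and b: "!!v w. \<bar>f v w\<bar> <= a v * ball_ind R v * (u w * norm (v - w) powr (-1))"
 shows "integrable (lborel \<Otimes>\<^sub>M lborel) (case_prod f)"
proof (rule integrable_pairI[OF assms(1)])
 obtain B where B: "0 <= B" "!!v. norm v <= R ==> (NBINT w. ennreal (u w * norm (v - w) powr (-1))) <= ennreal B"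
  using Newton_bounded by blast
 have "(NBINT v. (NBINT w. ennreal (norm (f v w)))) <= (NBINT v. (ennreal (a v) * ball_ind R v) * ennreal B)"
 proof (rule nn_integral_mono)
  fix v
  have "(NBINT w. ennreal (norm (f v w))) <= (NBINT w. (ennreal (a v) * ball_ind R v) * ennreal (u w * norm (v - w) powr (-1)))"
  proof (rule nn_integral_mono)
   fix w
   have "ennreal (norm (f v w)) <= ennreal (a v * ball_ind R v * (u w * norm (v - w) powr (-1)))"
    by (rule ennreal_leI) (simp only: real_norm_def b)
   also have "... = (ennreal (a v) * ball_ind R v) * ennreal (u w * norm (v - w) powr (-1))"
    using a0[of v] u0[of w] by (cases "norm v <= R") (simp_all add: ennreal_mult[symmetric])
   finally show "ennreal (norm (f v w)) <= (ennreal (a v) * ball_ind R v) * ennreal (u w * norm (v - w) powr (-1))" .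
  qed
  also have "... = (ennreal (a v) * ball_ind R v) * (NBINT w. ennreal (u w * norm (v - w) powr (-1)))"
   by (rule nn_integral_cmult) measurable
  also have "... <= (ennreal (a v) * ball_ind R v) * ennreal B"
   using B(2)[of v] by (cases "norm v <= R") (auto intro: mult_left_mono)
  finally show "(NBINT w. ennreal (norm (f v w))) <= (ennreal (a v) * ball_ind R v) * ennreal B" .
 qed
 also have "... = (NBALL R (%v. ennreal (a v))) * ennreal B" by (rule nn_integral_multc) measurable
 also have "... < \<infinity>" using af by (simp add: ennreal_mult_less_top)
 finally show "(NBINT v. (NBINT w. ennreal (norm (f v w)))) < \<infinity>" .
qed

lemma flux_weak_form:
 assumes \<psi>: "smooth_test UNIV \<psi>"
 shows "(LBINT v. flux v \<bullet> grad \<psi> v) =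
  - (1/2 * (LINT (v, w)|lborel. u v * u w * frobenius (landau_N (v - w)) (hess \<psi> v + hess \<psi> w))
   - 1 / (4 * pi) * (LINT (v, w)|lborel. u v * u w * (((1 / norm (v - w) ^ 3) *\<^sub>R (v - w)) \<bullet> (grad \<psi> v - grad \<psi> w))))"
proof -
 obtain L R where L: "0 < L" "0 < R" "!!v. norm (grad \<psi> v) <= L * ball_ind R v"
  "!!v w. norm (grad \<psi> v - grad \<psi> w) <= L * norm (v - w)"
  "!!i j v. \<bar>hess \<psi> v $ i $ j\<bar> <= L * ball_ind R v" "!!v. R < norm v ==> \<psi> v = 0"
  using smooth_test_grad_hess_bounds[OF \<psi>] by blast
 have s: "smooth \<psi>" using \<psi> by (simp add: smooth_test_iff)
 have z1: "partial i \<psi> v = 0" if "R < norm v" for i v by (rule partial_zero_outside[OF s L(6) that])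
 note [measurable] = grad_borel[OF s] hess_borel[OF s]
 let ?g = "grad \<psi>" and ?M = "lborel \<Otimes>\<^sub>M lborel :: ((real^3) \<times> (real^3)) measure"
 define T1 where "T1 v w = u w * ((landau_N (v - w) *v G v) \<bullet> ?g v)" for v w
 define T2 where "T2 v w = u v * u w * (coulomb_field (v - w) \<bullet> ?g v)" for v w
 define T3 where "T3 v w = u v * u w * frobenius (landau_N (v - w)) (hess \<psi> v)" for v w
 have m1[measurable]: "(%p. T1 (fst p) (snd p)) : borel_measurable ?M" unfolding T1_def by measurable
 have m2[measurable]: "(%p. T2 (fst p) (snd p)) : borel_measurable ?M" unfolding T2_def by measurable
 have m3[measurable]: "(%p. T3 (fst p) (snd p)) : borel_measurable ?M" unfolding T3_def by measurable
 have i1: "integrable ?M (case_prod T1)"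
 proof (rule pair_integrable_Newton[where a="%v. L * norm (G v)" and R=R])
  have "(NBALL R (%v. ennreal (L * norm (G v)))) = ennreal L * (NBALL R (%v. ennreal (norm (G v))))"
   using L(1) by (subst nn_integral_cmult[symmetric]) (auto simp: ennreal_mult mult.assoc)
  then show "(NBALL R (%v. ennreal (L * norm (G v)))) < \<infinity>" using G_loc by (simp add: ennreal_mult_less_top)
  fix v w
  have "\<bar>(landau_N (v - w) *v G v) \<bullet> ?g v\<bar> <= norm (landau_N (v - w) *v G v) * norm (?g v)" by (rule Cauchy_Schwarz_ineq2)
  also have "... <= (norm (v - w) powr (-1) * norm (G v)) * (L * ball_ind R v)"
   by (intro mult_mono norm_landau_N_vec_le L(3)) auto
  finally have "u w * \<bar>(landau_N (v - w) *v G v) \<bullet> ?g v\<bar> <= u w * ((norm (v - w) powr (-1) * norm (G v)) * (L * ball_ind R v))"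
   by (intro mult_left_mono u0)
  then show "\<bar>T1 v w\<bar> <= L * norm (G v) * ball_ind R v * (u w * norm (v - w) powr (-1))"
   using u0[of w] by (simp only: T1_def abs_mult abs_of_nonneg ac_simps)
 qed (use L(1) in \<open>auto intro: m1\<close>)
 have i3: "integrable ?M (case_prod T3)"
 proof (rule pair_integrable_Newton[where a="%v. 9 * L * u v" and R=R])
  have "(NBALL R (%v. ennreal (9 * L * u v))) = ennreal (9 * L) * (NBALL R (%v. ennreal \<bar>u v\<bar>))"
   using L(1) u0 by (subst nn_integral_cmult[symmetric]) (auto simp: ennreal_mult mult.assoc)
  then show "(NBALL R (%v. ennreal (9 * L * u v))) < \<infinity>" using loc_int_finite[OF lu] by (simp add: ennreal_mult_less_top)
  fix v w
  have "\<bar>frobenius (landau_N (v - w)) (hess \<psi> v)\<bar> <= 9 * (L * ball_ind R v) * norm (v - w) powr (-1)"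
   by (rule frobenius_landau_N_bound[OF L(5)])
  from mult_left_mono[OF this, of "u v * u w"]
  show "\<bar>T3 v w\<bar> <= 9 * L * u v * ball_ind R v * (u w * norm (v - w) powr (-1))"
   using u0[of v] u0[of w] by (simp add: T3_def abs_mult ac_simps)
 qed (use L(1) u0 in \<open>auto intro: m3\<close>)
 have i2: "integrable ?M (case_prod T2)"
 proof (rule integrable_pairI[OF m2])
  have "(NBINT v. (NBINT w. ennreal (norm (T2 v w))))
   <= (NBINT v. ennreal L * ((NBINT w. ennreal (u v * (u w * norm (v - w) powr (-2)))) * ball_ind R v))"
  proof (rule nn_integral_mono)
   fix v
   have "(NBINT w. ennreal (norm (T2 v w))) <= (NBINT w. (ennreal L * ball_ind R v) * ennreal (u v * (u w * norm (v - w) powr (-2))))"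
   proof (rule nn_integral_mono)
    fix w
    have "\<bar>coulomb_field (v - w) \<bullet> ?g v\<bar> <= norm (v - w) powr (-2) * (L * ball_ind R v)"
     by (rule order_trans[OF Cauchy_Schwarz_ineq2]) (intro mult_mono norm_coulomb_field_le L(3), auto)
    from mult_left_mono[OF this mult_nonneg_nonneg[OF u0[of v] u0[of w]]]
    have "norm (T2 v w) <= (L * ball_ind R v) * (u v * (u w * norm (v - w) powr (-2)))"
     using u0[of v] u0[of w] by (simp only: T2_def real_norm_def abs_mult abs_of_nonneg mult_nonneg_nonneg ac_simps)
    then have "ennreal (norm (T2 v w)) <= ennreal ((L * ball_ind R v) * (u v * (u w * norm (v - w) powr (-2))))" by (rule ennreal_leI)
    also have "... = (ennreal L * ball_ind R v) * ennreal (u v * (u w * norm (v - w) powr (-2)))"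
     using L(1) u0[of v] u0[of w] by (simp add: ennreal_mult ennreal_indicator)
    finally show "ennreal (norm (T2 v w)) <= (ennreal L * ball_ind R v) * ennreal (u v * (u w * norm (v - w) powr (-2)))" .
   qed
   also have "... = (ennreal L * ball_ind R v) * (NBINT w. ennreal (u v * (u w * norm (v - w) powr (-2))))"
    by (rule nn_integral_cmult) measurable
   finally show "(NBINT w. ennreal (norm (T2 v w))) <= ennreal L * ((NBINT w. ennreal (u v * (u w * norm (v - w) powr (-2)))) * ball_ind R v)"
    by (simp only: ac_simps)
  qed
  also have "... = ennreal L * (NBALL R (%v. (NBINT w. ennreal (u v * (u w * norm (v - w) powr (-2))))))"
   by (rule nn_integral_cmult) measurable
  also have "... < \<infinity>" using double_potential_finite[OF u_borel u0 u_fin u3_fin, of R] by (simp add: ennreal_mult_less_top)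
  finally show "(NBINT v. (NBINT w. ennreal (norm (T2 v w)))) < \<infinity>" .
 qed
 have Fl: "(LBINT v. flux v \<bullet> ?g v) = integral\<^sup>L ?M (case_prod T1) - integral\<^sup>L ?M (case_prod T2)"
 proof -
  have "(LBINT v. flux v \<bullet> ?g v) = (LBINT v. (LBINT w. T1 v w) - (LBINT w. T2 v w))"
  proof (rule integral_cong_AE)
   show "AEL v. flux v \<bullet> ?g v = (LBINT w. T1 v w) - (LBINT w. T2 v w)"
    using AE_quadratic
   proof eventually_elim
    case (elim v)
    have "(borel_A u v *v G v) \<bullet> ?g v = (LBINT w. T1 v w)"
     using integral_bounded_linear[OF bounded_linear_inner_left[of "?g v"] integrable_Ax[where v=v and x="G v"]]
     by (simp add: borel_A_vec T1_def)
    moreover have "(u v *\<^sub>R borel_B u v) \<bullet> ?g v = (LBINT w. T2 v w)"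
    proof -
     have "borel_B u v \<bullet> ?g v = (LBINT w. (u w *\<^sub>R coulomb_field (v - w)) \<bullet> ?g v)"
      using integral_bounded_linear[OF bounded_linear_inner_left[of "?g v"] borel_B_nth(1)[OF u_borel u0 elim]]
      by (simp add: borel_B_def)
     then have "(u v *\<^sub>R borel_B u v) \<bullet> ?g v = u v * (LBINT w. u w * (coulomb_field (v - w) \<bullet> ?g v))" by simp
     also have "... = (LBINT w. u v * (u w * (coulomb_field (v - w) \<bullet> ?g v)))" by (rule integral_mult_right_zero[symmetric])
     finally show ?thesis by (simp add: T2_def mult.assoc)
    qed
    ultimately show ?case by (simp add: flux_def inner_diff_left)
   qed
  qed measurable
  also have "... = (LBINT v. LBINT w. T1 v w) - (LBINT v. LBINT w. T2 v w)"
   by (intro Bochner_Integration.integral_diff lborel_pair.integrable_fst i1 i2)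
  also have "... = integral\<^sup>L ?M (case_prod T1) - integral\<^sup>L ?M (case_prod T2)"
   by (simp add: lborel_pair.integral_fst[OF i1] lborel_pair.integral_fst[OF i2])
  finally show ?thesis .
 qed
 have byparts: "AEL w. (LBINT v. T1 v w) = - ((LBINT v. T2 v w) + (LBINT v. T3 v w))"
 proof -
  have a2: "AEL w. (NBALL R (%v. ennreal (\<bar>u v\<bar> * norm (v - w) powr (-2)))) < \<infinity>"
   by (rule AE_local_potential_finite[OF lu]) auto
  have "AEL w. (NBALL R (%v. ennreal (\<bar>G v $ j\<bar> * norm (v - w) powr (-1)))) < \<infinity>" for j
   by (rule AE_local_potential_finite[OF lG]) auto
  then have "AEL w. \<forall>j. (NBALL R (%v. ennreal (\<bar>G v $ j\<bar> * norm (v - w) powr (-1)))) < \<infinity>"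
   unfolding AE_all_countable by blast
  with a2 show ?thesis
  proof eventually_elim
   case (elim w)
   note p = landau_kernel_integral_by_parts[OF wg smooth_test_partial[OF \<psi>] z1 elim(1) spec[OF elim(2)]]
   have e1: "T1 v w = u w * (\<Sum>i\<in>UNIV. (landau_N (v - w) *v G v) $ i * partial i \<psi> v)" for v
    by (simp add: T1_def inner_vec_def grad_def)
   have e2: "T2 v w = u w * (\<Sum>i\<in>UNIV. u v * (coulomb_field (v - w) $ i * partial i \<psi> v))" for v
    by (simp add: T2_def inner_vec_def grad_def sum_distrib_left ac_simps)
   have e3: "T3 v w = u w * (\<Sum>i\<in>UNIV. u v * (\<Sum>j\<in>UNIV. landau_N (v - w) $ i $ j * partial j (partial i \<psi>) v))" for v
   proof -
    have "frobenius (landau_N (v - w)) (hess \<psi> v) = (\<Sum>j\<in>UNIV. \<Sum>i\<in>UNIV. landau_N (v - w) $ i $ j * partial j (partial i \<psi>) v)"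
     unfolding frobenius_def hess_def by (auto intro!: sum.cong simp: landau_N_commute[of _ _ _])
    also have "... = (\<Sum>i\<in>UNIV. \<Sum>j\<in>UNIV. landau_N (v - w) $ i $ j * partial j (partial i \<psi>) v)" by (rule sum.swap)
    finally show ?thesis by (simp add: T3_def sum_distrib_left[symmetric] ac_simps)
   qed
   have "(LBINT v. T1 v w) = u w * (\<Sum>i\<in>UNIV. LBINT v. (landau_N (v - w) *v G v) $ i * partial i \<psi> v)"
    unfolding e1 integral_mult_right_zero by (subst Bochner_Integration.integral_sum) (auto intro: p(1))
   also have "... = - (u w * (\<Sum>i\<in>UNIV. LBINT v. u v * (coulomb_field (v - w) $ i * partial i \<psi> v))
     + u w * (\<Sum>i\<in>UNIV. LBINT v. u v * (\<Sum>j\<in>UNIV. landau_N (v - w) $ i $ j * partial j (partial i \<psi>) v)))"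
   proof -
    have "(LBINT v. (landau_N (v - w) *v G v) $ i * partial i \<psi> v) =
     - ((LBINT v. u v * (coulomb_field (v - w) $ i * partial i \<psi> v)) + (LBINT v. u v * (\<Sum>j\<in>UNIV. landau_N (v - w) $ i $ j * partial j (partial i \<psi>) v)))" for i
     by (rule p(4))
    then show ?thesis by (simp only: sum_negf sum.distrib mult_minus_right distrib_left)
   qed
   also have "u w * (\<Sum>i\<in>UNIV. LBINT v. u v * (coulomb_field (v - w) $ i * partial i \<psi> v)) = (LBINT v. T2 v w)"
    unfolding e2 integral_mult_right_zero by (subst Bochner_Integration.integral_sum) (auto intro: p(2))
   also have "u w * (\<Sum>i\<in>UNIV. LBINT v. u v * (\<Sum>j\<in>UNIV. landau_N (v - w) $ i $ j * partial j (partial i \<psi>) v)) = (LBINT v. T3 v w)"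
    unfolding e3 integral_mult_right_zero by (subst Bochner_Integration.integral_sum) (auto intro: p(3))
   finally show ?case .
  qed
 qed
 have "integral\<^sup>L ?M (case_prod T1) = (LBINT w. LBINT v. T1 v w)"
  by (rule lborel_pair.integral_snd[OF i1, symmetric])
 also have "... = (LBINT w. - ((LBINT v. T2 v w) + (LBINT v. T3 v w)))"
  using lborel_pair.integrable_snd[OF i1] lborel_pair.integrable_snd[OF i2] lborel_pair.integrable_snd[OF i3]
  by (intro integral_cong_AE byparts borel_measurable_uminus borel_measurable_add borel_measurable_integrable)
 also have "... = - ((LBINT w. LBINT v. T2 v w) + (LBINT w. LBINT v. T3 v w))"
  using lborel_pair.integrable_snd[OF i2] lborel_pair.integrable_snd[OF i3] by simp
 also have "... = - (integral\<^sup>L ?M (case_prod T2) + integral\<^sup>L ?M (case_prod T3))"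
  by (simp only: lborel_pair.integral_snd[OF i2] lborel_pair.integral_snd[OF i3])
 finally have I1: "integral\<^sup>L ?M (case_prod T1) = - (integral\<^sup>L ?M (case_prod T2) + integral\<^sup>L ?M (case_prod T3))" .
 have i2s: "integrable ?M (%(v, w). T2 w v)" and i3s: "integrable ?M (%(v, w). T3 w v)"
  using lborel_pair.integrable_product_swap[OF i2] lborel_pair.integrable_product_swap[OF i3] by simp_all
 have X: "(LINT (v, w)|lborel. u v * u w * frobenius (landau_N (v - w)) (hess \<psi> v + hess \<psi> w)) = 2 * integral\<^sup>L ?M (case_prod T3)"
 proof -
  have "landau_N (v - w) = landau_N (w - v)" for v w using landau_N_minus[of "w - v"] by simp
  then have "u v * u w * frobenius (landau_N (v - w)) (hess \<psi> v + hess \<psi> w) = T3 v w + T3 w v" for v w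
   by (simp add: T3_def frobenius_def sum.distrib distrib_left ac_simps)
  then have "(LINT (v, w)|lborel. u v * u w * frobenius (landau_N (v - w)) (hess \<psi> v + hess \<psi> w)) = (LINT p|?M. case_prod T3 p + (case p of (v, w) => T3 w v))"
   by (simp add: lborel_prod case_prod_unfold)
  also have "... = 2 * integral\<^sup>L ?M (case_prod T3)"
   using integral_pair_swap[OF m3] by (subst Bochner_Integration.integral_add[OF i3 i3s]) simp
  finally show ?thesis .
 qed
 have Y: "- (1 / (4 * pi)) * (LINT (v, w)|lborel. u v * u w * (((1 / norm (v - w) ^ 3) *\<^sub>R (v - w)) \<bullet> (?g v - ?g w))) = 2 * integral\<^sup>L ?M (case_prod T2)"
 proof -
  have "- (1 / (4 * pi)) * (u v * u w * (((1 / norm (v - w) ^ 3) *\<^sub>R (v - w)) \<bullet> (?g v - ?g w))) = T2 v w + T2 w v" for v w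
  proof -
   have "- (1 / (4 * pi)) * (((1 / norm (v - w) ^ 3) *\<^sub>R (v - w)) \<bullet> (?g v - ?g w)) = coulomb_field (v - w) \<bullet> (?g v - ?g w)"
    by (simp add: coulomb_field_def)
   also have "... = coulomb_field (v - w) \<bullet> ?g v + coulomb_field (w - v) \<bullet> ?g w"
    using coulomb_field_minus[of "w - v"] by (simp add: inner_diff_right)
   finally have "u v * u w * (- (1 / (4 * pi)) * (((1 / norm (v - w) ^ 3) *\<^sub>R (v - w)) \<bullet> (?g v - ?g w)))
    = u v * u w * (coulomb_field (v - w) \<bullet> ?g v + coulomb_field (w - v) \<bullet> ?g w)" by (rule arg_cong)
   then show ?thesis by (simp add: T2_def distrib_left ac_simps)
  qed
  then have "(LINT (v, w)|lborel. - (1 / (4 * pi)) * (u v * u w * (((1 / norm (v - w) ^ 3) *\<^sub>R (v - w)) \<bullet> (?g v - ?g w)))) = (LINT p|?M. case_prod T2 p + (case p of (v, w) => T2 w v))"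
   by (simp add: lborel_prod case_prod_unfold)
  also have "... = 2 * integral\<^sup>L ?M (case_prod T2)"
   using integral_pair_swap[OF m2] by (subst Bochner_Integration.integral_add[OF i2 i2s]) simp
  finally show ?thesis by (simp only: case_prod_unfold integral_mult_right_zero)
 qed
 show ?thesis unfolding Fl I1 X using Y[unfolded mult_minus_left] by linarith
qed

end

subsection \<open>The flux is controlled by the dissipation\<close>

lemma partial_scale:
 assumes "smooth u" shows "partial i (%x. u (c *\<^sub>R x)) x = c * partial i u (c *\<^sub>R x)"
proof -
 have *: "((%x. c *\<^sub>R x) has_derivative (%h. c *\<^sub>R h)) (at x)" by (auto intro!: derivative_eq_intros)
 have "linear (frechet_derivative u (at (c *\<^sub>R x)))"
  using smooth_has_derivative[OF assms] has_derivative_linear by blast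
 with partial_eqI[OF has_derivative_compose[OF * smooth_has_derivative[OF assms]], of i]
 show ?thesis by (simp add: partial_def linear_scale)
qed

definition cutoff :: "nat => real^3 => real" where
 "cutoff m w = bump (inverse (real (Suc m)) *\<^sub>R w) / bump (0::real^3)"

lemma bump0: "0 < bump (0::real^3)" by (rule bump_pos) simp

lemma cutoff_eq: "cutoff m w = (1 / bump (0::real^3)) * bump (inverse (real (Suc m)) *\<^sub>R w)"
 by (simp add: cutoff_def)

lemma cutoff_zero: "real (Suc m) < norm w ==> cutoff m w = 0"
 using bump_zero[of "inverse (real (Suc m)) *\<^sub>R w"] by (simp add: cutoff_def field_simps)

lemma smooth_cutoff: "smooth (cutoff m)"
 unfolding cutoff_eq[abs_def] by (intro smooth_mult smooth_const smooth_scale smooth_bump)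

lemma smooth_test_cutoff: "smooth_test UNIV (cutoff m)"
 by (rule smooth_testI[OF smooth_cutoff cutoff_zero])

lemma cutoff_tendsto: "(%m. cutoff m w) \<leadsto> 1"
proof -
 have "isCont bump (0 *\<^sub>R w)"
  using smooth_continuous[OF smooth_bump[where 'a="real^3"], of UNIV] by (simp add: continuous_on_eq_continuous_at)
 then have "(%m. bump (inverse (real (Suc m)) *\<^sub>R w)) \<leadsto> bump (0 *\<^sub>R w)"
  by (rule isCont_tendsto_compose) (intro tendsto_intros LIMSEQ_inverse_real_of_nat)
 from tendsto_divide[OF this tendsto_const[of "bump (0::real^3)"]] show ?thesis
  using bump0 by (simp add: cutoff_def)
qed

lemma cutoff_bound: obtains C where "0 <= C" "!!m w. \<bar>cutoff m w\<bar> <= C" "!!m w i. \<bar>partial i (cutoff m) w\<bar> <= C * inverse (real (Suc m))"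
proof -
 have t: "smooth_test UNIV (bump :: real^3 => real)"
  by (rule smooth_testI[OF smooth_bump, of 1]) (simp add: bump_zero)
 have "\<forall>i. \<exists>B. 0 < B \<and> (\<forall>v. \<bar>partial i (bump :: real^3 => real) v\<bar> <= B)"
  using smooth_test_bounded[OF smooth_test_partial[OF t]] by metis
 then obtain B where B: "!!i. 0 < B i" "!!i v. \<bar>partial i (bump :: real^3 => real) v\<bar> <= B i" by metis
 define b where "b = bump (0::real^3)"
 have b: "0 < b" using bump0 by (simp add: b_def)
 define C where "C = 1 / b + (\<Sum>i\<in>UNIV. B i) / b"
 have s0: "0 <= (\<Sum>i\<in>UNIV. B i)" by (intro sum_nonneg less_imp_le B)
 have BC: "B i / b <= C" for i
 proof -
  have "B i <= (\<Sum>i\<in>UNIV. B i)" by (rule member_le_sum) (auto intro: less_imp_le B)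
  then have "B i / b <= (\<Sum>i\<in>UNIV. B i) / b" using b by (intro divide_right_mono) auto
  then show ?thesis using b by (simp add: C_def add_increasing)
 qed
 show ?thesis
 proof (rule that)
  show "0 <= C" using b s0 by (simp add: C_def)
  show "\<bar>cutoff m w\<bar> <= C" for m w
  proof -
   have "\<bar>cutoff m w\<bar> <= 1 / b"
    using bump_nonneg[of "inverse (real (Suc m)) *\<^sub>R w"] bump_le_1[of "inverse (real (Suc m)) *\<^sub>R w"] b
    by (simp add: cutoff_def b_def[symmetric] divide_right_mono)
   also have "... <= C" using s0 b by (simp add: C_def)
   finally show ?thesis .
  qed
  show "\<bar>partial i (cutoff m) w\<bar> <= C * inverse (real (Suc m))" for m w i
  proof -
   have "partial i (cutoff m) w = (1 / b) * (inverse (real (Suc m)) * partial i bump (inverse (real (Suc m)) *\<^sub>R w))"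
    unfolding cutoff_eq[abs_def] b_def
    by (subst partial_mult[OF smooth_const smooth_scale[OF smooth_bump]]) (simp only: partial_const partial_scale[OF smooth_bump] mult_zero_left add_0_right)
   then have "\<bar>partial i (cutoff m) w\<bar> = (\<bar>partial i bump (inverse (real (Suc m)) *\<^sub>R w)\<bar> / b) * inverse (real (Suc m))"
    using b by (simp add: abs_mult)
   also have "... <= (B i / b) * inverse (real (Suc m))"
    using b by (intro mult_right_mono divide_right_mono B) auto
   also have "... <= C * inverse (real (Suc m))" by (intro mult_right_mono BC) simp
   finally show ?thesis .
  qed
 qed
qed

context sobolev_density
begin

definition pair_flux :: "real^3 => real^3 => real^3" where
 "pair_flux v w = landau_N (v - w) *v (u w *\<^sub>R G v - u v *\<^sub>R G w)"

definition pair_dissipation :: "real^3 => real^3 => real" where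
 "pair_dissipation v w = u v * u w * ((landau_N (v - w) *v (G v /\<^sub>R u v - G w /\<^sub>R u w)) \<bullet> (G v /\<^sub>R u v - G w /\<^sub>R u w))"

lemma pair_flux_borel[measurable]: "(%p. pair_flux (fst p) (snd p)) : borel_measurable (lborel \<Otimes>\<^sub>M lborel)"
 unfolding pair_flux_def by measurable

lemma pair_flux_borel'[measurable]: "pair_flux v : Borel"
 unfolding pair_flux_def[abs_def] by measurable

lemma pair_dissipation_borel[measurable]: "(%p. pair_dissipation (fst p) (snd p)) : borel_measurable (lborel \<Otimes>\<^sub>M lborel)"
 unfolding pair_dissipation_def by measurable

lemma pair_dissipation_nonneg: "0 <= pair_dissipation v w"
 unfolding pair_dissipation_def by (intro mult_nonneg_nonneg u0 landau_N_form_nonneg)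

text \<open>Where \<open>u\<close> vanishes its gradient vanishes almost everywhere, so that the pair flux is
 $u(v)u(w)N(v-w)\xi$ at almost every pair of points.\<close>

lemma norm_pair_flux_le:
 "AEL v. AEL w. norm (pair_flux v w) <= u v * (u w * norm (v - w) powr (-1)) + pair_dissipation v w"
proof -
 have z: "AEL v. u v = 0 --> G v = 0" by (rule borel_weak_grad_zero_set[OF wg u0])
 show ?thesis using z
 proof eventually_elim
  case v: (elim v)
  show ?case using z
  proof eventually_elim
   case w: (elim w)
   show ?case
   proof (cases "u v = 0 \<or> u w = 0")
    case True
    then have "u w *\<^sub>R G v - u v *\<^sub>R G w = 0" using v w by auto
    then have "pair_flux v w = landau_N (v - w) *v 0" unfolding pair_flux_def by (rule arg_cong)
    then have "pair_flux v w = 0" by simp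
    then show ?thesis using pair_dissipation_nonneg[of v w] u0[of v] u0[of w] by simp
   next
    case False
    then have pos: "0 < u v" "0 < u w" using u0[of v] u0[of w] by auto
    let ?\<xi> = "G v /\<^sub>R u v - G w /\<^sub>R u w"
    have "u w *\<^sub>R G v - u v *\<^sub>R G w = (u v * u w) *\<^sub>R ?\<xi>"
    proof -
     have e: "u v * u w * inverse (u v) = u w" "u v * u w * inverse (u w) = u v" using pos by simp_all
     show ?thesis by (simp only: scaleR_diff_right scaleR_scaleR e)
    qed
    then have "pair_flux v w = (u v * u w) *\<^sub>R (landau_N (v - w) *v ?\<xi>)"
     by (simp add: pair_flux_def matrix_vector_mult_scaleR)
    then have "norm (pair_flux v w) = (u v * u w) * norm (landau_N (v - w) *v ?\<xi>)" using pos by simp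
    also have "... <= (u v * u w) * (1 / norm (v - w) + (landau_N (v - w) *v ?\<xi>) \<bullet> ?\<xi>)"
     using pos by (intro mult_left_mono norm_landau_N_vec_le_form) auto
    finally show ?thesis by (simp add: pair_dissipation_def norm_powr_minus_1 algebra_simps)
   qed
  qed
 qed
qed

text \<open>The term with $\nabla u(w)$ is integrated by parts in $w$ after multiplication with a cutoff
 function at scale $m$, and $m\to\infty$. The two parts of the pair flux need not be integrable
 separately at infinity.\<close>

lemma AE_flux_eq_integral_pair_flux:
 "AEL v. integrable lborel (pair_flux v) --> flux v = (LBINT w. pair_flux v w)"
proof -
 obtain C where C: "0 <= C" "!!m w. \<bar>cutoff m w\<bar> <= C" "!!m w i. \<bar>partial i (cutoff m) w\<bar> <= C * inverse (real (Suc m))"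
  using cutoff_bound by blast
 note [measurable] = smooth_borel[OF smooth_cutoff] smooth_borel[OF smooth_partial[OF smooth_cutoff]]
 have "AEL v. (NBALL (real (Suc m)) (%w. ennreal (\<bar>u w\<bar> * norm (w - v) powr (-2)))) < \<infinity>" for m
  by (rule AE_local_potential_finite[OF lu]) auto
 then have a2: "AEL v. \<forall>m. (NBALL (real (Suc m)) (%w. ennreal (\<bar>u w\<bar> * norm (w - v) powr (-2)))) < \<infinity>"
  unfolding AE_all_countable by blast
 have "AEL v. (NBALL (real (Suc m)) (%w. ennreal (\<bar>G w $ j\<bar> * norm (w - v) powr (-1)))) < \<infinity>" for m j
  by (rule AE_local_potential_finite[OF lG]) auto
 then have a1: "AEL v. \<forall>m j. (NBALL (real (Suc m)) (%w. ennreal (\<bar>G w $ j\<bar> * norm (w - v) powr (-1)))) < \<infinity>"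
  unfolding AE_all_countable by blast
 show ?thesis using a1 a2 AE_quadratic
 proof eventually_elim
  case (elim v)
  show ?case
  proof
   assume ih: "integrable lborel (pair_flux v)"
   have "flux v $ i = (LBINT w. pair_flux v w) $ i" for i
   proof -
    let ?a = "%w. u w * (landau_N (v - w) *v G v) $ i"
    let ?b = "%w. (landau_N (v - w) *v G w) $ i"
    let ?k = "%w. u w * coulomb_field (v - w) $ i"
    let ?r = "%m w. u w * (\<Sum>j\<in>UNIV. landau_N (v - w) $ i $ j * partial j (cutoff m) w)"
    have Nsym: "landau_N (w - v) = landau_N (v - w)" for w using landau_N_minus[of "v - w"] by simp
    have Ksym: "coulomb_field (w - v) = - coulomb_field (v - w)" for w using coulomb_field_minus[of "v - w"] by simp
    note p = landau_kernel_integral_by_parts[OF wg smooth_test_cutoff cutoff_zero spec[OF elim(2)] spec[OF spec[OF elim(1)]], where i=i, unfolded Nsym Ksym]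
    have ib: "integrable lborel (%w. ?b w * cutoff m w)" for m by (rule p(1))
    have ik: "integrable lborel (%w. ?k w * cutoff m w)" for m
     using p(2)[of m] by (simp add: mult.assoc)
    have ir: "integrable lborel (?r m)" for m by (rule p(3))
    have eb: "(LBINT w. ?b w * cutoff m w) = (LBINT w. ?k w * cutoff m w) - (LBINT w. ?r m w)" for m
     using p(4)[of m] by (simp add: mult.assoc)
    have Ia: "integrable lborel ?a"
     using integrable_bounded_linear[OF bounded_linear_vec_nth[of i] integrable_Ax[where v=v and x="G v"]] by simp
    have Ik: "integrable lborel ?k"
     using integrable_bounded_linear[OF bounded_linear_vec_nth[of i] borel_B_nth(1)[OF u_borel u0 elim(3)]] by simp
    have ia: "integrable lborel (%w. ?a w * cutoff m w)" for m
     by (rule Bochner_Integration.integrable_bound[OF integrable_mult_left[OF Ia, of C]])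
      (use C in \<open>auto simp: abs_mult intro!: AE_I2 mult_left_mono\<close>)
    have LIM: "(%m. LBINT w. f w * cutoff m w) \<leadsto> (LBINT w. f w)"
     if f: "integrable lborel f" for f :: "real^3 => real"
    proof (rule integral_dominated_convergence[where w="%w. \<bar>f w\<bar> * C"])
     show "AEL w. (%m. f w * cutoff m w) \<leadsto> f w"
      using tendsto_mult[OF tendsto_const cutoff_tendsto] by (intro AE_I2) fastforce
     show "AEL w. norm (f w * cutoff m w) <= \<bar>f w\<bar> * C" for m
      using C by (auto simp: abs_mult intro!: AE_I2 mult_left_mono)
    qed (use f in auto)
    have rlim: "(%m. LBINT w. ?r m w) \<leadsto> 0"
    proof (rule Lim_null_comparison)
     define P where "P = enn2real (NBINT w. ennreal (u w * norm (v - w) powr (-1)))"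
     have P: "(NBINT w. ennreal (u w * norm (v - w) powr (-1))) = ennreal P" "0 <= P"
      using Newton_finite[of v] by (auto simp: P_def less_top)
     show "\<forall>\<^sub>F m in sequentially. norm (LBINT w. ?r m w) <= (3 * C * P) * inverse (real (Suc m))"
     proof (intro always_eventually allI)
      fix m
      have "ennreal (norm (LBINT w. ?r m w)) <= (NBINT w. ennreal (norm (?r m w)))"
       by (rule integral_norm_bound_ennreal[OF ir])
      also have "... <= (NBINT w. ennreal (3 * C * inverse (real (Suc m))) * ennreal (u w * norm (v - w) powr (-1)))"
      proof (intro nn_integral_mono)
       fix w
       have "\<bar>\<Sum>j\<in>UNIV. landau_N (v - w) $ i $ j * partial j (cutoff m) w\<bar> <= (\<Sum>j\<in>(UNIV::3 set). norm (v - w) powr (-1) * (C * inverse (real (Suc m))))"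
        by (rule order_trans[OF sum_abs]) (unfold abs_mult, intro sum_mono mult_mono abs_landau_N_nth_le C(3), auto)
       also have "... = 3 * C * inverse (real (Suc m)) * norm (v - w) powr (-1)" by simp
       finally have "u w * \<bar>\<Sum>j\<in>UNIV. landau_N (v - w) $ i $ j * partial j (cutoff m) w\<bar> <= u w * (3 * C * inverse (real (Suc m)) * norm (v - w) powr (-1))"
        by (rule mult_left_mono[OF _ u0])
       then have "norm (?r m w) <= 3 * C * inverse (real (Suc m)) * (u w * norm (v - w) powr (-1))"
        using u0[of w] by (simp only: real_norm_def abs_mult abs_of_nonneg ac_simps)
       then have "ennreal (norm (?r m w)) <= ennreal (3 * C * inverse (real (Suc m)) * (u w * norm (v - w) powr (-1)))" by (rule ennreal_leI)
       also have "... = ennreal (3 * C * inverse (real (Suc m))) * ennreal (u w * norm (v - w) powr (-1))"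
        using C(1) u0[of w] by (intro ennreal_mult) auto
       finally show "ennreal (norm (?r m w)) <= ennreal (3 * C * inverse (real (Suc m))) * ennreal (u w * norm (v - w) powr (-1))" .
      qed
      also have "... = ennreal (3 * C * inverse (real (Suc m))) * ennreal P"
       unfolding P(1)[symmetric] by (rule nn_integral_cmult) measurable
      also have "... = ennreal (3 * C * inverse (real (Suc m)) * P)"
       using C(1) P(2) by (intro ennreal_mult[symmetric]) auto
      finally have "norm (LBINT w. ?r m w) <= 3 * C * inverse (real (Suc m)) * P"
       using C(1) P(2) by (subst (asm) ennreal_le_iff) auto
      then show "norm (LBINT w. ?r m w) <= (3 * C * P) * inverse (real (Suc m))"
       by (simp only: ac_simps)
     qed
     show "(%m. (3 * C * P) * inverse (real (Suc m))) \<leadsto> 0"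
      using tendsto_mult[OF tendsto_const LIMSEQ_inverse_real_of_nat, of "3 * C * P"] by simp
    qed
    have hi: "pair_flux v w $ i = ?a w - u v * ?b w" for w
     by (simp add: pair_flux_def matrix_vector_mult_diff_distrib matrix_vector_mult_scaleR)
    have eq: "(LBINT w. pair_flux v w $ i * cutoff m w) = (LBINT w. ?a w * cutoff m w) - u v * ((LBINT w. ?k w * cutoff m w) - (LBINT w. ?r m w))" for m
    proof -
     have "(LBINT w. pair_flux v w $ i * cutoff m w) = (LBINT w. ?a w * cutoff m w - u v * (?b w * cutoff m w))"
      unfolding hi by (intro Bochner_Integration.integral_cong refl) (simp add: algebra_simps)
     also have "... = (LBINT w. ?a w * cutoff m w) - u v * (LBINT w. ?b w * cutoff m w)"
      using ia[of m] ib[of m] by (subst Bochner_Integration.integral_diff) auto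
     finally show ?thesis unfolding eb .
    qed
    have ihi: "integrable lborel (%w. pair_flux v w $ i)"
     by (rule integrable_bounded_linear[OF bounded_linear_vec_nth ih])
    have "(%m. LBINT w. pair_flux v w $ i * cutoff m w) \<leadsto> (LBINT w. ?a w) - u v * ((LBINT w. ?k w) - 0)"
     unfolding eq by (intro tendsto_intros LIM Ia Ik rlim)
    from LIMSEQ_unique[OF LIM[OF ihi] this]
    have "(LBINT w. pair_flux v w $ i) = (LBINT w. ?a w) - u v * (LBINT w. ?k w)" by simp
    moreover have "(LBINT w. pair_flux v w $ i) = (LBINT w. pair_flux v w) $ i"
     by (rule integral_bounded_linear[OF bounded_linear_vec_nth ih])
    moreover have "(borel_A u v *v G v) $ i = (LBINT w. ?a w)"
     using integral_bounded_linear[OF bounded_linear_vec_nth[of i] integrable_Ax[where v=v and x="G v"]] by (simp add: borel_A_vec)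
    moreover have "borel_B u v $ i = (LBINT w. ?k w)" by (rule borel_B_nth(2)[OF u_borel u0 elim(3)])
    ultimately show ?thesis by (simp add: flux_def)
   qed
   then show "flux v = (LBINT w. pair_flux v w)" by (simp add: vec_eq_iff)
  qed
 qed
qed

text \<open>The first summand stems from $|z|^{-1}$, the second from $N\xi\cdot\xi$ in the bound for
 $|N\xi|$. If the right-hand side is infinite at \<open>v\<close> there is nothing to show; otherwise the pair flux
 is integrable in \<open>w\<close> and its integral is the flux.\<close>

lemma flux_L1_bound:
 "(NBALL R (%v. ennreal (norm (flux v))))
  <= pair_energy u R + (NBINT v. (NBINT w. ennreal (pair_dissipation v w)))"
proof -
 let ?E = "%v. \<integral>\<^sup>+w. ennreal (u v * (u w * norm (v - w) powr (-1))) \<partial>lborel"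
 let ?D = "%v. \<integral>\<^sup>+w. ennreal (pair_dissipation v w) \<partial>lborel"
 have b: "AEL v. norm v <= R --> ennreal (norm (flux v)) <= ?E v + ?D v"
  using AE_flux_eq_integral_pair_flux norm_pair_flux_le
 proof eventually_elim
  case (elim v)
  show ?case
  proof
   have md: "(%w. pair_dissipation v w) : Borel" unfolding pair_dissipation_def by measurable
   have hb: "(NBINT w. ennreal (norm (pair_flux v w))) <= ?E v + ?D v"
   proof -
    have "(NBINT w. ennreal (norm (pair_flux v w))) <= (NBINT w. ennreal (u v * (u w * norm (v - w) powr (-1))) + ennreal (pair_dissipation v w))"
    proof (rule nn_integral_mono_AE, use elim(2) in eventually_elim)
     case (elim w)
     have "ennreal (norm (pair_flux v w)) <= ennreal (u v * (u w * norm (v - w) powr (-1)) + pair_dissipation v w)"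
      using elim by (rule ennreal_leI)
     also have "... = ennreal (u v * (u w * norm (v - w) powr (-1))) + ennreal (pair_dissipation v w)"
      using u0[of v] u0[of w] pair_dissipation_nonneg[of v w] by (intro ennreal_plus) auto
     finally show ?case .
    qed
    also have "... = ?E v + ?D v" by (rule nn_integral_add) (use md in auto)
    finally show ?thesis .
   qed
   show "ennreal (norm (flux v)) <= ?E v + ?D v"
   proof (cases "(NBINT w. ennreal (norm (pair_flux v w))) < \<infinity>")
    case True
    then have i: "integrable lborel (pair_flux v)" by (intro integrableI_bounded) auto
    with elim(1) have "flux v = (LBINT w. pair_flux v w)" by blast
    then have "ennreal (norm (flux v)) <= (NBINT w. ennreal (norm (pair_flux v w)))"
     using integral_norm_bound_ennreal[OF i] by simp
    then show ?thesis using hb by (rule order_trans)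
   next
    case False
    then have "?E v + ?D v = top" using hb by (simp add: less_top[symmetric] top_unique)
    then show ?thesis by (simp only: top_greatest)
   qed
  qed
 qed
 have "(NBALL R (%v. ennreal (norm (flux v)))) <= (NBINT v. ?E v * ball_ind R v + ?D v)"
 proof (rule nn_integral_mono_AE, use b in eventually_elim)
  case (elim v)
  then show ?case by (cases "norm v <= R") auto
 qed
 also have "... = pair_energy u R + (NBINT v. ?D v)"
  unfolding pair_energy_def by (rule nn_integral_add) measurable
 finally show ?thesis .
qed

end

section \<open>Joint measurability of weak gradients\<close>

lemma L1_loc_test_tendsto:
 fixes f :: "nat => real^3 => real"
 assumes f: "!!k. loc_int (f k)" and g: "loc_int g" and \<psi>: "smooth_test UNIV \<psi>"
  and lim: "!!R. (%k. \<integral>\<^sup>+x\<in>cball 0 R. ennreal \<bar>f k x - g x\<bar> \<partial>lborel) \<leadsto> 0"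
 shows "(%k. LBINT x. f k x * \<psi> x) \<leadsto> (LBINT x. g x * \<psi> x)"
proof -
 obtain R where R: "0 < R" "smooth \<psi>" "!!v. R <= norm v ==> \<psi> v = 0" using smooth_testE[OF \<psi>] by blast
 obtain B where B: "0 < B" "!!x. \<bar>\<psi> x\<bar> <= B" using smooth_test_bounded[OF \<psi>] by blast
 have [measurable]: "f k : Borel" "g : Borel" for k using f g by auto
 note [measurable] = smooth_borel[OF R(2)]
 let ?d = "%k. \<integral>\<^sup>+x\<in>cball 0 R. ennreal \<bar>f k x - g x\<bar> \<partial>lborel"
 have "(%k. (LBINT x. f k x * \<psi> x) - (LBINT x. g x * \<psi> x)) \<leadsto> 0"
 proof (rule Lim_null_comparison)
  have "(%k. enn2real (?d k)) \<leadsto> 0" using lim[of R] by (intro tendsto_enn2real) simp_all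
  from tendsto_mult_right_zero[OF this, of B] show "(%k. B * enn2real (?d k)) \<leadsto> 0" .
  show "\<forall>\<^sub>F k in sequentially. norm ((LBINT x. f k x * \<psi> x) - (LBINT x. g x * \<psi> x)) <= B * enn2real (?d k)"
  proof (intro always_eventually allI)
   fix k
   have i: "integrable lborel (%x. f k x * \<psi> x)" "integrable lborel (%x. g x * \<psi> x)"
    using loc_int_times_test f g \<psi> by auto
   have dfin: "?d k < \<infinity>" using loc_int_finite[OF loc_int_lincomb[OF f[of k] g, of 1 "-1"], of R] by simp
   have "ennreal (norm (LBINT x. f k x * \<psi> x - g x * \<psi> x)) <= (NBINT x. ennreal (norm (f k x * \<psi> x - g x * \<psi> x)))"
    by (rule integral_norm_bound_ennreal) (use i in auto)
   also have "... <= (NBINT x. ennreal B * (ennreal \<bar>f k x - g x\<bar> * ball_ind R x))"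
   proof (intro nn_integral_mono)
    fix x
    show "ennreal (norm (f k x * \<psi> x - g x * \<psi> x)) <= ennreal B * (ennreal \<bar>f k x - g x\<bar> * ball_ind R x)"
    proof (cases "norm x <= R")
     case True
     have "\<bar>f k x - g x\<bar> * \<bar>\<psi> x\<bar> <= \<bar>f k x - g x\<bar> * B" by (intro mult_left_mono B) simp
     then have "norm (f k x * \<psi> x - g x * \<psi> x) <= B * \<bar>f k x - g x\<bar>"
      by (simp only: left_diff_distrib[symmetric] real_norm_def abs_mult) (simp add: mult.commute)
     then show ?thesis using True B(1) by (simp add: ennreal_mult[symmetric] ennreal_leI)
    next
     case False then show ?thesis using R(3)[of x] by simp
    qed
   qed
   also have "... = ennreal B * ?d k" by (rule nn_integral_cmult) measurable
   also have "... = ennreal (B * enn2real (?d k))" using dfin B(1) by (simp add: ennreal_mult less_top)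
   finally have "norm (LBINT x. f k x * \<psi> x - g x * \<psi> x) <= B * enn2real (?d k)"
    using B(1) by (subst (asm) ennreal_le_iff) auto
   then show "norm ((LBINT x. f k x * \<psi> x) - (LBINT x. g x * \<psi> x)) <= B * enn2real (?d k)"
    using i by simp
  qed
 qed
 then show ?thesis by (rule LIM_zero_cancel)
qed

lemma smooth_integral_by_parts:
 assumes m: "smooth m" and \<psi>: "smooth_test UNIV \<psi>"
 shows "(LBINT v. m v * partial i \<psi> v) = - (LBINT v. partial i m v * \<psi> v)"
proof -
 have s: "smooth \<psi>" using \<psi> by (simp add: smooth_test_iff)
 have i: "integrable lborel (%v. m v * partial i \<psi> v)" "integrable lborel (%v. partial i m v * \<psi> v)"
  by (intro loc_int_times_test loc_int_of_cont smooth_continuous smooth_partial smooth_test_partial m \<psi>)+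
 have "0 = (LBINT v. partial i (%v. \<psi> v * m v) v)"
  by (rule integral_partial_zero[OF smooth_test_mult[OF \<psi> m], symmetric])
 also have "... = (LBINT v. m v * partial i \<psi> v + partial i m v * \<psi> v)"
  by (intro Bochner_Integration.integral_cong refl) (simp add: partial_mult[OF s m])
 also have "... = (LBINT v. m v * partial i \<psi> v) + (LBINT v. partial i m v * \<psi> v)" using i by simp
 finally show ?thesis by simp
qed

definition grad_dist :: "(nat => 3 => real^3 => real) => nat => nat => nat => ennreal" where
 "grad_dist g n m k = (NBALL (real k) (%v. ennreal (\<Sum>i\<in>UNIV. \<bar>g n i v - g m i v\<bar>)))"

text \<open>If the gradients of the mollifications are Cauchy in $L^1_{loc}$, then along a fast subsequence they
 converge almost everywhere, and the pointwise limit is the weak gradient.\<close>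

lemma borel_weak_grad_limit:
 assumes u: "loc_int u" and r: "!!k. r k \<ge> k"
  and c: "!!k n. n \<ge> k ==> grad_dist (%n i. partial i (moll n u)) (r n) (r k) k <= ennreal ((1/2) ^ k)"
 shows "borel_weak_grad u (%v. \<chi> i. lim (%k. partial i (moll (r k) u) v))"
proof -
 let ?g = "%k i. partial i (moll (r k) u)"
 define G where "G i v = lim (%k. ?g k i v)" for i v
 have sg: "smooth (moll n u)" for n by (rule smooth_moll[OF u])
 note [measurable] = smooth_borel[OF smooth_partial[OF sg]]
 have Gm[measurable]: "G i : Borel" for i unfolding G_def[abs_def] by measurable
 have "AEL x. summable (%k. \<bar>\<Sum>i\<in>UNIV. \<bar>?g (Suc k) i x - ?g k i x\<bar>\<bar>)"
 proof (rule AE_summable_of_fast_L1_loc)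
  show "(NBALL (real k) (%x. ennreal \<bar>\<Sum>i\<in>UNIV. \<bar>?g (Suc k) i x - ?g k i x\<bar>\<bar>)) <= ennreal ((1/2) ^ k)" for k
   using c[of k "Suc k"] by (simp add: grad_dist_def abs_of_nonneg sum_nonneg)
 qed measurable
 then have conv: "AEL x. \<forall>i. (%k. ?g k i x) \<leadsto> G i x"
 proof eventually_elim
  case (elim x)
  show ?case
  proof
   fix i
   have "summable (%k. \<bar>?g (Suc k) i x - ?g k i x\<bar>)"
   proof (rule summable_comparison_test'[OF elim])
    fix k :: nat
    show "norm \<bar>?g (Suc k) i x - ?g k i x\<bar> <= \<bar>\<Sum>i\<in>UNIV. \<bar>?g (Suc k) i x - ?g k i x\<bar>\<bar>"
     using member_le_sum[of i UNIV "%i. \<bar>?g (Suc k) i x - ?g k i x\<bar>"] by (simp add: abs_of_nonneg sum_nonneg)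
   qed
   then have "summable (%k. ?g (Suc k) i x - ?g k i x)" by (rule summable_rabs_cancel)
   then have "convergent (%n. \<Sum>k<n. ?g (Suc k) i x - ?g k i x)" by (simp add: summable_iff_convergent)
   then have "convergent (%n. ?g n i x - ?g 0 i x)" by (simp only: sum_lessThan_telescope[of "%k. ?g k i x"])
   then obtain l where "(%n. ?g n i x - ?g 0 i x) \<leadsto> l" by (auto simp: convergent_def)
   from tendsto_add[OF this tendsto_const[of "?g 0 i x"]] have "convergent (%n. ?g n i x)"
    by (auto simp: convergent_def)
   then show "(%k. ?g k i x) \<leadsto> G i x" unfolding G_def by (simp add: convergent_LIMSEQ_iff)
  qed
 qed
 have fatou: "(NBALL (real k) (%x. ennreal \<bar>?g k i x - G i x\<bar>)) <= ennreal ((1/2) ^ k)" for k i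
 proof -
  have "(NBALL (real k) (%x. ennreal \<bar>?g k i x - G i x\<bar>))
   = (NBINT x. liminf (%n. ennreal \<bar>?g n i x - ?g k i x\<bar> * ball_ind (real k) x))"
  proof (rule nn_integral_cong_AE, use conv in eventually_elim)
   case (elim x)
   have "(%n. ennreal \<bar>?g n i x - ?g k i x\<bar>) \<leadsto> ennreal \<bar>G i x - ?g k i x\<bar>"
    by (intro tendsto_ennrealI tendsto_intros spec[OF elim])
   then have "(%n. ennreal \<bar>?g n i x - ?g k i x\<bar> * ball_ind (real k) x) \<leadsto> ennreal \<bar>G i x - ?g k i x\<bar> * ball_ind (real k) x"
    by (cases "norm x <= real k") auto
   from lim_imp_Liminf[OF _ this] show ?case by (simp add: abs_minus_commute)
  qed
  also have "... <= liminf (%n. \<integral>\<^sup>+x. ennreal \<bar>?g n i x - ?g k i x\<bar> * ball_ind (real k) x \<partial>lborel)"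
   by (rule nn_integral_liminf) measurable
  also have "... <= ennreal ((1/2) ^ k)"
  proof (rule Liminf_le)
   show "\<forall>\<^sub>F n in sequentially. (NBINT x. ennreal \<bar>?g n i x - ?g k i x\<bar> * ball_ind (real k) x) <= ennreal ((1/2) ^ k)"
    using eventually_ge_at_top[of k]
   proof eventually_elim
    case (elim n)
    have "(NBINT x. ennreal \<bar>?g n i x - ?g k i x\<bar> * ball_ind (real k) x) <= grad_dist (%n i. partial i (moll n u)) (r n) (r k) k"
     unfolding grad_dist_def
     by (intro nn_integral_mono mult_right_mono ennreal_leI) (auto intro: member_le_sum[where f="%i. \<bar>?g n i x - ?g k i x\<bar>" for x])
    then show ?case using c[OF elim] by (rule order_trans)
   qed
  qed simp
  finally show ?thesis .
 qed
 have lg: "loc_int (?g k i)" for k i by (intro loc_int_of_cont smooth_continuous smooth_partial sg)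
 have lG: "loc_int (G i)" for i
  unfolding loc_int_def
 proof (intro conjI Gm allI)
  fix R
  obtain k where k: "R <= real k" using real_arch_simple by blast
  have "(NBALL R (%x. ennreal \<bar>G i x\<bar>)) <= (NBINT x. ennreal \<bar>?g k i x - G i x\<bar> * ball_ind (real k) x + ennreal \<bar>?g k i x\<bar> * ball_ind (real k) x)"
  proof (intro nn_integral_mono)
   fix x
   have "ennreal \<bar>G i x\<bar> <= ennreal (\<bar>?g k i x - G i x\<bar> + \<bar>?g k i x\<bar>)" by (intro ennreal_leI) simp
   also have "... = ennreal \<bar>?g k i x - G i x\<bar> + ennreal \<bar>?g k i x\<bar>" by (rule ennreal_plus) auto
   finally show "ennreal \<bar>G i x\<bar> * ball_ind R x <= ennreal \<bar>?g k i x - G i x\<bar> * ball_ind (real k) x + ennreal \<bar>?g k i x\<bar> * ball_ind (real k) x"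
    using k by (auto simp: indicator_def)
  qed
  also have "... = (NBALL (real k) (%x. ennreal \<bar>?g k i x - G i x\<bar>)) + (NBALL (real k) (%x. ennreal \<bar>?g k i x\<bar>))"
   by (rule nn_integral_add) measurable
  also have "... < \<infinity>" using le_less_trans[OF fatou ennreal_less_top] loc_int_finite[OF lg] by simp
  finally show "(NBALL R (%x. ennreal \<bar>G i x\<bar>)) < \<infinity>" .
 qed
 have Llim: "(%k. \<integral>\<^sup>+x\<in>cball 0 R. ennreal \<bar>?g k i x - G i x\<bar> \<partial>lborel) \<leadsto> 0" for R i
 proof (rule tendsto_sandwich[OF _ _ tendsto_const])
  show "(%k. ennreal ((1/2) ^ k)) \<leadsto> 0"
   using tendsto_ennrealI[OF LIMSEQ_realpow_zero[of "1/2"]] by simp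
  obtain K where K: "R <= real K" using real_arch_simple by blast
  show "\<forall>\<^sub>F k in sequentially. (NBALL R (%x. ennreal \<bar>?g k i x - G i x\<bar>)) <= ennreal ((1/2) ^ k)"
   using eventually_ge_at_top[of K]
  proof eventually_elim
   case (elim k)
   have "(NBALL R (%x. ennreal \<bar>?g k i x - G i x\<bar>)) <= (NBALL (real k) (%x. ennreal \<bar>?g k i x - G i x\<bar>))"
    using K elim by (intro nn_integral_mono) (auto simp: indicator_def)
   then show ?case using fatou by (rule order_trans)
  qed
 qed simp
 have rtop: "filterlim r at_top sequentially"
  using r by (intro filterlim_at_top_mono[OF filterlim_ident]) (auto intro: always_eventually)
 show ?thesis unfolding borel_weak_grad_def G_def[symmetric]
 proof (intro conjI allI impI u)
  show "(%v. \<chi> i. G i v) : Borel" by (rule borel_measurable_cartesian) simp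
  show "loc_int (%v. (\<chi> i. G i v) $ i)" for i using lG by simp
  fix \<psi> :: "real^3 => real" and i assume \<psi>: "smooth_test UNIV \<psi>"
  have 1: "(%k. LBINT v. moll (r k) u v * partial i \<psi> v) \<leadsto> (LBINT v. u v * partial i \<psi> v)"
   by (rule L1_loc_test_tendsto[OF loc_int_of_cont[OF smooth_continuous[OF sg]] u smooth_test_partial[OF \<psi>] filterlim_compose[OF moll_L1_loc[OF u] rtop]])
  have 2: "(%k. LBINT v. ?g k i v * \<psi> v) \<leadsto> (LBINT v. G i v * \<psi> v)"
   by (rule L1_loc_test_tendsto[OF lg lG \<psi> Llim])
  have "(%k. LBINT v. moll (r k) u v * partial i \<psi> v) \<leadsto> - (LBINT v. G i v * \<psi> v)"
   unfolding smooth_integral_by_parts[OF sg \<psi>] by (rule tendsto_minus[OF 2])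
  from LIMSEQ_unique[OF 1 this]
  show "(LBINT v. u v * partial i \<psi> v) = - (LBINT v. (\<chi> i. G i v) $ i * \<psi> v)" by simp
 qed
qed

lemma weakly_differentiable_imp_Cauchy:
 assumes w: "borel_weak_grad u G"
 shows "\<exists>N. \<forall>n\<ge>N. \<forall>m\<ge>N. grad_dist (%n i. partial i (moll n u)) n m k <= ennreal ((1/2) ^ j)"
proof -
 have l: "loc_int (%v. G v $ i)" for i using w by (auto simp: borel_weak_grad_def)
 have [measurable]: "(%v. G v $ i) : Borel" for i using l by auto
 note [measurable] = moll_borel[OF l]
 define e where "e n = (\<Sum>i\<in>UNIV. \<integral>\<^sup>+v\<in>cball 0 (real k). ennreal \<bar>moll n (%v. G v $ i) v - G v $ i\<bar> \<partial>lborel)" for n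
 have "e \<leadsto> (\<Sum>i\<in>(UNIV::3 set). 0)" unfolding e_def by (intro tendsto_sum moll_L1_loc l)
 then have "e \<leadsto> 0" by simp
 then have "\<forall>\<^sub>F n in sequentially. e n < ennreal ((1/2) ^ Suc j)" by (rule order_tendstoD) simp
 then obtain N where N: "!!n. n \<ge> N ==> e n < ennreal ((1/2) ^ Suc j)" by (auto simp: eventually_sequentially)
 have "grad_dist (%n i. partial i (moll n u)) n m k <= ennreal ((1/2) ^ j)" if "n \<ge> N" "m \<ge> N" for n m
 proof -
  let ?d = "%n i v. ennreal \<bar>moll n (%v. G v $ i) v - G v $ i\<bar> * ball_ind (real k) v"
  have "grad_dist (%n i. partial i (moll n u)) n m k <= (NBINT v. (\<Sum>i\<in>UNIV. ?d n i v) + (\<Sum>i\<in>UNIV. ?d m i v))"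
   unfolding grad_dist_def partial_moll[OF w]
  proof (intro nn_integral_mono)
   fix v
   have "(\<Sum>i\<in>UNIV. \<bar>moll n (%v. G v $ i) v - moll m (%v. G v $ i) v\<bar>)
    <= (\<Sum>i\<in>UNIV. \<bar>moll n (%v. G v $ i) v - G v $ i\<bar> + \<bar>moll m (%v. G v $ i) v - G v $ i\<bar>)"
    by (intro sum_mono) simp
   then have "ennreal (\<Sum>i\<in>UNIV. \<bar>moll n (%v. G v $ i) v - moll m (%v. G v $ i) v\<bar>)
    <= ennreal ((\<Sum>i\<in>UNIV. \<bar>moll n (%v. G v $ i) v - G v $ i\<bar>) + (\<Sum>i\<in>UNIV. \<bar>moll m (%v. G v $ i) v - G v $ i\<bar>))"
    by (intro ennreal_leI) (simp add: sum.distrib)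
   also have "... = (\<Sum>i\<in>UNIV. ennreal \<bar>moll n (%v. G v $ i) v - G v $ i\<bar>) + (\<Sum>i\<in>UNIV. ennreal \<bar>moll m (%v. G v $ i) v - G v $ i\<bar>)"
    by (simp add: ennreal_plus sum_nonneg sum_ennreal)
   finally show "ennreal (\<Sum>i\<in>UNIV. \<bar>moll n (%v. G v $ i) v - moll m (%v. G v $ i) v\<bar>) * ball_ind (real k) v
    <= (\<Sum>i\<in>UNIV. ?d n i v) + (\<Sum>i\<in>UNIV. ?d m i v)"
    by (cases "norm v <= real k") simp_all
  qed
  also have "... = e n + e m" unfolding e_def
   by (subst nn_integral_add, measurable, subst nn_integral_sum, measurable, subst nn_integral_sum, measurable)
  also have "... <= ennreal ((1/2) ^ Suc j) + ennreal ((1/2) ^ Suc j)"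
   by (intro add_mono less_imp_le N that)
  also have "... = ennreal ((1/2) ^ j)" by (subst ennreal_plus[symmetric]) simp_all
  finally show ?thesis .
 qed
 then show ?thesis by blast
qed

text \<open>The set of times at which a jointly measurable function is weakly differentiable is described by
 the Cauchy criterion, which involves countably many measurable conditions; the subsequence along
 which the gradients converge is chosen measurably in time as the least one that works.\<close>

lemma measurable_weak_gradient:
 fixes F :: "real \<times> (real^3) => real"
 assumes [measurable]: "F : Borel"
 obtains S G where "S : sets borel" "G : Borel"
  "!!t. t : S \<longleftrightarrow> weakly_differentiable (%v. F (t, v))"
  "!!t. t : S ==> borel_weak_grad (%v. F (t, v)) (%v. G (t, v))"
proof -
 define L where "L = {t. \<forall>k::nat. (NBALL (real k) (%v. ennreal \<bar>F (t, v)\<bar>)) < \<infinity>}"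
 have Lm[measurable]: "L : sets borel" unfolding L_def by measurable
 have L: "loc_int (%v. F (t, v))" if "t : L" for t
  unfolding loc_int_def
 proof (intro conjI allI)
  fix R
  obtain k where k: "R <= real k" using real_arch_simple by blast
  have "(NBALL R (%v. ennreal \<bar>F (t, v)\<bar>)) <= (NBALL (real k) (%v. ennreal \<bar>F (t, v)\<bar>))"
   using k by (intro nn_integral_mono) (auto simp: indicator_def)
  also have "... < \<infinity>" using that by (simp add: L_def)
  finally show "(NBALL R (%v. ennreal \<bar>F (t, v)\<bar>)) < \<infinity>" .
 qed measurable
 note [measurable] = smooth_borel[OF smooth_partial[OF smooth_mollifier]]
 define g where "g n i p = (LBINT y. F (fst p, y) * partial i (mollifier n) (snd p - y))" for n i and p :: "real \<times> (real^3)"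
 have [measurable]: "F : borel_measurable (borel \<Otimes>\<^sub>M borel)" using assms by (simp add: borel_prod)
 have gm'[measurable]: "g n i : borel_measurable (borel \<Otimes>\<^sub>M borel)" for n i unfolding g_def[abs_def] by measurable
 have gm: "g n i : Borel" for n i using gm'[of n i] by (simp add: borel_prod)
 have g: "g n i (t, v) = partial i (moll n (%v. F (t, v))) v" if "t : L" for n i t v
  unfolding moll_def partial_conv[OF L[OF that] smooth_test_mollifier] by (simp add: g_def conv_def)
 define d where "d t n m k = grad_dist (%n i v. g n i (t, v)) n m k" for t n m k
 have dm[measurable]: "(%t. d t n m k) : Borel" for n m k
  unfolding d_def grad_dist_def by measurable
 have dg: "d t n m k = grad_dist (%n i. partial i (moll n (%v. F (t, v)))) n m k" if "t : L" for t n m k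
  unfolding d_def grad_dist_def g[OF that] ..
 define Q where "Q t k N \<longleftrightarrow> (\<forall>j\<le>k. \<forall>n\<ge>N. \<forall>m\<ge>N. d t n m j <= ennreal ((1/2) ^ j))" for t and k N :: nat
 have Qm[measurable]: "Measurable.pred borel (%t. Q t k N)" for k N unfolding Q_def by measurable
 have QD: "d t n m k <= ennreal ((1/2) ^ k)" if "Q t k N" "N <= n" "N <= m" for t k N n m
  using that unfolding Q_def by simp
 have Qmono: "Q t k N" if "Q t n N" "k <= n" for t k n N
  using that unfolding Q_def by simp
 define S where "S = {t. t : L \<and> (\<forall>k. \<exists>N. Q t k N)}"
 have Sm: "S : sets borel" unfolding S_def by measurable
 define r where "r k t = k + (LEAST N. Q t k N)" for k t
 have rm[measurable]: "r k : borel \<rightarrow>\<^sub>M count_space UNIV" for k unfolding r_def by measurable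
 define G where "G p = (\<chi> i. lim (%k. g (r k (fst p)) i p))" for p
 have Gm: "G : Borel"
 proof (rule borel_measurable_cartesian)
  fix i
  have "(%p. g (r k (fst p)) i p) : Borel" for k
  proof -
   have "(%p. g (r k (fst p)) i p) : borel_measurable (borel \<Otimes>\<^sub>M borel)"
    by (rule measurable_compose_countable[where g="%p. r k (fst p)"]) measurable
   then show ?thesis by (simp add: borel_prod)
  qed
  then show "(%p. G p $ i) : Borel" unfolding G_def by simp
 qed
 have main: "borel_weak_grad (%v. F (t, v)) (%v. G (t, v))" if tS: "t : S" for t
 proof -
  have tL: "t : L" using tS by (simp add: S_def)
  have QL: "Q t k (LEAST N. Q t k N)" for k using tS LeastI_ex[of "Q t k"] by (simp add: S_def)
  have mono: "(LEAST N. Q t k N) <= (LEAST N. Q t n N)" if "k <= n" for k n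
  proof (rule Least_le)
   show "Q t k (LEAST N. Q t n N)" by (rule Qmono[OF QL[of n] that])
  qed
  have "borel_weak_grad (%v. F (t, v)) (%v. \<chi> i. lim (%k. partial i (moll (r k t) (%v. F (t, v))) v))"
  proof (rule borel_weak_grad_limit[OF L[OF tL]])
   show "k <= r k t" for k by (simp add: r_def)
   fix k n :: nat assume kn: "k <= n"
   have "d t (r n t) (r k t) k <= ennreal ((1/2) ^ k)"
    by (rule QD[OF QL[of k]]) (use mono[OF kn] in \<open>simp_all add: r_def trans_le_add2\<close>)
   then show "grad_dist (%n i. partial i (moll n (%v. F (t, v)))) (r n t) (r k t) k <= ennreal ((1/2) ^ k)"
    unfolding dg[OF tL] .
  qed
  then show ?thesis unfolding G_def by (simp add: g[OF tL])
 qed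
 show ?thesis
 proof (rule that[OF Sm Gm _ main])
  fix t
  show "t : S \<longleftrightarrow> weakly_differentiable (%v. F (t, v))"
  proof
   assume "t : S"
   then show "weakly_differentiable (%v. F (t, v))" using wgrad_eqI(1)[OF main] by blast
  next
   assume w: "weakly_differentiable (%v. F (t, v))"
   have fm: "(%v. F (t, v)) : Borel" by measurable
   obtain H where H: "borel_weak_grad (%v. F (t, v)) H"
    using weakly_differentiable_borel[OF w fm] by blast
   then have "loc_int (%v. F (t, v))" by (simp add: borel_weak_grad_def)
   then have tL: "t : L" using loc_int_finite by (auto simp: L_def)
   have "\<exists>N. Q t k N" for k
   proof -
    have "\<forall>j. \<exists>N. \<forall>n\<ge>N. \<forall>m\<ge>N. d t n m j <= ennreal ((1/2) ^ j)"
     using weakly_differentiable_imp_Cauchy[OF H] unfolding dg[OF tL] by blast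
    then obtain N where N: "!!j n m. n \<ge> N j ==> m \<ge> N j ==> d t n m j <= ennreal ((1/2) ^ j)" by metis
    have "Q t k (Max (N ` {..k}))" unfolding Q_def
    proof (intro allI impI)
     fix j n m assume a: "j <= k" "Max (N ` {..k}) <= n" "Max (N ` {..k}) <= m"
     have "N j <= Max (N ` {..k})" using a by (intro Max_ge) auto
     then show "d t n m j <= ennreal ((1/2) ^ j)" using a by (intro N) auto
    qed
    then show ?thesis by blast
   qed
   then show "t : S" using tL by (simp add: S_def)
  qed
 qed
qed

section \<open>Functions of time and velocity\<close>

lemma AE_lebesgue_on_iff:
 fixes A :: "'a::euclidean_space set"
 assumes "A : sets borel"
 shows "(AE t in lebesgue_on A. P t) \<longleftrightarrow> (AEL t. t : A --> P t)"
proof -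
 have "A \<inter> space lebesgue : sets lebesgue" using assms by simp
 from AE_restrict_space_iff[OF this, of P] show ?thesis by (simp add: AE_completion_iff)
qed

lemma AE_lborel_snd:
 fixes P :: "'b::euclidean_space => bool"
 assumes "AEL v. P v"
 shows "AE p in (lborel :: ('a::euclidean_space \<times> 'b) measure). P (snd p)"
proof -
 from AE_E[OF assms] obtain N where N: "{v : space lborel. \<not> P v} \<subseteq> N" "emeasure lborel N = 0" "N : sets lborel" .
 have [measurable]: "N : sets borel" using N(3) by simp
 have nN: "AEL v. v \<notin> N" by (rule AE_I[of _ _ N]) (use N in auto)
 have "AE p in (lborel :: 'a measure) \<Otimes>\<^sub>M lborel. snd p \<notin> N"
 proof (rule lborel_pair.AE_pair_measure)
  show "{x : space ((lborel :: 'a measure) \<Otimes>\<^sub>M lborel). snd x \<notin> N} : sets ((lborel :: 'a measure) \<Otimes>\<^sub>M lborel)" by measurable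
  show "AE v in (lborel :: 'a measure). AEL w. snd (v, w) \<notin> N" using nN by simp
 qed
 then show ?thesis unfolding lborel_prod by eventually_elim (use N(1) in auto)
qed

lemma AE_lborel_fst:
 fixes P :: "'a::euclidean_space => bool"
 assumes "AEL v. P v"
 shows "AE p in (lborel :: ('a \<times> 'b::euclidean_space) measure). P (fst p)"
proof -
 from AE_E[OF assms] obtain N where N: "{v : space lborel. \<not> P v} \<subseteq> N" "emeasure lborel N = 0" "N : sets lborel" .
 have [measurable]: "N : sets borel" using N(3) by simp
 have nN: "AEL v. v \<notin> N" by (rule AE_I[of _ _ N]) (use N in auto)
 have "AE p in lborel \<Otimes>\<^sub>M (lborel :: 'b measure). fst p \<notin> N"
 proof (rule lborel_pair.AE_pair_measure)
  show "{x : space (lborel \<Otimes>\<^sub>M (lborel :: 'b measure)). fst x \<notin> N} : sets (lborel \<Otimes>\<^sub>M (lborel :: 'b measure))" by measurable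
  show "AEL v. AE w in (lborel :: 'b measure). fst (v, w) \<notin> N" using nN by eventually_elim simp
 qed
 then show ?thesis unfolding lborel_prod by eventually_elim (use N(1) in auto)
qed

lemma AE_lborel_reflect:
 fixes v :: "real^3"
 assumes "AEL y. P y" shows "AEL y. P (v - y)"
proof -
 from AE_E[OF assms] obtain N where N: "{v : space lborel. \<not> P v} \<subseteq> N" "emeasure lborel N = 0" "N : sets lborel" .
 have m[measurable]: "N : sets borel" using N(3) by simp
 have [measurable]: "(%y. v - y) -` N : sets borel"
  using measurable_sets[of "%y. v - y" borel borel N] by simp
 have "emeasure lborel ((%y. v - y) -` N) = (NBINT y. indicator N (v - y))"
  by (subst nn_integral_indicator[symmetric]) (auto intro!: nn_integral_cong simp: indicator_def simp del: nn_integral_indicator)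
 also have "... = (NBINT y. indicator N y)" by (rule nn_integral_lborel_reflect) measurable
 also have "... = 0" using N by simp
 finally show ?thesis by (intro AE_I[of _ _ "(%y. v - y) -` N"]) (use N(1) in auto)
qed

lemma slab_ex_borel:
 fixes g :: "real \<times> (real^3) => real"
 assumes A: "A : sets borel" and g: "g : borel_measurable (lebesgue_on (A \<times> UNIV))"
 obtains F where "F : Borel"
  "AEL t. t : A --> (AEL v. g (t, v) = F (t, v))"
proof -
 have "A \<times> (UNIV :: (real^3) set) : sets (borel \<Otimes>\<^sub>M borel)" using A by (intro pair_measureI) auto
 then have s: "A \<times> (UNIV :: (real^3) set) : sets borel" unfolding borel_prod .
 then have "A \<times> (UNIV :: (real^3) set) \<inter> space lebesgue : sets lebesgue" by simp
 from borel_measurable_restrict_space_iff[OF this, of g] g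
 have "(%x. indicator (A \<times> UNIV) x *\<^sub>R g x) : borel_measurable lebesgue" by simp
 from completion_ex_borel_measurable_real[OF this] obtain F where F: "F : Borel"
  "AEL x. indicator (A \<times> UNIV) x *\<^sub>R g x = F x" by auto
 have "AE x in (lborel \<Otimes>\<^sub>M lborel). indicator (A \<times> (UNIV :: (real^3) set)) x *\<^sub>R g x = F x"
  unfolding lborel_prod by (rule F(2))
 from lborel_pair.AE_pair[OF this]
 have "AEL t. t : A --> (AEL v. g (t, v) = F (t, v))"
  by eventually_elim (auto simp: indicator_def)
 with F(1) show ?thesis by (rule that)
qed

lemma borel_imp_slab_measurable:
 fixes g :: "real \<times> (real^3) => 'b::euclidean_space"
 assumes "g : Borel" "AEL t. t : {0<..<T} --> (AEL v. u t v = g (t, v))"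
 shows "slab_measurable T u"
 unfolding slab_measurable_def slab_rep_def
proof (intro bexI[of _ g])
 show "AE t in lebesgue_on {0<..<T}. AE v in lebesgue. u t v = g (t, v)"
  using assms(2) by (simp add: AE_lebesgue_on_iff AE_completion_iff)
 have "g : borel_measurable lborel" using assms(1) by simp
 from measurable_completion[OF this]
 show "g : borel_measurable (lebesgue_on (slab T))" by (rule measurable_restrict_space1)
qed

lemma time_integral_borel:
 fixes g h :: "real => real"
 assumes [measurable]: "h : Borel" "A : sets borel"
  and ae: "AEL t. t : A --> g t = h t"
 shows "(LINT t:A|lebesgue. g t) = (LBINT t. indicator A t * h t)"
  and "set_integrable lebesgue A g \<longleftrightarrow> (NBSET A (%t. ennreal \<bar>h t\<bar>)) < \<infinity>"
proof -
 have e: "AEL t. indicator A t *\<^sub>R g t = indicator A t *\<^sub>R h t"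
  using ae by eventually_elim (auto simp: indicator_def)
 show "(LINT t:A|lebesgue. g t) = (LBINT t. indicator A t * h t)"
  unfolding set_lebesgue_integral_def lebesgue_integral_cong_AE[OF e] by (subst integral_completion) auto
 show "set_integrable lebesgue A g \<longleftrightarrow> (NBSET A (%t. ennreal \<bar>h t\<bar>)) < \<infinity>"
  using set_integrable_lebesgue_iff[of h A] lebesgue_integrable_cong_AE[OF e] by (simp add: set_integrable_def)
qed

lemma slab_Fubini:
 fixes K :: "real \<times> (real^3) => real"
 assumes [measurable]: "K : Borel"
  and fin: "(NBSET {0<..<T} (%t. (NBINT v. ennreal \<bar>K (t, v)\<bar>))) < \<infinity>"
  and ae: "AEL t. t : {0<..<T} --> (AEL v. u t v = K (t, v))"
 shows "slab_integrable T u"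
  and "set_integrable lebesgue {0<..<T} (%t. LINT v|lebesgue. u t v)"
  and "(LINT t:{0<..<T}|lebesgue. LINT v|lebesgue. u t v) = (LBINT t. indicator {0<..<T} t * (LBINT v. K (t, v)))"
  and "integrable lborel (%(t, v). indicator {0<..<T} t * K (t, v))"
  and "(LINT (t, v)|lborel. indicator {0<..<T} t * K (t, v)) = (LBINT t. indicator {0<..<T} t * (LBINT v. K (t, v)))"
proof -
 let ?I = "{0<..<T}"
 have [measurable]: "K : borel_measurable (borel \<Otimes>\<^sub>M borel)" by (simp add: borel_prod)
 have n: "(\<integral>\<^sup>+p. ennreal \<bar>indicator ?I (fst p) * K p\<bar> \<partial>(lborel \<Otimes>\<^sub>M lborel)) = (NBSET ?I (%t. (NBINT v. ennreal \<bar>K (t, v)\<bar>)))"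
  by (subst lborel.nn_integral_fst[symmetric]) (auto intro!: nn_integral_cong simp: indicator_def)
 have i: "integrable (lborel \<Otimes>\<^sub>M lborel) (%(t, v). indicator ?I t * K (t, v))"
  using n fin by (intro integrableI_bounded) (auto simp: case_prod_unfold)
 then show "integrable lborel (%(t, v). indicator ?I t * K (t, v))" by (simp add: lborel_prod)
 have "(LBINT t. LBINT v. indicator ?I t * K (t, v)) = (LINT (t, v)|(lborel \<Otimes>\<^sub>M lborel). indicator ?I t * K (t, v))"
  using lborel_pair.integral_fst[OF i] by simp
 then show "(LINT (t, v)|lborel. indicator ?I t * K (t, v)) = (LBINT t. indicator ?I t * (LBINT v. K (t, v)))"
  by (simp add: lborel_prod)
 have ae': "AEL t. t : ?I --> (LINT v|lebesgue. u t v) = (LBINT v. K (t, v))"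
  using ae
 proof eventually_elim
  case (elim t)
  have "(LINT v|lebesgue. K (t, v)) = (LBINT v. K (t, v))" by (rule integral_completion) simp
  with elim show ?case using lebesgue_integral_cong_AE[of "u t" "%v. K (t, v)"] by simp
 qed
 note tb = time_integral_borel[OF _ _ ae']
 show "(LINT t:?I|lebesgue. LINT v|lebesgue. u t v) = (LBINT t. indicator ?I t * (LBINT v. K (t, v)))"
  by (rule tb(1)) measurable
 have "(NBSET ?I (%t. ennreal \<bar>LBINT v. K (t, v)\<bar>)) <= (NBSET ?I (%t. (NBINT v. ennreal \<bar>K (t, v)\<bar>)))"
 proof (intro nn_integral_mono mult_right_mono)
  fix t :: real
  show "ennreal \<bar>LBINT v. K (t, v)\<bar> <= (NBINT v. ennreal \<bar>K (t, v)\<bar>)"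
  proof (cases "integrable lborel (%v. K (t, v))")
   case True
   from integral_norm_bound_ennreal[OF this] show ?thesis by simp
  qed (simp add: not_integrable_integral_eq)
 qed simp
 with fin have "(NBSET ?I (%t. ennreal \<bar>LBINT v. K (t, v)\<bar>)) < \<infinity>" by simp
 then show "set_integrable lebesgue ?I (%t. LINT v|lebesgue. u t v)" by (subst tb(2)) auto
 have s: "slab T : sets borel"
  using pair_measureI[of ?I borel "UNIV :: (real^3) set" borel] unfolding borel_prod by simp
 have "(NBSET (slab T) (%x. ennreal (norm (K x)))) = (\<integral>\<^sup>+p. ennreal \<bar>indicator ?I (fst p) * K p\<bar> \<partial>(lborel \<Otimes>\<^sub>M lborel))"
  unfolding lborel_prod by (intro nn_integral_cong) (auto simp: indicator_def)
 then have "set_integrable lebesgue (slab T) K" using set_integrable_lebesgue_iff[OF assms(1) s] n fin by simp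
 then have "integrable (lebesgue_on (slab T)) K"
  using s by (simp add: set_integrable_def integrable_restrict_space)
 then show "slab_integrable T u"
  unfolding slab_integrable_def slab_rep_def using ae by (auto simp: AE_lebesgue_on_iff AE_completion_iff)
qed

lemma Linf_LplocI:
 fixes g :: "real \<times> (real^3) => 'b::euclidean_space"
 assumes [measurable]: "g : Borel"
  and ae: "AEL t. t : {0<..<T} --> (AEL v. u t v = g (t, v))"
  and b: "!!R. \<exists>C. AEL t. t : {0<..<T} --> (NBALL R (%v. ennreal (norm (g (t, v)) powr p))) <= ennreal C"
  and p: "0 < p"
 shows "Linf_Lploc T p u"
 unfolding Linf_Lploc_def
proof (intro conjI allI impI)
 show "slab_measurable T u" by (rule borel_imp_slab_measurable[OF _ ae]) simp
 fix K :: "(real^3) set" assume K: "compact K"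
 have Kb[measurable]: "K : sets borel" using compact_imp_closed[OF K] by (rule borel_closed)
 obtain R where R: "!!v. v : K ==> norm v <= R" using compact_imp_bounded[OF K] by (auto simp: bounded_iff)
 obtain C0 where C0: "AEL t. t : {0<..<T} --> (NBALL R (%v. ennreal (norm (g (t, v)) powr p))) <= ennreal C0"
  using b by blast
 define C where "C = max 0 C0"
 have "ennreal C0 <= ennreal C" by (simp add: C_def ennreal_leI)
 have "AEL t. t : {0<..<T} --> (in_Lp p (lebesgue_on K) (u t) \<and> Lp_norm p (lebesgue_on K) (u t) <= C powr (1 / p))"
  using ae C0
 proof eventually_elim
  case (elim t)
  show ?case
  proof
   assume t: "t : {0<..<T}"
   let ?g = "%v. g (t, v)"
   have aeg: "AEL v. u t v = ?g v" using elim(1) t by blast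
   have n: "(NBSET K (%v. ennreal (norm (?g v) powr p))) <= ennreal C"
   proof -
    have "(NBSET K (%v. ennreal (norm (?g v) powr p))) <= (NBALL R (%v. ennreal (norm (?g v) powr p)))"
     using R by (intro nn_integral_mono) (auto simp: indicator_def)
    also have "... <= ennreal C" using elim(2) t \<open>ennreal C0 \<le> ennreal C\<close> by (blast intro: order_trans)
    finally show ?thesis .
   qed
   have gm: "?g : borel_measurable lebesgue" by (rule measurable_completion) measurable
   then have um: "u t : borel_measurable lebesgue" using lebesgue_measurable_cong_AE[OF aeg] by simp
   have Ks: "K \<inter> space lebesgue : sets lebesgue" using Kb by simp
   have aek: "AEL v. indicator K v *\<^sub>R (norm (u t v) powr p) = indicator K v *\<^sub>R (norm (?g v) powr p)"
    using aeg by eventually_elim simp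
   have "set_integrable lebesgue K (%v. norm (?g v) powr p)"
    by (subst set_integrable_lebesgue_iff) (use n in \<open>auto intro: le_less_trans\<close>)
   then have i: "integrable (lebesgue_on K) (%v. norm (u t v) powr p)"
    unfolding integrable_restrict_space[OF Ks] lebesgue_integrable_cong_AE[OF aek] by (simp add: set_integrable_def)
   have "(LINT v|lebesgue_on K. norm (u t v) powr p) = (LBINT v. indicator K v *\<^sub>R (norm (?g v) powr p))"
    unfolding integral_restrict_space[OF Ks] lebesgue_integral_cong_AE[OF aek] by (rule integral_completion) measurable
   also have "... = enn2real (NBINT v. ennreal (indicator K v *\<^sub>R (norm (?g v) powr p)))"
    by (rule integral_eq_nn_integral) auto
   also have "(NBINT v. ennreal (indicator K v *\<^sub>R (norm (?g v) powr p))) = (NBSET K (%v. ennreal (norm (?g v) powr p)))"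
    by (intro nn_integral_cong) (auto simp: indicator_def)
   also have "enn2real ... <= C" using n by (intro enn2real_leI) (auto simp: C_def)
   finally have le: "(LINT v|lebesgue_on K. norm (u t v) powr p) <= C" .
   have "0 <= (LINT v|lebesgue_on K. norm (u t v) powr p)" by (rule integral_nonneg_AE) simp
   from powr_mono2[OF _ this le, of "1 / p"] p
   show "in_Lp p (lebesgue_on K) (u t) \<and> Lp_norm p (lebesgue_on K) (u t) <= C powr (1 / p)"
    using i measurable_restrict_space1[OF um] by (simp add: in_Lp_def Lp_norm_def)
  qed
 qed
 then show "\<exists>C. AE t in lebesgue_on {0<..<T}. in_Lp p (lebesgue_on K) (u t) \<and> Lp_norm p (lebesgue_on K) (u t) <= C"
  by (auto simp: AE_lebesgue_on_iff)
qed

section \<open>Functions in \<open>W1inf_c\<close> and their gradients\<close>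

lemma esssup_lebesgue_nonneg:
 fixes f :: "real^3 => ereal"
 assumes "!!v. 0 <= f v" shows "0 <= esssup lebesgue f"
proof (cases "f : borel_measurable lebesgue")
 case True
 have "AE v in (lebesgue :: (real^3) measure). 0 <= esssup lebesgue f"
  by (rule eventually_mono[OF esssup_AE[of f lebesgue]]) (rule order_trans[OF assms])
 then have "emeasure lebesgue {v::real^3. \<not> 0 <= esssup lebesgue f} = 0"
  using AE_iff_measurable[of "{v::real^3. \<not> 0 <= esssup lebesgue f}" lebesgue "%v. 0 <= esssup lebesgue f"] by simp
 then show ?thesis by (cases "0 <= esssup lebesgue f") auto
qed (simp add: esssup_non_measurable)

lemma W1inf_norm_leD:
 assumes "W1inf_norm \<psi> <= ereal \<epsilon>"
 shows "AEL v. \<bar>\<psi> v\<bar> <= \<epsilon>" "AEL v. norm (wgrad \<psi> v) <= \<epsilon>"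
proof -
 have *: "AEL v. f v <= \<epsilon>" if e: "esssup lebesgue (%v. ereal (f v)) <= ereal \<epsilon>" for f :: "real^3 => real"
 proof -
  have "AE v in lebesgue. ereal (f v) <= esssup lebesgue (%v. ereal (f v))" by (rule esssup_AE)
  then have "AE v in lebesgue. f v <= \<epsilon>" by eventually_elim (use e in \<open>auto dest: order_trans\<close>)
  then show ?thesis by (simp add: AE_completion_iff)
 qed
 let ?a = "esssup lebesgue (%v. ereal \<bar>\<psi> v\<bar>)" and ?b = "esssup lebesgue (%v. ereal (norm (wgrad \<psi> v)))"
 have nn: "0 <= ?a" "0 <= ?b" by (auto intro!: esssup_lebesgue_nonneg)
 have "?a <= ?a + ?b" "?b <= ?a + ?b" using nn by (auto intro: add_increasing add_increasing2)
 with assms have "?a <= ereal \<epsilon>" "?b <= ereal \<epsilon>" unfolding W1inf_norm_def by (auto dest: order_trans)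
 then show "AEL v. \<bar>\<psi> v\<bar> <= \<epsilon>" "AEL v. norm (wgrad \<psi> v) <= \<epsilon>" by (auto intro: *)
qed

text \<open>The radius grows by one because the gradient is reached as a limit of mollifications, which
 enlarge the support.\<close>

lemma borel_weak_grad_zero_outside:
 assumes w: "borel_weak_grad u G" and z: "AEL v. R < norm v --> u v = 0"
 shows "AEL v. R + 1 < norm v --> G v = 0"
proof -
 have l: "loc_int u" using w by (simp add: borel_weak_grad_def)
 obtain r where "filterlim r at_top sequentially" "AEL x. (%k. moll (r k) u x) \<leadsto> u x"
  and lim: "AEL x. \<forall>i. (%k. partial i (moll (r k) u) x) \<leadsto> G x $ i"
  by (rule borel_weak_grad_moll_AE[OF w])
 from lim show ?thesis
 proof eventually_elim
  case (elim x)
  show ?case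
  proof
   assume "R + 1 < norm x"
   then have "partial i (moll (r k) u) x = 0" for i k
    using moll_zero_outside[OF z _ l] by (intro partial_zero_outside[OF smooth_moll[OF l], of "R + 1"]) auto
   with elim have "G x $ i = 0" for i by (simp add: LIMSEQ_const_iff)
   then show "G x = 0" by (simp add: vec_eq_iff)
  qed
 qed
qed

lemma wgrad_zero_outside:
 assumes "weakly_differentiable \<psi>" "supp_in_ball R \<psi>"
 shows "AEL v. R + 1 < norm v --> wgrad \<psi> v = 0"
proof -
 obtain u G where u: "AEL v. \<psi> v = u v" "borel_weak_grad u G" "AEL v. wgrad \<psi> v = G v"
  by (rule weakly_differentiable_rep[OF assms(1)])
 have "AEL v. R < norm v --> \<psi> v = 0" using assms(2) by (simp add: supp_in_ball_def AE_completion_iff)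
 with u(1) have "AEL v. R < norm v --> u v = 0" by eventually_elim auto
 from borel_weak_grad_zero_outside[OF u(2) this] u(3) show ?thesis by eventually_elim auto
qed

lemma W1inf_c_rep:
 assumes "\<psi> : W1inf_c"
 obtains u Y C R where "AEL v. \<psi> v = u v" "borel_weak_grad u Y" "AEL v. wgrad \<psi> v = Y v"
  "0 <= C" "AEL v. \<bar>u v\<bar> <= C" "AEL v. norm (Y v) <= C"
  "AEL v. R < norm v --> u v = 0" "AEL v. R < norm v --> Y v = 0"
proof -
 from assms obtain R where w: "weakly_differentiable \<psi>" and f: "W1inf_norm \<psi> < \<infinity>" and R: "supp_in_ball R \<psi>"
  by (auto simp: W1inf_c_def)
 obtain u G where u: "AEL v. \<psi> v = u v" "borel_weak_grad u G" "AEL v. wgrad \<psi> v = G v"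
  by (rule weakly_differentiable_rep[OF w])
 have n0: "0 <= W1inf_norm \<psi>" unfolding W1inf_norm_def by (intro add_nonneg_nonneg esssup_lebesgue_nonneg) auto
 then obtain C where C: "W1inf_norm \<psi> = ereal C" "0 <= C" using f by (cases "W1inf_norm \<psi>") auto
 note d = W1inf_norm_leD[of \<psi> C]
 have "AEL v. \<bar>u v\<bar> <= C" using d(1) C u(1) by (auto elim: eventually_elim2)
 moreover have "AEL v. norm (G v) <= C" using d(2) C u(3) by (auto elim: eventually_elim2)
 moreover have "AEL v. R + 1 < norm v --> u v = 0"
 proof -
  have "AEL v. R < norm v --> \<psi> v = 0" using R by (simp add: supp_in_ball_def AE_completion_iff)
  with u(1) show ?thesis by eventually_elim auto
 qed
 moreover have "AEL v. R + 1 < norm v --> G v = 0"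
  using wgrad_zero_outside[OF w R] u(3) by eventually_elim auto
 ultimately show ?thesis using that[OF u C(2)] by blast
qed

text \<open>The representatives \<open>wgrad\<close> are chosen separately at each time; they have a common Borel
 representative because a Borel version of \<open>\<phi>\<close> has one.\<close>

lemma Linf_W1inf_c_grad:
 assumes "\<phi> : Linf_W1inf_c T"
 obtains X C R where "X : Borel" "0 <= C"
  "AEL t. t : {0<..<T} --> (AEL v. wgrad (%v. \<phi> (t, v)) v = X (t, v))"
  "AEL t. t : {0<..<T} --> (AEL v. norm (X (t, v)) <= C * ball_ind R v)"
proof -
 from assms obtain C0 R0 where m: "slab_measurable T (%t v. \<phi> (t, v))"
  and b0: "AE t in lebesgue_on {0<..<T}. (%v. \<phi> (t, v)) : W1inf_c \<and> W1inf_norm (%v. \<phi> (t, v)) <= ereal C0 \<and> supp_in_ball R0 (%v. \<phi> (t, v))"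
  by (auto simp: Linf_W1inf_c_def)
 have b: "AEL t. t : {0<..<T} --> ((%v. \<phi> (t, v)) : W1inf_c \<and> W1inf_norm (%v. \<phi> (t, v)) <= ereal C0 \<and> supp_in_ball R0 (%v. \<phi> (t, v)))"
  using b0 by (subst (asm) AE_lebesgue_on_iff) simp_all
 from m obtain g where g: "g : borel_measurable (lebesgue_on (slab T))" "AE t in lebesgue_on {0<..<T}. AE v in lebesgue. \<phi> (t, v) = g (t, v)"
  by (auto simp: slab_measurable_def slab_rep_def)
 have g2: "AEL t. t : {0<..<T} --> (AEL v. \<phi> (t, v) = g (t, v))"
  using g(2) by (simp add: AE_lebesgue_on_iff AE_completion_iff)
 obtain F where F: "F : Borel" "AEL t. t : {0<..<T} --> (AEL v. g (t, v) = F (t, v))"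
  by (rule slab_ex_borel[OF _ g(1)]) simp
 obtain S X where X: "S : sets borel" "X : Borel"
  "!!t. t : S \<longleftrightarrow> weakly_differentiable (%v. F (t, v))"
  "!!t. t : S ==> borel_weak_grad (%v. F (t, v)) (%v. X (t, v))"
  by (rule measurable_weak_gradient[OF F(1)]) blast
 have w: "AEL t. t : {0<..<T} --> (AEL v. wgrad (%v. \<phi> (t, v)) v = X (t, v))"
  using b g2 F(2)
 proof eventually_elim
  case (elim t)
  show ?case
  proof
   assume t: "t : {0<..<T}"
   have "AEL v. \<phi> (t, v) = g (t, v)" "AEL v. g (t, v) = F (t, v)" using elim t by auto
   then have e: "AEL v. \<phi> (t, v) = F (t, v)" by eventually_elim simp
   have "weakly_differentiable (%v. \<phi> (t, v))" using elim(1) t by (simp add: W1inf_c_def)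
   then have "t : S" using X(3) wgrad_cong_AE(2)[OF e] by simp
   from wgrad_eqI(2)[OF X(4)[OF this]]
   show "AEL v. wgrad (%v. \<phi> (t, v)) v = X (t, v)" unfolding wgrad_cong_AE(1)[OF e] .
  qed
 qed
 have "AEL t. t : {0<..<T} --> (AEL v. norm (X (t, v)) <= max 0 C0 * ball_ind (R0 + 1) v)"
  using w b
 proof eventually_elim
  case (elim t)
  show ?case
  proof
   assume t: "t : {0<..<T}"
   let ?\<psi> = "%v. \<phi> (t, v)"
   from elim t have w: "AEL v. wgrad ?\<psi> v = X (t, v)" and "?\<psi> : W1inf_c" "W1inf_norm ?\<psi> <= ereal C0" "supp_in_ball R0 ?\<psi>" by auto
   then have "AEL v. norm (wgrad ?\<psi> v) <= C0" "AEL v. R0 + 1 < norm v --> wgrad ?\<psi> v = 0"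
    using W1inf_norm_leD(2) wgrad_zero_outside by (auto simp: W1inf_c_def)
   with w show "AEL v. norm (X (t, v)) <= max 0 C0 * ball_ind (R0 + 1) v"
    by eventually_elim (auto simp: indicator_def)
  qed
 qed
 from that[OF X(2) _ w this] show ?thesis by simp
qed

section \<open>Divergence-form functionals\<close>

lemma Linf_W1inf_c_slices:
 assumes "\<phi> : Linf_W1inf_c T"
 obtains R where "AEL t. t : {0<..<T} --> weakly_differentiable (%v. \<phi> (t, v)) \<and> supp_in_ball R (%v. \<phi> (t, v))"
proof -
 obtain C R where *: "AE t in lebesgue_on {0<..<T}. (%v. \<phi> (t, v)) : W1inf_c \<and> W1inf_norm (%v. \<phi> (t, v)) <= ereal C \<and> supp_in_ball R (%v. \<phi> (t, v))"
  using assms by (auto simp: Linf_W1inf_c_def)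
 have "AEL t. t : {0<..<T} --> (%v. \<phi> (t, v)) : W1inf_c \<and> W1inf_norm (%v. \<phi> (t, v)) <= ereal C \<and> supp_in_ball R (%v. \<phi> (t, v))"
  using * by (subst (asm) AE_lebesgue_on_iff) simp_all
 then have "AEL t. t : {0<..<T} --> weakly_differentiable (%v. \<phi> (t, v)) \<and> supp_in_ball R (%v. \<phi> (t, v))"
  by eventually_elim (simp add: W1inf_c_def)
 then show ?thesis by (rule that)
qed

lemma slab_integrable_ball:
 fixes J :: "real \<times> (real^3) => 'b::euclidean_space"
 assumes [measurable]: "J : Borel"
  and fin: "(NBSET {0<..<T} (%t. (NBALL R (%v. ennreal (norm (J (t, v))))))) < \<infinity>"
 shows "integrable lborel (%(t, v). indicator {0<..<T} t * (norm (J (t, v)) * ball_ind R v))"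
proof -
 let ?K = "%p. norm (J p) * ball_ind R (snd p)"
 have [measurable]: "J : borel_measurable (borel \<Otimes>\<^sub>M borel)" by (simp add: borel_prod)
 have m: "?K : Borel" unfolding borel_prod[symmetric] by measurable
 have "(NBSET {0<..<T} (%t. (NBINT v. ennreal \<bar>?K (t, v)\<bar>))) < \<infinity>"
  using fin by (simp add: ennreal_mult' ennreal_indicator)
 from slab_Fubini(4)[OF m this, of "%t v. ?K (t, v)"] show ?thesis by simp
qed

lemma slab_dominated:
 fixes H :: "real \<times> (real^3) => 'b::euclidean_space" and K :: "real \<times> (real^3) => real"
 assumes Hb: "H : Borel"
  and H: "(NBSET {0<..<T} (%t. (NBALL S (%v. ennreal (norm (H (t, v))))))) < \<infinity>"
  and c: "0 <= c"
  and bd: "AEL t. t : {0<..<T} --> (AEL v. \<bar>K (t, v)\<bar> <= c * (norm (H (t, v)) * ball_ind S v))"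
 shows "(NBSET {0<..<T} (%t. (NBINT v. ennreal \<bar>K (t, v)\<bar>))) < \<infinity>"
proof -
 let ?I = "{0<..<T}" and ?H = "%t. \<integral>\<^sup>+v\<in>cball 0 S. ennreal (norm (H (t, v))) \<partial>lborel"
 have [measurable]: "H : borel_measurable (borel \<Otimes>\<^sub>M borel)" using Hb by (simp add: borel_prod)
 have "(NBSET ?I (%t. (NBINT v. ennreal \<bar>K (t, v)\<bar>))) <= (NBINT t. ennreal c * (?H t * indicator ?I t))"
 proof (rule nn_integral_mono_AE)
  show "AEL t. (NBINT v. ennreal \<bar>K (t, v)\<bar>) * indicator ?I t <= ennreal c * (?H t * indicator ?I t)"
   using bd
  proof eventually_elim
   case (elim t)
   show ?case
   proof (cases "t : ?I")
    case True
    with elim have "AEL v. \<bar>K (t, v)\<bar> <= c * (norm (H (t, v)) * ball_ind S v)" by blast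
    then have "AEL v. ennreal \<bar>K (t, v)\<bar> <= ennreal (c * (norm (H (t, v)) * ball_ind S v))"
     by eventually_elim (rule ennreal_leI)
    then have "(NBINT v. ennreal \<bar>K (t, v)\<bar>) <= (NBINT v. ennreal (c * (norm (H (t, v)) * ball_ind S v)))"
     by (rule nn_integral_mono_AE)
    also have "... = (NBINT v. ennreal c * (ennreal (norm (H (t, v))) * ball_ind S v))"
     using c by (intro nn_integral_cong) (auto simp: indicator_def ennreal_mult)
    also have "... = ennreal c * ?H t" by (rule nn_integral_cmult) measurable
    finally show ?thesis using True by simp
   qed simp
  qed
 qed
 also have "... = ennreal c * (NBSET ?I (%t. ?H t))" by (rule nn_integral_cmult) measurable
 also have "... < \<infinity>" using H by (simp add: ennreal_mult_less_top)
 finally show ?thesis .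
qed

text \<open>A flux that is locally integrable on the slab defines, by $\psi\mapsto-\int j\cdot\nabla\psi$, a
 functional at almost every time and one on functions of time and velocity. The Borel function
 \<open>J\<close> represents the family \<open>j\<close>.\<close>

locale integrable_flux =
 fixes T :: real and J :: "real \<times> (real^3) => real^3" and j :: "real => real^3 => real^3"
 assumes J_borel[measurable]: "J : Borel"
  and J_fin: "!!R. (NBSET {0<..<T} (%t. (NBALL R (%v. ennreal (norm (J (t, v))))))) < \<infinity>"
  and j_eq: "AEL t. t : {0<..<T} --> (AEL v. j t v = J (t, v))"
begin

definition flux_functional :: "real => (real^3 => real) => real" where
 "flux_functional t \<psi> = - (LINT v|lebesgue. j t v \<bullet> wgrad \<psi> v)"

definition flux_mass :: "real => real" where
 "flux_mass R = (LINT (t, v)|lborel. indicator {0<..<T} t * (norm (J (t, v)) * ball_ind R v))"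

lemma J_pair[measurable]: "J : borel_measurable (borel \<Otimes>\<^sub>M borel)" by (simp add: borel_prod)

lemma integrable_J: "integrable lborel (%(t, v). indicator {0<..<T} t * (norm (J (t, v)) * ball_ind R v))"
 using slab_integrable_ball[where J=J and R=R and T=T, OF J_borel J_fin] .

lemma flux_mass_nonneg: "0 <= flux_mass R"
 unfolding flux_mass_def case_prod_unfold by (rule Bochner_Integration.integral_nonneg) simp

lemma pairing:
 assumes [measurable]: "X : Borel" and c: "0 <= c"
  and w: "AEL t. t : {0<..<T} --> (AEL v. wgrad (%v. \<phi> (t, v)) v = X (t, v))"
  and b: "AEL t. t : {0<..<T} --> (AEL v. norm (X (t, v)) <= c * ball_ind R v)"
 shows "slab_integrable T (%t v. j t v \<bullet> wgrad (%v. \<phi> (t, v)) v)"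
  and "set_integrable lebesgue {0<..<T} (%t. flux_functional t (%v. \<phi> (t, v)))"
  and "time_pairing T flux_functional \<phi> = - (LINT t:{0<..<T}|lebesgue. LINT v|lebesgue. j t v \<bullet> wgrad (%v. \<phi> (t, v)) v)"
  and "time_pairing T flux_functional \<phi> = - (LINT (t, v)|lborel. indicator {0<..<T} t * (J (t, v) \<bullet> X (t, v)))"
  and "integrable lborel (%(t, v). indicator {0<..<T} t * (J (t, v) \<bullet> X (t, v)))"
  and "\<bar>time_pairing T flux_functional \<phi>\<bar> <= c * flux_mass R"
proof -
 let ?I = "{0<..<T}"
 have Xp[measurable]: "X : borel_measurable (borel \<Otimes>\<^sub>M borel)" by (simp add: borel_prod)
 let ?K = "%p. J p \<bullet> X p"
 have m: "?K : Borel" unfolding borel_prod[symmetric] by measurable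
 have slice: "AEL t. t : ?I --> (AEL v. \<bar>?K (t, v)\<bar> <= c * (norm (J (t, v)) * ball_ind R v))"
  using b
 proof eventually_elim
  case (elim t)
  show ?case
  proof
   assume "t : ?I"
   with elim have "AEL v. norm (X (t, v)) <= c * ball_ind R v" by blast
   then show "AEL v. \<bar>?K (t, v)\<bar> <= c * (norm (J (t, v)) * ball_ind R v)"
   proof eventually_elim
    case (elim v)
    have "\<bar>?K (t, v)\<bar> <= norm (J (t, v)) * norm (X (t, v))" by (rule Cauchy_Schwarz_ineq2)
    also have "... <= norm (J (t, v)) * (c * ball_ind R v)" by (rule mult_left_mono[OF elim]) simp
    finally show ?case by (simp add: ac_simps)
   qed
  qed
 qed
 have fin: "(NBSET ?I (%t. (NBINT v. ennreal \<bar>?K (t, v)\<bar>))) < \<infinity>"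
  by (rule slab_dominated[where K="?K", OF J_borel J_fin c slice])
 have ae: "AEL t. t : ?I --> (AEL v. j t v \<bullet> wgrad (%v. \<phi> (t, v)) v = ?K (t, v))"
  using w j_eq
 proof eventually_elim
  case (elim t)
  show ?case
  proof
   assume "t : ?I"
   with elim have "AEL v. wgrad (%v. \<phi> (t, v)) v = X (t, v)" "AEL v. j t v = J (t, v)" by blast+
   then show "AEL v. j t v \<bullet> wgrad (%v. \<phi> (t, v)) v = ?K (t, v)" by eventually_elim simp
  qed
 qed
 note F = slab_Fubini[OF m fin ae]
 show "slab_integrable T (%t v. j t v \<bullet> wgrad (%v. \<phi> (t, v)) v)" by (rule F(1))
 show "set_integrable lebesgue ?I (%t. flux_functional t (%v. \<phi> (t, v)))"
  using F(2) by (simp add: set_integrable_def flux_functional_def)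
 show e: "time_pairing T flux_functional \<phi> = - (LINT t:?I|lebesgue. LINT v|lebesgue. j t v \<bullet> wgrad (%v. \<phi> (t, v)) v)"
  by (simp add: time_pairing_def flux_functional_def set_lebesgue_integral_def)
 show e2: "time_pairing T flux_functional \<phi> = - (LINT (t, v)|lborel. indicator ?I t * ?K (t, v))"
  unfolding e F(3) F(5) ..
 show i: "integrable lborel (%(t, v). indicator ?I t * ?K (t, v))" by (rule F(4))
 have "AE p in (lborel \<Otimes>\<^sub>M lborel). norm (indicator ?I (fst p) * ?K p) <= c * (indicator ?I (fst p) * (norm (J p) * ball_ind R (snd p)))"
 proof (rule lborel_pair.AE_pair_measure)
  show "{p : space (lborel \<Otimes>\<^sub>M lborel). norm (indicator ?I (fst p) * ?K p) <= c * (indicator ?I (fst p) * (norm (J p) * ball_ind R (snd p)))} : sets (lborel \<Otimes>\<^sub>M lborel)"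
   by measurable
  show "AEL t. AEL v. norm (indicator ?I (fst (t, v)) * ?K (t, v)) <= c * (indicator ?I (fst (t, v)) * (norm (J (t, v)) * ball_ind R (snd (t, v))))"
   using slice
  proof eventually_elim
   case (elim t)
   then show ?case by (cases "t : ?I") simp_all
  qed
 qed
 then have ae2: "AEL p. norm (case p of (t, v) => indicator ?I t * ?K (t, v))
   <= c * (case p of (t, v) => indicator ?I t * (norm (J (t, v)) * ball_ind R v))"
  by (simp only: case_prod_unfold prod.collapse lborel_prod)
 have "norm (LINT (t, v)|lborel. indicator ?I t * ?K (t, v)) <= (LBINT p. norm (case p of (t, v) => indicator ?I t * ?K (t, v)))"
  by (rule integral_norm_bound)
 also have "... <= (LBINT p. c * (case p of (t, v) => indicator ?I t * (norm (J (t, v)) * ball_ind R v)))"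
  by (rule integral_mono_AE[OF integrable_norm[OF i] integrable_mult_right[OF integrable_J] ae2])
 finally show "\<bar>time_pairing T flux_functional \<phi>\<bar> <= c * flux_mass R"
  unfolding e2 flux_mass_def by simp
qed

lemma pairing_lincomb:
 assumes "\<phi> : Linf_W1inf_c T" "\<rho> : Linf_W1inf_c T"
 shows "time_pairing T flux_functional (%x. a * \<phi> x + b * \<rho> x) = a * time_pairing T flux_functional \<phi> + b * time_pairing T flux_functional \<rho>"
proof -
 let ?I = "{0<..<T}"
 obtain X1 C1 R1 where X1: "X1 : Borel" "0 <= C1"
  "AEL t. t : ?I --> (AEL v. wgrad (%v. \<phi> (t, v)) v = X1 (t, v))"
  "AEL t. t : ?I --> (AEL v. norm (X1 (t, v)) <= C1 * ball_ind R1 v)"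
  by (rule Linf_W1inf_c_grad[OF assms(1)])
 obtain X2 C2 R2 where X2: "X2 : Borel" "0 <= C2"
  "AEL t. t : ?I --> (AEL v. wgrad (%v. \<rho> (t, v)) v = X2 (t, v))"
  "AEL t. t : ?I --> (AEL v. norm (X2 (t, v)) <= C2 * ball_ind R2 v)"
  by (rule Linf_W1inf_c_grad[OF assms(2)])
 let ?X = "%p. a *\<^sub>R X1 p + b *\<^sub>R X2 p"
 obtain S1 where S1: "AEL t. t : ?I --> weakly_differentiable (%v. \<phi> (t, v)) \<and> supp_in_ball S1 (%v. \<phi> (t, v))"
  by (rule Linf_W1inf_c_slices[OF assms(1)])
 obtain S2 where S2: "AEL t. t : ?I --> weakly_differentiable (%v. \<rho> (t, v)) \<and> supp_in_ball S2 (%v. \<rho> (t, v))"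
  by (rule Linf_W1inf_c_slices[OF assms(2)])
 have w: "AEL t. t : ?I --> (AEL v. wgrad (%v. a * \<phi> (t, v) + b * \<rho> (t, v)) v = ?X (t, v))"
  using S1 S2 X1(3) X2(3)
 proof eventually_elim
  case (elim t)
  show ?case
  proof
   assume "t : ?I"
   with elim have "weakly_differentiable (%v. \<phi> (t, v))" "weakly_differentiable (%v. \<rho> (t, v))"
    "AEL v. wgrad (%v. \<phi> (t, v)) v = X1 (t, v)" "AEL v. wgrad (%v. \<rho> (t, v)) v = X2 (t, v)" by blast+
   from wgrad_lincomb(2)[OF this(1,2), of a b] this(3,4)
   show "AEL v. wgrad (%v. a * \<phi> (t, v) + b * \<rho> (t, v)) v = ?X (t, v)" by eventually_elim simp
  qed
 qed
 have bd: "AEL t. t : ?I --> (AEL v. norm (?X (t, v)) <= (\<bar>a\<bar> * C1 + \<bar>b\<bar> * C2) * ball_ind (max R1 R2) v)"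
  using X1(4) X2(4)
 proof eventually_elim
  case (elim t)
  show ?case
  proof
   assume "t : ?I"
   with elim have "AEL v. norm (X1 (t, v)) <= C1 * ball_ind R1 v" "AEL v. norm (X2 (t, v)) <= C2 * ball_ind R2 v" by blast+
   then show "AEL v. norm (?X (t, v)) <= (\<bar>a\<bar> * C1 + \<bar>b\<bar> * C2) * ball_ind (max R1 R2) v"
   proof eventually_elim
    case (elim v)
    have i: "C1 * ball_ind R1 v <= C1 * ball_ind (max R1 R2) v" "C2 * ball_ind R2 v <= C2 * ball_ind (max R1 R2) v"
     using X1(2) X2(2) by (auto simp: indicator_def)
    have "norm (?X (t, v)) <= \<bar>a\<bar> * norm (X1 (t, v)) + \<bar>b\<bar> * norm (X2 (t, v))"
     using norm_triangle_ineq[of "a *\<^sub>R X1 (t, v)" "b *\<^sub>R X2 (t, v)"] by simp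
    also have "... <= \<bar>a\<bar> * (C1 * ball_ind (max R1 R2) v) + \<bar>b\<bar> * (C2 * ball_ind (max R1 R2) v)"
     using elim i by (intro add_mono mult_left_mono) auto
    finally show ?case by (simp add: algebra_simps)
   qed
  qed
 qed
 have mX: "?X : Borel" using X1(1) X2(1) by measurable
 have c0: "0 <= \<bar>a\<bar> * C1 + \<bar>b\<bar> * C2" using X1(2) X2(2) by simp
 have "(%(t, v). indicator ?I t * (J (t, v) \<bullet> ?X (t, v))) = (%p. a * (case p of (t, v) => indicator ?I t * (J (t, v) \<bullet> X1 (t, v))) + b * (case p of (t, v) => indicator ?I t * (J (t, v) \<bullet> X2 (t, v))))"
  by (auto simp: fun_eq_iff inner_add_right algebra_simps)
 then have "(LINT (t, v)|lborel. indicator ?I t * (J (t, v) \<bullet> ?X (t, v)))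
  = a * (LINT (t, v)|lborel. indicator ?I t * (J (t, v) \<bullet> X1 (t, v))) + b * (LINT (t, v)|lborel. indicator ?I t * (J (t, v) \<bullet> X2 (t, v)))"
  using pairing(5)[OF X1] pairing(5)[OF X2] by (simp only: Bochner_Integration.integral_add integrable_mult_right integral_mult_right_zero)
 then show ?thesis
  unfolding pairing(4)[where \<phi>="%x. a * \<phi> x + b * \<rho> x", OF mX c0 w bd] pairing(4)[OF X1] pairing(4)[OF X2] by simp
qed

lemma time_pairing_dual: "time_pairing T flux_functional : Linf_W1inf_c_dual T"
 unfolding seq_dual_def
proof (intro CollectI conjI ballI allI impI)
 let ?I = "{0<..<T}"
 fix \<phi> \<rho> :: "real \<times> (real^3) => real" and a b
 assume "\<phi> : Linf_W1inf_c T" "\<rho> : Linf_W1inf_c T"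
 then show "time_pairing T flux_functional (%x. a * \<phi> x + b * \<rho> x) = a * time_pairing T flux_functional \<phi> + b * time_pairing T flux_functional \<rho>"
  by (rule pairing_lincomb)
next
 let ?I = "{0<..<T}"
 fix \<phi>s :: "nat => real \<times> (real^3) => real" and \<phi>
 assume a: "(\<forall>n. \<phi>s n : Linf_W1inf_c T) \<and> \<phi> : Linf_W1inf_c T \<and> conv_Linf_W1inf_c T \<phi>s \<phi>"
 then have mem: "\<phi>s n : Linf_W1inf_c T" "\<phi> : Linf_W1inf_c T" for n by auto
 from a have cv: "conv_Linf_W1inf_c T \<phi>s \<phi>" by blast
 then obtain R1 where R1': "!!n. AE t in lebesgue_on ?I. supp_in_ball R1 (%v. \<phi>s n (t, v))"
  unfolding conv_Linf_W1inf_c_def by blast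
 have R1: "AEL t. t : ?I --> supp_in_ball R1 (%v. \<phi>s n (t, v))" for n
  using R1'[of n] by (subst (asm) AE_lebesgue_on_iff) simp_all
 obtain R2 where R2: "AEL t. t : ?I --> weakly_differentiable (%v. \<phi> (t, v)) \<and> supp_in_ball R2 (%v. \<phi> (t, v))"
  by (rule Linf_W1inf_c_slices[OF mem(2)])
 define R where "R = max R1 R2"
 show "(%n. time_pairing T flux_functional (\<phi>s n)) \<leadsto> time_pairing T flux_functional \<phi>"
 proof (rule tendstoI)
  fix e :: real assume e: "0 < e"
  (* One is added because the mass of the flux may vanish. *)
  define \<epsilon> where "\<epsilon> = e / (1 + flux_mass (R + 1))"
  have fm: "0 <= flux_mass (R + 1)" by (rule flux_mass_nonneg)
  have \<epsilon>: "0 < \<epsilon>" "\<epsilon> * flux_mass (R + 1) < e" using e fm by (auto simp: \<epsilon>_def field_simps)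
  have "\<forall>\<^sub>F n in sequentially. AE t in lebesgue_on ?I. W1inf_norm (%v. \<phi>s n (t, v) - \<phi> (t, v)) <= ereal \<epsilon>"
   using cv \<epsilon>(1) unfolding conv_Linf_W1inf_c_def by blast
  then show "\<forall>\<^sub>F n in sequentially. dist (time_pairing T flux_functional (\<phi>s n)) (time_pairing T flux_functional \<phi>) < e"
  proof eventually_elim
   case (elim n)
   have small: "AEL t. t : ?I --> W1inf_norm (%v. \<phi>s n (t, v) - \<phi> (t, v)) <= ereal \<epsilon>"
    using elim by (subst (asm) AE_lebesgue_on_iff) simp_all
   obtain Sn where Sn: "AEL t. t : ?I --> weakly_differentiable (%v. \<phi>s n (t, v)) \<and> supp_in_ball Sn (%v. \<phi>s n (t, v))"
    by (rule Linf_W1inf_c_slices[OF mem(1)])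
   obtain X1 C1 S1 where X1: "X1 : Borel" "0 <= C1"
    "AEL t. t : ?I --> (AEL v. wgrad (%v. \<phi>s n (t, v)) v = X1 (t, v))"
    "AEL t. t : ?I --> (AEL v. norm (X1 (t, v)) <= C1 * ball_ind S1 v)"
    by (rule Linf_W1inf_c_grad[OF mem(1)])
   obtain X2 C2 S2 where X2: "X2 : Borel" "0 <= C2"
    "AEL t. t : ?I --> (AEL v. wgrad (%v. \<phi> (t, v)) v = X2 (t, v))"
    "AEL t. t : ?I --> (AEL v. norm (X2 (t, v)) <= C2 * ball_ind S2 v)"
    by (rule Linf_W1inf_c_grad[OF mem(2)])
   let ?d = "%x. 1 * \<phi>s n x + (-1) * \<phi> x" and ?X = "%p. X1 p - X2 p"
   have de: "(%v. ?d (t, v)) = (%v. \<phi>s n (t, v) - \<phi> (t, v))" for t by simp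
   have both: "AEL t. t : ?I --> (AEL v. wgrad (%v. ?d (t, v)) v = ?X (t, v)) \<and>
    (AEL v. norm (?X (t, v)) <= \<epsilon> * ball_ind (R + 1) v)"
    using Sn X1(3) X2(3) small R1[of n] R2
   proof eventually_elim
    case (elim t)
    show ?case
    proof
     assume "t : ?I"
     with elim have g: "weakly_differentiable (%v. \<phi>s n (t, v))" "weakly_differentiable (%v. \<phi> (t, v))"
      "AEL v. wgrad (%v. \<phi>s n (t, v)) v = X1 (t, v)" "AEL v. wgrad (%v. \<phi> (t, v)) v = X2 (t, v)"
      "W1inf_norm (%v. \<phi>s n (t, v) - \<phi> (t, v)) <= ereal \<epsilon>" "supp_in_ball R1 (%v. \<phi>s n (t, v))" "supp_in_ball R2 (%v. \<phi> (t, v))" by blast+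
     note lc = wgrad_lincomb[OF g(1,2), of 1 "-1"]
     have w: "AEL v. wgrad (%v. ?d (t, v)) v = ?X (t, v)" using lc(2) g(3,4) by eventually_elim simp
     have n: "AEL v. norm (wgrad (%v. ?d (t, v)) v) <= \<epsilon>" unfolding de by (rule W1inf_norm_leD(2)[OF g(5)])
     have "supp_in_ball R (%v. ?d (t, v))" using g(6,7) unfolding supp_in_ball_def by eventually_elim (auto simp: R_def)
     from wgrad_zero_outside[OF lc(1) this] n w
     have "AEL v. norm (?X (t, v)) <= \<epsilon> * ball_ind (R + 1) v" by eventually_elim (auto simp: indicator_def)
     with w show "(AEL v. wgrad (%v. ?d (t, v)) v = ?X (t, v)) \<and> (AEL v. norm (?X (t, v)) <= \<epsilon> * ball_ind (R + 1) v)" by blast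
    qed
   qed
   have w: "AEL t. t : ?I --> (AEL v. wgrad (%v. ?d (t, v)) v = ?X (t, v))"
    and bd: "AEL t. t : ?I --> (AEL v. norm (?X (t, v)) <= \<epsilon> * ball_ind (R + 1) v)"
    using both by (eventually_elim, blast)+
   have mX: "?X : Borel" using X1(1) X2(1) by measurable
   have "\<bar>time_pairing T flux_functional ?d\<bar> <= \<epsilon> * flux_mass (R + 1)"
    by (rule pairing(6)[where \<phi>="?d", OF mX less_imp_le[OF \<epsilon>(1)] w bd])
   with \<epsilon>(2) show ?case unfolding pairing_lincomb[OF mem(1)[of n] mem(2), of 1 "-1"] by (simp add: dist_real_def)
  qed
 qed
qed

end

lemma const_Linf_W1inf_c:
 assumes "\<psi> : W1inf_c" shows "(%p. \<psi> (snd p)) : Linf_W1inf_c T"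
proof -
 obtain u Y C R where u: "AEL v. \<psi> v = u v" "borel_weak_grad u Y" "AEL v. wgrad \<psi> v = Y v"
  "0 <= C" "AEL v. \<bar>u v\<bar> <= C" "AEL v. norm (Y v) <= C"
  "AEL v. R < norm v --> u v = 0" "AEL v. R < norm v --> Y v = 0"
  by (rule W1inf_c_rep[OF assms])
 have [measurable]: "u : Borel" using u(2) by (auto simp: borel_weak_grad_def loc_int_def)
 have "(%p. u (snd p)) : borel_measurable (borel :: (real \<times> (real^3)) measure)"
  unfolding borel_prod[symmetric] by measurable
 from borel_imp_slab_measurable[OF this, of T "%t. \<psi>"] u(1)
 have m: "slab_measurable T (%t. \<psi>)" by simp
 have n0: "0 <= W1inf_norm \<psi>" unfolding W1inf_norm_def by (intro add_nonneg_nonneg esssup_lebesgue_nonneg) auto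
 from assms obtain S where S: "supp_in_ball S \<psi>" and f: "W1inf_norm \<psi> < \<infinity>" by (auto simp: W1inf_c_def)
 obtain D where "W1inf_norm \<psi> = ereal D" using f n0 by (cases "W1inf_norm \<psi>") auto
 with S assms show ?thesis
  unfolding Linf_W1inf_c_def mem_Collect_eq snd_conv
  by (intro conjI m) (rule exI[of _ D], rule exI[of _ S], simp)
qed

text \<open>A functional at a fixed time is the pairing over the time interval $(0,1)$ with the flux
 constant in time, restricted to test functions constant in time.\<close>

lemma flux_functional_W1inf_c_dual:
 assumes [measurable]: "h : Borel"
  and fin: "!!R. (NBALL R (%v. ennreal (norm (h v)))) < \<infinity>"
  and j: "AEL v. j v = h v"
 shows "(%\<psi>. - (LINT v|lebesgue. j v \<bullet> wgrad \<psi> v)) : W1inf_c_dual"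
proof -
 let ?L = "%\<psi>. - (LINT v|lebesgue. j v \<bullet> wgrad \<psi> v)"
 interpret C: integrable_flux 1 "%p. h (snd p)" "%t. j"
 proof
  show "(%p. h (snd p)) : borel_measurable (borel :: (real \<times> (real^3)) measure)"
   unfolding borel_prod[symmetric] by measurable
  show "(NBSET {0<..<1::real} (%t. (NBALL R (%v. ennreal (norm (h (snd (t, v)))))))) < \<infinity>" for R
   using fin[of R] by (simp add: nn_integral_cmult_indicator ennreal_mult_less_top)
  show "AEL t. t : {0<..<1::real} --> (AEL v. j v = h (snd (t, v)))" using j by simp
 qed
 have m1: "measure lebesgue {0<..<1::real} = 1" by (simp add: measure_completion)
 have L: "time_pairing 1 C.flux_functional (%p. \<psi> (snd p)) = ?L \<psi>" for \<psi>
  using m1 by (simp add: time_pairing_def C.flux_functional_def set_lebesgue_integral_def integral_mult_left_zero)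
 show ?thesis
  unfolding seq_dual_def
 proof (intro CollectI conjI ballI allI impI)
  fix u w :: "real^3 => real" and a b assume "u : W1inf_c" "w : W1inf_c"
  from C.pairing_lincomb[OF const_Linf_W1inf_c[OF this(1)] const_Linf_W1inf_c[OF this(2)], of a b]
  show "?L (%x. a * u x + b * w x) = a * ?L u + b * ?L w" unfolding L[symmetric] .
 next
  fix us :: "nat => real^3 => real" and u
  assume a: "(\<forall>n. us n : W1inf_c) \<and> u : W1inf_c \<and> conv_W1inf_c us u"
  then obtain R where R: "!!n. supp_in_ball R (us n)" and l: "(%n. W1inf_norm (%v. us n v - u v)) \<leadsto> 0"
   by (auto simp: conv_W1inf_c_def)
  have "\<forall>\<^sub>F n in sequentially. W1inf_norm (%v. us n v - u v) <= ereal \<epsilon>" if "0 < \<epsilon>" for \<epsilon>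
  proof -
   have "\<forall>\<^sub>F n in sequentially. W1inf_norm (%v. us n v - u v) < ereal \<epsilon>"
    by (rule order_tendstoD(2)[OF l]) (use that in simp)
   then show ?thesis by eventually_elim simp
  qed
  note small = this
  have "\<forall>\<epsilon>>0. \<forall>\<^sub>F n in sequentially. AE t in lebesgue_on {0<..<1::real}. W1inf_norm (%v. us n v - u v) <= ereal \<epsilon>"
  proof (intro allI impI)
   fix \<epsilon> :: real assume "0 < \<epsilon>"
   from small[OF this] show "\<forall>\<^sub>F n in sequentially. AE t in lebesgue_on {0<..<1::real}. W1inf_norm (%v. us n v - u v) <= ereal \<epsilon>"
    by eventually_elim simp
  qed
  then have "conv_Linf_W1inf_c 1 (%n p. us n (snd p)) (%p. u (snd p))"
   using R unfolding conv_Linf_W1inf_c_def by (intro conjI exI[of _ R]) simp_all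
  note cv = this
  have m: "\<forall>n. (%p. us n (snd p)) : Linf_W1inf_c 1" "(%p. u (snd p)) : Linf_W1inf_c 1"
   using a const_Linf_W1inf_c by simp_all
  have cont: "(%n. time_pairing 1 C.flux_functional (\<phi>s n)) \<leadsto> time_pairing 1 C.flux_functional \<phi>"
   if "\<forall>n. \<phi>s n : Linf_W1inf_c 1" "\<phi> : Linf_W1inf_c 1" "conv_Linf_W1inf_c 1 \<phi>s \<phi>" for \<phi>s \<phi>
   using C.time_pairing_dual that unfolding seq_dual_def by simp
  have "(%n. time_pairing 1 C.flux_functional (%p. us n (snd p))) \<leadsto> time_pairing 1 C.flux_functional (%p. u (snd p))"
   by (rule cont[OF m cv])
  then show "(%n. ?L (us n)) \<leadsto> ?L u" unfolding L .
 qed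
qed

lemma smooth_test_time_derivative:
 fixes \<theta> :: "real => real"
 assumes "smooth_test A \<theta>"
 obtains B where "0 < B" "!!t. \<bar>\<theta> t\<bar> <= B" "!!t. \<bar>deriv \<theta> t\<bar> <= B"
  "\<theta> : Borel" "deriv \<theta> : Borel"
proof -
 have t: "smooth_test UNIV \<theta>" using assms by (auto simp: smooth_test_def Ck_test_def)
 then have s: "smooth \<theta>" by (simp add: smooth_test_iff)
 have d: "deriv \<theta> t = frechet_derivative \<theta> (at t) 1" for t
 proof -
  have "\<theta> differentiable (at t)" using smooth_has_derivative[OF s] by (auto simp: differentiable_def)
  then have "(\<theta> has_real_derivative deriv \<theta> t) (at t)" by (simp add: DERIV_deriv_iff_real_differentiable)
  from frechet_derivative_eqI[OF has_field_derivative_imp_has_derivative[OF this], of 1] show ?thesis by simp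
 qed
 obtain B1 where B1: "0 < B1" "!!t. \<bar>\<theta> t\<bar> <= B1" using smooth_test_bounded[OF t] by blast
 obtain B2 where B2: "0 < B2" "!!t. \<bar>frechet_derivative \<theta> (at t) 1\<bar> <= B2"
  using smooth_test_bounded[OF smooth_test_frechet_derivative[OF t, of 1]] by blast
 have m: "deriv \<theta> : Borel"
  using smooth_borel[OF smooth_frechet_derivative[OF s, of 1]] unfolding d[abs_def] .
 show ?thesis
 proof (rule that[of "max B1 B2", OF _ _ _ smooth_borel[OF s] m])
  show "0 < max B1 B2" using B1(1) by simp
  show "\<bar>\<theta> t\<bar> <= max B1 B2" "\<bar>deriv \<theta> t\<bar> <= max B1 B2" for t
   using B1(2)[of t] B2(2)[of t] by (simp_all add: d)
 qed
qed

lemma norm_le_of_components: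
 fixes x :: "real^3"
 assumes "!!i. \<bar>x $ i\<bar> <= C" shows "norm x <= 3 * C"
proof -
 have "norm x <= (\<Sum>i\<in>UNIV. \<bar>x $ i\<bar>)" by (rule norm_le_l1_cart)
 also have "... <= (\<Sum>i\<in>(UNIV::3 set). C)" by (rule sum_mono) (rule assms)
 finally show ?thesis by simp
qed

context integrable_flux
begin

lemma AE_slice_dual: "AEL t. t : {0<..<T} --> flux_functional t : W1inf_c_dual"
proof -
 have "AEL t. (NBALL (real n) (%v. ennreal (norm (J (t, v))))) * indicator {0<..<T} t \<noteq> \<infinity>" for n :: nat
  using J_fin[of "real n"] by (intro nn_integral_PInf_AE) auto
 then have "AEL t. \<forall>n::nat. (NBALL (real n) (%v. ennreal (norm (J (t, v))))) * indicator {0<..<T} t \<noteq> \<infinity>"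
  unfolding AE_all_countable by blast
 with j_eq show ?thesis
 proof eventually_elim
  case (elim t)
  show ?case
  proof
   assume t: "t : {0<..<T}"
   have "(NBALL R (%v. ennreal (norm (J (t, v))))) < \<infinity>" for R
   proof -
    obtain n :: nat where n: "R <= real n" using real_arch_simple by blast
    have "(NBALL R (%v. ennreal (norm (J (t, v))))) <= (NBALL (real n) (%v. ennreal (norm (J (t, v)))))"
     using n by (intro nn_integral_mono) (auto simp: indicator_def)
    also have "... < \<infinity>" using spec[OF elim(2), of n] t by (simp add: less_top)
    finally show ?thesis .
   qed
   moreover have "(%v. J (t, v)) : Borel" by measurable
   moreover have "AEL v. j t v = J (t, v)" using elim(1) t by blast
   ultimately have "(%\<psi>. - (LINT v|lebesgue. j t v \<bullet> wgrad \<psi> v)) : W1inf_c_dual"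
    by (intro flux_functional_W1inf_c_dual[where h="%v. J (t, v)"])
   then show "flux_functional t : W1inf_c_dual" unfolding flux_functional_def[abs_def] .
  qed
 qed
qed

text \<open>It is enough to test with smooth functions of the velocity: the mollifications of an element of
 \<open>W1inf_c\<close> and their gradients are bounded uniformly, have supports in a common ball and converge
 almost everywhere.\<close>

lemma is_time_derivI:
 assumes Fb[measurable]: "F : Borel"
  and F_fin: "!!R. (NBSET {0<..<T} (%t. (NBALL R (%v. ennreal (norm (F (t, v) :: real)))))) < \<infinity>"
  and F_eq: "AEL t. t : {0<..<T} --> (AEL v. f t v = F (t, v))"
  and sm: "!!\<theta> \<psi>. smooth_test {0<..<T} \<theta> ==> smooth_test UNIV \<psi> ==>
   (LINT (t, v)|lborel. indicator {0<..<T} t * (\<theta> t * (J (t, v) \<bullet> grad \<psi> v))) =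
   (LINT (t, v)|lborel. indicator {0<..<T} t * (deriv \<theta> t * (F (t, v) * \<psi> v)))"
 shows "is_time_deriv T f flux_functional"
 unfolding is_time_deriv_def
proof (intro conjI ballI allI impI)
 let ?I = "{0<..<T}"
 show "AE t in lebesgue_on ?I. flux_functional t : W1inf_c_dual"
  using AE_slice_dual by (simp add: AE_lebesgue_on_iff)
 fix \<psi> \<theta> assume \<psi>: "\<psi> : W1inf_c" and \<theta>: "smooth_test ?I \<theta>"
 obtain u Y C R where u: "AEL v. \<psi> v = u v" "borel_weak_grad u Y" "AEL v. wgrad \<psi> v = Y v"
  and C: "0 <= C" "AEL v. \<bar>u v\<bar> <= C" "AEL v. norm (Y v) <= C"
  and R: "AEL v. R < norm v --> u v = 0" "AEL v. R < norm v --> Y v = 0"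
  by (rule W1inf_c_rep[OF \<psi>])
 obtain B where B: "0 < B" "!!t. \<bar>\<theta> t\<bar> <= B" "!!t. \<bar>deriv \<theta> t\<bar> <= B"
  and [measurable]: "\<theta> : Borel" "deriv \<theta> : Borel"
  using smooth_test_time_derivative[OF \<theta>] by metis
 have lu: "loc_int u" and lY: "!!i. loc_int (%v. Y v $ i)" and Yb[measurable]: "Y : Borel"
  using u(2) by (auto simp: borel_weak_grad_def)
 have ub[measurable]: "u : Borel" using lu by (simp add: loc_int_def)
 have Fp[measurable]: "F : borel_measurable (borel \<Otimes>\<^sub>M borel)" by (simp add: borel_prod)
 obtain r where "filterlim r at_top sequentially"
  and limu: "AEL x. (%k. moll (r k) u x) \<leadsto> u x"
  and limY: "AEL x. \<forall>i. (%k. partial i (moll (r k) u) x) \<leadsto> Y x $ i"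
  by (rule borel_weak_grad_moll_AE[OF u(2)])
 let ?\<psi> = "%k. moll (r k) u"
 have s\<psi>: "smooth (?\<psi> k)" for k by (rule smooth_moll[OF lu])
 have z\<psi>: "?\<psi> k v = 0" if "R + 1 <= norm v" for k v by (rule moll_zero_outside[OF R(1) that lu])
 have t\<psi>: "smooth_test UNIV (?\<psi> k)" for k by (rule smooth_testI[OF s\<psi>, of "R + 1"]) (simp add: z\<psi>)
 have b\<psi>: "\<bar>?\<psi> k v\<bar> <= C * ball_ind (R + 1) v" for k v
  using moll_bound[OF lu C(2), of "r k" v] z\<psi>[of v k] by (cases "norm v <= R + 1") (auto simp: indicator_def)
 have bY: "norm (grad (?\<psi> k) v) <= 3 * C * ball_ind (R + 1) v" for k v
 proof (cases "norm v <= R + 1")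
  case True
  have "AEL v. \<bar>Y v $ i\<bar> <= C" for i
   using C(3) by eventually_elim (rule order_trans[OF component_le_norm_cart])
  then have "\<bar>grad (?\<psi> k) v $ i\<bar> <= C" for i
   using moll_bound[OF lY[of i]] by (simp add: grad_def partial_moll[OF u(2)])
  then have "norm (grad (?\<psi> k) v) <= 3 * C" by (rule norm_le_of_components)
  then show ?thesis using True by (simp add: indicator_def)
 next
  case False
  then have "partial i (?\<psi> k) v = 0" for i
   by (intro partial_zero_outside[OF s\<psi>, of "R + 1"]) (auto simp: z\<psi>)
  then have "grad (?\<psi> k) v = 0" by (simp add: grad_def vec_eq_iff)
  then show ?thesis using C(1) by (simp add: indicator_def)
 qed
 have intF: "integrable lborel (%(t, v). indicator ?I t * (norm (F (t, v)) * ball_ind S v))" for S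
  by (rule slab_integrable_ball[OF Fb F_fin])
 have lim1: "(%k. LINT (t, v)|lborel. indicator ?I t * (\<theta> t * (J (t, v) \<bullet> grad (?\<psi> k) v))) \<leadsto> (LINT (t, v)|lborel. indicator ?I t * (\<theta> t * (J (t, v) \<bullet> Y v)))"
 proof (rule integral_dominated_convergence[where w="%p. (B * (3 * C)) * (case p of (t, v) => indicator ?I t * (norm (J (t, v)) * ball_ind (R + 1) v))"])
  show "integrable lborel (%p. (B * (3 * C)) * (case p of (t, v) => indicator ?I t * (norm (J (t, v)) * ball_ind (R + 1) v)))"
   by (intro integrable_mult_right integrable_J)
  have [measurable]: "grad (?\<psi> k) : Borel" for k by (rule grad_borel[OF s\<psi>])
  show "(%(t, v). indicator ?I t * (\<theta> t * (J (t, v) \<bullet> Y v))) : borel_measurable lborel"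
   "(%(t, v). indicator ?I t * (\<theta> t * (J (t, v) \<bullet> grad (?\<psi> k) v))) : borel_measurable lborel" for k
   unfolding measurable_lborel1 measurable_lborel2 borel_prod[symmetric] by measurable
  have "AE p in (lborel :: (real \<times> (real^3)) measure). (%k. grad (?\<psi> k) (snd p)) \<leadsto> Y (snd p)"
   by (rule AE_lborel_snd) (use limY in \<open>eventually_elim, auto simp: grad_def intro!: vec_tendstoI\<close>)
  then show "AEL p. (%k. case p of (t, v) => indicator ?I t * (\<theta> t * (J (t, v) \<bullet> grad (?\<psi> k) v))) \<leadsto> (case p of (t, v) => indicator ?I t * (\<theta> t * (J (t, v) \<bullet> Y v)))"
   by eventually_elim (auto simp: case_prod_unfold intro!: tendsto_intros)
  show "AEL p. norm (case p of (t, v) => indicator ?I t * (\<theta> t * (J (t, v) \<bullet> grad (?\<psi> k) v)))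
   <= (B * (3 * C)) * (case p of (t, v) => indicator ?I t * (norm (J (t, v)) * ball_ind (R + 1) v))" for k
  proof (rule AE_I2)
   fix p :: "real \<times> (real^3)"
   obtain t v where p: "p = (t, v)" by force
   have "\<bar>J (t, v) \<bullet> grad (?\<psi> k) v\<bar> <= norm (J (t, v)) * norm (grad (?\<psi> k) v)" by (rule Cauchy_Schwarz_ineq2)
   also have "... <= norm (J (t, v)) * (3 * C * ball_ind (R + 1) v)" by (rule mult_left_mono[OF bY]) simp
   finally have "\<bar>\<theta> t\<bar> * \<bar>J (t, v) \<bullet> grad (?\<psi> k) v\<bar> <= B * (norm (J (t, v)) * (3 * C * ball_ind (R + 1) v))"
    using B(1) by (intro mult_mono B(2)) auto
   from mult_left_mono[OF this, of "indicator ?I t"]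
   show "norm (case p of (t, v) => indicator ?I t * (\<theta> t * (J (t, v) \<bullet> grad (?\<psi> k) v)))
    <= (B * (3 * C)) * (case p of (t, v) => indicator ?I t * (norm (J (t, v)) * ball_ind (R + 1) v))"
    by (simp add: p abs_mult ac_simps)
  qed
 qed
 have lim2: "(%k. LINT (t, v)|lborel. indicator ?I t * (deriv \<theta> t * (F (t, v) * ?\<psi> k v))) \<leadsto> (LINT (t, v)|lborel. indicator ?I t * (deriv \<theta> t * (F (t, v) * u v)))"
 proof (rule integral_dominated_convergence[where w="%p. (B * C) * (case p of (t, v) => indicator ?I t * (norm (F (t, v)) * ball_ind (R + 1) v))"])
  show "integrable lborel (%p. (B * C) * (case p of (t, v) => indicator ?I t * (norm (F (t, v)) * ball_ind (R + 1) v)))"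
   by (intro integrable_mult_right intF)
  have [measurable]: "?\<psi> k : Borel" for k by (rule smooth_borel[OF s\<psi>])
  show "(%(t, v). indicator ?I t * (deriv \<theta> t * (F (t, v) * u v))) : borel_measurable lborel"
   "(%(t, v). indicator ?I t * (deriv \<theta> t * (F (t, v) * ?\<psi> k v))) : borel_measurable lborel" for k
   unfolding measurable_lborel1 measurable_lborel2 borel_prod[symmetric] by measurable
  have "AE p in (lborel :: (real \<times> (real^3)) measure). (%k. ?\<psi> k (snd p)) \<leadsto> u (snd p)"
   by (rule AE_lborel_snd[OF limu])
  then show "AEL p. (%k. case p of (t, v) => indicator ?I t * (deriv \<theta> t * (F (t, v) * ?\<psi> k v))) \<leadsto> (case p of (t, v) => indicator ?I t * (deriv \<theta> t * (F (t, v) * u v)))"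
   by eventually_elim (auto simp: case_prod_unfold intro!: tendsto_intros)
  show "AEL p. norm (case p of (t, v) => indicator ?I t * (deriv \<theta> t * (F (t, v) * ?\<psi> k v)))
   <= (B * C) * (case p of (t, v) => indicator ?I t * (norm (F (t, v)) * ball_ind (R + 1) v))" for k
  proof (rule AE_I2)
   fix p :: "real \<times> (real^3)"
   obtain t v where p: "p = (t, v)" by force
   have "\<bar>deriv \<theta> t\<bar> * (\<bar>F (t, v)\<bar> * \<bar>?\<psi> k v\<bar>) <= B * (\<bar>F (t, v)\<bar> * (C * ball_ind (R + 1) v))"
    using B(1) by (intro mult_mono mult_left_mono B(3) b\<psi>) auto
   from mult_left_mono[OF this, of "indicator ?I t"]
   show "norm (case p of (t, v) => indicator ?I t * (deriv \<theta> t * (F (t, v) * ?\<psi> k v)))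
    <= (B * C) * (case p of (t, v) => indicator ?I t * (norm (F (t, v)) * ball_ind (R + 1) v))"
    by (simp add: p abs_mult ac_simps)
  qed
 qed
 have key: "(LINT (t, v)|lborel. indicator ?I t * (\<theta> t * (J (t, v) \<bullet> Y v))) = (LINT (t, v)|lborel. indicator ?I t * (deriv \<theta> t * (F (t, v) * u v)))"
  using LIMSEQ_unique[OF lim1[unfolded sm[OF \<theta> t\<psi>]] lim2] .
 let ?K1 = "%p. \<theta> (fst p) * (J p \<bullet> Y (snd p))" and ?K2 = "%p. deriv \<theta> (fst p) * (F p * u (snd p))"
 have m1: "?K1 : Borel" and m2: "?K2 : Borel"
  unfolding borel_prod[symmetric] by measurable
 have BC: "0 <= B * C" using B(1) C(1) by simp
 have b1: "AEL v. \<bar>?K1 (t, v)\<bar> <= (B * C) * (norm (J (t, v)) * ball_ind R v)" for t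
  using C(3) R(2)
 proof eventually_elim
  case (elim v)
  have "\<bar>J (t, v) \<bullet> Y v\<bar> <= norm (J (t, v)) * norm (Y v)" by (rule Cauchy_Schwarz_ineq2)
  also have "... <= norm (J (t, v)) * (C * ball_ind R v)" using elim by (intro mult_left_mono) (auto simp: indicator_def)
  finally have "\<bar>\<theta> t\<bar> * \<bar>J (t, v) \<bullet> Y v\<bar> <= B * (norm (J (t, v)) * (C * ball_ind R v))"
   using B(1) by (intro mult_mono B(2)) auto
  then show ?case by (simp add: abs_mult ac_simps)
 qed
 have f1: "(NBSET ?I (%t. (NBINT v. ennreal \<bar>?K1 (t, v)\<bar>))) < \<infinity>"
  by (rule slab_dominated[where K="?K1", OF J_borel J_fin BC AE_I2[OF impI[OF b1]]])
 have b2: "AEL v. \<bar>?K2 (t, v)\<bar> <= (B * C) * (norm (F (t, v)) * ball_ind R v)" for t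
  using C(2) R(1)
 proof eventually_elim
  case (elim v)
  have "\<bar>u v\<bar> <= C * ball_ind R v" using elim by (auto simp: indicator_def)
  then have "\<bar>deriv \<theta> t\<bar> * (\<bar>F (t, v)\<bar> * \<bar>u v\<bar>) <= B * (\<bar>F (t, v)\<bar> * (C * ball_ind R v))"
   using B(1) by (intro mult_mono mult_left_mono B(3)) auto
  then show ?case by (simp add: abs_mult ac_simps)
 qed
 have f2: "(NBSET ?I (%t. (NBINT v. ennreal \<bar>?K2 (t, v)\<bar>))) < \<infinity>"
  by (rule slab_dominated[where K="?K2", OF Fb F_fin BC AE_I2[OF impI[OF b2]]])
 have a1: "AEL t. t : ?I --> (AEL v. \<theta> t * (j t v \<bullet> wgrad \<psi> v) = ?K1 (t, v))"
  using j_eq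
 proof eventually_elim
  case (elim t)
  show ?case
  proof
   assume "t : ?I"
   with elim have "AEL v. j t v = J (t, v)" by blast
   with u(3) show "AEL v. \<theta> t * (j t v \<bullet> wgrad \<psi> v) = ?K1 (t, v)" by eventually_elim simp
  qed
 qed
 have a2: "AEL t. t : ?I --> (AEL v. deriv \<theta> t * (f t v * \<psi> v) = ?K2 (t, v))"
  using F_eq
 proof eventually_elim
  case (elim t)
  show ?case
  proof
   assume "t : ?I"
   with elim have "AEL v. f t v = F (t, v)" by blast
   with u(1) show "AEL v. deriv \<theta> t * (f t v * \<psi> v) = ?K2 (t, v)" by eventually_elim simp
  qed
 qed
 note S1 = slab_Fubini[OF m1 f1 a1] and S2 = slab_Fubini[OF m2 f2 a2]
 show "set_integrable lebesgue ?I (%t. \<theta> t * flux_functional t \<psi>)"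
  using S1(2) by (simp add: flux_functional_def set_integrable_def)
 have "(LINT t:?I|lebesgue. \<theta> t * flux_functional t \<psi>) = - (LINT t:?I|lebesgue. LINT v|lebesgue. \<theta> t * (j t v \<bullet> wgrad \<psi> v))"
  by (simp add: flux_functional_def set_lebesgue_integral_def)
 also have "... = - (LINT t:?I|lebesgue. LINT v|lebesgue. deriv \<theta> t * (f t v * \<psi> v))"
  unfolding S1(3) S2(3) S1(5)[symmetric] S2(5)[symmetric] using key by simp
 finally show "(LINT t:?I|lebesgue. \<theta> t * flux_functional t \<psi>) = - (LINT t:?I|lebesgue. deriv \<theta> t * (LINT v|lebesgue. f t v * \<psi> v))"
  by simp
qed

end

section \<open>Curves of densities with finite dissipation\<close>

lemma norm_potential_le:
 fixes k :: "real^3 => 'b::{banach, second_countable_topology}"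
 assumes [measurable]: "u : Borel" "k : Borel" and u0: "!!x. 0 <= u x"
  and kb: "!!z. norm (k z) <= c * norm z powr (-s)" and c: "0 <= c"
  and fin: "(NBINT w. ennreal (u w * norm (v - w) powr (-s))) < \<infinity>"
 shows "norm (LBINT w. u w *\<^sub>R k (v - w)) <= c * enn2real (NBINT w. ennreal (u w * norm (v - w) powr (-s)))"
proof -
 have i: "integrable lborel (%w. u w *\<^sub>R k (v - w))"
  by (rule integrable_kernel[OF assms(1,2) kb]) (use fin u0 in simp)
 let ?P = "\<integral>\<^sup>+w. ennreal (u w * norm (v - w) powr (-s)) \<partial>lborel"
 have "ennreal (norm (LBINT w. u w *\<^sub>R k (v - w))) <= (NBINT w. ennreal (norm (u w *\<^sub>R k (v - w))))"
  by (rule integral_norm_bound_ennreal[OF i])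
 also have "... <= (NBINT w. ennreal c * ennreal (u w * norm (v - w) powr (-s)))"
 proof (rule nn_integral_mono)
  fix w
  from mult_left_mono[OF kb[of "v - w"] u0[of w]]
  show "ennreal (norm (u w *\<^sub>R k (v - w))) <= ennreal c * ennreal (u w * norm (v - w) powr (-s))"
   using u0[of w] c by (simp add: ennreal_mult[symmetric] ennreal_leI ac_simps)
 qed
 also have "... = ennreal c * ?P" by (rule nn_integral_cmult) measurable
 also have "?P = ennreal (enn2real ?P)" using fin by simp
 also have "ennreal c * ... = ennreal (c * enn2real ?P)" using c by (simp add: ennreal_mult)
 finally show ?thesis using c by (simp add: ennreal_le_iff)
qed

text \<open>What remains of an H-solution once a null set of times is discarded: on it the curve may be
 taken to be zero, so that all bounds hold at every time. The function \<open>n\<close> is the weighted $L^3$ norm.\<close>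

locale landau_curve =
 fixes F :: "real \<times> (real^3) => real" and G :: "real \<times> (real^3) => real^3" and n :: "real => real" and T M H :: real
 assumes F_borel[measurable]: "F : Borel" and G_borel[measurable]: "G : Borel"
  and n_borel[measurable]: "n : Borel"
  and M_pos: "0 < M" and H_nonneg: "0 <= H" and T_pos: "0 < T"
  and density: "!!t. sobolev_density (%v. F (t, v)) (%v. G (t, v))"
  and mass_le: "!!t. (NBINT v. ennreal (F (t, v))) <= ennreal M"
  and LlogL_le: "!!t. (NBINT v. ennreal (F (t, v) * max 0 (ln (F (t, v))))) <= ennreal H"
  and n_nonneg: "!!t. 0 <= n t"
  and cube_le: "!!t R. 0 <= R ==> (NBALL R (%v. ennreal (F (t, v) ^ 3))) <= ennreal (((1 + R) * n t) ^ 3)"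
  and n_fin: "(NBSET {0<..<T} (%t. ennreal (n t))) < \<infinity>"
  and dissipation_fin: "(NBSET {0<..<T} (%t. (NBINT v. (NBINT w. ennreal (sobolev_density.pair_dissipation (%v. F (t, v)) (%v. G (t, v)) v w))))) < \<infinity>"
begin

lemma F_nonneg: "0 <= F p"
 using sobolev_density.u0[OF density[of "fst p"], of "snd p"] by simp

lemma pair_measurable[measurable]: "F : borel_measurable (borel \<Otimes>\<^sub>M borel)" "G : borel_measurable (borel \<Otimes>\<^sub>M borel)"
 by (simp_all add: borel_prod)

lemma F_slice[measurable]: "(%v. F (t, v)) : Borel"
 by measurable

text \<open>The exponent \<open>3/p\<close> is the borderline one, for which the $L\log L$ bound is needed.\<close>

lemma potential_Lp_bound:
 fixes k :: "real^3 => 'b::{banach, second_countable_topology}"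
 assumes p: "1 < p" and c: "0 <= c" and [measurable]: "k : Borel"
  and kb: "!!z. norm (k z) <= c * norm z powr (-(3/p))"
 shows "\<exists>C. \<forall>t. (NBALL R (%v. ennreal (norm (LBINT w. F (t, w) *\<^sub>R k (v - w)) powr p))) <= ennreal C"
proof -
 obtain C where C: "!!u :: real^3 => real. u : Borel ==> (!!x. 0 <= u x) ==>
  (NBINT w. ennreal (u w)) <= ennreal M ==>
  (NBINT w. ennreal (u w * max 0 (ln (u w)))) <= ennreal H ==>
  (AEL v. (NBINT w. ennreal (u w * norm (v - w) powr (-(3/p)))) < \<infinity>) \<and>
  (NBALL R (%v. ennreal (enn2real (NBINT w. ennreal (u w * norm (v - w) powr (-(3/p)))) powr p))) <= ennreal C"
  using Riesz_potential_borderline[OF p M_pos H_nonneg, of R] by blast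
 show ?thesis
 proof (intro exI[of _ "c powr p * max 0 C"] allI)
  fix t
  let ?P = "%v. \<integral>\<^sup>+w. ennreal (F (t, w) * norm (v - w) powr (-(3/p))) \<partial>lborel"
  have Ct: "AEL v. ?P v < \<infinity>" "(NBALL R (%v. ennreal (enn2real (?P v) powr p))) <= ennreal C"
   using C[OF F_slice F_nonneg mass_le LlogL_le, of t] by auto
  have "(NBALL R (%v. ennreal (norm (LBINT w. F (t, w) *\<^sub>R k (v - w)) powr p)))
   <= (NBINT v. ennreal (c powr p) * (ennreal (enn2real (?P v) powr p) * ball_ind R v))"
  proof (rule nn_integral_mono_AE)
   show "AEL v. ennreal (norm (LBINT w. F (t, w) *\<^sub>R k (v - w)) powr p) * ball_ind R v
    <= ennreal (c powr p) * (ennreal (enn2real (?P v) powr p) * ball_ind R v)"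
    using Ct(1)
   proof eventually_elim
    case (elim v)
    have "norm (LBINT w. F (t, w) *\<^sub>R k (v - w)) <= c * enn2real (?P v)"
     by (rule norm_potential_le[OF F_slice _ F_nonneg kb c elim]) measurable
    then have "norm (LBINT w. F (t, w) *\<^sub>R k (v - w)) powr p <= (c * enn2real (?P v)) powr p"
     using p by (intro powr_mono2) auto
    also have "... = c powr p * enn2real (?P v) powr p" by (rule powr_mult)
    finally show ?case by (auto simp: indicator_def ennreal_mult[symmetric] ennreal_leI)
   qed
  qed
  also have "... = ennreal (c powr p) * (NBALL R (%v. ennreal (enn2real (?P v) powr p)))"
   by (rule nn_integral_cmult) measurable
  also have "... <= ennreal (c powr p) * ennreal (max 0 C)"
   by (intro mult_left_mono order_trans[OF Ct(2)] ennreal_leI) auto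
  also have "... = ennreal (c powr p * max 0 C)" by (simp add: ennreal_mult)
  finally show "(NBALL R (%v. ennreal (norm (LBINT w. F (t, w) *\<^sub>R k (v - w)) powr p))) <= ennreal (c powr p * max 0 C)" .
 qed
qed

text \<open>The potential is estimated with the free parameter $1 + n(t)$, which makes the bound linear in
 \<open>n\<close>, the only quantity that is merely integrable in time.\<close>

lemma pair_energy_le:
 assumes R: "0 <= R"
 shows "\<exists>K\<ge>0. \<forall>t. pair_energy (%v. F (t, v)) R <= ennreal (K * (1 + n t))"
proof -
 obtain C where C: "0 <= C" "!!(u :: real^3 => real) \<mu> v. u : Borel ==> (!!x. 0 <= u x) ==> 0 < \<mu> ==>
  (NBINT w. ennreal (u w * norm (v - w) powr (-1)))
   <= (NBINT w. ennreal (u w)) + ennreal \<mu> * (ennreal C + (NBSET (cball v 1) (%w. ennreal ((u w / \<mu>) ^ 3))))"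
  using Newton_potential_L3_bound by blast
 define c where "c = M + (C + (2 + R) ^ 3)"
 have c0: "0 <= c" using M_pos C(1) R by (simp add: c_def)
 show ?thesis
 proof (intro exI[of _ "M * c"] conjI allI)
  show "0 <= M * c" using M_pos c0 by simp
  fix t
  let ?u = "%v. F (t, v)"
  (* One is added to keep the parameter positive and to absorb the mass. *)
  define \<mu> where "\<mu> = 1 + n t"
  have \<mu>: "1 <= \<mu>" "n t <= \<mu>" "0 < \<mu>" using n_nonneg[of t] by (simp_all add: \<mu>_def)
  have pot: "(NBINT w. ennreal (?u w * norm (v - w) powr (-1))) <= ennreal (c * \<mu>)" if v: "norm v <= R" for v
  proof -
   have "(NBSET (cball v 1) (%w. ennreal ((?u w / \<mu>) ^ 3))) <= (NBINT w. ennreal ((1 / \<mu>) ^ 3) * (ennreal (?u w ^ 3) * ball_ind (R + 1) w))"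
   proof (rule nn_integral_mono)
    fix w
    have "norm w <= R + 1" if "dist v w <= 1" using that v norm_triangle_ineq4[of v "v - w"] by (simp add: dist_norm)
    then show "ennreal ((?u w / \<mu>) ^ 3) * indicator (cball v 1) w <= ennreal ((1 / \<mu>) ^ 3) * (ennreal (?u w ^ 3) * ball_ind (R + 1) w)"
     using \<mu>(3) F_nonneg[of "(t, w)"] by (auto simp: indicator_def ennreal_mult[symmetric] power_divide)
   qed
   also have "... = ennreal ((1 / \<mu>) ^ 3) * (NBALL (R + 1) (%w. ennreal (?u w ^ 3)))" by (rule nn_integral_cmult) measurable
   also have "... <= ennreal ((1 / \<mu>) ^ 3) * ennreal (((1 + (R + 1)) * n t) ^ 3)"
    using R by (intro mult_left_mono cube_le) auto
   also have "... = ennreal (((2 + R) * (n t / \<mu>)) ^ 3)"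
    using R \<mu>(3) n_nonneg[of t] by (simp add: ennreal_mult[symmetric] power_mult_distrib[symmetric] field_simps)
   also have "... <= ennreal ((2 + R) ^ 3)"
   proof (intro ennreal_leI power_mono)
    have "n t / \<mu> <= 1" using \<mu> by simp
    from mult_left_mono[OF this, of "2 + R"] show "(2 + R) * (n t / \<mu>) <= 2 + R" using R by simp
    show "0 <= (2 + R) * (n t / \<mu>)" using R \<mu>(3) n_nonneg[of t] by simp
   qed
   finally have cub: "(NBSET (cball v 1) (%w. ennreal ((?u w / \<mu>) ^ 3))) <= ennreal ((2 + R) ^ 3)" .
   have "(NBINT w. ennreal (?u w * norm (v - w) powr (-1)))
    <= (NBINT w. ennreal (?u w)) + ennreal \<mu> * (ennreal C + (NBSET (cball v 1) (%w. ennreal ((?u w / \<mu>) ^ 3))))"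
    by (rule C(2)[OF F_slice F_nonneg \<mu>(3)])
   also have "... <= ennreal M + ennreal \<mu> * (ennreal C + ennreal ((2 + R) ^ 3))"
    by (intro add_mono mult_left_mono mass_le cub order_refl) auto
   also have "... = ennreal (M + \<mu> * (C + (2 + R) ^ 3))"
    using M_pos C(1) R \<mu>(3) by (simp add: ennreal_plus[symmetric] ennreal_mult[symmetric] del: ennreal_plus)
   also have "... <= ennreal (c * \<mu>)"
   proof (rule ennreal_leI)
    have "M * 1 <= M * \<mu>" using M_pos \<mu>(1) by (intro mult_left_mono) auto
    then show "M + \<mu> * (C + (2 + R) ^ 3) <= c * \<mu>" by (simp add: c_def algebra_simps)
   qed
   finally show ?thesis .
  qed
  have "pair_energy ?u R <= (NBINT v. ennreal (c * \<mu>) * ennreal (?u v))"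
   unfolding pair_energy_def
  proof (rule nn_integral_mono)
   fix v
   show "(NBINT w. ennreal (?u v * (?u w * norm (v - w) powr (-1)))) * ball_ind R v <= ennreal (c * \<mu>) * ennreal (?u v)"
   proof (cases "norm v <= R")
    case True
    have "(NBINT w. ennreal (?u v * (?u w * norm (v - w) powr (-1)))) = (NBINT w. ennreal (?u v) * ennreal (?u w * norm (v - w) powr (-1)))"
     by (intro nn_integral_cong ennreal_mult F_nonneg mult_nonneg_nonneg) auto
    also have "... = ennreal (?u v) * (NBINT w. ennreal (?u w * norm (v - w) powr (-1)))" by (rule nn_integral_cmult) measurable
    also have "... <= ennreal (?u v) * ennreal (c * \<mu>)" by (intro mult_left_mono pot[OF True]) auto
    finally show ?thesis using True by (simp add: mult.commute)
   qed simp
  qed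
  also have "... = ennreal (c * \<mu>) * (NBINT v. ennreal (?u v))" by (rule nn_integral_cmult) measurable
  also have "... <= ennreal (c * \<mu>) * ennreal M" by (intro mult_left_mono mass_le) auto
  also have "... = ennreal (M * c * (1 + n t))" using c0 \<mu>(3) M_pos by (simp add: ennreal_mult[symmetric] \<mu>_def ac_simps)
  finally show "pair_energy ?u R <= ennreal (M * c * (1 + n t))" .
 qed
qed

lemma time_fin: "(NBSET {0<..<T} (%t. ennreal (K * (1 + n t)))) < \<infinity>" if K: "0 <= K"
proof -
 have "(NBSET {0<..<T} (%t. ennreal (K * (1 + n t)))) = (NBINT t. ennreal K * (indicator {0<..<T} t + ennreal (n t) * indicator {0<..<T} t))"
  using K n_nonneg by (intro nn_integral_cong) (auto simp: indicator_def ennreal_mult ennreal_plus)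
 also have "... = ennreal K * (NBINT t. indicator {0<..<T} t + ennreal (n t) * indicator {0<..<T} t)"
  by (rule nn_integral_cmult) measurable
 also have "(NBINT t. indicator {0<..<T} t + ennreal (n t) * indicator {0<..<T} t) = (NBINT t. indicator {0<..<T} t) + (NBSET {0<..<T} (%t. ennreal (n t)))"
  by (rule nn_integral_add) measurable
 also have "(NBINT t. indicator {0<..<T} t) = ennreal T" using T_pos by simp
 also have "ennreal K * (ennreal T + (NBSET {0<..<T} (%t. ennreal (n t)))) < \<infinity>"
  using n_fin by (simp add: ennreal_mult_less_top)
 finally show ?thesis .
qed

definition flux :: "real \<times> (real^3) => real^3" where
 "flux p = borel_A (%w. F (fst p, w)) (snd p) *v G p - F p *\<^sub>R borel_B (%w. F (fst p, w)) (snd p)"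

lemma flux_slice: "flux (t, v) = sobolev_density.flux (%w. F (t, w)) (%w. G (t, w)) v"
 by (simp add: flux_def sobolev_density.flux_def[OF density])

lemma borel_A_joint: "(%p. borel_A (%w. F (fst p, w)) (snd p)) : borel_measurable (borel \<Otimes>\<^sub>M borel)"
 unfolding borel_A_def by measurable

lemma borel_B_joint: "(%p. borel_B (%w. F (fst p, w)) (snd p)) : borel_measurable (borel \<Otimes>\<^sub>M borel)"
 unfolding borel_B_def by measurable

lemma flux_borel: "flux : Borel"
proof -
 note [measurable] = borel_A_joint borel_B_joint
 show ?thesis unfolding borel_prod[symmetric] flux_def[abs_def] by measurable
qed

lemma dissipation_borel:
 "(%t. \<integral>\<^sup>+v. (NBINT w. ennreal (sobolev_density.pair_dissipation (%v. F (t, v)) (%v. G (t, v)) v w)) \<partial>lborel) : Borel"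
 unfolding sobolev_density.pair_dissipation_def[OF density] by measurable

lemma flux_fin: "(NBSET {0<..<T} (%t. (NBALL R (%v. ennreal (norm (flux (t, v))))))) < \<infinity>"
proof -
 let ?I = "{0<..<T}" and ?S = "max 0 R"
 let ?D = "%t. \<integral>\<^sup>+v. (NBINT w. ennreal (sobolev_density.pair_dissipation (%v. F (t, v)) (%v. G (t, v)) v w)) \<partial>lborel"
 obtain K where K: "0 <= K" "!!t. pair_energy (%v. F (t, v)) ?S <= ennreal (K * (1 + n t))"
  using pair_energy_le[of ?S] by auto
 note [measurable] = dissipation_borel
 have "(NBSET ?I (%t. (NBALL R (%v. ennreal (norm (flux (t, v)))))))
  <= (NBINT t. ennreal (K * (1 + n t)) * indicator ?I t + ?D t * indicator ?I t)"
 proof (rule nn_integral_mono)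
  fix t
  have "(NBALL R (%v. ennreal (norm (flux (t, v))))) <= (NBALL ?S (%v. ennreal (norm (flux (t, v)))))"
   by (intro nn_integral_mono) (auto simp: indicator_def)
  also have "... <= pair_energy (%v. F (t, v)) ?S + ?D t"
   unfolding flux_slice by (rule sobolev_density.flux_L1_bound[OF density])
  also have "... <= ennreal (K * (1 + n t)) + ?D t" by (intro add_mono K(2) order_refl)
  finally show "(NBALL R (%v. ennreal (norm (flux (t, v))))) * indicator ?I t
   <= ennreal (K * (1 + n t)) * indicator ?I t + ?D t * indicator ?I t"
   by (auto simp: indicator_def)
 qed
 also have "... = (NBSET ?I (%t. ennreal (K * (1 + n t)))) + (NBSET ?I (%t. ?D t))"
  by (rule nn_integral_add) measurable
 also have "... < \<infinity>" using time_fin[OF K(1)] dissipation_fin by simp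
 finally show ?thesis .
qed

lemma F_fin: "(NBSET {0<..<T} (%t. (NBALL R (%v. ennreal (norm (F (t, v))))))) < \<infinity>"
proof -
 have "(NBSET {0<..<T} (%t. (NBALL R (%v. ennreal (norm (F (t, v))))))) <= (NBINT t. ennreal M * indicator {0<..<T} t)"
 proof (intro nn_integral_mono mult_right_mono)
  fix t
  have "(NBALL R (%v. ennreal (norm (F (t, v))))) <= (NBINT v. ennreal (F (t, v)))"
   by (intro nn_integral_mono) (auto simp: indicator_def F_nonneg)
  also have "... <= ennreal M" by (rule mass_le)
  finally show "(NBALL R (%v. ennreal (norm (F (t, v))))) <= ennreal M" .
 qed simp
 also have "... < \<infinity>" using T_pos by (simp add: nn_integral_cmult_indicator ennreal_mult_less_top)
 finally show ?thesis .
qed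

text \<open>Testing with a product $\theta(t)\psi(v)$: the flux form of the equation follows from the ultraweak
 form at almost every time, because the terms of the latter are bounded by the pair energy and hence
 integrable in time.\<close>

lemma flux_time_integral:
 assumes \<theta>: "smooth_test {0<..<T} \<theta>" and \<psi>: "smooth_test UNIV \<psi>"
 defines "X \<equiv> %t. LINT (v, w)|lborel. F (t, v) * F (t, w) * frobenius (landau_N (v - w)) (hess \<psi> v + hess \<psi> w)"
  and "Y \<equiv> %t. LINT (v, w)|lborel. F (t, v) * F (t, w) * (((1 / norm (v - w) ^ 3) *\<^sub>R (v - w)) \<bullet> (grad \<psi> v - grad \<psi> w))"
 shows "(LINT (t, v)|lborel. indicator {0<..<T} t * (\<theta> t * (flux (t, v) \<bullet> grad \<psi> v))) =
   - (1/2 * (LBINT t. indicator {0<..<T} t * (\<theta> t * X t)) - 1 / (4 * pi) * (LBINT t. indicator {0<..<T} t * (\<theta> t * Y t)))"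
  and "X : Borel" "Y : Borel"
proof -
 let ?I = "{0<..<T}"
 have s: "smooth \<psi>" using \<psi> by (simp add: smooth_test_iff)
 note [measurable] = grad_borel[OF s] hess_borel[OF s] flux_borel
 have [measurable]: "flux : borel_measurable (borel \<Otimes>\<^sub>M borel)" by (simp add: borel_prod flux_borel)
 have [measurable]: "(fst :: (real^3) \<times> (real^3) => real^3) : Borel" "(snd :: (real^3) \<times> (real^3) => real^3) : Borel"
  by (auto intro!: borel_measurable_continuous_onI continuous_intros)
 show Xb[measurable]: "X : Borel" unfolding X_def case_prod_unfold by measurable
 show Yb[measurable]: "Y : Borel" unfolding Y_def case_prod_unfold by measurable
 obtain B where B: "0 < B" "!!t. \<bar>\<theta> t\<bar> <= B" and [measurable]: "\<theta> : Borel"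
  using smooth_test_time_derivative[OF \<theta>] by metis
 obtain C R where CR: "0 <= C" "0 < R" "!!u. u : Borel ==> (!!x. 0 <= u x) ==>
   ennreal \<bar>LINT (v, w)|lborel. u v * u w * frobenius (landau_N (v - w)) (hess \<psi> v + hess \<psi> w)\<bar> <= ennreal C * pair_energy u R \<and>
   ennreal \<bar>LINT (v, w)|lborel. u v * u w * (((1 / norm (v - w) ^ 3) *\<^sub>R (v - w)) \<bullet> (grad \<psi> v - grad \<psi> w))\<bar> <= ennreal C * pair_energy u R"
  using ultraweak_terms_bound[OF \<psi>] by blast
 obtain K where K: "0 <= K" "!!t. pair_energy (%v. F (t, v)) R <= ennreal (K * (1 + n t))"
  using pair_energy_le[of R] CR(2) by auto
 have XY: "ennreal \<bar>X t\<bar> <= ennreal (C * K * (1 + n t))" "ennreal \<bar>Y t\<bar> <= ennreal (C * K * (1 + n t))" for t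
 proof -
  have "ennreal C * pair_energy (%v. F (t, v)) R <= ennreal C * ennreal (K * (1 + n t))"
   by (intro mult_left_mono K(2)) auto
  also have "... = ennreal (C * K * (1 + n t))" using CR(1) K(1) n_nonneg[of t] by (simp add: ennreal_mult[symmetric] mult.assoc)
  finally have *: "ennreal C * pair_energy (%v. F (t, v)) R <= ennreal (C * K * (1 + n t))" .
  show "ennreal \<bar>X t\<bar> <= ennreal (C * K * (1 + n t))" "ennreal \<bar>Y t\<bar> <= ennreal (C * K * (1 + n t))"
   unfolding X_def Y_def using CR(3)[OF F_slice F_nonneg, of t] * by (blast intro: order_trans)+
 qed
 have int: "integrable lborel (%t. indicator ?I t * (\<theta> t * Z t))"
  if [measurable]: "Z : Borel" and Z: "!!t. ennreal \<bar>Z t\<bar> <= ennreal (C * K * (1 + n t))" for Z :: "real => real"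
 proof (rule integrableI_bounded)
  have "(NBINT t. ennreal (norm (indicator ?I t * (\<theta> t * Z t)))) <= (NBSET ?I (%t. ennreal (B * (C * K) * (1 + n t))))"
  proof (rule nn_integral_mono)
   fix t
   have "0 <= C * K * (1 + n t)" using CR(1) K(1) n_nonneg[of t] by simp
   then have "\<bar>Z t\<bar> <= C * K * (1 + n t)" using Z[of t] by (simp add: ennreal_le_iff)
   then have "\<bar>\<theta> t\<bar> * \<bar>Z t\<bar> <= B * (C * K * (1 + n t))" using B(1) by (intro mult_mono B(2)) auto
   then show "ennreal (norm (indicator ?I t * (\<theta> t * Z t))) <= ennreal (B * (C * K) * (1 + n t)) * indicator ?I t"
    by (auto simp: indicator_def abs_mult ac_simps intro!: ennreal_leI)
  qed
  also have "... < \<infinity>" using B(1) CR(1) K(1) by (intro time_fin) simp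
  finally show "(NBINT t. ennreal (norm (indicator ?I t * (\<theta> t * Z t)))) < \<infinity>" .
 qed measurable
 obtain L S where L: "0 < L" "0 < S" "!!v. norm (grad \<psi> v) <= L * ball_ind S v"
  using smooth_test_grad_hess_bounds[OF \<psi>] by metis
 let ?K = "%p. \<theta> (fst p) * (flux p \<bullet> grad \<psi> (snd p))"
 have mK: "?K : Borel" unfolding borel_prod[symmetric] by measurable
 have bd: "\<bar>?K (t, v)\<bar> <= (B * L) * (norm (flux (t, v)) * ball_ind S v)" for t v
 proof -
  have "\<bar>flux (t, v) \<bullet> grad \<psi> v\<bar> <= norm (flux (t, v)) * norm (grad \<psi> v)" by (rule Cauchy_Schwarz_ineq2)
  also have "... <= norm (flux (t, v)) * (L * ball_ind S v)" by (rule mult_left_mono[OF L(3)]) simp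
  finally have "\<bar>\<theta> t\<bar> * \<bar>flux (t, v) \<bullet> grad \<psi> v\<bar> <= B * (norm (flux (t, v)) * (L * ball_ind S v))"
   using B(1) by (intro mult_mono B(2)) auto
  then show ?thesis by (simp add: abs_mult ac_simps)
 qed
 have fin: "(NBSET ?I (%t. (NBINT v. ennreal \<bar>?K (t, v)\<bar>))) < \<infinity>"
  by (rule slab_dominated[where K="?K", OF flux_borel flux_fin _ AE_I2[OF impI[OF AE_I2[OF bd]]]]) (use B(1) L(1) in simp)
 have "(LINT (t, v)|lborel. indicator ?I t * ?K (t, v)) = (LBINT t. indicator ?I t * (LBINT v. ?K (t, v)))"
  by (rule slab_Fubini(5)[OF mK fin, of "%t v. ?K (t, v)"]) simp
 also have "... = (LBINT t. - (1/2 * (indicator ?I t * (\<theta> t * X t)) - 1 / (4 * pi) * (indicator ?I t * (\<theta> t * Y t))))"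
 proof (rule Bochner_Integration.integral_cong)
  fix t
  have "(LBINT v. ?K (t, v)) = \<theta> t * (LBINT v. flux (t, v) \<bullet> grad \<psi> v)" by simp
  also have "(LBINT v. flux (t, v) \<bullet> grad \<psi> v) = - (1/2 * X t - 1 / (4 * pi) * Y t)"
   unfolding flux_slice X_def Y_def by (rule sobolev_density.flux_weak_form[OF density \<psi>])
  finally show "indicator ?I t * (LBINT v. ?K (t, v)) = - (1/2 * (indicator ?I t * (\<theta> t * X t)) - 1 / (4 * pi) * (indicator ?I t * (\<theta> t * Y t)))"
   by (cases "t : ?I") (simp_all add: algebra_simps)
 qed simp
 also have "... = - (1/2 * (LBINT t. indicator ?I t * (\<theta> t * X t)) - 1 / (4 * pi) * (LBINT t. indicator ?I t * (\<theta> t * Y t)))"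
  using int[OF Xb XY(1)] int[OF Yb XY(2)]
  by (simp only: Bochner_Integration.integral_minus Bochner_Integration.integral_diff integrable_mult_right integral_mult_right_zero)
 finally show "(LINT (t, v)|lborel. indicator ?I t * (\<theta> t * (flux (t, v) \<bullet> grad \<psi> v))) =
   - (1/2 * (LBINT t. indicator ?I t * (\<theta> t * X t)) - 1 / (4 * pi) * (LBINT t. indicator ?I t * (\<theta> t * Y t)))"
  by simp
qed

end

section \<open>H-solutions\<close>

lemma landau_potentials_cong_AE:
 assumes "AEL v. u v = u' v"
 shows "landau_A u v = landau_A u' v" "landau_a u v = landau_a u' v"
proof -
 have "AEL y. u (v - y) *\<^sub>R landau_N y = u' (v - y) *\<^sub>R landau_N y"
  using AE_lborel_reflect[OF assms, of v] by eventually_elim simp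
 from lebesgue_integral_cong_AE[OF this] show "landau_A u v = landau_A u' v" by (simp add: landau_A_def)
 have "AEL y. u y / norm (v - y) = u' y / norm (v - y)" using assms by eventually_elim simp
 from lebesgue_integral_cong_AE[OF this] show "landau_a u v = landau_a u' v" by (simp add: landau_a_def)
qed

lemma entropy_dissipation_eq:
 assumes ae: "AEL v. u' v = u v" and d: "sobolev_density u G"
 shows "entropy_dissipation u' = ennreal (1/2) * (NBINT v. (NBINT w. ennreal (sobolev_density.pair_dissipation u G v w)))"
proof -
 interpret sobolev_density u G by (rule d)
 have wd: "weakly_differentiable u'" using wgrad_cong_AE(2)[OF ae] wgrad_eqI(1)[OF wg] by simp
 have "AEL v. wgrad u' v = G v" unfolding wgrad_cong_AE(1)[OF ae] by (rule wgrad_eqI(2)[OF wg])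
 with ae have *: "AEL v. u' v = u v \<and> wgrad u' v = G v" by eventually_elim simp
 have "AEL p. (case p of (v, w) => ennreal (u' v * u' w * ((landau_N (v - w) *v (grad_log u' v - grad_log u' w)) \<bullet> (grad_log u' v - grad_log u' w))))
  = ennreal (pair_dissipation (fst p) (snd p))"
  using AE_lborel_fst[OF *, where 'b="real^3"] AE_lborel_snd[OF *, where 'a="real^3"]
  by eventually_elim (simp add: pair_dissipation_def grad_log_def case_prod_unfold)
 from nn_integral_cong_AE[OF this]
 have "(\<integral>\<^sup>+(v, w). ennreal (u' v * u' w * ((landau_N (v - w) *v (grad_log u' v - grad_log u' w)) \<bullet> (grad_log u' v - grad_log u' w))) \<partial>lebesgue)
  = (NBINT p. ennreal (pair_dissipation (fst p) (snd p)))"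
  by (simp only: nn_integral_completion)
 also have "... = (\<integral>\<^sup>+p. ennreal (pair_dissipation (fst p) (snd p)) \<partial>(lborel \<Otimes>\<^sub>M lborel))"
  by (simp only: lborel_prod)
 also have "... = (NBINT v. (NBINT w. ennreal (pair_dissipation v w)))"
  by (subst lborel.nn_integral_fst[symmetric]) simp_all
 finally show ?thesis using wd by (simp add: entropy_dissipation_def)
qed

lemma borel_weak_grad_zero: "borel_weak_grad (%_. 0) (%_. 0)"
 unfolding borel_weak_grad_def loc_int_def by simp

lemma sobolev_density_zero: "sobolev_density (%_. 0) (%_. 0)"
 by standard (simp_all add: borel_weak_grad_zero)

text \<open>The negative part of the entropy is compensated by the
 energy and the integrable weight $(1+|v|^2)^{-2}$.\<close>

lemma density_bounds:
 fixes u g :: "real^3 => real"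
 assumes i: "integrable lebesgue (%v. u v * (1 + (norm v)\<^sup>2))" and um: "u : borel_measurable lebesgue"
  and u0: "AEL v. 0 <= u v" and il: "integrable lebesgue (%v. u v * ln (u v))"
  and ae: "AEL v. u v = g v"
 shows "(NBINT v. ennreal (g v)) = ennreal (LINT v|lebesgue. u v)"
  and "(NBINT v. ennreal (g v * max 0 (ln (g v))))
   <= ennreal ((LINT v|lebesgue. u v * ln (u v)) + 4 * (LINT v|lebesgue. u v * (norm v)\<^sup>2)
     + 2 * (LINT v|lebesgue. (1 + (norm (v::real^3))\<^sup>2) powr (-2)))"
proof -
 have nm: "(%v::real^3. (norm v)\<^sup>2) : borel_measurable lebesgue" by (rule measurable_completion) measurable
 have i1: "integrable lebesgue u"
 proof (rule Bochner_Integration.integrable_bound[OF i um])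
  show "AE v in lebesgue. norm (u v) <= norm (u v * (1 + (norm v)\<^sup>2))"
  proof (rule AE_I2)
   fix v :: "real^3"
   have "\<bar>u v\<bar> * 1 <= \<bar>u v\<bar> * (1 + (norm v)\<^sup>2)" by (intro mult_left_mono) auto
   then show "norm (u v) <= norm (u v * (1 + (norm v)\<^sup>2))" by (simp add: abs_mult)
  qed
 qed
 have i2: "integrable lebesgue (%v. u v * (norm v)\<^sup>2)"
  using Bochner_Integration.integrable_diff[OF i i1] by (simp add: algebra_simps)
 let ?q = "%v::real^3. (1 + (norm v)\<^sup>2) powr (-2)"
 have "integrable lborel ?q" by (rule integrableI_bounded) (use quartic_decay_integrable in simp_all)
 then have i3: "integrable lebesgue ?q" by (subst integrable_completion) auto
 have "(NBINT v. ennreal (g v)) = (NBINT v. ennreal (u v))"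
  by (rule nn_integral_cong_AE) (use ae in \<open>eventually_elim, simp\<close>)
 also have "... = (\<integral>\<^sup>+v. ennreal (u v) \<partial>lebesgue)" by (simp only: nn_integral_completion)
 also have "... = ennreal (LINT v|lebesgue. u v)"
  using u0 by (intro nn_integral_eq_integral i1) (simp add: AE_completion_iff)
 finally show "(NBINT v. ennreal (g v)) = ennreal (LINT v|lebesgue. u v)" .
 let ?h = "%v. u v * ln (u v) + 4 * (u v * (norm v)\<^sup>2) + 2 * ?q v"
 have le: "AEL v. g v * max 0 (ln (g v)) <= ?h v \<and> 0 <= ?h v"
  using ae u0
 proof eventually_elim
  case (elim v)
  from xlnx_bound[OF elim(2), of "(norm v)\<^sup>2"] have "u v * max 0 (ln (u v)) <= ?h v" by simp
  moreover have "0 <= u v * max 0 (ln (u v))" using elim(2) by simp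
  ultimately show ?case unfolding elim(1)[symmetric] by (auto intro: order_trans)
 qed
 have "(NBINT v. ennreal (g v * max 0 (ln (g v)))) <= (NBINT v. ennreal (?h v))"
  by (rule nn_integral_mono_AE) (use le in \<open>eventually_elim, auto intro: ennreal_leI\<close>)
 also have "... = (\<integral>\<^sup>+v. ennreal (?h v) \<partial>lebesgue)" by (simp only: nn_integral_completion)
 also have "... = ennreal (LINT v|lebesgue. ?h v)"
 proof (rule nn_integral_eq_integral)
  show "integrable lebesgue ?h" by (intro Bochner_Integration.integrable_add integrable_mult_right il i2 i3)
  have "AEL v. 0 <= ?h v" using le by eventually_elim simp
  then show "AE v in lebesgue. 0 <= ?h v" by (simp only: AE_completion_iff)
 qed
 also have "(LINT v|lebesgue. ?h v) = (LINT v|lebesgue. u v * ln (u v)) + 4 * (LINT v|lebesgue. u v * (norm v)\<^sup>2) + 2 * (LINT v|lebesgue. ?q v)"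
  using il i2 i3 by (simp only: Bochner_Integration.integral_add integral_mult_right_zero integrable_mult_right Bochner_Integration.integrable_add)
 finally show "(NBINT v. ennreal (g v * max 0 (ln (g v))))
   <= ennreal ((LINT v|lebesgue. u v * ln (u v)) + 4 * (LINT v|lebesgue. u v * (norm v)\<^sup>2) + 2 * (LINT v|lebesgue. ?q v))" .
qed

lemma weighted_L3_eq:
 fixes u g :: "real^3 => real"
 defines "M \<equiv> density lebesgue (%v::real^3. ennreal ((1 + norm v) powr - 3))"
  and "q \<equiv> \<integral>\<^sup>+v. ennreal (g v ^ 3 * (1 + norm v) powr - 3) \<partial>lborel"
 assumes um: "u : borel_measurable lebesgue" and g0: "!!v. 0 <= g v" and ae: "AEL v. u v = g v"
  and Lp: "in_Lp 3 M u"
 shows "Lp_norm 3 M u = enn2real q powr (1 / 3)" "q < \<infinity>"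
proof -
 let ?w = "%v::real^3. ennreal ((1 + norm v) powr - 3)"
 have wm: "?w : borel_measurable lebesgue" by (rule measurable_completion) measurable
 have nm: "(%v. ennreal (norm (u v) powr 3)) : borel_measurable lebesgue" using um by simp
 have i: "integrable M (%v. norm (u v) powr 3)" using Lp by (simp add: in_Lp_def)
 have "(\<integral>\<^sup>+v. ennreal (norm (u v) powr 3) \<partial>M) = (\<integral>\<^sup>+v. ?w v * ennreal (norm (u v) powr 3) \<partial>lebesgue)"
  unfolding M_def by (rule nn_integral_density[OF wm nm])
 also have "... = (NBINT v. ?w v * ennreal (norm (u v) powr 3))" by (simp only: nn_integral_completion)
 also have "... = q"
  unfolding q_def
 proof (rule nn_integral_cong_AE)
  show "AEL v. ?w v * ennreal (norm (u v) powr 3) = ennreal (g v ^ 3 * (1 + norm v) powr - 3)"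
   using ae
  proof eventually_elim
   case (elim v)
   have "norm (u v) powr 3 = g v ^ 3" using elim g0[of v] by (cases "g v = 0") (simp_all add: powr_numeral)
   then show ?case using g0[of v] by (simp add: ennreal_mult[symmetric] mult.commute)
  qed
 qed
 finally have q: "(\<integral>\<^sup>+v. ennreal (norm (u v) powr 3) \<partial>M) = q" .
 have "(\<integral>\<^sup>+v. ennreal (norm (norm (u v) powr 3)) \<partial>M) < \<infinity>" using i by (simp add: integrable_iff_bounded)
 then show "q < \<infinity>" using q by simp
 have "(LINT v|M. norm (u v) powr 3) = enn2real (\<integral>\<^sup>+v. ennreal (norm (u v) powr 3) \<partial>M)"
  by (rule integral_eq_nn_integral) (use i in auto)
 then show "Lp_norm 3 M u = enn2real q powr (1 / 3)" by (simp only: Lp_norm_def q)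
qed

lemma ereal_add_enn2ereal_le:
 assumes "ereal a + enn2ereal x <= ereal b" shows "a <= b" "x < \<infinity>"
proof -
 have "ereal a <= ereal a + enn2ereal x" by (simp add: add_increasing2)
 with assms show "a <= b" by (metis ereal_less_eq(3) order_trans)
 show "x < \<infinity>" using assms by (cases x rule: ennreal_cases) auto
qed

text \<open>The dissipation is infinite at a time without weak gradient. Its measurability in time is not
 known beforehand, but the set \<open>S\<close> is measurable, which suffices for a comparison from below.\<close>

lemma AE_imp_of_dissipation_finite:
 fixes T :: real
 assumes fin: "(\<integral>\<^sup>+t. entropy_dissipation (f t) \<partial>lebesgue_on {0..T}) < \<infinity>" and [measurable]: "S : sets borel"
  and S: "AEL t. t : {0..T} --> (weakly_differentiable (f t) \<longleftrightarrow> t : S)"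
 shows "AEL t. t : {0..T} --> t : S"
  and "(NBSET {0..T} (%t. entropy_dissipation (f t))) < \<infinity>"
proof -
 have "(\<integral>\<^sup>+t. entropy_dissipation (f t) \<partial>lebesgue_on {0..T}) = (\<integral>\<^sup>+t\<in>{0..T}. entropy_dissipation (f t) \<partial>lebesgue)"
  by (rule nn_integral_restrict_space) simp
 also have "... = (NBSET {0..T} (%t. entropy_dissipation (f t)))" by (simp only: nn_integral_completion)
 finally show fin': "(NBSET {0..T} (%t. entropy_dissipation (f t))) < \<infinity>" using fin by simp
 have "(NBINT t. \<infinity> * indicator ({0..T} - S) t) <= (NBSET {0..T} (%t. entropy_dissipation (f t)))"
 proof (rule nn_integral_mono_AE)
  show "AEL t. \<infinity> * indicator ({0..T} - S) t <= entropy_dissipation (f t) * indicator {0..T} t"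
   using S by eventually_elim (auto simp: indicator_def entropy_dissipation_def)
 qed
 then have "(NBINT t. \<infinity> * indicator ({0..T} - S) t) \<noteq> \<infinity>" using fin' by auto
 then have "AEL t. \<infinity> * indicator ({0..T} - S) t \<noteq> (\<infinity> :: ennreal)"
  by (intro nn_integral_PInf_AE) auto
 then show "AEL t. t : {0..T} --> t : S"
 proof eventually_elim
  case (elim t)
  then show ?case by (cases "t : S") auto
 qed
qed

lemma global_H_solution_curve:
 assumes sol: "global_H_solution f_in f" and T: "0 < T"
 obtains F G n M H where "landau_curve F G n T M H"
  "AEL t. t : {0<..<T} --> (AEL v. f t v = F (t, v))"
proof -
 let ?J = "{0..T}" and ?I = "{0<..<T}"
 let ?W = "density lebesgue (%v::real^3. ennreal ((1 + norm v) powr - 3))"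
 note c1 = sol[unfolded global_H_solution_def Let_def]
 note c2 = c1[THEN conjunct2] note c3 = c2[THEN conjunct2] note c4 = c3[THEN conjunct2]
 note c5 = c4[THEN conjunct2] note c6 = c5[THEN conjunct2] note c7 = c6[THEN conjunct2]
 note gm = c1[THEN conjunct1] and nn = c2[THEN conjunct1] and cons = c4[THEN conjunct1]
  and ent = c6[THEN conjunct1] and L3 = c7[THEN conjunct1, rule_format, OF T]
 obtain F0 where F0[measurable]: "F0 : Borel"
  and fF0: "AEL t. t : {0..} --> (AEL v. (case (t, v) of (t, v) => f t v) = F0 (t, v))"
  by (rule slab_ex_borel[OF _ gm]) simp
 (* A Borel version that is nonnegative everywhere. *)
 define F1 where "F1 p = max 0 (F0 p)" for p
 have F1b[measurable]: "F1 : Borel" unfolding F1_def by measurable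
 have F1p[measurable]: "F1 : borel_measurable (borel \<Otimes>\<^sub>M borel)" by (simp add: borel_prod)
 have F1nn: "0 <= F1 p" for p by (simp add: F1_def)
 have u0: "AEL v. 0 <= f t v" if "0 <= t" for t
  using nn that by (simp add: AE_completion_iff)
 have fF1: "AEL t. t : ?J --> (AEL v. f t v = F1 (t, v))"
  using fF0
 proof eventually_elim
  case (elim t)
  show ?case
  proof
   assume t: "t : ?J"
   with elim have "AEL v. f t v = F0 (t, v)" by simp
   moreover have "AEL v. 0 <= f t v" by (rule u0) (use t in simp)
   ultimately show "AEL v. f t v = F1 (t, v)" by eventually_elim (simp add: F1_def)
  qed
 qed
 obtain S G0 where S[measurable]: "S : sets borel" and G0[measurable]: "G0 : Borel"
  and SG: "!!t. t : S \<longleftrightarrow> weakly_differentiable (%v. F1 (t, v))"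
  "!!t. t : S ==> borel_weak_grad (%v. F1 (t, v)) (%v. G0 (t, v))"
  by (rule measurable_weak_gradient[OF F1b]) blast
 have G0p[measurable]: "G0 : borel_measurable (borel \<Otimes>\<^sub>M borel)" by (simp add: borel_prod)
 have fS: "AEL t. t : ?J --> (weakly_differentiable (f t) \<longleftrightarrow> t : S)"
  using fF1
 proof eventually_elim
  case (elim t)
  show ?case
  proof
   assume "t : ?J"
   with elim have "AEL v. f t v = F1 (t, v)" by blast
   from wgrad_cong_AE(2)[OF this] show "weakly_differentiable (f t) \<longleftrightarrow> t : S" by (simp add: SG(1))
  qed
 qed
 have Dfin: "(\<integral>\<^sup>+ s. entropy_dissipation (f s) \<partial>lebesgue_on ?J) < \<infinity>"
  by (rule ereal_add_enn2ereal_le(2)[OF ent[THEN spec, THEN mp, OF less_imp_le[OF T], THEN conjunct2]])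
 note dis = AE_imp_of_dissipation_finite[OF Dfin S fS]
 define M where "M = max 1 (LINT v|lebesgue. f_in v)"
 define H where "H = max 0 ((LINT v|lebesgue. f_in v * ln (f_in v)) + 4 * (LINT v|lebesgue. f_in v * (norm v)\<^sup>2)
     + 2 * (LINT v|lebesgue. (1 + (norm (v::real^3))\<^sup>2) powr (-2)))"
 define q where "q t = (NBINT v. ennreal (F1 (t, v) ^ 3 * (1 + norm v) powr - 3))" for t
 define n where "n t = enn2real (q t) powr (1 / 3)" for t
 have qb[measurable]: "q : Borel" unfolding q_def by measurable
 have nb[measurable]: "n : Borel" unfolding n_def by measurable
 have n3: "ennreal (n t ^ 3) = q t" if "q t < \<infinity>" for t
 proof -
  have "n t ^ 3 = enn2real (q t)"
   unfolding n_def by (cases "enn2real (q t) = 0") (simp_all add: powr_power)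
  then show ?thesis using that by simp
 qed
 (* The times at which all bounds hold; elsewhere the curve is set to zero. *)
 define E where "E = {t. t : S \<and> (NBINT v. ennreal (F1 (t, v))) <= ennreal M
  \<and> (NBINT v. ennreal (F1 (t, v) * max 0 (ln (F1 (t, v))))) <= ennreal H \<and> q t < \<infinity>}"
 have Eb[measurable]: "E : sets borel" unfolding E_def by measurable
 have Lae: "AEL t. t : ?J --> in_Lp 3 ?W (f t)"
  using L3[THEN conjunct1] by (subst (asm) AE_lebesgue_on_iff) simp_all
 have Nn: "AEL t. t : ?J --> Lp_norm 3 ?W (f t) = n t \<and> q t < \<infinity>"
  using Lae fF1
 proof eventually_elim
  case (elim t)
  show ?case
  proof
   assume t: "t : ?J"
   then have "0 <= t" by simp
   note fm = cons[THEN spec, THEN mp, OF this, THEN conjunct2, THEN conjunct1]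
   from elim t have "in_Lp 3 ?W (f t)" "AEL v. f t v = F1 (t, v)" by blast+
   from weighted_L3_eq[where u="f t" and g="%v. F1 (t, v)", OF fm F1nn this(2,1)]
   show "Lp_norm 3 ?W (f t) = n t \<and> q t < \<infinity>"
    unfolding n_def q_def by (rule conjI)
  qed
 qed
 have inE: "AEL t. t : ?J --> t : E"
  using fF1 Nn dis(1)
 proof eventually_elim
  case (elim t)
  show ?case
  proof
   assume t: "t : ?J"
   then have t0: "0 <= t" by simp
   from elim t have ae: "AEL v. f t v = F1 (t, v)" by blast
   note e = ent[THEN spec, THEN mp, OF t0]
   note e1 = e[THEN conjunct1] and e2 = ereal_add_enn2ereal_le(1)[OF e[THEN conjunct2]]
   note c1 = cons[THEN spec, THEN mp, OF t0] note c2 = c1[THEN conjunct2] note c3 = c2[THEN conjunct2]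
   note c5 = c3[THEN conjunct2, THEN conjunct2]
   note db = density_bounds[OF c1[THEN conjunct1] c2[THEN conjunct1] u0[OF t0] e1 ae]
   have "(NBINT v. ennreal (F1 (t, v))) <= ennreal M"
    unfolding db(1) c3[THEN conjunct1] M_def by (intro ennreal_leI) simp
   moreover have "(NBINT v. ennreal (F1 (t, v) * max 0 (ln (F1 (t, v))))) <= ennreal H"
    by (rule order_trans[OF db(2)], rule ennreal_leI, unfold c5 H_def) (use e2 in simp)
   ultimately show "t : E" using elim t unfolding E_def by blast
  qed
 qed
 define F where "F p = (if fst p : E then F1 p else 0)" for p
 define G where "G p = (if fst p : E then G0 p else 0)" for p
 have FG: "(%v. F (t, v)) = (if t : E then (%v. F1 (t, v)) else (%_. 0))" "(%v. G (t, v)) = (if t : E then (%v. G0 (t, v)) else (%_. 0))" for t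
  by (auto simp: F_def G_def)
 have cube: "(NBALL R (%v. ennreal (F1 (t, v) ^ 3))) <= ennreal (((1 + R) * n t) ^ 3)" if "q t < \<infinity>" "0 <= R" for t R
 proof -
  have "(NBALL R (%v. ennreal (F1 (t, v) ^ 3))) <= (NBINT v. ennreal ((1 + R) ^ 3) * ennreal (F1 (t, v) ^ 3 * (1 + norm v) powr - 3))"
  proof (rule nn_integral_mono)
   fix v :: "real^3"
   have "1 <= (1 + R) ^ 3 * (1 + norm v) powr - 3" if v: "norm v <= R"
   proof -
    have pos: "0 < 1 + norm v" using norm_ge_zero[of v] by linarith
    have "1 = (1 + norm v) ^ 3 * (1 + norm v) powr - 3" using pos by (simp add: powr_minus powr_numeral)
    also have "... <= (1 + R) ^ 3 * (1 + norm v) powr - 3" using v by (intro mult_right_mono power_mono) auto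
    finally show ?thesis .
   qed
   from mult_left_mono[OF this, of "F1 (t, v) ^ 3"]
   have "F1 (t, v) ^ 3 <= (1 + R) ^ 3 * (F1 (t, v) ^ 3 * (1 + norm v) powr - 3)" if "norm v <= R"
    using that F1nn[of "(t, v)"] by (simp add: ac_simps)
   then show "ennreal (F1 (t, v) ^ 3) * ball_ind R v <= ennreal ((1 + R) ^ 3) * ennreal (F1 (t, v) ^ 3 * (1 + norm v) powr - 3)"
    using F1nn[of "(t, v)"] \<open>0 \<le> R\<close> by (auto simp: indicator_def ennreal_mult[symmetric] intro!: ennreal_leI)
  qed
  also have "... = ennreal ((1 + R) ^ 3) * q t" unfolding q_def by (rule nn_integral_cmult) measurable
  also have "... = ennreal (((1 + R) * n t) ^ 3)"
   using \<open>0 \<le> R\<close> unfolding n3[OF that(1), symmetric] by (simp add: ennreal_mult[symmetric] power_mult_distrib n_def)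
  finally show ?thesis .
 qed
 have dens: "sobolev_density (%v. F (t, v)) (%v. G (t, v))" for t
 proof (cases "t : E")
  case True
  then have E: "t : S" "(NBINT v. ennreal (F1 (t, v))) <= ennreal M" "q t < \<infinity>" by (auto simp: E_def)
  have "sobolev_density (%v. F1 (t, v)) (%v. G0 (t, v))"
  proof
   show "0 <= F1 (t, x)" for x by (rule F1nn)
   show "(NBINT w. ennreal (F1 (t, w))) < \<infinity>" using E(2) by (rule le_less_trans) simp
   show "borel_weak_grad (%v. F1 (t, v)) (%v. G0 (t, v))" by (rule SG(2)[OF E(1)])
   fix r
   have "(NBALL r (%w. ennreal (F1 (t, w) ^ 3))) <= (NBALL (max 0 r) (%w. ennreal (F1 (t, w) ^ 3)))"
    by (intro nn_integral_mono) (auto simp: indicator_def)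
   also have "... < \<infinity>" by (rule le_less_trans[OF cube[OF E(3)]]) auto
   finally show "(NBALL r (%w. ennreal (F1 (t, w) ^ 3))) < \<infinity>" .
  qed
  then show ?thesis using True by (simp add: FG)
 qed (simp add: FG sobolev_density_zero)
 let ?D = "%t. \<integral>\<^sup>+v. (NBINT w. ennreal (sobolev_density.pair_dissipation (%v. F (t, v)) (%v. G (t, v)) v w)) \<partial>lborel"
 have [measurable]: "F : borel_measurable (borel \<Otimes>\<^sub>M borel)" "G : borel_measurable (borel \<Otimes>\<^sub>M borel)"
  unfolding F_def G_def by measurable
 have fF: "AEL t. t : ?I --> (AEL v. f t v = F (t, v))"
  using fF1 inE by eventually_elim (simp add: F_def)
 have "ennreal (1/2) * (NBSET ?I (%t. ?D t)) = (NBINT t. ennreal (1/2) * (?D t * indicator ?I t))"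
  unfolding sobolev_density.pair_dissipation_def[OF dens] by (rule nn_integral_cmult[symmetric]) measurable
 also have "... <= (NBSET ?J (%t. entropy_dissipation (f t)))"
 proof (rule nn_integral_mono_AE)
  show "AEL t. ennreal (1/2) * (?D t * indicator ?I t) <= entropy_dissipation (f t) * indicator ?J t"
   using fF
  proof eventually_elim
   case (elim t)
   show ?case
   proof (cases "t : ?I")
    case True
    with elim have "AEL v. f t v = F (t, v)" by blast
    from entropy_dissipation_eq[OF this dens] show ?thesis using True by simp
   qed simp
  qed
 qed
 also have "... < \<infinity>" by (rule dis(2))
 finally have dfin: "(NBSET ?I (%t. ?D t)) < \<infinity>" by (auto simp: ennreal_mult_less_top)
 have nfin: "(NBSET ?I (%t. ennreal (n t))) < \<infinity>"
 proof -
  have "AEL t. t : ?J --> Lp_norm 3 ?W (f t) = n t" using Nn by eventually_elim simp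
  from time_integral_borel(2)[OF nb _ this] L3[THEN conjunct2]
  have "(NBSET ?J (%t. ennreal \<bar>n t\<bar>)) < \<infinity>" by simp
  moreover have "(NBSET ?I (%t. ennreal (n t))) <= (NBSET ?J (%t. ennreal \<bar>n t\<bar>))"
   by (intro nn_integral_mono) (auto simp: indicator_def intro!: ennreal_leI)
  ultimately show ?thesis by (rule le_less_trans[rotated])
 qed
 have "landau_curve F G n T M H"
 proof (rule landau_curve.intro)
  show "F : Borel" unfolding borel_prod[symmetric] by measurable
  show "G : Borel" unfolding borel_prod[symmetric] by measurable
  show "n : Borel" by (rule nb)
  show "0 < M" by (simp add: M_def)
  show "0 <= H" by (simp add: H_def)
  show "0 < T" by (rule T)
  show "sobolev_density (%v. F (t, v)) (%v. G (t, v))" for t by (rule dens)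
  show "(NBINT v. ennreal (F (t, v))) <= ennreal M" for t by (cases "t : E") (simp add: F_def, simp add: E_def, simp add: F_def)
  show "(NBINT v. ennreal (F (t, v) * max 0 (ln (F (t, v))))) <= ennreal H" for t by (cases "t : E") (simp add: F_def, simp add: E_def, simp add: F_def)
  show "0 <= n t" for t by (simp add: n_def)
  show "(NBALL R (%v. ennreal (F (t, v) ^ 3))) <= ennreal (((1 + R) * n t) ^ 3)" if "0 <= R" for t R
   using cube[OF _ that, of t] by (cases "t : E") (simp add: F_def, simp add: E_def, simp add: F_def)
  show "(NBSET ?I (%t. ennreal (n t))) < \<infinity>" by (rule nfin)
  show "(NBSET ?I (%t. ?D t)) < \<infinity>" by (rule dfin)
 qed
 from this fF show ?thesis by (rule that)
qed

lemma smooth_test_zero_off: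
 fixes \<theta> :: "real => real"
 assumes \<theta>: "smooth_test A \<theta>" and t: "t \<notin> A"
 shows "\<theta> t = 0" "deriv \<theta> t = 0"
proof -
 have "closure {t. \<theta> t \<noteq> 0} \<subseteq> A" using \<theta> by (auto simp: smooth_test_def Ck_test_def)
 then have tc: "t : - closure {t. \<theta> t \<noteq> 0}" using t by blast
 have z: "0 = \<theta> s" if "s : - closure {t. \<theta> t \<noteq> 0}" for s
  using that closure_subset[of "{t. \<theta> t \<noteq> 0}"] by auto
 show "\<theta> t = 0" using z[OF tc] by simp
 have "(\<theta> has_field_derivative 0) (at t)"
  by (rule has_field_derivative_transform_within_open[OF DERIV_const[of "0::real"] open_Compl[OF closed_closure] tc z])
 then show "deriv \<theta> t = 0" by (rule DERIV_imp_deriv)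
qed

lemma Ck_test_product:
 fixes \<theta> :: "real => real" and \<psi> :: "real^3 => real"
 assumes \<theta>: "smooth_test UNIV \<theta>" and \<psi>: "smooth_test UNIV \<psi>"
 shows "Ck_test k UNIV (%p. \<theta> (fst p) * \<psi> (snd p))"
proof -
 have "Ck k (%p::real \<times> (real^3). \<theta> (0 + fst p))" "Ck k (%p::real \<times> (real^3). \<psi> (0 + snd p))"
  using \<theta> \<psi> by (auto simp only: smooth_test_iff smooth_def intro!: Ck_affine bounded_linear_fst bounded_linear_snd)
 then have c: "Ck k (%p. \<theta> (fst p) * \<psi> (snd p))" by (intro Ck_mult) simp_all
 have "bounded ({t. \<theta> t \<noteq> 0} \<times> {v. \<psi> v \<noteq> 0})" using \<theta> \<psi> by (intro bounded_Times) (auto simp: smooth_test_iff)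
 then have "bounded {p. \<theta> (fst p) * \<psi> (snd p) \<noteq> 0}" by (rule bounded_subset) auto
 then show ?thesis using c by (simp add: Ck_test_def compact_closure)
qed

lemma grad_hess_scaled:
 assumes s: "smooth \<psi>"
 shows "grad (%x. c * \<psi> x) v = c *\<^sub>R grad \<psi> v" "hess (%x. c * \<psi> x) v = c *\<^sub>R hess \<psi> v"
proof -
 have p: "partial i (%x. c * u x) x = c * partial i u x" if "smooth u" for i u x
  using partial_mult[OF smooth_const that, of i c x] by (simp add: partial_const)
 show "grad (%x. c * \<psi> x) v = c *\<^sub>R grad \<psi> v" by (simp add: grad_def vec_eq_iff p[OF s])
 have "partial j (%x. c * \<psi> x) = (%x. c * partial j \<psi> x)" for j using p[OF s] by blast
 then show "hess (%x. c * \<psi> x) v = c *\<^sub>R hess \<psi> v" by (simp add: hess_def vec_eq_iff p[OF smooth_partial[OF s]])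
qed

lemma frobenius_scaled: "frobenius A (c *\<^sub>R B + c *\<^sub>R D) = c * frobenius A (B + D)"
 by (simp add: frobenius_def sum_distrib_left algebra_simps)

lemma (in landau_curve) ultraweak_flux_form:
 assumes uw: "ultraweak f_in f"
  and fF: "AEL t. t : {0<..<T} --> (AEL v. f t v = F (t, v))"
  and \<theta>: "smooth_test {0<..<T} \<theta>" and \<psi>: "smooth_test UNIV \<psi>"
 shows "(LINT (t, v)|lborel. indicator {0<..<T} t * (\<theta> t * (flux (t, v) \<bullet> grad \<psi> v))) =
   (LINT (t, v)|lborel. indicator {0<..<T} t * (deriv \<theta> t * (F (t, v) * \<psi> v)))"
proof -
 let ?I = "{0<..<T}"
 have \<theta>U: "smooth_test UNIV \<theta>" using \<theta> by (auto simp: smooth_test_def Ck_test_def)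
 have s: "smooth \<psi>" and s\<theta>: "smooth \<theta>" using \<psi> \<theta>U by (simp_all add: smooth_test_iff)
 note [measurable] = grad_borel[OF s] hess_borel[OF s] smooth_borel[OF s]
 have [measurable]: "(fst :: (real^3) \<times> (real^3) => real^3) : Borel" "(snd :: (real^3) \<times> (real^3) => real^3) : Borel"
  by (auto intro!: borel_measurable_continuous_onI continuous_intros)
 note off = smooth_test_zero_off[OF \<theta>]
 obtain B where B: "0 < B" "!!t. \<bar>\<theta> t\<bar> <= B" "!!t. \<bar>deriv \<theta> t\<bar> <= B"
  and [measurable]: "\<theta> : Borel" "deriv \<theta> : Borel"
  using smooth_test_time_derivative[OF \<theta>] by metis
 obtain L S where L: "0 < L" "!!v. \<bar>\<psi> v\<bar> <= L" and S: "!!v. S <= norm v ==> \<psi> v = 0"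
  using smooth_test_bounded[OF \<psi>] smooth_testE[OF \<psi>] by metis
 define X where "X t = (LINT (v, w)|lborel. F (t, v) * F (t, w) * frobenius (landau_N (v - w)) (hess \<psi> v + hess \<psi> w))" for t
 define Y where "Y t = (LINT (v, w)|lborel. F (t, v) * F (t, w) * (((1 / norm (v - w) ^ 3) *\<^sub>R (v - w)) \<bullet> (grad \<psi> v - grad \<psi> w)))" for t
 note fti = flux_time_integral[OF \<theta> \<psi>, folded X_def Y_def]
 have Xb[measurable]: "X : Borel" and Yb[measurable]: "Y : Borel"
  using fti(2,3) by (simp_all add: X_def[abs_def] Y_def[abs_def])
 let ?\<phi> = "%p. \<theta> (fst p) * \<psi> (snd p)"
 have d: "deriv (%s. \<theta> s * \<psi> v) t = deriv \<theta> t * \<psi> v" for t v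
 proof -
  have "\<theta> differentiable (at t)" using smooth_has_derivative[OF s\<theta>] by (auto simp: differentiable_def)
  then have "(\<theta> has_real_derivative deriv \<theta> t) (at t)" by (simp add: DERIV_deriv_iff_real_differentiable)
  from DERIV_cmult_right[OF this, of "\<psi> v"] show ?thesis by (rule DERIV_imp_deriv)
 qed
 have th0: "\<theta> 0 = 0" by (rule off(1)) simp
 have u: "- (LINT t:{0..}|lebesgue. LINT v|lebesgue. f t v * (deriv \<theta> t * \<psi> v))
  = 1/2 * (LINT t:{0..}|lebesgue. LINT (v, w)|lebesgue. f t v * f t w *
     frobenius (landau_N (v - w)) (\<theta> t *\<^sub>R hess \<psi> v + \<theta> t *\<^sub>R hess \<psi> w))
  - 1 / (4 * pi) * (LINT t:{0..}|lebesgue. LINT (v, w)|lebesgue. f t v * f t w *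
     (((1 / norm (v - w) ^ 3) *\<^sub>R (v - w)) \<bullet> (\<theta> t *\<^sub>R grad \<psi> v - \<theta> t *\<^sub>R grad \<psi> w)))"
  using uw[unfolded ultraweak_def, THEN spec, THEN mp, OF Ck_test_product[OF \<theta>U \<psi>]]
  by (simp only: fst_conv snd_conv d grad_hess_scaled[OF s] th0 mult_zero_left mult_zero_right Bochner_Integration.integral_zero minus_zero diff_0)
 have pair: "AEL t. t : ?I --> (AE p in (lborel :: ((real^3) \<times> (real^3)) measure). f t (fst p) = F (t, fst p) \<and> f t (snd p) = F (t, snd p))"
  using fF
 proof eventually_elim
  case (elim t)
  show ?case
  proof
   assume "t : ?I"
   with elim have ae: "AEL v. f t v = F (t, v)" by blast
   show "AE p in (lborel :: ((real^3) \<times> (real^3)) measure). f t (fst p) = F (t, fst p) \<and> f t (snd p) = F (t, snd p)"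
    using AE_lborel_fst[OF ae, where 'b="real^3"] AE_lborel_snd[OF ae, where 'a="real^3"] by eventually_elim simp
  qed
 qed
 have A0: "AEL t. t : {0..} --> (LINT v|lebesgue. f t v * (deriv \<theta> t * \<psi> v)) = indicator ?I t * (LBINT v. deriv \<theta> t * (F (t, v) * \<psi> v))"
  using fF
 proof eventually_elim
  case (elim t)
  show ?case
  proof (cases "t : ?I")
   case True
   with elim have "AEL v. f t v = F (t, v)" by blast
   then have "AEL v. f t v * (deriv \<theta> t * \<psi> v) = deriv \<theta> t * (F (t, v) * \<psi> v)" by eventually_elim simp
   from lebesgue_integral_cong_AE[OF this]
   have "(LINT v|lebesgue. f t v * (deriv \<theta> t * \<psi> v)) = (LINT v|lebesgue. deriv \<theta> t * (F (t, v) * \<psi> v))" .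
   also have "... = (LBINT v. deriv \<theta> t * (F (t, v) * \<psi> v))" by (rule integral_completion) measurable
   finally show ?thesis using True by simp
  next
   case False
   then show ?thesis using off(2)[OF False] by simp
  qed
 qed
 have i0: "indicator {0..} t * (indicator ?I t * z) = indicator ?I t * z" for t z :: real by (simp add: indicator_def)
 have dbl: "(LINT t:{0..}|lebesgue. LINT p|lebesgue. f t (fst p) * f t (snd p) * (\<theta> t * k p)) = (LBINT t. indicator ?I t * (\<theta> t * Z t))"
  if kb[measurable]: "k : Borel" and Zb: "Z : Borel"
   and Z: "!!t. Z t = (LBINT p. F (t, fst p) * F (t, snd p) * k p)" for k :: "(real^3) \<times> (real^3) => real" and Z
 proof -
  have "AEL t. t : {0..} --> (LINT p|lebesgue. f t (fst p) * f t (snd p) * (\<theta> t * k p)) = indicator ?I t * (\<theta> t * Z t)"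
   using pair
  proof eventually_elim
   case (elim t)
   show ?case
   proof (cases "t : ?I")
    case True
    with elim have "AE p in (lborel :: ((real^3) \<times> (real^3)) measure). f t (fst p) = F (t, fst p) \<and> f t (snd p) = F (t, snd p)" by blast
    then have "AEL p. f t (fst p) * f t (snd p) * (\<theta> t * k p) = \<theta> t * (F (t, fst p) * F (t, snd p) * k p)"
     by eventually_elim simp
    from lebesgue_integral_cong_AE[OF this]
    have "(LINT p|lebesgue. f t (fst p) * f t (snd p) * (\<theta> t * k p)) = (LINT p|lebesgue. \<theta> t * (F (t, fst p) * F (t, snd p) * k p))" .
    also have "... = (LBINT p. \<theta> t * (F (t, fst p) * F (t, snd p) * k p))" by (rule integral_completion) measurable
    also have "... = \<theta> t * Z t" unfolding Z by (rule integral_mult_right_zero)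
    finally show ?thesis using True by simp
   next
    case False
    then show ?thesis using off(1)[OF False] by simp
   qed
  qed
  from time_integral_borel(1)[OF _ _ this] Zb show ?thesis by (simp add: i0)
 qed
 let ?K = "%p. deriv \<theta> (fst p) * (F p * \<psi> (snd p))"
 have mK: "?K : Borel" unfolding borel_prod[symmetric] by measurable
 have bd: "\<bar>?K (t, v)\<bar> <= (B * L) * (norm (F (t, v)) * ball_ind S v)" for t v
 proof -
  have "\<bar>\<psi> v\<bar> <= L * ball_ind S v" using L(2)[of v] S[of v] by (auto simp: indicator_def)
  then have "\<bar>deriv \<theta> t\<bar> * (\<bar>F (t, v)\<bar> * \<bar>\<psi> v\<bar>) <= B * (\<bar>F (t, v)\<bar> * (L * ball_ind S v))"
   using B(1) by (intro mult_mono mult_left_mono B(3)) auto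
  then show ?thesis by (simp add: abs_mult ac_simps)
 qed
 have fin: "(NBSET ?I (%t. (NBINT v. ennreal \<bar>?K (t, v)\<bar>))) < \<infinity>"
  by (rule slab_dominated[where K="?K", OF F_borel F_fin _ AE_I2[OF impI[OF AE_I2[OF bd]]]]) (use B(1) L(1) in simp)
 have I0: "(LINT t:{0..}|lebesgue. LINT v|lebesgue. f t v * (deriv \<theta> t * \<psi> v)) = (LINT (t, v)|lborel. indicator ?I t * ?K (t, v))"
 proof -
  have "(LINT t:{0..}|lebesgue. LINT v|lebesgue. f t v * (deriv \<theta> t * \<psi> v)) = (LBINT t. indicator {0..} t * (indicator ?I t * (LBINT v. deriv \<theta> t * (F (t, v) * \<psi> v))))"
   by (rule time_integral_borel(1)[OF _ _ A0]) measurable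
  also have "... = (LINT (t, v)|lborel. indicator ?I t * ?K (t, v))"
   unfolding i0 using slab_Fubini(5)[OF mK fin, of "%t v. ?K (t, v)"] by simp
  finally show ?thesis .
 qed
 have I1: "(LINT t:{0..}|lebesgue. LINT (v, w)|lebesgue. f t v * f t w *
     frobenius (landau_N (v - w)) (\<theta> t *\<^sub>R hess \<psi> v + \<theta> t *\<^sub>R hess \<psi> w)) = (LBINT t. indicator ?I t * (\<theta> t * X t))"
  unfolding case_prod_unfold frobenius_scaled
  by (rule dbl[OF _ Xb]) (measurable, simp add: X_def case_prod_unfold)
 have I2: "(LINT t:{0..}|lebesgue. LINT (v, w)|lebesgue. f t v * f t w *
     (((1 / norm (v - w) ^ 3) *\<^sub>R (v - w)) \<bullet> (\<theta> t *\<^sub>R grad \<psi> v - \<theta> t *\<^sub>R grad \<psi> w))) = (LBINT t. indicator ?I t * (\<theta> t * Y t))"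
  unfolding case_prod_unfold scaleR_diff_right[symmetric] inner_scaleR_right
  by (rule dbl[OF _ Yb]) (measurable, simp add: Y_def case_prod_unfold)
 show ?thesis using u[unfolded I0 I1 I2] fti(1) by simp
qed

theorem corollary1:
  fixes f_in :: "real^3 \<Rightarrow> real" and f :: "real \<Rightarrow> real^3 \<Rightarrow> real" and T :: real
  assumes "admissible_datum f_in"
    and "global_H_solution f_in f"
    and "T > 0"
  shows "Linf_Lploc T 3 (\<lambda>t. landau_A (f t)) \<and>
    (AE t in lebesgue_on {0<..<T}. weakly_differentiable (landau_a (f t))) \<and>
    Linf_Lploc T (3/2) (\<lambda>t. wgrad (landau_a (f t))) \<and>
    (AE t in lebesgue_on {0<..<T}. weakly_differentiable (f t)) \<and>
    (\<exists>dtf. is_time_deriv T f dtf \<and> time_pairing T dtf \<in> Linf_W1inf_c_dual T \<and>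
      (\<forall>\<phi>\<in>Linf_W1inf_c T.
         set_integrable lebesgue {0<..<T} (\<lambda>t. dtf t (\<lambda>v. \<phi> (t, v))) \<and>
         slab_integrable T (\<lambda>t v. landau_flux (f t) v \<bullet> wgrad (\<lambda>w. \<phi> (t, w)) v) \<and>
         time_pairing T dtf \<phi>
           + (LINT t:{0<..<T}|lebesgue. LINT v|lebesgue.
                landau_flux (f t) v \<bullet> wgrad (\<lambda>w. \<phi> (t, w)) v) = 0))"
proof -
 let ?I = "{0<..<T}"
 obtain F G n M H where lc: "landau_curve F G n T M H"
  and fF: "AEL t. t : ?I --> (AEL v. f t v = F (t, v))"
  by (rule global_H_solution_curve[OF assms(2,3)])
 interpret L: landau_curve F G n T M H by (rule lc)
 let ?B = "%p. borel_B (%w. F (fst p, w)) (snd p)" and ?A = "%p. borel_A (%w. F (fst p, w)) (snd p)"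
 have slice: "AEL t. t : ?I --> weakly_differentiable (f t) \<and> weakly_differentiable (landau_a (f t)) \<and>
  (\<forall>v. landau_A (f t) v = ?A (t, v)) \<and> (AEL v. wgrad (landau_a (f t)) v = ?B (t, v)) \<and>
  (AEL v. landau_flux (f t) v = L.flux (t, v))"
  using fF
 proof eventually_elim
  case (elim t)
  show ?case
  proof
   assume "t : ?I"
   with elim have ae: "AEL v. f t v = F (t, v)" by blast
   interpret D: sobolev_density "%v. F (t, v)" "%v. G (t, v)" by (rule L.density)
   have A: "landau_A (f t) v = ?A (t, v)" for v
    using landau_potentials_cong_AE(1)[OF ae] landau_A_eq_borel_A[OF D.u_borel] by simp
   have a: "landau_a (f t) = landau_a (%v. F (t, v))"
    using landau_potentials_cong_AE(2)[OF ae] by blast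
   note wa = wgrad_eqI[OF borel_weak_grad_landau_a[OF D.u_borel D.u0 D.u_fin], folded a]
   have wd: "weakly_differentiable (f t)" using wgrad_cong_AE(2)[OF ae] wgrad_eqI(1)[OF D.wg] by simp
   have "AEL v. wgrad (f t) v = G (t, v)" unfolding wgrad_cong_AE(1)[OF ae] by (rule wgrad_eqI(2)[OF D.wg])
   with ae wa(2) have "AEL v. landau_flux (f t) v = L.flux (t, v)"
    by eventually_elim (simp add: landau_flux_def L.flux_def A)
   then show "weakly_differentiable (f t) \<and> weakly_differentiable (landau_a (f t)) \<and>
    (\<forall>v. landau_A (f t) v = ?A (t, v)) \<and> (AEL v. wgrad (landau_a (f t)) v = ?B (t, v)) \<and>
    (AEL v. landau_flux (f t) v = L.flux (t, v))" using wd wa A by simp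
  qed
 qed
 have Ab: "?A : Borel" and Bb: "?B : Borel"
  using L.borel_A_joint L.borel_B_joint by (simp_all only: borel_prod)
 have LA: "Linf_Lploc T 3 (%t. landau_A (f t))"
 proof (rule Linf_LplocI[OF Ab])
  show "AEL t. t : ?I --> (AEL v. landau_A (f t) v = ?A (t, v))"
   using slice by eventually_elim simp
  fix R
  have "norm (landau_N z) <= 9 * norm z powr (-(3/3))" for z using norm_landau_N_le[of z] by simp
  from L.potential_Lp_bound[OF _ _ landau_N_borel this, of R]
  obtain C where "!!t. (NBALL R (%v. ennreal (norm (?A (t, v)) powr 3))) <= ennreal C"
   by (auto simp: borel_A_def)
  then show "\<exists>C. AEL t. t : ?I --> (NBALL R (%v. ennreal (norm (?A (t, v)) powr 3))) <= ennreal C"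
   by (intro exI[of _ C] AE_I2 impI)
 qed simp
 have LB: "Linf_Lploc T (3/2) (%t. wgrad (landau_a (f t)))"
 proof (rule Linf_LplocI[OF Bb])
  show "AEL t. t : ?I --> (AEL v. wgrad (landau_a (f t)) v = ?B (t, v))"
   using slice by eventually_elim simp
  fix R
  have "norm (coulomb_field z) <= 1 * norm z powr (-(3/(3/2)))" for z using norm_coulomb_field_le[of z] by simp
  from L.potential_Lp_bound[OF _ _ coulomb_field_borel this, of R]
  obtain C where "!!t. (NBALL R (%v. ennreal (norm (?B (t, v)) powr (3/2)))) <= ennreal C"
   by (auto simp: borel_B_def)
  then show "\<exists>C. AEL t. t : ?I --> (NBALL R (%v. ennreal (norm (?B (t, v)) powr (3/2)))) <= ennreal C"
   by (intro exI[of _ C] AE_I2 impI)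
 qed simp
 interpret J: integrable_flux T L.flux "%t. landau_flux (f t)"
 proof
  show "L.flux : Borel" by (rule L.flux_borel)
  show "(NBSET ?I (%t. (NBALL R (%v. ennreal (norm (L.flux (t, v))))))) < \<infinity>" for R by (rule L.flux_fin)
  show "AEL t. t : ?I --> (AEL v. landau_flux (f t) v = L.flux (t, v))"
   using slice by eventually_elim simp
 qed
 have uw: "ultraweak f_in f" using assms(2) unfolding global_H_solution_def Let_def by (elim conjE)
 have td: "is_time_deriv T f J.flux_functional"
  by (rule J.is_time_derivI[OF L.F_borel L.F_fin fF L.ultraweak_flux_form[OF uw fF]])
 have wf: "set_integrable lebesgue ?I (%t. J.flux_functional t (%v. \<phi> (t, v))) \<and>
   slab_integrable T (%t v. landau_flux (f t) v \<bullet> wgrad (%w. \<phi> (t, w)) v) \<and>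
   time_pairing T J.flux_functional \<phi>
    + (LINT t:?I|lebesgue. LINT v|lebesgue. landau_flux (f t) v \<bullet> wgrad (%w. \<phi> (t, w)) v) = 0"
  if \<phi>: "\<phi> : Linf_W1inf_c T" for \<phi>
 proof -
  obtain X C R where X: "X : Borel" "0 <= C"
   "AEL t. t : ?I --> (AEL v. wgrad (%v. \<phi> (t, v)) v = X (t, v))"
   "AEL t. t : ?I --> (AEL v. norm (X (t, v)) <= C * ball_ind R v)"
   by (rule Linf_W1inf_c_grad[OF \<phi>])
  show ?thesis using J.pairing(1-3)[OF X] by simp
 qed
 have ae: "AE t in lebesgue_on ?I. weakly_differentiable (landau_a (f t))" "AE t in lebesgue_on ?I. weakly_differentiable (f t)"
  by (simp_all add: AE_lebesgue_on_iff) (use slice in \<open>eventually_elim, simp\<close>)+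
 show ?thesis using LA LB ae td J.time_pairing_dual wf by blast
qed

end
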